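(* Let $(I\times F, g^f=-d\tau^2+f^2 g)$ be a GRW spacetime with weakly convex fiber $(F,g)$. Then: (i) Two points $z_0=(\tau_0,x_0)$, $z_0'=(\tau_0',x_0')$ with $\tau_0<\tau_0'$ are chronologically (resp. causally) related if and only if $\int_{\tau_0}^{\tau_0'}f^{-1}\,d\tau>d_F(x_0,x_0')$ (resp. $\ge d_F(x_0,x_0')$) and, in this case, they can be joined with at least one timelike (resp. non-spacelike) geodesic. (ii) If Condition (C) or Condition (R) holds, then the GRW spacetime is geodesically connected (i.e. each two of its points can be joined by a geodesic).
   Context: **GRW spacetime.** $(F,g)$ is a Riemannian manifold with associated distance $d_F$ and diameter $\mathrm{diam}(F)\in(0,\infty]$; $I=(a,b)\subseteq\mathbb{R}$ is an open interval, $-\infty\le a<b\le\infty$; $f:I\to(0,\infty)$ is smooth. The GRW spacetime is $I\times F$ with the Lorentz metric $g^f=-d\tau^2+f(\tau)^2g$. $(F,g)$ is *weakly convex* if any two of its points can be joined by a geodesic which minimizes the distance. **Causality.** A tangent vector $X$ is timelike (resp. lightlike, causal or non-spacelike, spacelike) if $g^f(X,X)<0$ (resp. $=0$, $\le0$, $>0$); a geodesic has the causal character of its velocity. The timelike vector field $\partial/\partial\tau$ fixes the future orientation. Two points $z,z'$ are *causally* (resp. *chronologically* ) related if they can be joined ($z$ with $z'$ or vice versa) by a future-pointing non-spacelike (resp. timelike) piecewise smooth curve. **Turning points.** For a base point $\tau_0\in I$ and $D\in\mathbb{R}$ with $1/f^2(\tau_0)\ge D$ put $A_+=\{\tau\in(a,b):\tau\ge\tau_0,\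 1/f^2(\tau)=D\}\cup\{b\}$ and $A_-=\{\tau\in(a,b):\tau\le\tau_0,\ 1/f^2(\tau)=D\}\cup\{a\}$. Define $a_*=a_*(D)$, $b_*=b_*(D)$ as follows: if $\frac{d}{d\tau}\frac1{f^2}(\tau_0)>0$, $b_*=\min(A_+\setminus\{\tau_0\})$, $a_*=\max A_-$; if it is $<0$, $b_*=\min A_+$, $a_*=\max(A_-\setminus\{\tau_0\})$; if it is $0$, $b_*=\min A_+$, $a_*=\max A_-$. **Relative minima at the extremes.** Put $m_b=\liminf_{\tau\to b}1/f^2(\tau)$, $m_a=\liminf_{\tau\to a}1/f^2(\tau)$, $m=\inf_{(a,b)}1/f^2$. The function $1/f^2$ *reaches a relative minimum at $b$* if: when $b<\infty$, there is $\epsilon>0$ with $1/f^2(b-\epsilon')>m_b$ for all $0<\epsilon'<\epsilon$; when $b=\infty$, there is $M>0$ with $1/f^2(M')>m_b$ for all $M'>M$. Analogously at $a$ (with $a+\epsilon'$, resp. $-M'$, and $m_a$). A point $c\in(a,b)$ is *close to* $b$ if $c\in(b-\epsilon,b)$ (resp. $c>M$) with such $\epsilon$, $M$; analogously for $a$. **The numbers $d_b,d_a$.** If $1/f^2$ reaches a relative minimum at $b$ and $\int_c^b f^{-2}(\frac1{f^2}-m_b)^{-1/2}d\tau<\infty$ for some $c$ close to $b$, define $$d_b=\limsup_{D\to m_b}\Big(\int_c^{b_*(D)}f^{-2}\big(\tfrac1{f^2}-D\big)^{-1/2}d\tau\Big)-\int_c^bf^{-2}\big(\tfrac1{f^2}-m_b\big)^{-1/2}d\tau\in[0,\infty]$$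 ($b_*(D)$ taken with base point $c$; this is independent of $c$). Analogously, when $1/f^2$ reaches a relative minimum at $a$ and $\int_a^cf^{-2}(\frac1{f^2}-m_a)^{-1/2}d\tau<\infty$ for some $c$ close to $a$, $d_a=\limsup_{D\to m_a}\big(\int_{a_*(D)}^{c}f^{-2}(\frac1{f^2}-D)^{-1/2}d\tau\big)-\int_a^cf^{-2}(\frac1{f^2}-m_a)^{-1/2}d\tau$. **The numbers $i_b,i_a$.** If moreover $2d_b<\mathrm{diam}(F)$ and $m<m_b$, define $i_b=\inf_{D\in(m,m_b]}\int_{a_*(D)}^{b}f^{-2}(\frac1{f^2}-D)^{-1/2}d\tau$, with $a_*(D)$ taken with a base point $\tau_0$ close to $b$ (independent of the choice). Analogously, if $2d_a<\mathrm{diam}(F)$ and $m<m_a$, $i_a=\inf_{D\in(m,m_a]}\int_a^{b_*(D)}f^{-2}(\frac1{f^2}-D)^{-1/2}d\tau$ with base point close to $a$. **Condition (C)** holds if, at the extreme $b$, one of the following holds: $1/f^2$ does not reach a relative minimum at $b$; or $\int_c^bf^{-2}(\frac1{f^2}-m_b)^{-1/2}d\tau=\infty$ for some $c$ close to $b$; or $2d_b\ge\mathrm{diam}(F)$; or $i_b$ is defined and $d_b\ge i_b$; and the analogous alternative holds at $a$ (with $\int_a^c f^{-2}(\frac1{f^2}-m_a)^{-1/2}d\tau$, $d_a$, $i_a$). **Condition (R).** Suppose $1/f^2>m$ on $(a,b)$ and $m_a=m_b=m$. For $\tau_0\in I$ and $D>m$ near $m$, with $a_*,b_*$ computed from base point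 $\tau_0$ and $h=f^{-2}(\frac1{f^2}-D)^{-1/2}$, put $R=\int_{\tau_0}^{b_*}h$, $\Lambda=\int_{a_*}^{\tau_0}h$, $W=\Lambda+R$. For $n\ge0$, let $E_n=R$ if $n$ is even and $E_n=\Lambda$ if $n$ is odd; let $G_n=\Lambda$ if $n$ is even and $G_n=R$ if $n$ is odd. For $n\ge1$ define $r_i^n(\tau_0)=\lim_{\epsilon\searrow0}\liminf_{D\searrow m}\{E_n+(n-1)W+\int_{a_*}^{b-\epsilon}h\}$ and $l_i^n(\tau_0)=\lim_{\epsilon\searrow0}\liminf_{D\searrow m}\{G_n+(n-1)W+\int_{a+\epsilon}^{b_*}h\}$; put $r_i^0(\tau_0)=\lim_{\epsilon\searrow0}\liminf_{D\searrow m}\int_{\tau_0}^{b-\epsilon}h$ and $l_i^0(\tau_0)=\lim_{\epsilon\searrow0}\liminf_{D\searrow m}\int_{a+\epsilon}^{\tau_0}h$; and for $n\ge0$ $r_s^n(\tau_0)=\lim_{\epsilon\searrow0}\limsup_{D\searrow m}\{E_n+nW+\int_{b-\epsilon}^{b_*}h\}$, $l_s^n(\tau_0)=\lim_{\epsilon\searrow0}\limsup_{D\searrow m}\{G_n+nW+\int_{a_*}^{a+\epsilon}h\}$. (If $b=\infty$, resp. $a=-\infty$, replace $b-\epsilon$ by $M$, resp. $a+\epsilon$ by $-M$, and $\epsilon\searrow0$ by $M\to\infty$.) These quantities take values in $[0,\infty]$. Condition (R) holds if $1/f^2>m$ on $(a,b)$, $m_a=m_b=m$ and, for every $\tau_0\in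 I$, $$[r_i^0(\tau_0),\mathrm{diam}(F)]\subseteq\bigcup_{n\ge0}[r_i^n(\tau_0),r_s^n(\tau_0)],\qquad [l_i^0(\tau_0),\mathrm{diam}(F)]\subseteq\bigcup_{n\ge0}[l_i^n(\tau_0),l_s^n(\tau_0)],$$ where the intervals are closed intervals of $[0,\infty]$ (so they contain $\infty$ when their right end is $\infty$), and an interval is empty if its left end exceeds its right end. *)

theory Defs
  imports "HOL-Analysis.Analysis"
begin

section \<open>Smooth maps between open subsets of Euclidean spaces\<close>

primrec C_k_on :: "nat \<Rightarrow> 'a::real_normed_vector set \<Rightarrow> ('a \<Rightarrow> 'b::real_normed_vector) \<Rightarrow> bool" where
  "C_k_on 0 S f \<longleftrightarrow> continuous_on S f"
| "C_k_on (Suc k) S f \<longleftrightarrow>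
     (\<forall>x\<in>S. f differentiable (at x)) \<and>
     (\<forall>v. C_k_on k S (\<lambda>x. frechet_derivative f (at x) v))"

text \<open>Used only for open \<open>S\<close> and finite-dimensional domains, where it is the usual
  \<open>C\<^sup>\<infinity>\<close> notion.\<close>

definition smooth_on :: "'a::real_normed_vector set \<Rightarrow> ('a \<Rightarrow> 'b::real_normed_vector) \<Rightarrow> bool" where
  "smooth_on S f \<longleftrightarrow> (\<forall>k. C_k_on k S f)"


section \<open>Manifolds with a metric tensor\<close>

text \<open>
  A manifold is given by an indexed atlas on an open part of a Hausdorff, second countable space.
  A tangent vector at \<open>p\<close> is represented, for a chart \<open>i\<close> around \<open>p\<close>, by its coordinates
  in the model space \<open>'e\<close>; \<open>metric_at M i p v w\<close> is the metric applied to the two tangent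
  vectors at \<open>p\<close> whose coordinates in chart \<open>i\<close> are \<open>v\<close> and \<open>w\<close>.
\<close>

record ('i, 'p, 'e) metric_manifold =
  charts :: "'i set"
  chart_dom :: "'i \<Rightarrow> 'p set"
  chart_map :: "'i \<Rightarrow> 'p \<Rightarrow> 'e"
  metric_at :: "'i \<Rightarrow> 'p \<Rightarrow> 'e \<Rightarrow> 'e \<Rightarrow> real"

definition points :: "('i, 'p, 'e) metric_manifold \<Rightarrow> 'p set" where
  "points M = (\<Union>i\<in>charts M. chart_dom M i)"

definition chart_inv :: "('i, 'p, 'e) metric_manifold \<Rightarrow> 'i \<Rightarrow> 'e \<Rightarrow> 'p" where
  "chart_inv M i = inv_into (chart_dom M i) (chart_map M i)"

definition smooth_manifold ::
  "('i, 'p::{t2_space, second_countable_topology}, 'e::euclidean_space) metric_manifold \<Rightarrow> bool" where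
  "smooth_manifold M \<longleftrightarrow>
     points M \<noteq> {} \<and>
     (\<forall>i\<in>charts M. open (chart_dom M i) \<and> open (chart_map M i ` chart_dom M i) \<and>
        homeomorphism (chart_dom M i) (chart_map M i ` chart_dom M i) (chart_map M i) (chart_inv M i)) \<and>
     (\<forall>i\<in>charts M. \<forall>j\<in>charts M.
        smooth_on (chart_map M i ` (chart_dom M i \<inter> chart_dom M j)) (chart_map M j \<circ> chart_inv M i))"

definition riemannian_manifold ::
  "('i, 'p::{t2_space, second_countable_topology}, 'e::euclidean_space) metric_manifold \<Rightarrow> bool" where
  "riemannian_manifold M \<longleftrightarrow>
     smooth_manifold M \<and>
     (\<forall>i\<in>charts M. \<forall>p\<in>chart_dom M i.
        bilinear (metric_at M i p) \<and>
        (\<forall>v w. metric_at M i p v w = metric_at M i p w v) \<and>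
        (\<forall>v. v \<noteq> 0 \<longrightarrow> metric_at M i p v v > 0)) \<and>
     (\<forall>i\<in>charts M. \<forall>v w.
        smooth_on (chart_map M i ` chart_dom M i) (\<lambda>x. metric_at M i (chart_inv M i x) v w)) \<and>
     (\<forall>i\<in>charts M. \<forall>j\<in>charts M. \<forall>p\<in>chart_dom M i \<inter> chart_dom M j. \<forall>v w.
        let T = frechet_derivative (chart_map M j \<circ> chart_inv M i) (at (chart_map M i p))
        in metric_at M i p v w = metric_at M j p (T v) (T w))"


section \<open>Curves\<close>

definition smooth_curve ::
  "('i, 'p::topological_space, 'e::euclidean_space) metric_manifold \<Rightarrow> real set \<Rightarrow> (real \<Rightarrow> 'p) \<Rightarrow> bool" where
  "smooth_curve M J \<gamma> \<longleftrightarrow>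
     open J \<and> is_interval J \<and> \<gamma> ` J \<subseteq> points M \<and> continuous_on J \<gamma> \<and>
     (\<forall>i\<in>charts M. smooth_on {t\<in>J. \<gamma> t \<in> chart_dom M i} (chart_map M i \<circ> \<gamma>))"

definition velocity ::
  "('i, 'p, 'e::real_normed_vector) metric_manifold \<Rightarrow> 'i \<Rightarrow> (real \<Rightarrow> 'p) \<Rightarrow> real \<Rightarrow> 'e" where
  "velocity M i \<gamma> t = vector_derivative (chart_map M i \<circ> \<gamma>) (at t)"

text \<open>For quantities that do not depend on the chart it suffices to evaluate them in some chart
  around the point.\<close>

definition some_chart :: "('i, 'p, 'e) metric_manifold \<Rightarrow> 'p \<Rightarrow> 'i" where
  "some_chart M p = (SOME i. i \<in> charts M \<and> p \<in> chart_dom M i)"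

definition velocity_square ::
  "('i, 'p, 'e::real_normed_vector) metric_manifold \<Rightarrow> (real \<Rightarrow> 'p) \<Rightarrow> real \<Rightarrow> real" where
  "velocity_square M \<gamma> t =
     (let i = some_chart M (\<gamma> t); v = velocity M i \<gamma> t in metric_at M i (\<gamma> t) v v)"

text \<open>
  A piecewise smooth curve from \<open>p\<close> to \<open>q\<close> with breaks \<open>t 0 < \<dots> < t (n + 1)\<close>: its
  restriction to \<open>[t k, t (k + 1)]\<close> is \<open>c k\<close>, which is smooth on a neighbourhood of that
  interval. Thus the velocities of \<open>c k\<close> at the end points are the one-sided ones of the curve.
\<close>

definition piecewise_smooth_curve ::
  "('i, 'p::topological_space, 'e::euclidean_space) metric_manifold \<Rightarrow> nat \<Rightarrow> (nat \<Rightarrow> real) \<Rightarrow>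
     (nat \<Rightarrow> real \<Rightarrow> 'p) \<Rightarrow> 'p \<Rightarrow> 'p \<Rightarrow> bool" where
  "piecewise_smooth_curve M n t c p q \<longleftrightarrow>
     (\<forall>k\<le>n. t k < t (Suc k) \<and> (\<exists>J. {t k..t (Suc k)} \<subseteq> J \<and> smooth_curve M J (c k))) \<and>
     (\<forall>k<n. c k (t (Suc k)) = c (Suc k) (t (Suc k))) \<and>
     c 0 (t 0) = p \<and> c n (t (Suc n)) = q"


section \<open>Geodesics\<close>

text \<open>
  The value at \<open>p\<close>, in chart \<open>i\<close>, of the covariant derivative of the coordinate vector fields
  with constant components \<open>u\<close> and \<open>v\<close>, that is \<open>\<Sum>\<Gamma>\<^sup>k\<^sub>l\<^sub>m u\<^sup>l v\<^sup>m \<partial>\<^sub>k\<close>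
  for the Levi-Civita connection, given by the Koszul formula.
\<close>

definition christoffel ::
  "('i, 'p, 'e::real_normed_vector) metric_manifold \<Rightarrow> 'i \<Rightarrow> 'p \<Rightarrow> 'e \<Rightarrow> 'e \<Rightarrow> 'e" where
  "christoffel M i p u v =
     (let D = (\<lambda>x y z. frechet_derivative (\<lambda>\<xi>. metric_at M i (chart_inv M i \<xi>) y z)
                         (at (chart_map M i p)) x)
      in THE z. \<forall>w. 2 * metric_at M i p z w = D u v w + D v u w - D w u v)"

definition geodesic ::
  "('i, 'p::topological_space, 'e::euclidean_space) metric_manifold \<Rightarrow> real set \<Rightarrow> (real \<Rightarrow> 'p) \<Rightarrow> bool" where
  "geodesic M J \<gamma> \<longleftrightarrow>
     smooth_curve M J \<gamma> \<and>
     (\<forall>t\<in>J. \<forall>i\<in>charts M. \<gamma> t \<in> chart_dom M i \<longrightarrow>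
        vector_derivative (velocity M i \<gamma>) (at t)
          + christoffel M i (\<gamma> t) (velocity M i \<gamma> t) (velocity M i \<gamma> t) = 0)"

definition geodesic_joins ::
  "('i, 'p::topological_space, 'e::euclidean_space) metric_manifold \<Rightarrow> (real \<Rightarrow> 'p) \<Rightarrow> 'p \<Rightarrow> 'p \<Rightarrow> bool" where
  "geodesic_joins M \<gamma> p q \<longleftrightarrow>
     (\<exists>J. {0..1} \<subseteq> J \<and> geodesic M J \<gamma>) \<and> \<gamma> 0 = p \<and> \<gamma> 1 = q"

definition geodesically_connected ::
  "('i, 'p::topological_space, 'e::euclidean_space) metric_manifold \<Rightarrow> bool" where
  "geodesically_connected M \<longleftrightarrow> (\<forall>p\<in>points M. \<forall>q\<in>points M. \<exists>\<gamma>. geodesic_joins M \<gamma> p q)"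


section \<open>Riemannian distance, diameter, weak convexity\<close>

definition curve_length ::
  "('i, 'p, 'e::real_normed_vector) metric_manifold \<Rightarrow> real \<Rightarrow> real \<Rightarrow> (real \<Rightarrow> 'p) \<Rightarrow> ennreal" where
  "curve_length M s s' \<gamma> = (\<integral>\<^sup>+t\<in>{s..s'}. ennreal (sqrt (velocity_square M \<gamma> t)) \<partial>lborel)"

definition riemannian_dist ::
  "('i, 'p::topological_space, 'e::euclidean_space) metric_manifold \<Rightarrow> 'p \<Rightarrow> 'p \<Rightarrow> ennreal" where
  "riemannian_dist M p q =
     Inf {(\<Sum>k\<le>n. curve_length M (t k) (t (Suc k)) (c k)) | n t c. piecewise_smooth_curve M n t c p q}"

definition riemannian_diam ::
  "('i, 'p::topological_space, 'e::euclidean_space) metric_manifold \<Rightarrow> ennreal" where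
  "riemannian_diam M = (SUP p\<in>points M. SUP q\<in>points M. riemannian_dist M p q)"

definition weakly_convex ::
  "('i, 'p::topological_space, 'e::euclidean_space) metric_manifold \<Rightarrow> bool" where
  "weakly_convex M \<longleftrightarrow>
     (\<forall>p\<in>points M. \<forall>q\<in>points M. \<exists>\<gamma>. geodesic_joins M \<gamma> p q \<and>
        curve_length M 0 1 \<gamma> = riemannian_dist M p q)"


section \<open>GRW spacetimes and their causality\<close>

definition interval_I :: "ereal \<Rightarrow> ereal \<Rightarrow> real set" where
  "interval_I a b = {\<tau>. a < ereal \<tau> \<and> ereal \<tau> < b}"

definition grw ::
  "ereal \<Rightarrow> ereal \<Rightarrow> (real \<Rightarrow> real) \<Rightarrow> ('i, 'p, 'e) metric_manifold \<Rightarrow>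
     ('i, real \<times> 'p, real \<times> 'e) metric_manifold" where
  "grw a b f F =
     \<lparr> charts = charts F,
       chart_dom = (\<lambda>i. interval_I a b \<times> chart_dom F i),
       chart_map = (\<lambda>i (\<tau>, x). (\<tau>, chart_map F i x)),
       metric_at = (\<lambda>i (\<tau>, x) (s, v) (s', v'). - (s * s') + (f \<tau>)\<^sup>2 * metric_at F i x v v') \<rparr>"

text \<open>In every chart of \<open>grw a b f F\<close> the vector \<open>(1, 0)\<close> represents \<open>\<partial>/\<partial>\<tau>\<close>.\<close>

definition future_pointing ::
  "('i, real \<times> 'p, real \<times> 'e::real_normed_vector) metric_manifold \<Rightarrow> (real \<Rightarrow> real \<times> 'p) \<Rightarrow> real \<Rightarrow> bool" where
  "future_pointing M \<gamma> t \<longleftrightarrow>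
     (let i = some_chart M (\<gamma> t) in metric_at M i (\<gamma> t) (velocity M i \<gamma> t) (1, 0) < 0)"

definition timelike_at ::
  "('i, 'p, 'e::real_normed_vector) metric_manifold \<Rightarrow> (real \<Rightarrow> 'p) \<Rightarrow> real \<Rightarrow> bool" where
  "timelike_at M \<gamma> t \<longleftrightarrow> velocity_square M \<gamma> t < 0"

definition nonspacelike_at ::
  "('i, 'p, 'e::real_normed_vector) metric_manifold \<Rightarrow> (real \<Rightarrow> 'p) \<Rightarrow> real \<Rightarrow> bool" where
  "nonspacelike_at M \<gamma> t \<longleftrightarrow> velocity_square M \<gamma> t \<le> 0"

definition chron_precedes ::
  "('i, real \<times> 'p::topological_space, real \<times> 'e::euclidean_space) metric_manifold \<Rightarrow>
     real \<times> 'p \<Rightarrow> real \<times> 'p \<Rightarrow> bool" where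
  "chron_precedes M z z' \<longleftrightarrow>
     (\<exists>n t c. piecewise_smooth_curve M n t c z z' \<and>
        (\<forall>k\<le>n. \<forall>s\<in>{t k..t (Suc k)}. timelike_at M (c k) s \<and> future_pointing M (c k) s))"

definition causally_precedes ::
  "('i, real \<times> 'p::topological_space, real \<times> 'e::euclidean_space) metric_manifold \<Rightarrow>
     real \<times> 'p \<Rightarrow> real \<times> 'p \<Rightarrow> bool" where
  "causally_precedes M z z' \<longleftrightarrow>
     (\<exists>n t c. piecewise_smooth_curve M n t c z z' \<and>
        (\<forall>k\<le>n. \<forall>s\<in>{t k..t (Suc k)}. nonspacelike_at M (c k) s \<and> future_pointing M (c k) s))"

definition chronologically_related ::
  "('i, real \<times> 'p::topological_space, real \<times> 'e::euclidean_space) metric_manifold \<Rightarrow>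
     real \<times> 'p \<Rightarrow> real \<times> 'p \<Rightarrow> bool" where
  "chronologically_related M z z' \<longleftrightarrow> chron_precedes M z z' \<or> chron_precedes M z' z"

definition causally_related ::
  "('i, real \<times> 'p::topological_space, real \<times> 'e::euclidean_space) metric_manifold \<Rightarrow>
     real \<times> 'p \<Rightarrow> real \<times> 'p \<Rightarrow> bool" where
  "causally_related M z z' \<longleftrightarrow> causally_precedes M z z' \<or> causally_precedes M z' z"


section \<open>Turning points\<close>

definition warp :: "(real \<Rightarrow> real) \<Rightarrow> real \<Rightarrow> real" where
  "warp f \<tau> = 1 / (f \<tau>)\<^sup>2"

definition A_plus :: "ereal \<Rightarrow> ereal \<Rightarrow> (real \<Rightarrow> real) \<Rightarrow> real \<Rightarrow> real \<Rightarrow> ereal set" where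
  "A_plus a b f \<tau>0 D = ereal ` {\<tau>\<in>interval_I a b. \<tau> \<ge> \<tau>0 \<and> warp f \<tau> = D} \<union> {b}"

definition A_minus :: "ereal \<Rightarrow> ereal \<Rightarrow> (real \<Rightarrow> real) \<Rightarrow> real \<Rightarrow> real \<Rightarrow> ereal set" where
  "A_minus a b f \<tau>0 D = ereal ` {\<tau>\<in>interval_I a b. \<tau> \<le> \<tau>0 \<and> warp f \<tau> = D} \<union> {a}"

text \<open>For \<open>D \<le> warp f \<tau>0\<close> the infimum and supremum below are attained, so they are the
  minimum and the maximum.\<close>

definition b_star :: "ereal \<Rightarrow> ereal \<Rightarrow> (real \<Rightarrow> real) \<Rightarrow> real \<Rightarrow> real \<Rightarrow> ereal" where
  "b_star a b f \<tau>0 D =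
     (if deriv (warp f) \<tau>0 > 0 then Inf (A_plus a b f \<tau>0 D - {ereal \<tau>0})
      else Inf (A_plus a b f \<tau>0 D))"

definition a_star :: "ereal \<Rightarrow> ereal \<Rightarrow> (real \<Rightarrow> real) \<Rightarrow> real \<Rightarrow> real \<Rightarrow> ereal" where
  "a_star a b f \<tau>0 D =
     (if deriv (warp f) \<tau>0 < 0 then Sup (A_minus a b f \<tau>0 D - {ereal \<tau>0})
      else Sup (A_minus a b f \<tau>0 D))"

definition h_int :: "(real \<Rightarrow> real) \<Rightarrow> real \<Rightarrow> ereal \<Rightarrow> ereal \<Rightarrow> ennreal" where
  "h_int f D \<alpha> \<beta> =
     (\<integral>\<^sup>+\<tau>\<in>interval_I \<alpha> \<beta>. ennreal (1 / (f \<tau>)\<^sup>2 / sqrt (warp f \<tau> - D)) \<partial>lborel)"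


section \<open>Relative minima at the extremes\<close>

text \<open>The real variable tends to \<open>b\<close> from the left, resp. to \<open>a\<close> from the right; this
  covers finite and infinite extremes at once.\<close>

definition to_b :: "ereal \<Rightarrow> real filter" where
  "to_b b = (if b = \<infinity> then at_top else at_left (real_of_ereal b))"

definition to_a :: "ereal \<Rightarrow> real filter" where
  "to_a a = (if a = -\<infinity> then at_bot else at_right (real_of_ereal a))"

definition m_b :: "ereal \<Rightarrow> (real \<Rightarrow> real) \<Rightarrow> ereal" where
  "m_b b f = Liminf (to_b b) (\<lambda>\<tau>. ereal (warp f \<tau>))"

definition m_a :: "ereal \<Rightarrow> (real \<Rightarrow> real) \<Rightarrow> ereal" where
  "m_a a f = Liminf (to_a a) (\<lambda>\<tau>. ereal (warp f \<tau>))"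

definition m_inf :: "ereal \<Rightarrow> ereal \<Rightarrow> (real \<Rightarrow> real) \<Rightarrow> real" where
  "m_inf a b f = (INF \<tau>\<in>interval_I a b. warp f \<tau>)"

text \<open>In \<open>close_to_b\<close> the number \<open>s\<close> plays the role of \<open>b - \<epsilon>\<close> for finite \<open>b\<close> and of
  \<open>M\<close> for \<open>b = \<infinity>\<close>; similarly in \<open>close_to_a\<close>.\<close>

definition close_to_b :: "ereal \<Rightarrow> ereal \<Rightarrow> (real \<Rightarrow> real) \<Rightarrow> real \<Rightarrow> bool" where
  "close_to_b a b f c \<longleftrightarrow> c \<in> interval_I a b \<and>
     (\<exists>s\<in>interval_I a b. s < c \<and> (\<forall>\<tau>\<in>interval_I a b. s < \<tau> \<longrightarrow> ereal (warp f \<tau>) > m_b b f))"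

definition close_to_a :: "ereal \<Rightarrow> ereal \<Rightarrow> (real \<Rightarrow> real) \<Rightarrow> real \<Rightarrow> bool" where
  "close_to_a a b f c \<longleftrightarrow> c \<in> interval_I a b \<and>
     (\<exists>s\<in>interval_I a b. c < s \<and> (\<forall>\<tau>\<in>interval_I a b. \<tau> < s \<longrightarrow> ereal (warp f \<tau>) > m_a a f))"

definition rel_min_at_b :: "ereal \<Rightarrow> ereal \<Rightarrow> (real \<Rightarrow> real) \<Rightarrow> bool" where
  "rel_min_at_b a b f \<longleftrightarrow>
     (\<exists>s\<in>interval_I a b. \<forall>\<tau>\<in>interval_I a b. s < \<tau> \<longrightarrow> ereal (warp f \<tau>) > m_b b f)"

definition rel_min_at_a :: "ereal \<Rightarrow> ereal \<Rightarrow> (real \<Rightarrow> real) \<Rightarrow> bool" where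
  "rel_min_at_a a b f \<longleftrightarrow>
     (\<exists>s\<in>interval_I a b. \<forall>\<tau>\<in>interval_I a b. \<tau> < s \<longrightarrow> ereal (warp f \<tau>) > m_a a f)"


section \<open>Condition (C)\<close>

text \<open>
  If there is a relative minimum at \<open>b\<close>, then \<open>m_b b f\<close> is finite. The numbers \<open>d_b\<close> and
  \<open>i_b\<close> do not depend on the choice of the point \<open>c\<close> close to \<open>b\<close>, and the difference
  defining \<open>d_b\<close> is nonnegative, so truncated subtraction is harmless. They are meaningful only
  under the conditions spelled out in \<open>condition_C_b\<close>. The same applies at \<open>a\<close>.
\<close>

definition d_b :: "ereal \<Rightarrow> ereal \<Rightarrow> (real \<Rightarrow> real) \<Rightarrow> ennreal" where
  "d_b a b f =
     (let c = (SOME c. close_to_b a b f c); \<mu> = real_of_ereal (m_b b f)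
      in Limsup (at \<mu>) (\<lambda>D. h_int f D (ereal c) (b_star a b f c D)) - h_int f \<mu> (ereal c) b)"

definition d_a :: "ereal \<Rightarrow> ereal \<Rightarrow> (real \<Rightarrow> real) \<Rightarrow> ennreal" where
  "d_a a b f =
     (let c = (SOME c. close_to_a a b f c); \<mu> = real_of_ereal (m_a a f)
      in Limsup (at \<mu>) (\<lambda>D. h_int f D (a_star a b f c D) (ereal c)) - h_int f \<mu> a (ereal c))"

definition i_b :: "ereal \<Rightarrow> ereal \<Rightarrow> (real \<Rightarrow> real) \<Rightarrow> ennreal" where
  "i_b a b f =
     (let c = (SOME c. close_to_b a b f c)
      in INF D\<in>{m_inf a b f<..real_of_ereal (m_b b f)}. h_int f D (a_star a b f c D) b)"

definition i_a :: "ereal \<Rightarrow> ereal \<Rightarrow> (real \<Rightarrow> real) \<Rightarrow> ennreal" where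
  "i_a a b f =
     (let c = (SOME c. close_to_a a b f c)
      in INF D\<in>{m_inf a b f<..real_of_ereal (m_a a f)}. h_int f D a (b_star a b f c D))"

definition condition_C_b :: "ereal \<Rightarrow> ereal \<Rightarrow> (real \<Rightarrow> real) \<Rightarrow> ennreal \<Rightarrow> bool" where
  "condition_C_b a b f diamF \<longleftrightarrow>
     \<not> rel_min_at_b a b f \<or>
     (\<exists>c. close_to_b a b f c \<and> h_int f (real_of_ereal (m_b b f)) (ereal c) b = \<infinity>) \<or>
     2 * d_b a b f \<ge> diamF \<or>
     (2 * d_b a b f < diamF \<and> ereal (m_inf a b f) < m_b b f \<and> d_b a b f \<ge> i_b a b f)"

definition condition_C_a :: "ereal \<Rightarrow> ereal \<Rightarrow> (real \<Rightarrow> real) \<Rightarrow> ennreal \<Rightarrow> bool" where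
  "condition_C_a a b f diamF \<longleftrightarrow>
     \<not> rel_min_at_a a b f \<or>
     (\<exists>c. close_to_a a b f c \<and> h_int f (real_of_ereal (m_a a f)) a (ereal c) = \<infinity>) \<or>
     2 * d_a a b f \<ge> diamF \<or>
     (2 * d_a a b f < diamF \<and> ereal (m_inf a b f) < m_a a f \<and> d_a a b f \<ge> i_a a b f)"

definition condition_C :: "ereal \<Rightarrow> ereal \<Rightarrow> (real \<Rightarrow> real) \<Rightarrow> ennreal \<Rightarrow> bool" where
  "condition_C a b f diamF \<longleftrightarrow> condition_C_b a b f diamF \<and> condition_C_a a b f diamF"


section \<open>Condition (R)\<close>

definition R_int :: "ereal \<Rightarrow> ereal \<Rightarrow> (real \<Rightarrow> real) \<Rightarrow> real \<Rightarrow> real \<Rightarrow> ennreal" where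
  "R_int a b f \<tau>0 D = h_int f D (ereal \<tau>0) (b_star a b f \<tau>0 D)"

definition \<Lambda>_int :: "ereal \<Rightarrow> ereal \<Rightarrow> (real \<Rightarrow> real) \<Rightarrow> real \<Rightarrow> real \<Rightarrow> ennreal" where
  "\<Lambda>_int a b f \<tau>0 D = h_int f D (a_star a b f \<tau>0 D) (ereal \<tau>0)"

definition W_int :: "ereal \<Rightarrow> ereal \<Rightarrow> (real \<Rightarrow> real) \<Rightarrow> real \<Rightarrow> real \<Rightarrow> ennreal" where
  "W_int a b f \<tau>0 D = \<Lambda>_int a b f \<tau>0 D + R_int a b f \<tau>0 D"

definition E_int :: "ereal \<Rightarrow> ereal \<Rightarrow> (real \<Rightarrow> real) \<Rightarrow> real \<Rightarrow> nat \<Rightarrow> real \<Rightarrow> ennreal" where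
  "E_int a b f \<tau>0 n D = (if even n then R_int a b f \<tau>0 D else \<Lambda>_int a b f \<tau>0 D)"

definition G_int :: "ereal \<Rightarrow> ereal \<Rightarrow> (real \<Rightarrow> real) \<Rightarrow> real \<Rightarrow> nat \<Rightarrow> real \<Rightarrow> ennreal" where
  "G_int a b f \<tau>0 n D = (if even n then \<Lambda>_int a b f \<tau>0 D else R_int a b f \<tau>0 D)"

text \<open>The variable \<open>T\<close> stands for \<open>b - \<epsilon>\<close> (or \<open>M\<close>), resp. for \<open>a + \<epsilon>\<close> (or
  \<open>- M\<close>). All expressions are monotone in \<open>T\<close>, so the outer limits exist in
  \<open>[0, \<infinity>]\<close>.\<close>

definition r_i :: "ereal \<Rightarrow> ereal \<Rightarrow> (real \<Rightarrow> real) \<Rightarrow> real \<Rightarrow> nat \<Rightarrow> ennreal" where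
  "r_i a b f \<tau>0 n =
     Lim (to_b b) (\<lambda>T. Liminf (at_right (m_inf a b f)) (\<lambda>D.
       if n = 0 then h_int f D (ereal \<tau>0) (ereal T)
       else E_int a b f \<tau>0 n D + of_nat (n - 1) * W_int a b f \<tau>0 D
              + h_int f D (a_star a b f \<tau>0 D) (ereal T)))"

definition l_i :: "ereal \<Rightarrow> ereal \<Rightarrow> (real \<Rightarrow> real) \<Rightarrow> real \<Rightarrow> nat \<Rightarrow> ennreal" where
  "l_i a b f \<tau>0 n =
     Lim (to_a a) (\<lambda>T. Liminf (at_right (m_inf a b f)) (\<lambda>D.
       if n = 0 then h_int f D (ereal T) (ereal \<tau>0)
       else G_int a b f \<tau>0 n D + of_nat (n - 1) * W_int a b f \<tau>0 D
              + h_int f D (ereal T) (b_star a b f \<tau>0 D)))"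

definition r_s :: "ereal \<Rightarrow> ereal \<Rightarrow> (real \<Rightarrow> real) \<Rightarrow> real \<Rightarrow> nat \<Rightarrow> ennreal" where
  "r_s a b f \<tau>0 n =
     Lim (to_b b) (\<lambda>T. Limsup (at_right (m_inf a b f)) (\<lambda>D.
       E_int a b f \<tau>0 n D + of_nat n * W_int a b f \<tau>0 D
         + h_int f D (ereal T) (b_star a b f \<tau>0 D)))"

definition l_s :: "ereal \<Rightarrow> ereal \<Rightarrow> (real \<Rightarrow> real) \<Rightarrow> real \<Rightarrow> nat \<Rightarrow> ennreal" where
  "l_s a b f \<tau>0 n =
     Lim (to_a a) (\<lambda>T. Limsup (at_right (m_inf a b f)) (\<lambda>D.
       G_int a b f \<tau>0 n D + of_nat n * W_int a b f \<tau>0 D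
         + h_int f D (a_star a b f \<tau>0 D) (ereal T)))"

definition condition_R :: "ereal \<Rightarrow> ereal \<Rightarrow> (real \<Rightarrow> real) \<Rightarrow> ennreal \<Rightarrow> bool" where
  "condition_R a b f diamF \<longleftrightarrow>
     (\<forall>\<tau>\<in>interval_I a b. warp f \<tau> > m_inf a b f) \<and>
     m_a a f = ereal (m_inf a b f) \<and> m_b b f = ereal (m_inf a b f) \<and>
     (\<forall>\<tau>0\<in>interval_I a b.
        {r_i a b f \<tau>0 0..diamF} \<subseteq> (\<Union>n. {r_i a b f \<tau>0 n..r_s a b f \<tau>0 n}) \<and>
        {l_i a b f \<tau>0 0..diamF} \<subseteq> (\<Union>n. {l_i a b f \<tau>0 n..l_s a b f \<tau>0 n}))"

end

theory Submission imports Defs begin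

text \<open>
  Let \<open>V = 1 / f\<^sup>2\<close>. Projecting to the fibre, a geodesic of the warped product that is not vertical
  runs along a fibre geodesic, and with the fibre arc length \<open>r\<close> as parameter its base component \<open>u\<close>
  satisfies \<open>u' = p / V(u)\<close>, \<open>p' = V'(u) / (2 V(u))\<close>, \<open>p\<^sup>2 = V(u) - D\<close> for a constant \<open>D\<close>. Since fibre
  points are joined by minimizing geodesics of length \<open>L = d\<^sub>F\<close>, one has to find a level \<open>D\<close> for
  which such a trajectory leads from \<open>\<tau>\<^sub>0\<close> to \<open>\<tau>\<^sub>1\<close> in time exactly \<open>L\<close>. Travel times are integrals of
  \<open>h\<^sub>D = V / sqrt (V - D)\<close>.

  For \<open>D \<le> 0\<close> the direct travel time increases continuously from \<open>0\<close> to \<open>\<integral> 1 / f\<close> at \<open>D = 0\<close>, and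
  the sign of \<open>D\<close> is the causal character. Conversely a causal curve satisfies
  \<open>|x'| \<le> \<tau>' / f\<close>, which integrates to the bound on the distance.

  For (ii), raise \<open>D\<close> up to the minimum \<open>Y\<close> of \<open>V\<close> between the two points. If the direct travel time
  stays below \<open>L\<close>, the minimum is attained only at an end point, with nonzero slope, say at
  \<open>\<tau>\<^sub>1\<close> with \<open>V' < 0\<close>. There the direct family continues into trajectories that bounce beyond \<open>\<tau>\<^sub>1\<close>, with
  \<open>D\<close> now decreasing. If no bouncing trajectory takes time \<open>L\<close>, all of them take less, so none can
  approach a critical point and \<open>D\<close> decreases to \<open>m\<^sub>b\<close>; the limit gives \<open>2 d\<^sub>b < L\<close>. Condition (C) then
  provides \<open>d\<^sub>b \<ge> i\<^sub>b\<close>, hence a bounce at the left, to which the reflected argument applies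
  and exhausts the alternatives at \<open>a\<close>. Under condition (R) the periodic trajectories with \<open>n\<close> bounces arrive
  before \<open>L\<close> for some level and after \<open>L\<close> for another, and continuity in \<open>D\<close> gives the solution.
\<close>

section \<open>Smooth functions\<close>

text \<open>With the fibre arc length as time, the end point condition is a single equation for the
  single unknown \<open>D\<close>. Solving it by continuity meets two obstacles: a travel time
  becomes infinite when a turning point is critical, and it may jump when a turning point escapes to
  an end of the interval. Travel times therefore live in \<open>ennreal\<close>. Their lower
  semicontinuity in \<open>D\<close> is proved at every level below the starting value of
  \<open>V\<close>, upper semicontinuity only where the turning point is interior; a finite time
  forces such a point to be nondegenerate. Hence the search is arranged as a proof by contradiction:
  if no level is a solution, the time of a continuous family over a connected set of levels never
  equals \<open>L\<close> and stays on the side on which it starts. The lower side is the useful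
  one, since the bound by \<open>L\<close> supplies the finiteness needed to continue the family. At
  the two limits where continuity is lost, the level tending to \<open>m_b\<close> or to the value
  of \<open>V\<close> at an end point, one-sided estimates take over.\<close>

lemma C_k_on_cong:
  assumes "open S" "\<And>x. x \<in> S \<Longrightarrow> f x = g x" "C_k_on k S f"
  shows "C_k_on k S g"
  using assms(2,3)
proof (induction k arbitrary: f g)
  case 0
  then show ?case using continuous_on_cong[of S S f g] by simp
next
  case (Suc k)
  have d: "(g has_derivative frechet_derivative f (at x)) (at x)" if "x \<in> S" for x
  proof (rule has_derivative_transform_within_open[OF _ assms(1) that])
    show "(f has_derivative frechet_derivative f (at x)) (at x)"
      using Suc.prems(2) that frechet_derivative_works C_k_on.simps(2) by blast
  qed (use Suc.prems(1) in blast)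
  have eq: "frechet_derivative g (at x) = frechet_derivative f (at x)" if "x \<in> S" for x
    using frechet_derivative_at[OF d[OF that]] by simp
  show ?case
    using Suc.prems d eq Suc.IH by (auto simp: differentiable_def)
qed

lemma C_k_on_subset: "C_k_on k S f \<Longrightarrow> T \<subseteq> S \<Longrightarrow> C_k_on k T f"
  by (induction k arbitrary: f) (auto intro: continuous_on_subset)

lemma C_k_on_imp_continuous_on: "C_k_on k S f \<Longrightarrow> continuous_on S f"
  by (cases k) (auto intro!: differentiable_imp_continuous_within continuous_at_imp_continuous_on)

lemma C_k_on_Suc_imp: "C_k_on (Suc k) S f \<Longrightarrow> C_k_on k S f"
proof (induction k arbitrary: f)
  case 0
  then show ?case using C_k_on_imp_continuous_on[of "Suc 0"] by simp
next
  case (Suc k)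
  then show ?case unfolding C_k_on.simps(2)[of "Suc k"] C_k_on.simps(2)[of k] by blast
qed

lemma C_k_on_bounded_linear:
  assumes "open S" "bounded_linear L" "C_k_on k S f"
  shows "C_k_on k S (\<lambda>x. L (f x))"
  using assms(3)
proof (induction k arbitrary: f)
  case 0
  then show ?case by (simp add: bounded_linear.continuous_on[OF assms(2)])
next
  case (Suc k)
  have d: "((\<lambda>x. L (f x)) has_derivative (\<lambda>v. L (frechet_derivative f (at x) v))) (at x)"
    if "x \<in> S" for x
    using Suc.prems that bounded_linear.has_derivative[OF assms(2)] frechet_derivative_works
      C_k_on.simps(2) by blast
  have eq: "frechet_derivative (\<lambda>x. L (f x)) (at x) = (\<lambda>v. L (frechet_derivative f (at x) v))"
    if "x \<in> S" for x
    using frechet_derivative_at[OF d[OF that]] by simp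
  have "C_k_on k S (\<lambda>x. frechet_derivative (\<lambda>x. L (f x)) (at x) v)" for v
    using Suc.prems
    by (intro C_k_on_cong[OF assms(1) _ Suc.IH[of "\<lambda>x. frechet_derivative f (at x) v"]])
       (auto simp: eq)
  then show ?case using d by (auto simp: differentiable_def)
qed

text \<open>A linear map on the real line is determined by its value at 1, so the quantifier over
  directions collapses to one derivative function. The closure properties under sums, products,
  composition and inverses are inductions through this form.\<close>

lemma C_k_on_Suc_real:
  fixes f :: "real \<Rightarrow> 'b::real_normed_vector"
  assumes "open S"
  shows "C_k_on (Suc k) S f \<longleftrightarrow>
    (\<exists>f'. (\<forall>x\<in>S. (f has_vector_derivative f' x) (at x)) \<and> C_k_on k S f')" (is "?l \<longleftrightarrow> ?r")
proof
  assume ?l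
  then have "(f has_vector_derivative frechet_derivative f (at x) 1) (at x)" if "x \<in> S" for x
    using that unfolding has_vector_derivative_def
    by (subst linear_frechet_derivative[THEN linear_scale, symmetric])
       (auto simp: frechet_derivative_works[symmetric])
  then show ?r
    using \<open>?l\<close> by (intro exI[of _ "\<lambda>x. frechet_derivative f (at x) 1"]) auto
next
  assume ?r
  then obtain f' where f': "\<And>x. x \<in> S \<Longrightarrow> (f has_vector_derivative f' x) (at x)" "C_k_on k S f'"
    by blast
  have eq: "frechet_derivative f (at x) = (\<lambda>v. v *\<^sub>R f' x)" if "x \<in> S" for x
    using frechet_derivative_at[OF f'(1)[OF that, unfolded has_vector_derivative_def]] by simp
  have "C_k_on k S (\<lambda>x. frechet_derivative f (at x) v)" for v
    by (rule C_k_on_cong[OF assms _ C_k_on_bounded_linear[OF assms bounded_linear_scaleR_right[of v] f'(2)]])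
       (simp add: eq)
  then show ?l
    using f'(1) by (auto simp: differentiable_def has_vector_derivative_def)
qed

lemma C_k_on_add:
  fixes f g :: "real \<Rightarrow> 'b::real_normed_vector"
  assumes "open S" "C_k_on k S f" "C_k_on k S g"
  shows "C_k_on k S (\<lambda>x. f x + g x)"
  using assms(2,3)
proof (induction k arbitrary: f g)
  case (Suc k)
  from Suc.prems obtain f' g' where
    "\<And>x. x \<in> S \<Longrightarrow> (f has_vector_derivative f' x) (at x)" "C_k_on k S f'"
    "\<And>x. x \<in> S \<Longrightarrow> (g has_vector_derivative g' x) (at x)" "C_k_on k S g'"
    unfolding C_k_on_Suc_real[OF assms(1)] by blast
  then show ?case
    unfolding C_k_on_Suc_real[OF assms(1)] using Suc.IH
    by (intro exI[of _ "\<lambda>x. f' x + g' x"]) (auto intro!: has_vector_derivative_add)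
qed (auto intro: continuous_intros)

lemma C_k_on_bilinear:
  fixes f :: "real \<Rightarrow> 'b::real_normed_vector" and g :: "real \<Rightarrow> 'c::real_normed_vector"
  assumes "open S" "bounded_bilinear B" "C_k_on k S f" "C_k_on k S g"
  shows "C_k_on k S (\<lambda>x. B (f x) (g x))"
  using assms(3,4)
proof (induction k arbitrary: f g)
  case 0
  then show ?case by (simp add: bounded_bilinear.continuous_on[OF assms(2)])
next
  case (Suc k)
  from Suc.prems obtain f' g' where
    *: "\<And>x. x \<in> S \<Longrightarrow> (f has_vector_derivative f' x) (at x)" "C_k_on k S f'"
    "\<And>x. x \<in> S \<Longrightarrow> (g has_vector_derivative g' x) (at x)" "C_k_on k S g'"
    unfolding C_k_on_Suc_real[OF assms(1)] by blast
  have "C_k_on k S f" "C_k_on k S g"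
    using Suc.prems C_k_on_Suc_imp by blast+
  then have "C_k_on k S (\<lambda>x. B (f x) (g' x) + B (f' x) (g x))"
    using C_k_on_add[OF assms(1)] Suc.IH[OF _ *(4)] Suc.IH[OF *(2)] by blast
  then show ?case
    unfolding C_k_on_Suc_real[OF assms(1)] using *
    by (intro exI[of _ "\<lambda>x. B (f x) (g' x) + B (f' x) (g x)"])
       (auto intro!: bounded_bilinear.has_vector_derivative[OF assms(2)])
qed

lemma C_k_on_compose:
  fixes g :: "real \<Rightarrow> 'b::real_normed_vector" and r :: "real \<Rightarrow> real"
  assumes "open S" "open T" "r ` S \<subseteq> T" "C_k_on k S r" "C_k_on k T g"
  shows "C_k_on k S (\<lambda>x. g (r x))"
  using assms(4,5)
proof (induction k arbitrary: g)
  case 0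
  then show ?case using assms(3) by (auto intro: continuous_on_compose2)
next
  case (Suc k)
  from Suc.prems obtain r' g' where
    *: "\<And>x. x \<in> S \<Longrightarrow> (r has_vector_derivative r' x) (at x)" "C_k_on k S r'"
    "\<And>x. x \<in> T \<Longrightarrow> (g has_vector_derivative g' x) (at x)" "C_k_on k T g'"
    unfolding C_k_on_Suc_real[OF assms(1)] C_k_on_Suc_real[OF assms(2)] by blast
  have "C_k_on k S (\<lambda>x. g' (r x))"
    using C_k_on_Suc_imp[OF Suc.prems(1)] *(4) by (intro Suc.IH)
  then have "C_k_on k S (\<lambda>x. r' x *\<^sub>R g' (r x))"
    using C_k_on_bilinear[OF assms(1) bounded_bilinear_scaleR *(2)] by blast
  moreover have "((\<lambda>x. g (r x)) has_vector_derivative r' x *\<^sub>R g' (r x)) (at x)" if "x \<in> S" for x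
    using vector_diff_chain_at[OF *(1)[OF that] *(3)[of "r x"]] assms(3) that by (auto simp: o_def)
  ultimately show ?case
    unfolding C_k_on_Suc_real[OF assms(1)] by (intro exI[of _ "\<lambda>x. r' x *\<^sub>R g' (r x)"]) simp
qed

lemma C_k_on_inverse:
  fixes f :: "real \<Rightarrow> real"
  assumes "open S" "C_k_on k S f" "\<And>x. x \<in> S \<Longrightarrow> f x \<noteq> 0"
  shows "C_k_on k S (\<lambda>x. inverse (f x))"
  using assms(2)
proof (induction k)
  case 0
  then show ?case using assms(3) by (auto intro: continuous_on_inverse)
next
  case (Suc k)
  from Suc.prems obtain f' where
    *: "\<And>x. x \<in> S \<Longrightarrow> (f has_vector_derivative f' x) (at x)" "C_k_on k S f'"
    unfolding C_k_on_Suc_real[OF assms(1)] by blast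
  have "C_k_on k S (\<lambda>x. inverse (f x))" using Suc C_k_on_Suc_imp by blast
  then have "C_k_on k S (\<lambda>x. - (inverse (f x) * f' x * inverse (f x)))"
    using C_k_on_bounded_linear[OF assms(1) bounded_linear_minus[OF bounded_linear_ident]
       C_k_on_bilinear[OF assms(1) bounded_bilinear_mult C_k_on_bilinear[OF assms(1) bounded_bilinear_mult _ *(2)]]]
    by blast
  moreover have "((\<lambda>x. inverse (f x)) has_vector_derivative - (inverse (f x) * f' x * inverse (f x))) (at x)"
    if "x \<in> S" for x
    using DERIV_inverse'[of f "f' x" x UNIV] *(1)[OF that] assms(3)[OF that]
    by (simp add: has_real_derivative_iff_has_vector_derivative)
  ultimately show ?case
    unfolding C_k_on_Suc_real[OF assms(1)]
    by (intro exI[of _ "\<lambda>x. - (inverse (f x) * f' x * inverse (f x))"]) simp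
qed

lemma C_k_on_Pair:
  fixes f :: "real \<Rightarrow> 'b::real_normed_vector" and g :: "real \<Rightarrow> 'c::real_normed_vector"
  assumes "open S" "C_k_on k S f" "C_k_on k S g"
  shows "C_k_on k S (\<lambda>x. (f x, g x))"
proof -
  have b: "bounded_linear (\<lambda>x. (x, 0::'c))" "bounded_linear (\<lambda>y. (0::'b, y))"
    using bounded_linear_Pair[OF bounded_linear_ident bounded_linear_zero]
      bounded_linear_Pair[OF bounded_linear_zero bounded_linear_ident] by blast+
  show ?thesis
    using C_k_on_add[OF assms(1) C_k_on_bounded_linear[OF assms(1) b(1) assms(2)]
        C_k_on_bounded_linear[OF assms(1) b(2) assms(3)]] by simp
qed

lemma C_k_on_const:
  fixes c :: "'b::real_normed_vector"
  assumes "open (S::real set)"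
  shows "C_k_on k S (\<lambda>x. c)"
proof (induction k arbitrary: c)
  case (Suc k)
  show ?case unfolding C_k_on_Suc_real[OF assms]
    using has_vector_derivative_const[of c] Suc[of 0] by (intro exI[of _ "\<lambda>_. 0"]) simp
qed simp

lemma C_k_on_id:
  assumes "open (S::real set)"
  shows "C_k_on k S (\<lambda>x. x)"
proof (cases k)
  case (Suc n)
  show ?thesis unfolding Suc C_k_on_Suc_real[OF assms]
    using has_vector_derivative_id C_k_on_const[OF assms, of n 1] by (intro exI[of _ "\<lambda>_. 1"]) simp
qed simp

lemma smooth_onD_deriv:
  fixes f :: "real \<Rightarrow> 'b::real_normed_vector"
  assumes "open S" "smooth_on S f"
  shows "smooth_on S (\<lambda>x. vector_derivative f (at x))"
    and "\<And>x. x \<in> S \<Longrightarrow> (f has_vector_derivative vector_derivative f (at x)) (at x)"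
proof -
  have "C_k_on k S (\<lambda>x. vector_derivative f (at x))" for k
  proof -
    have "C_k_on (Suc k) S f" using assms unfolding smooth_on_def by blast
    then obtain f' where
      *: "\<And>x. x \<in> S \<Longrightarrow> (f has_vector_derivative f' x) (at x)" "C_k_on k S f'"
      unfolding C_k_on_Suc_real[OF assms(1)] by blast
    show ?thesis
      by (rule C_k_on_cong[OF assms(1) _ *(2)]) (simp add: vector_derivative_at[OF *(1)])
  qed
  then show "smooth_on S (\<lambda>x. vector_derivative f (at x))" unfolding smooth_on_def by blast
  have "C_k_on (Suc 0) S f" using assms unfolding smooth_on_def by blast
  then show "\<And>x. x \<in> S \<Longrightarrow> (f has_vector_derivative vector_derivative f (at x)) (at x)"
    unfolding C_k_on_Suc_real[OF assms(1)] by (force simp: vector_derivative_at)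
qed

lemma smooth_on_differentiable: "smooth_on S f \<Longrightarrow> x \<in> S \<Longrightarrow> f differentiable (at x)"
  unfolding smooth_on_def using C_k_on.simps(2)[of 0 S f] by blast

text \<open>Bootstrapping: the derivatives of \<open>u\<close> and \<open>p\<close> are expressed by
  \<open>p\<close> and \<open>Q (u t)\<close>, so both functions gain one order of differentiability
  in each step. Thus base components of geodesics are smooth by their equations of motion
  alone.\<close>

lemma smooth_on_ode2:
  fixes u p :: "real \<Rightarrow> real"
  assumes "open J" "open T" "u ` J \<subseteq> T" "smooth_on T Q"
    and u: "\<And>t. t \<in> J \<Longrightarrow> (u has_real_derivative p t) (at t)"
    and p: "\<And>t. t \<in> J \<Longrightarrow> (p has_real_derivative Q (u t)) (at t)"
  shows "smooth_on J u"
proof -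
  have "C_k_on k J u \<and> C_k_on k J p" for k
  proof (induction k)
    case 0
    have "continuous_on J u" "continuous_on J p"
      using u p DERIV_isCont by (blast intro: continuous_at_imp_continuous_on)+
    then show ?case by simp
  next
    case (Suc k)
    have "C_k_on k T Q" using assms(4) unfolding smooth_on_def by blast
    then have "C_k_on k J (\<lambda>t. Q (u t))"
      using C_k_on_compose[OF assms(1,2,3), of k Q] Suc by blast
    then have "C_k_on (Suc k) J p"
      unfolding C_k_on_Suc_real[OF assms(1)] has_real_derivative_iff_has_vector_derivative[symmetric]
      using p by (intro exI[of _ "\<lambda>t. Q (u t)"]) simp
    moreover have "C_k_on (Suc k) J u"
      unfolding C_k_on_Suc_real[OF assms(1)] has_real_derivative_iff_has_vector_derivative[symmetric]
      using u Suc by (intro exI[of _ p]) simp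
    ultimately show ?case by blast
  qed
  then show ?thesis unfolding smooth_on_def by blast
qed

lemma smooth_on_antiderivative:
  fixes u :: "real \<Rightarrow> real"
  assumes "open J" "\<And>t. t \<in> J \<Longrightarrow> (u has_real_derivative p t) (at t)" "smooth_on J p"
  shows "smooth_on J u"
proof -
  have "C_k_on (Suc k) J u" for k
    unfolding C_k_on_Suc_real[OF assms(1)] using assms(2,3)
    unfolding smooth_on_def has_real_derivative_iff_has_vector_derivative by (intro exI[of _ p]) simp
  then show ?thesis using C_k_on_Suc_imp unfolding smooth_on_def by blast
qed

section \<open>Charts, velocities and Christoffel symbols\<close>

lemma bilinear_expand:
  fixes B :: "'e::euclidean_space \<Rightarrow> 'e \<Rightarrow> real"
  assumes "bilinear B"
  shows "B y z = (\<Sum>b\<in>Basis. \<Sum>b'\<in>Basis. (y \<bullet> b) * (z \<bullet> b') * B b b')"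
proof -
  have "B y z = B (\<Sum>b\<in>Basis. (y \<bullet> b) *\<^sub>R b) (\<Sum>b'\<in>Basis. (z \<bullet> b') *\<^sub>R b')"
    by (simp add: euclidean_representation)
  also have "\<dots> = (\<Sum>(b, b')\<in>Basis \<times> Basis. B ((y \<bullet> b) *\<^sub>R b) ((z \<bullet> b') *\<^sub>R b'))"
    using bilinear_sum[OF assms] .
  also have "\<dots> = (\<Sum>b\<in>Basis. \<Sum>b'\<in>Basis. (y \<bullet> b) * (z \<bullet> b') * B b b')"
    by (simp add: sum.cartesian_product bilinear_lmul[OF assms] bilinear_rmul[OF assms] mult_ac)
  finally show ?thesis .
qed

text \<open>Positivity makes \<open>T\<close>, which collects the values of \<open>B z\<close> on
  the basis, injective and hence onto in finite dimension. This gives the existence of the vector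
  described by \<open>christoffel\<close>.\<close>

lemma bilinear_riesz:
  fixes B :: "'e::euclidean_space \<Rightarrow> 'e \<Rightarrow> real"
  assumes B: "bilinear B" and pos: "\<And>v. v \<noteq> 0 \<Longrightarrow> B v v > 0" and l: "linear l"
  obtains z where "\<And>w. B z w = l w"
proof -
  define T where "T z = (\<Sum>b\<in>Basis. B z b *\<^sub>R b)" for z
  have lin: "linear T"
    unfolding T_def
    by (rule linearI) (simp_all add: bilinear_ladd[OF B] bilinear_lmul[OF B] scaleR_add_left sum.distrib scaleR_sum_right)
  have Tb: "T z \<bullet> b = B z b" if "b \<in> Basis" for z b
    unfolding T_def using that by simp
  have "inj T"
  proof (rule linear_injective_0[THEN iffD2, OF lin], safe)
    fix v assume "T v = 0"
    then have z: "B v b = 0" if "b \<in> Basis" for b using Tb[OF that, of v] by simp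
    have "B v v = (\<Sum>b\<in>Basis. (v \<bullet> b) * B v b)"
      using B linear_sum[of "B v" "\<lambda>b. (v \<bullet> b) *\<^sub>R b" Basis] bilinear_rmul[OF B]
      by (simp add: bilinear_def euclidean_representation)
    then have "B v v = 0" using z by simp
    then show "v = 0" using pos[of v] by force
  qed
  then have "surj T" using linear_injective_imp_surjective[OF lin] by simp
  then obtain z where z: "T z = (\<Sum>b\<in>Basis. l b *\<^sub>R b)" by (metis surjD)
  have "B z b = l b" if "b \<in> Basis" for b
    using Tb[OF that, of z] that by (simp add: z)
  moreover have "linear (B z)" using B by (simp add: bilinear_def)
  ultimately have "B z = l" using l linear_eq_stdbasis by blast
  then show ?thesis using that[of z] by simp
qed

text \<open>The derivative of g(y, z) in the direction x, with the direction as first argument;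
  \<open>christoffel\<close> contains it unabbreviated.\<close>

definition dmet :: "('i, 'p, 'e::real_normed_vector) metric_manifold \<Rightarrow> 'i \<Rightarrow> 'p \<Rightarrow> 'e \<Rightarrow> 'e \<Rightarrow> 'e \<Rightarrow> real" where
  "dmet M i p x y z =
     frechet_derivative (\<lambda>\<xi>. metric_at M i (chart_inv M i \<xi>) y z) (at (chart_map M i p)) x"

text \<open>Uniqueness is a premise instead of positive definiteness, so that the lemma serves the
  Riemannian fibre and the Lorentzian product alike.\<close>

lemma christoffel_eqI:
  assumes "\<And>w. 2 * metric_at M i p z w = dmet M i p u v w + dmet M i p v u w - dmet M i p w u v"
    and "\<And>z'. (\<And>w. metric_at M i p z' w = metric_at M i p z w) \<Longrightarrow> z' = z"
  shows "christoffel M i p u v = z"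
  unfolding christoffel_def Let_def
proof (rule the_equality)
  show "\<forall>w. 2 * metric_at M i p z w =
      frechet_derivative (\<lambda>\<xi>. metric_at M i (chart_inv M i \<xi>) v w) (at (chart_map M i p)) u +
      frechet_derivative (\<lambda>\<xi>. metric_at M i (chart_inv M i \<xi>) u w) (at (chart_map M i p)) v -
      frechet_derivative (\<lambda>\<xi>. metric_at M i (chart_inv M i \<xi>) u v) (at (chart_map M i p)) w"
    using assms(1) by (simp add: dmet_def)
next
  fix z' assume *: "\<forall>w. 2 * metric_at M i p z' w =
      frechet_derivative (\<lambda>\<xi>. metric_at M i (chart_inv M i \<xi>) v w) (at (chart_map M i p)) u +
      frechet_derivative (\<lambda>\<xi>. metric_at M i (chart_inv M i \<xi>) u w) (at (chart_map M i p)) v -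
      frechet_derivative (\<lambda>\<xi>. metric_at M i (chart_inv M i \<xi>) u v) (at (chart_map M i p)) w"
  show "z' = z"
  proof (rule assms(2))
    fix w show "metric_at M i p z' w = metric_at M i p z w"
      using *[rule_format, of w] assms(1)[of w] by (simp add: dmet_def)
  qed
qed

locale riem =
  fixes F :: "('i, 'p::{t2_space, second_countable_topology}, 'e::euclidean_space) metric_manifold"
  assumes riem: "riemannian_manifold F"
begin

lemma chart_props:
  assumes "i \<in> charts F"
  shows "open (chart_dom F i)" "open (chart_map F i ` chart_dom F i)"
    "homeomorphism (chart_dom F i) (chart_map F i ` chart_dom F i) (chart_map F i) (chart_inv F i)"
  using riem assms by (auto simp: riemannian_manifold_def smooth_manifold_def)

lemma chart_inv_map: "i \<in> charts F \<Longrightarrow> p \<in> chart_dom F i \<Longrightarrow> chart_inv F i (chart_map F i p) = p"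
  using chart_props(3) by (auto simp: homeomorphism_def)

lemma chart_inj: "i \<in> charts F \<Longrightarrow> inj_on (chart_map F i) (chart_dom F i)"
  by (metis chart_inv_map inj_on_inverseI)

lemma metric_props:
  assumes "i \<in> charts F" "p \<in> chart_dom F i"
  shows "bilinear (metric_at F i p)" "metric_at F i p v w = metric_at F i p w v"
    "v \<noteq> 0 \<Longrightarrow> metric_at F i p v v > 0"
  using riem assms by (auto simp: riemannian_manifold_def)

lemma metric_nonneg:
  assumes "i \<in> charts F" "p \<in> chart_dom F i"
  shows "metric_at F i p v v \<ge> 0"
  using metric_props(3)[OF assms, of v] bilinear_lzero[OF metric_props(1)[OF assms]] by (cases "v = 0") force+

lemma metric_nondegenerate:
  assumes "i \<in> charts F" "p \<in> chart_dom F i" "\<And>w. metric_at F i p z' w = metric_at F i p z w"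
  shows "z' = z"
proof -
  have "metric_at F i p (z' - z) (z' - z) = 0"
    using assms(3) by (simp add: bilinear_lsub[OF metric_props(1)[OF assms(1,2)]])
  then show ?thesis using metric_props(3)[OF assms(1,2), of "z' - z"] by force
qed

lemma metric_smooth_deriv:
  assumes "i \<in> charts F" "p \<in> chart_dom F i"
  shows "((\<lambda>\<xi>. metric_at F i (chart_inv F i \<xi>) y z) has_derivative (\<lambda>x. dmet F i p x y z)) (at (chart_map F i p))"
proof -
  have "smooth_on (chart_map F i ` chart_dom F i) (\<lambda>x. metric_at F i (chart_inv F i x) y z)"
    using riem assms by (auto simp: riemannian_manifold_def)
  then have "(\<lambda>x. metric_at F i (chart_inv F i x) y z) differentiable (at (chart_map F i p))"
    using assms by (intro smooth_on_differentiable) auto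
  then show ?thesis unfolding dmet_def frechet_derivative_works by simp
qed

text \<open>Differentiating the expansion in basis vectors transfers bilinearity in the last two
  arguments from the metric to its derivative.\<close>

lemma dmet_expand:
  assumes "i \<in> charts F" "p \<in> chart_dom F i"
  shows "dmet F i p x y z = (\<Sum>b\<in>Basis. \<Sum>b'\<in>Basis. (y \<bullet> b) * (z \<bullet> b') * dmet F i p x b b')"
proof -
  have "((\<lambda>\<xi>. metric_at F i (chart_inv F i \<xi>) y z) has_derivative
     (\<lambda>x. (\<Sum>b\<in>Basis. \<Sum>b'\<in>Basis. (y \<bullet> b) * (z \<bullet> b') * dmet F i p x b b'))) (at (chart_map F i p))"
  proof (rule has_derivative_transform_within_open[OF _ chart_props(2)[OF assms(1)]])
    show "((\<lambda>\<xi>. \<Sum>b\<in>Basis. \<Sum>b'\<in>Basis. (y \<bullet> b) * (z \<bullet> b') * metric_at F i (chart_inv F i \<xi>) b b') has_derivative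
     (\<lambda>x. (\<Sum>b\<in>Basis. \<Sum>b'\<in>Basis. (y \<bullet> b) * (z \<bullet> b') * dmet F i p x b b'))) (at (chart_map F i p))"
      by (intro has_derivative_sum has_derivative_mult_right metric_smooth_deriv[OF assms])
    show "chart_map F i p \<in> chart_map F i ` chart_dom F i" using assms by simp
    fix \<xi> assume "\<xi> \<in> chart_map F i ` chart_dom F i"
    then have "chart_inv F i \<xi> \<in> chart_dom F i" using chart_inv_map[OF assms(1)] by auto
    then show "(\<Sum>b\<in>Basis. \<Sum>b'\<in>Basis. (y \<bullet> b) * (z \<bullet> b') * metric_at F i (chart_inv F i \<xi>) b b')
      = metric_at F i (chart_inv F i \<xi>) y z"
      using bilinear_expand[OF metric_props(1)[OF assms(1)], of "chart_inv F i \<xi>" y z] by simp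
  qed
  from has_derivative_unique[OF this metric_smooth_deriv[OF assms]] show ?thesis by metis
qed

lemma dmet_linear:
  assumes "i \<in> charts F" "p \<in> chart_dom F i"
  shows "linear (\<lambda>x. dmet F i p x y z)" "linear (\<lambda>y. dmet F i p x y z)" "linear (\<lambda>z. dmet F i p x y z)"
proof -
  show "linear (\<lambda>x. dmet F i p x y z)"
    using metric_smooth_deriv[OF assms] has_derivative_bounded_linear bounded_linear.linear by blast
  show "linear (\<lambda>y. dmet F i p x y z)" "linear (\<lambda>z. dmet F i p x y z)"
    unfolding dmet_expand[OF assms, of x _ z] dmet_expand[OF assms, of x y]
    by (rule linearI; simp add: inner_add_left inner_scaleR_left ring_distribs sum.distrib sum_distrib_left mult.assoc mult.left_commute)+
qed

text \<open>The right-hand side of the Koszul formula is linear in \<open>w\<close>, so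
  \<open>bilinear_riesz\<close> represents it; the definite description becomes a usable
  equation.\<close>

lemma christoffel_char:
  assumes "i \<in> charts F" "p \<in> chart_dom F i"
  shows "2 * metric_at F i p (christoffel F i p u v) w
    = dmet F i p u v w + dmet F i p v u w - dmet F i p w u v"
proof -
  have "linear (\<lambda>w. (dmet F i p u v w + dmet F i p v u w - dmet F i p w u v) / 2)"
    using dmet_linear[OF assms] unfolding linear_iff by (simp add: field_simps)
  then obtain z where z: "\<And>w. metric_at F i p z w = (dmet F i p u v w + dmet F i p v u w - dmet F i p w u v) / 2"
    using bilinear_riesz[OF metric_props(1)[OF assms] metric_props(3)[OF assms]] by blast
  have ch: "christoffel F i p u v = z"
  proof (rule christoffel_eqI)
    show "2 * metric_at F i p z w = dmet F i p u v w + dmet F i p v u w - dmet F i p w u v" for w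
      unfolding z by simp
  qed (rule metric_nondegenerate[OF assms])
  show ?thesis unfolding ch z by simp
qed

section \<open>Velocities and speed of curves in the fibre\<close>

lemma some_chart: "p \<in> points F \<Longrightarrow> some_chart F p \<in> charts F \<and> p \<in> chart_dom F (some_chart F p)"
  unfolding some_chart_def points_def by (rule someI_ex) blast

lemma curve_chart_open:
  assumes "smooth_curve F J \<gamma>" "i \<in> charts F"
  shows "open {t\<in>J. \<gamma> t \<in> chart_dom F i}"
proof -
  have "open (J \<inter> \<gamma> -` chart_dom F i)"
    using assms chart_props(1)[OF assms(2)] by (intro continuous_open_preimage) (auto simp: smooth_curve_def)
  moreover have "J \<inter> \<gamma> -` chart_dom F i = {t\<in>J. \<gamma> t \<in> chart_dom F i}" by auto
  ultimately show ?thesis by simp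
qed

lemma velocity_smooth:
  assumes "smooth_curve F J \<gamma>" "i \<in> charts F"
  shows "smooth_on {t\<in>J. \<gamma> t \<in> chart_dom F i} (velocity F i \<gamma>)"
    and "t \<in> J \<Longrightarrow> \<gamma> t \<in> chart_dom F i \<Longrightarrow>
      ((chart_map F i \<circ> \<gamma>) has_vector_derivative velocity F i \<gamma> t) (at t)"
    and "t \<in> J \<Longrightarrow> \<gamma> t \<in> chart_dom F i \<Longrightarrow>
      (velocity F i \<gamma> has_vector_derivative vector_derivative (velocity F i \<gamma>) (at t)) (at t)"
proof -
  have s: "smooth_on {t\<in>J. \<gamma> t \<in> chart_dom F i} (chart_map F i \<circ> \<gamma>)"
    using assms by (auto simp: smooth_curve_def)
  note o = curve_chart_open[OF assms]
  show 1: "smooth_on {t\<in>J. \<gamma> t \<in> chart_dom F i} (velocity F i \<gamma>)"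
    using smooth_onD_deriv(1)[OF o s] unfolding velocity_def .
  show "t \<in> J \<Longrightarrow> \<gamma> t \<in> chart_dom F i \<Longrightarrow>
      ((chart_map F i \<circ> \<gamma>) has_vector_derivative velocity F i \<gamma> t) (at t)"
    using smooth_onD_deriv(2)[OF o s] unfolding velocity_def by blast
  show "t \<in> J \<Longrightarrow> \<gamma> t \<in> chart_dom F i \<Longrightarrow>
      (velocity F i \<gamma> has_vector_derivative vector_derivative (velocity F i \<gamma>) (at t)) (at t)"
    using smooth_onD_deriv(2)[OF o 1] by blast
qed

lemma velocity_change:
  assumes "smooth_curve F J \<gamma>" "t \<in> J" "i \<in> charts F" "j \<in> charts F"
    "\<gamma> t \<in> chart_dom F i" "\<gamma> t \<in> chart_dom F j"
  shows "velocity F j \<gamma> t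
    = frechet_derivative (chart_map F j \<circ> chart_inv F i) (at (chart_map F i (\<gamma> t))) (velocity F i \<gamma> t)"
proof -
  let ?T = "frechet_derivative (chart_map F j \<circ> chart_inv F i) (at (chart_map F i (\<gamma> t)))"
  have "smooth_on (chart_map F i ` (chart_dom F i \<inter> chart_dom F j)) (chart_map F j \<circ> chart_inv F i)"
    using riem assms by (auto simp: riemannian_manifold_def smooth_manifold_def)
  then have "(chart_map F j \<circ> chart_inv F i) differentiable (at (chart_map F i (\<gamma> t)))"
    using assms by (intro smooth_on_differentiable) auto
  then have d: "((chart_map F j \<circ> chart_inv F i) has_derivative ?T) (at ((chart_map F i \<circ> \<gamma>) t))"
    unfolding frechet_derivative_works by simp
  have "((chart_map F j \<circ> chart_inv F i \<circ> (chart_map F i \<circ> \<gamma>)) has_vector_derivative ?T (velocity F i \<gamma> t)) (at t)"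
    using vector_derivative_diff_chain_within[OF velocity_smooth(2)[OF assms(1,3,2,5)] has_derivative_at_withinI[OF d]] .
  then have "((chart_map F j \<circ> \<gamma>) has_vector_derivative ?T (velocity F i \<gamma> t)) (at t)"
    unfolding o_def
  proof (rule has_vector_derivative_transform_within_open[OF _ curve_chart_open[OF assms(1,3)]])
    show "t \<in> {t \<in> J. \<gamma> t \<in> chart_dom F i}" using assms by simp
  qed (auto simp: chart_inv_map[OF assms(3)])
  then show ?thesis unfolding velocity_def[of F j] by (rule vector_derivative_at)
qed

text \<open>The transition rule for velocities matches the transformation rule of the metric, so the
  chart picked by \<open>some_chart\<close> is immaterial.\<close>

lemma velocity_square_chart:
  assumes "smooth_curve F J \<gamma>" "t \<in> J" "i \<in> charts F" "\<gamma> t \<in> chart_dom F i"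
  shows "velocity_square F \<gamma> t = metric_at F i (\<gamma> t) (velocity F i \<gamma> t) (velocity F i \<gamma> t)"
proof -
  have "\<gamma> t \<in> points F" using assms by (auto simp: smooth_curve_def)
  note sc = some_chart[OF this]
  let ?j = "some_chart F (\<gamma> t)"
  have inv: "metric_at F i (\<gamma> t) v w = (let T = frechet_derivative (chart_map F ?j \<circ> chart_inv F i) (at (chart_map F i (\<gamma> t)))
     in metric_at F ?j (\<gamma> t) (T v) (T w))" for v w
    using riem assms sc unfolding riemannian_manifold_def Let_def by blast
  show ?thesis
    unfolding velocity_square_def Let_def inv
    using velocity_change[OF assms(1,2,3) _ assms(4), of ?j] sc by simp
qed

text \<open>The base point and both vector arguments vary at once. In basis coordinates this is the
  product rule for a finite sum, reassembled by bilinearity.\<close>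

lemma metric_along_deriv:
  assumes "smooth_curve F J \<gamma>" "t \<in> J" "i \<in> charts F" "\<gamma> t \<in> chart_dom F i"
    and w: "(w has_vector_derivative w') (at t)"
  shows "((\<lambda>t. metric_at F i (\<gamma> t) (w t) (w t)) has_real_derivative
     dmet F i (\<gamma> t) (velocity F i \<gamma> t) (w t) (w t) + 2 * metric_at F i (\<gamma> t) w' (w t)) (at t)"
proof -
  let ?G = "\<lambda>s b b'. metric_at F i (\<gamma> s) b b'"
  let ?v = "velocity F i \<gamma> t"
  have G: "((\<lambda>s. ?G s b b') has_real_derivative dmet F i (\<gamma> t) ?v b b') (at t)" for b b'
  proof -
    have "((\<lambda>\<xi>. metric_at F i (chart_inv F i \<xi>) b b') \<circ> (chart_map F i \<circ> \<gamma>) has_vector_derivative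
        dmet F i (\<gamma> t) ?v b b') (at t)"
      using vector_derivative_diff_chain_within[OF velocity_smooth(2)[OF assms(1,3,2,4)]]
        has_derivative_at_withinI metric_smooth_deriv[OF assms(3,4), of b b'] by (metis comp_apply)
    then have "((\<lambda>s. ?G s b b') has_vector_derivative dmet F i (\<gamma> t) ?v b b') (at t)"
    proof (rule has_vector_derivative_transform_within_open[OF _ curve_chart_open[OF assms(1,3)]])
      show "t \<in> {t \<in> J. \<gamma> t \<in> chart_dom F i}" using assms by simp
    qed (auto simp: chart_inv_map[OF assms(3)])
    then show ?thesis by (simp add: has_real_derivative_iff_has_vector_derivative)
  qed
  have wb: "((\<lambda>s. w s \<bullet> b) has_real_derivative w' \<bullet> b) (at t)" for b
    using bounded_linear.has_vector_derivative[OF bounded_linear_inner_left w]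
    by (simp add: has_real_derivative_iff_has_vector_derivative)
  have "((\<lambda>s. \<Sum>b\<in>Basis. \<Sum>b'\<in>Basis. (w s \<bullet> b) * (w s \<bullet> b') * ?G s b b') has_real_derivative
    (\<Sum>b\<in>Basis. \<Sum>b'\<in>Basis. ((w' \<bullet> b) * (w t \<bullet> b') + (w' \<bullet> b') * (w t \<bullet> b)) * ?G t b b'
        + dmet F i (\<gamma> t) ?v b b' * ((w t \<bullet> b) * (w t \<bullet> b')))) (at t)"
    by (intro DERIV_sum DERIV_mult wb G)
  then have 1: "((\<lambda>s. ?G s (w s) (w s)) has_real_derivative
    (\<Sum>b\<in>Basis. \<Sum>b'\<in>Basis. ((w' \<bullet> b) * (w t \<bullet> b') + (w' \<bullet> b') * (w t \<bullet> b)) * ?G t b b'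
        + dmet F i (\<gamma> t) ?v b b' * ((w t \<bullet> b) * (w t \<bullet> b')))) (at t)"
    unfolding has_real_derivative_iff_has_vector_derivative
  proof (rule has_vector_derivative_transform_within_open[OF _ curve_chart_open[OF assms(1,3)]])
    show "t \<in> {t \<in> J. \<gamma> t \<in> chart_dom F i}" using assms by simp
    fix s assume "s \<in> {t \<in> J. \<gamma> t \<in> chart_dom F i}"
    then show "(\<Sum>b\<in>Basis. \<Sum>b'\<in>Basis. (w s \<bullet> b) * (w s \<bullet> b') * ?G s b b') = ?G s (w s) (w s)"
      using bilinear_expand[OF metric_props(1)[OF assms(3)], of "\<gamma> s" "w s" "w s"] by simp
  qed
  have "(\<Sum>b\<in>Basis. \<Sum>b'\<in>Basis. ((w' \<bullet> b) * (w t \<bullet> b') + (w' \<bullet> b') * (w t \<bullet> b)) * ?G t b b'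
        + dmet F i (\<gamma> t) ?v b b' * ((w t \<bullet> b) * (w t \<bullet> b')))
     = ?G t w' (w t) + ?G t (w t) w' + dmet F i (\<gamma> t) ?v (w t) (w t)"
    unfolding bilinear_expand[OF metric_props(1)[OF assms(3,4)], of w' "w t"]
      bilinear_expand[OF metric_props(1)[OF assms(3,4)], of "w t" w'] dmet_expand[OF assms(3,4), of _ "w t" "w t"]
    by (simp add: sum.distrib[symmetric] algebra_simps)
  with 1 show ?thesis by (simp add: metric_props(2)[OF assms(3,4), of "w t" w'] algebra_simps)
qed

text \<open>With three equal arguments the Koszul formula says that twice g(\<Gamma>, v) is the
  derivative of g(v, v) along v, so the acceleration term cancels the change of the metric along the
  curve.\<close>

lemma geodesic_speed_constant:
  assumes "geodesic F J \<gamma>"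
  obtains c where "\<And>t. t \<in> J \<Longrightarrow> velocity_square F \<gamma> t = c"
proof -
  have sc: "smooth_curve F J \<gamma>" using assms by (simp add: geodesic_def)
  have d: "(velocity_square F \<gamma> has_real_derivative 0) (at t)" if t: "t \<in> J" for t
  proof -
    have "\<gamma> t \<in> points F" using t sc by (auto simp: smooth_curve_def)
    then obtain i where i: "i \<in> charts F" "\<gamma> t \<in> chart_dom F i" by (auto simp: points_def)
    let ?w = "velocity F i \<gamma>"
    have geo: "vector_derivative ?w (at t) = - christoffel F i (\<gamma> t) (?w t) (?w t)"
      using assms t i unfolding geodesic_def by (metis add_eq_0_iff2 minus_equation_iff)
    have "2 * metric_at F i (\<gamma> t) (vector_derivative ?w (at t)) (?w t) = - dmet F i (\<gamma> t) (?w t) (?w t) (?w t)"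
      unfolding geo using christoffel_char[OF i, of "?w t" "?w t" "?w t"]
      by (simp add: bilinear_lneg[OF metric_props(1)[OF i]])
    then have "((\<lambda>t. metric_at F i (\<gamma> t) (?w t) (?w t)) has_real_derivative 0) (at t)"
      using metric_along_deriv[OF sc t i velocity_smooth(3)[OF sc i(1) t i(2)]] by simp
    then show ?thesis
      unfolding has_real_derivative_iff_has_vector_derivative
    proof (rule has_vector_derivative_transform_within_open[OF _ curve_chart_open[OF sc i(1)]])
      show "t \<in> {t \<in> J. \<gamma> t \<in> chart_dom F i}" using t i by simp
    qed (auto simp: velocity_square_chart[OF sc _ i(1)])
  qed
  have "convex J" using sc is_interval_convex by (auto simp: smooth_curve_def)
  then have "\<exists>c. \<forall>t\<in>J. velocity_square F \<gamma> t = c"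
    by (rule has_field_derivative_zero_constant) (use d in \<open>blast intro: has_field_derivative_at_within\<close>)
  then show ?thesis using that by blast
qed

lemma velocity_square_nonneg:
  assumes "smooth_curve F J \<gamma>" "t \<in> J"
  shows "velocity_square F \<gamma> t \<ge> 0"
proof -
  have "\<gamma> t \<in> points F" using assms by (auto simp: smooth_curve_def)
  then show ?thesis unfolding velocity_square_def Let_def using some_chart metric_nonneg by blast
qed

lemma velocity_square_continuous:
  assumes "smooth_curve F J \<gamma>"
  shows "continuous_on J (velocity_square F \<gamma>)"
proof (rule continuous_at_imp_continuous_on, rule ballI)
  fix t assume t: "t \<in> J"
  have "\<gamma> t \<in> points F" using t assms by (auto simp: smooth_curve_def)
  then obtain i where i: "i \<in> charts F" "\<gamma> t \<in> chart_dom F i" by (auto simp: points_def)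
  let ?w = "velocity F i \<gamma>"
  have "(velocity_square F \<gamma> has_real_derivative
      dmet F i (\<gamma> t) (?w t) (?w t) (?w t) + 2 * metric_at F i (\<gamma> t) (vector_derivative ?w (at t)) (?w t)) (at t)"
    using metric_along_deriv[OF assms t i velocity_smooth(3)[OF assms i(1) t i(2)]]
    unfolding has_real_derivative_iff_has_vector_derivative
  proof (rule has_vector_derivative_transform_within_open[OF _ curve_chart_open[OF assms i(1)]])
    show "t \<in> {t \<in> J. \<gamma> t \<in> chart_dom F i}" using t i by simp
  qed (auto simp: velocity_square_chart[OF assms _ i(1)])
  then show "isCont (velocity_square F \<gamma>) t" by (rule DERIV_isCont)
qed

end

section \<open>Curves and geodesics of the warped product\<close>

lemma interval_I_props: "open (interval_I a b)" "is_interval (interval_I a b)"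
proof -
  have "interval_I a b = ereal -` {a<..<b}" by (auto simp: interval_I_def)
  moreover have "open (ereal -` {a<..<b})" by (rule open_vimage) (auto intro: continuous_intros)
  ultimately show "open (interval_I a b)" by simp
  show "is_interval (interval_I a b)"
    unfolding is_interval_1 interval_I_def
    by (auto; metis ereal_less_eq(3) le_less_trans less_le_trans)
qed

locale grw_space = riem F for F :: "('i, 'p::{t2_space, second_countable_topology}, 'e::euclidean_space) metric_manifold" +
  fixes a b :: ereal and f :: "real \<Rightarrow> real"
  assumes f_smooth: "smooth_on (interval_I a b) f"
    and f_pos: "\<And>\<tau>. \<tau> \<in> interval_I a b \<Longrightarrow> f \<tau> > 0"
begin

abbreviation "I \<equiv> interval_I a b"
abbreviation "M \<equiv> grw a b f F"

lemma grw_simps: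
  "charts M = charts F" "chart_dom M i = I \<times> chart_dom F i"
  "chart_map M i (\<tau>, x) = (\<tau>, chart_map F i x)"
  "metric_at M i (\<tau>, x) (s, v) (s', v') = - (s * s') + (f \<tau>)\<^sup>2 * metric_at F i x v v'"
  by (simp_all add: grw_def)

lemma f_deriv: "\<tau> \<in> I \<Longrightarrow> (f has_real_derivative deriv f \<tau>) (at \<tau>)"
  using smooth_on_differentiable[OF f_smooth] DERIV_deriv_iff_real_differentiable by blast

lemma points_grw: "points M = I \<times> points F"
  by (auto simp: points_def grw_simps)

lemma some_chart_grw: "\<tau> \<in> I \<Longrightarrow> some_chart M (\<tau>, x) = some_chart F x"
  by (simp add: some_chart_def grw_simps)

lemma chart_map_comp_grw: "chart_map M i \<circ> (\<lambda>t. (\<tau> t, x t)) = (\<lambda>t. (\<tau> t, (chart_map F i \<circ> x) t))"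
  by (simp add: fun_eq_iff grw_simps)

lemma chart_inv_grw:
  assumes "i \<in> charts F" "\<tau> \<in> I" "\<xi> \<in> chart_map F i ` chart_dom F i"
  shows "chart_inv M i (\<tau>, \<xi>) = (\<tau>, chart_inv F i \<xi>)"
  unfolding chart_inv_def[of M]
proof (rule inv_into_f_eq)
  show "inj_on (chart_map M i) (chart_dom M i)"
    using chart_inj[OF assms(1)] by (auto simp: inj_on_def grw_simps)
  show "(\<tau>, chart_inv F i \<xi>) \<in> chart_dom M i"
    using assms chart_inv_map[OF assms(1)] by (auto simp: grw_simps)
  show "chart_map M i (\<tau>, chart_inv F i \<xi>) = (\<tau>, \<xi>)"
    using assms chart_inv_map[OF assms(1)] by (auto simp: grw_simps)
qed

lemma smooth_curve_grwI:
  assumes "smooth_curve F J x" "smooth_on J \<tau>" "\<tau> ` J \<subseteq> I"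
  shows "smooth_curve M J (\<lambda>t. (\<tau> t, x t))"
  unfolding smooth_curve_def
proof (intro conjI ballI)
  show "open J" "is_interval J" using assms by (auto simp: smooth_curve_def)
  have "C_k_on 0 J \<tau>" using assms(2) unfolding smooth_on_def by blast
  then have "continuous_on J \<tau>" by simp
  then show "continuous_on J (\<lambda>t. (\<tau> t, x t))"
    using assms by (intro continuous_on_Pair) (auto simp: smooth_curve_def)
  show "(\<lambda>t. (\<tau> t, x t)) ` J \<subseteq> points M"
    using assms by (auto simp: points_grw smooth_curve_def)
  fix i assume i: "i \<in> charts M"
  then have i: "i \<in> charts F" by (simp add: grw_simps)
  let ?S = "{t \<in> J. x t \<in> chart_dom F i}"
  have eq: "{t \<in> J. (\<tau> t, x t) \<in> chart_dom M i} = ?S"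
    using assms by (auto simp: grw_simps)
  have s: "C_k_on k ?S (chart_map F i \<circ> x)" for k
    using assms(1) i unfolding smooth_curve_def smooth_on_def by blast
  have t: "C_k_on k ?S \<tau>" for k
    using assms(2) C_k_on_subset[of k J \<tau> ?S] unfolding smooth_on_def by blast
  show "smooth_on {t \<in> J. (\<tau> t, x t) \<in> chart_dom M i} (chart_map M i \<circ> (\<lambda>t. (\<tau> t, x t)))"
    unfolding eq smooth_on_def chart_map_comp_grw
    using C_k_on_Pair[OF curve_chart_open[OF assms(1) i] t s] by blast
qed

lemma smooth_curve_grwD:
  assumes "smooth_curve M J \<gamma>"
  shows "smooth_curve F J (snd \<circ> \<gamma>)" "(fst \<circ> \<gamma>) ` J \<subseteq> I"
    "\<And>t. t \<in> J \<Longrightarrow> (fst \<circ> \<gamma>) differentiable (at t)"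
proof -
  note sc = assms[unfolded smooth_curve_def points_grw]
  have "\<gamma> t \<in> I \<times> points F" if "t \<in> J" for t using sc that by blast
  then have I: "(fst \<circ> \<gamma>) ` J \<subseteq> I" and P: "(snd \<circ> \<gamma>) ` J \<subseteq> points F"
    by (auto simp: mem_Times_iff)
  show "(fst \<circ> \<gamma>) ` J \<subseteq> I" by (rule I)
  have c: "continuous_on J (snd \<circ> \<gamma>)" using sc by (auto intro: continuous_on_snd simp: o_def)
  have eq: "{t \<in> J. \<gamma> t \<in> chart_dom M i} = {t \<in> J. (snd \<circ> \<gamma>) t \<in> chart_dom F i}" for i
    using I by (auto simp: grw_simps mem_Times_iff)
  have o: "open {t \<in> J. (snd \<circ> \<gamma>) t \<in> chart_dom F i}" if "i \<in> charts F" for i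
  proof -
    have "open (J \<inter> (snd \<circ> \<gamma>) -` chart_dom F i)"
      using sc c chart_props(1)[OF that] by (intro continuous_open_preimage) auto
    moreover have "J \<inter> (snd \<circ> \<gamma>) -` chart_dom F i = {t\<in>J. (snd \<circ> \<gamma>) t \<in> chart_dom F i}" by auto
    ultimately show ?thesis by simp
  qed
  have cm: "chart_map M i \<circ> \<gamma> = (\<lambda>t. (fst (\<gamma> t), (chart_map F i \<circ> (snd \<circ> \<gamma>)) t))" for i
    using chart_map_comp_grw[of i "fst \<circ> \<gamma>" "snd \<circ> \<gamma>"] by (simp add: o_def)
  have s: "smooth_on {t \<in> J. (snd \<circ> \<gamma>) t \<in> chart_dom F i} (\<lambda>t. (fst (\<gamma> t), (chart_map F i \<circ> (snd \<circ> \<gamma>)) t))"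
    if "i \<in> charts F" for i
    unfolding eq[symmetric] cm[symmetric] using sc that grw_simps(1) by blast
  show "smooth_curve F J (snd \<circ> \<gamma>)"
    unfolding smooth_curve_def
  proof (intro conjI ballI P c)
    show "open J" "is_interval J" using sc by auto
    fix i assume i: "i \<in> charts F"
    have "C_k_on k {t \<in> J. (snd \<circ> \<gamma>) t \<in> chart_dom F i} (chart_map F i \<circ> (snd \<circ> \<gamma>))" for k
    proof -
      have "C_k_on k {t \<in> J. (snd \<circ> \<gamma>) t \<in> chart_dom F i} (\<lambda>t. (fst (\<gamma> t), (chart_map F i \<circ> (snd \<circ> \<gamma>)) t))"
        using s[OF i] unfolding smooth_on_def by blast
      from C_k_on_bounded_linear[OF o[OF i] bounded_linear_snd this] show ?thesis by (simp add: o_def)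
    qed
    then show "smooth_on {t \<in> J. (snd \<circ> \<gamma>) t \<in> chart_dom F i} (chart_map F i \<circ> (snd \<circ> \<gamma>))"
      unfolding smooth_on_def by blast
  qed
  fix t assume t: "t \<in> J"
  obtain i where i: "i \<in> charts F" "(snd \<circ> \<gamma>) t \<in> chart_dom F i"
    using P t by (auto simp: points_def)
  then have "(\<lambda>t. (fst (\<gamma> t), (chart_map F i \<circ> (snd \<circ> \<gamma>)) t)) differentiable (at t)"
    using smooth_on_differentiable[OF s[OF i(1)]] t by blast
  then obtain D where "((\<lambda>t. (fst (\<gamma> t), (chart_map F i \<circ> (snd \<circ> \<gamma>)) t)) has_derivative D) (at t)"
    by (auto simp: differentiable_def)
  from has_derivative_fst[OF this] show "(fst \<circ> \<gamma>) differentiable (at t)"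
    unfolding differentiable_def by (auto simp: o_def)
qed

lemma velocity_grw:
  assumes "smooth_curve F J x" "t \<in> J" "i \<in> charts F" "x t \<in> chart_dom F i"
    "(\<tau> has_real_derivative \<tau>') (at t)"
  shows "velocity M i (\<lambda>t. (\<tau> t, x t)) t = (\<tau>', velocity F i x t)"
  unfolding velocity_def[of M] chart_map_comp_grw
  using assms(5) velocity_smooth(2)[OF assms(1,3,2,4)]
  by (intro vector_derivative_at has_vector_derivative_Pair)
     (simp_all add: has_real_derivative_iff_has_vector_derivative o_def)

lemma velocity_square_grw:
  assumes "smooth_curve F J x" "t \<in> J" "\<tau> t \<in> I" "(\<tau> has_real_derivative \<tau>') (at t)"
  shows "velocity_square M (\<lambda>t. (\<tau> t, x t)) t = - \<tau>'\<^sup>2 + (f (\<tau> t))\<^sup>2 * velocity_square F x t"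
    and "future_pointing M (\<lambda>t. (\<tau> t, x t)) t \<longleftrightarrow> \<tau>' > 0"
proof -
  have "x t \<in> points F" using assms by (auto simp: smooth_curve_def)
  note sc = some_chart[OF this]
  note v = velocity_grw[OF assms(1,2) conjunct1[OF sc] conjunct2[OF sc] assms(4)]
  show "velocity_square M (\<lambda>t. (\<tau> t, x t)) t = - \<tau>'\<^sup>2 + (f (\<tau> t))\<^sup>2 * velocity_square F x t"
    unfolding velocity_square_def Let_def some_chart_grw[OF assms(3)] v grw_simps
    by (simp add: power2_eq_square)
  show "future_pointing M (\<lambda>t. (\<tau> t, x t)) t \<longleftrightarrow> \<tau>' > 0"
    unfolding future_pointing_def Let_def some_chart_grw[OF assms(3)] v grw_simps
    using sc by (simp add: bilinear_rzero[OF metric_props(1)])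
qed

section \<open>The Levi-Civita connection of the warped product\<close>

lemma dmet_grw:
  assumes "i \<in> charts F" "\<tau> \<in> I" "p \<in> chart_dom F i"
  shows "dmet M i (\<tau>, p) (s, v) (s1, v1) (s2, v2) =
    2 * f \<tau> * deriv f \<tau> * s * metric_at F i p v1 v2 + (f \<tau>)\<^sup>2 * dmet F i p v v1 v2"
proof -
  let ?\<xi> = "chart_map F i p"
  have d: "((\<lambda>z. - (s1 * s2) + (f (fst z))\<^sup>2 * metric_at F i (chart_inv F i (snd z)) v1 v2) has_derivative
     (\<lambda>h. (f \<tau>)\<^sup>2 * dmet F i p (snd h) v1 v2 + 2 * f \<tau> * (fst h * deriv f \<tau>) * metric_at F i p v1 v2)) (at (\<tau>, ?\<xi>))"
  proof -
    have g: "((\<lambda>z. metric_at F i (chart_inv F i (snd z)) v1 v2) has_derivative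
        (\<lambda>h. dmet F i p (snd h) v1 v2)) (at (\<tau>, ?\<xi>))"
      using has_derivative_compose[OF has_derivative_snd[OF has_derivative_ident], of "\<lambda>\<xi>. metric_at F i (chart_inv F i \<xi>) v1 v2" _ "(\<tau>, ?\<xi>)"]
        metric_smooth_deriv[OF assms(1,3), of v1 v2] by simp
    have "((\<lambda>z. f (fst z)) has_derivative (\<lambda>h. deriv f \<tau> * fst h)) (at (\<tau>, ?\<xi>))"
      using has_derivative_compose[OF has_derivative_fst[OF has_derivative_ident], of f "(*) (deriv f \<tau>)" "(\<tau>, ?\<xi>)"]
        f_deriv[OF assms(2)] by (simp add: has_field_derivative_def)
    then show ?thesis
      by (auto intro!: derivative_eq_intros g simp: chart_inv_map[OF assms(1,3)] power2_eq_square algebra_simps)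
  qed
  have "((\<lambda>z. metric_at M i (chart_inv M i z) (s1, v1) (s2, v2)) has_derivative
     (\<lambda>h. (f \<tau>)\<^sup>2 * dmet F i p (snd h) v1 v2 + 2 * f \<tau> * (fst h * deriv f \<tau>) * metric_at F i p v1 v2)) (at (\<tau>, ?\<xi>))"
  proof (rule has_derivative_transform_within_open[OF d])
    show "open (I \<times> chart_map F i ` chart_dom F i)"
      using chart_props(2)[OF assms(1)] interval_I_props by (intro open_Times)
    show "(\<tau>, ?\<xi>) \<in> I \<times> chart_map F i ` chart_dom F i" using assms by simp
    fix z assume "z \<in> I \<times> chart_map F i ` chart_dom F i"
    then show "- (s1 * s2) + (f (fst z))\<^sup>2 * metric_at F i (chart_inv F i (snd z)) v1 v2
      = metric_at M i (chart_inv M i z) (s1, v1) (s2, v2)"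
      using chart_inv_grw[OF assms(1)] by (cases z) (simp add: grw_simps)
  qed
  note fd = frechet_derivative_at[OF this]
  show ?thesis
    unfolding dmet_def[of M] grw_simps(3) fd[symmetric] by simp
qed

lemma christoffel_grw:
  assumes "i \<in> charts F" "\<tau> \<in> I" "p \<in> chart_dom F i"
  shows "christoffel M i (\<tau>, p) (s, v) (s, v) =
    (f \<tau> * deriv f \<tau> * metric_at F i p v v, christoffel F i p v v + (2 * deriv f \<tau> / f \<tau> * s) *\<^sub>R v)"
    (is "_ = ?z")
proof (rule christoffel_eqI)
  note fp = f_pos[OF assms(2)]
  note B = metric_props(1)[OF assms(1,3)]
  fix w :: "real \<times> 'e"
  obtain s' w' where w: "w = (s', w')" by (cases w)
  have e: "2 * ((f \<tau>)\<^sup>2 * metric_at F i p (christoffel F i p v v) w')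
      = (f \<tau>)\<^sup>2 * (2 * dmet F i p v v w' - dmet F i p w' v v)"
    using christoffel_char[OF assms(1,3), of v v w'] by (simp add: mult.left_commute)
  have e2: "(f \<tau>)\<^sup>2 * (2 * deriv f \<tau> / f \<tau> * s) = 2 * f \<tau> * deriv f \<tau> * s"
    using fp by (simp add: field_simps power2_eq_square)
  define K where "K = 2 * deriv f \<tau> / f \<tau> * s"
  show "2 * metric_at M i (\<tau>, p) ?z w =
    dmet M i (\<tau>, p) (s, v) (s, v) w + dmet M i (\<tau>, p) (s, v) (s, v) w - dmet M i (\<tau>, p) w (s, v) (s, v)"
    unfolding w grw_simps dmet_grw[OF assms] bilinear_ladd[OF B] bilinear_lmul[OF B] real_scaleR_def
    using e e2 unfolding K_def[symmetric] by algebra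
next
  note fp = f_pos[OF assms(2)]
  note B = metric_props(1)[OF assms(1,3)]
  \<comment> \<open>Nondegeneracy of the indefinite product metric is tested separately:
    \<open>(1, 0)\<close> detects the base component, the vectors \<open>(0, w)\<close> detect the
    fibre component.\<close>
  fix z' assume *: "\<And>w. metric_at M i (\<tau>, p) z' w = metric_at M i (\<tau>, p) ?z w"
  obtain s1 v1 where z': "z' = (s1, v1)" by (cases z')
  have 1: "s1 = fst ?z" using *[of "(1, 0)"] by (simp add: z' grw_simps bilinear_rzero[OF B])
  have 2: "v1 = snd ?z"
  proof (rule metric_nondegenerate[OF assms(1,3)])
    fix w show "metric_at F i p v1 w = metric_at F i p (snd ?z) w"
      using *[of "(0, w)"] fp by (simp add: z' grw_simps)
  qed
  show "z' = ?z" using 1 2 by (simp add: z')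
qed

lemma smooth_curve_reparam:
  assumes "smooth_curve F J' \<sigma>" "open J" "is_interval J" "smooth_on J \<rho>" "\<rho> ` J \<subseteq> J'"
  shows "smooth_curve F J (\<lambda>t. \<sigma> (\<rho> t))"
  unfolding smooth_curve_def
proof (intro conjI ballI assms(2,3))
  note sc = assms(1)[unfolded smooth_curve_def]
  show "(\<lambda>t. \<sigma> (\<rho> t)) ` J \<subseteq> points F" using sc assms(5) by blast
  have "C_k_on 0 J \<rho>" using assms(4) unfolding smooth_on_def by blast
  then have c: "continuous_on J \<rho>" by simp
  then show "continuous_on J (\<lambda>t. \<sigma> (\<rho> t))"
    using sc assms(5) by (auto intro: continuous_on_compose2)
  fix i assume i: "i \<in> charts F"
  let ?S = "{t \<in> J. \<sigma> (\<rho> t) \<in> chart_dom F i}" and ?T = "{t \<in> J'. \<sigma> t \<in> chart_dom F i}"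
  have o: "open ?T" using curve_chart_open[OF assms(1) i] .
  have eq: "?S = J \<inter> \<rho> -` ?T" using assms(5) by auto
  have oS: "open ?S" unfolding eq using o c assms(2) by (intro continuous_open_preimage)
  show "smooth_on ?S (chart_map F i \<circ> (\<lambda>t. \<sigma> (\<rho> t)))"
    unfolding smooth_on_def
  proof
    fix k
    have "C_k_on k ?S \<rho>" using assms(4) C_k_on_subset[of k J \<rho> ?S] unfolding smooth_on_def by blast
    moreover have "C_k_on k ?T (chart_map F i \<circ> \<sigma>)" using sc i unfolding smooth_on_def by blast
    ultimately have "C_k_on k ?S (\<lambda>t. (chart_map F i \<circ> \<sigma>) (\<rho> t))"
      by (rule C_k_on_compose[OF oS o, rotated]) (auto simp: eq)
    then show "C_k_on k ?S (chart_map F i \<circ> (\<lambda>t. \<sigma> (\<rho> t)))" by (simp add: o_def)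
  qed
qed

lemma velocity_reparam:
  assumes "smooth_curve F J' \<sigma>" "\<rho> t \<in> J'" "i \<in> charts F" "\<sigma> (\<rho> t) \<in> chart_dom F i"
    "(\<rho> has_real_derivative \<rho>') (at t)"
  shows "velocity F i (\<lambda>t. \<sigma> (\<rho> t)) t = \<rho>' *\<^sub>R velocity F i \<sigma> (\<rho> t)"
  unfolding velocity_def[of F i "\<lambda>t. \<sigma> (\<rho> t)"]
  using vector_diff_chain_at[of \<rho> \<rho>' t, OF _ velocity_smooth(2)[OF assms(1,3,2,4)]] assms(5)
  by (intro vector_derivative_at) (simp add: o_def has_real_derivative_iff_has_vector_derivative)

text \<open>The equations assumed for \<tau> and \<rho> are the base and fibre components of the
  geodesic equation according to \<open>christoffel_grw\<close>, for a fibre part that runs along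
  \<sigma> with parameter change \<rho>. The base equation sees \<sigma> only through its squared
  speed \<open>c\<close>.\<close>

lemma geodesic_lift:
  assumes geo: "geodesic F J' \<sigma>" and c: "\<And>t. t \<in> J' \<Longrightarrow> velocity_square F \<sigma> t = c"
    and J: "open J" "is_interval J" "\<tau> ` J \<subseteq> I" "\<rho> ` J \<subseteq> J'" "smooth_on J \<tau>" "smooth_on J \<rho>"
    and \<tau>: "\<And>t. t \<in> J \<Longrightarrow> (\<tau> has_real_derivative \<tau>' t) (at t)"
      "\<And>t. t \<in> J \<Longrightarrow> (\<tau>' has_real_derivative - (f (\<tau> t) * deriv f (\<tau> t) * c * (\<rho>' t)\<^sup>2)) (at t)"
    and \<rho>: "\<And>t. t \<in> J \<Longrightarrow> (\<rho> has_real_derivative \<rho>' t) (at t)"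
      "\<And>t. t \<in> J \<Longrightarrow> (\<rho>' has_real_derivative - (2 * deriv f (\<tau> t) / f (\<tau> t) * \<tau>' t * \<rho>' t)) (at t)"
  shows "geodesic M J (\<lambda>t. (\<tau> t, \<sigma> (\<rho> t)))"
    and "\<And>t. t \<in> J \<Longrightarrow> velocity_square M (\<lambda>t. (\<tau> t, \<sigma> (\<rho> t))) t = - (\<tau>' t)\<^sup>2 + (f (\<tau> t))\<^sup>2 * (c * (\<rho>' t)\<^sup>2)"
    and "\<And>t. t \<in> J \<Longrightarrow> future_pointing M (\<lambda>t. (\<tau> t, \<sigma> (\<rho> t))) t \<longleftrightarrow> \<tau>' t > 0"
proof -
  have sc: "smooth_curve F J' \<sigma>" using geo by (simp add: geodesic_def)
  note scx = smooth_curve_reparam[OF sc J(1,2,6,4)]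
  have vx: "velocity F i (\<lambda>t. \<sigma> (\<rho> t)) t = \<rho>' t *\<^sub>R velocity F i \<sigma> (\<rho> t)"
    if "t \<in> J" "i \<in> charts F" "\<sigma> (\<rho> t) \<in> chart_dom F i" for t i
    using velocity_reparam[where \<rho>=\<rho>, OF sc _ that(2,3) \<rho>(1)[OF that(1)]] J(4) that(1) by blast
  have vs: "velocity_square F (\<lambda>t. \<sigma> (\<rho> t)) t = c * (\<rho>' t)\<^sup>2" if t: "t \<in> J" for t
  proof -
    have r: "\<rho> t \<in> J'" using J t by blast
    then have "\<sigma> (\<rho> t) \<in> points F" using sc by (auto simp: smooth_curve_def)
    then obtain i where i: "i \<in> charts F" "\<sigma> (\<rho> t) \<in> chart_dom F i" by (auto simp: points_def)
    show ?thesis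
      unfolding velocity_square_chart[OF scx t i] vx[OF t i]
      using c[OF r] velocity_square_chart[OF sc r i]
      by (simp add: bilinear_lmul[OF metric_props(1)[OF i]] bilinear_rmul[OF metric_props(1)[OF i]] power2_eq_square)
  qed
  show "velocity_square M (\<lambda>t. (\<tau> t, \<sigma> (\<rho> t))) t = - (\<tau>' t)\<^sup>2 + (f (\<tau> t))\<^sup>2 * (c * (\<rho>' t)\<^sup>2)" if "t \<in> J" for t
    using velocity_square_grw(1)[where \<tau>=\<tau>, OF scx that _ \<tau>(1)[OF that]] J that vs by force
  show "future_pointing M (\<lambda>t. (\<tau> t, \<sigma> (\<rho> t))) t \<longleftrightarrow> \<tau>' t > 0" if "t \<in> J" for t
    using velocity_square_grw(2)[where \<tau>=\<tau>, OF scx that _ \<tau>(1)[OF that]] J that by blast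
  show "geodesic M J (\<lambda>t. (\<tau> t, \<sigma> (\<rho> t)))"
    unfolding geodesic_def
  proof (intro conjI ballI impI)
    show "smooth_curve M J (\<lambda>t. (\<tau> t, \<sigma> (\<rho> t)))" using smooth_curve_grwI[OF scx J(5,3)] .
    fix t i assume t: "t \<in> J" and "i \<in> charts M" "(\<tau> t, \<sigma> (\<rho> t)) \<in> chart_dom M i"
    then have i: "i \<in> charts F" "\<sigma> (\<rho> t) \<in> chart_dom F i" "\<tau> t \<in> I" by (auto simp: grw_simps)
    have r: "\<rho> t \<in> J'" using J t by blast
    let ?w = "velocity F i \<sigma>"
    let ?\<Gamma> = "christoffel F i (\<sigma> (\<rho> t)) (?w (\<rho> t)) (?w (\<rho> t))"
    note B = metric_props(1)[OF i(1,2)]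
    have w': "(?w has_vector_derivative - ?\<Gamma>) (at (\<rho> t))"
    proof -
      have "vector_derivative ?w (at (\<rho> t)) + ?\<Gamma> = 0" using geo r i unfolding geodesic_def by blast
      then show ?thesis using velocity_smooth(3)[OF sc i(1) r i(2)] by (simp add: add_eq_0_iff2)
    qed
    have "((\<lambda>s. ?w (\<rho> s)) has_vector_derivative \<rho>' t *\<^sub>R - ?\<Gamma>) (at t)"
      using vector_diff_chain_at[of \<rho> "\<rho>' t" t, OF _ w'] \<rho>(1)[OF t]
      by (simp add: o_def has_real_derivative_iff_has_vector_derivative)
    from has_vector_derivative_scaleR[OF \<rho>(2)[OF t] this]
    have d: "((\<lambda>s. \<rho>' s *\<^sub>R ?w (\<rho> s)) has_vector_derivative
      - ((\<rho>' t)\<^sup>2 *\<^sub>R ?\<Gamma>) - (2 * deriv f (\<tau> t) / f (\<tau> t) * \<tau>' t * \<rho>' t) *\<^sub>R ?w (\<rho> t)) (at t)"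
      by (simp add: power2_eq_square)
    have "((\<lambda>s. (\<tau>' s, \<rho>' s *\<^sub>R ?w (\<rho> s))) has_vector_derivative
      (- (f (\<tau> t) * deriv f (\<tau> t) * c * (\<rho>' t)\<^sup>2),
       - ((\<rho>' t)\<^sup>2 *\<^sub>R ?\<Gamma>) - (2 * deriv f (\<tau> t) / f (\<tau> t) * \<tau>' t * \<rho>' t) *\<^sub>R ?w (\<rho> t))) (at t)"
      using \<tau>(2)[OF t] by (intro has_vector_derivative_Pair d) (simp add: has_real_derivative_iff_has_vector_derivative)
    then have "(velocity M i (\<lambda>t. (\<tau> t, \<sigma> (\<rho> t))) has_vector_derivative
      (- (f (\<tau> t) * deriv f (\<tau> t) * c * (\<rho>' t)\<^sup>2),
       - ((\<rho>' t)\<^sup>2 *\<^sub>R ?\<Gamma>) - (2 * deriv f (\<tau> t) / f (\<tau> t) * \<tau>' t * \<rho>' t) *\<^sub>R ?w (\<rho> t))) (at t)"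
    proof (rule has_vector_derivative_transform_within_open[OF _ curve_chart_open[OF scx i(1)]])
      show "t \<in> {t \<in> J. \<sigma> (\<rho> t) \<in> chart_dom F i}" using t i by simp
      fix s assume "s \<in> {t \<in> J. \<sigma> (\<rho> t) \<in> chart_dom F i}"
      then show "(\<tau>' s, \<rho>' s *\<^sub>R ?w (\<rho> s)) = velocity M i (\<lambda>t. (\<tau> t, \<sigma> (\<rho> t))) s"
        using velocity_grw[where \<tau>=\<tau>, OF scx _ i(1) _ \<tau>(1)] vx i(1) by simp
    qed
    note 1 = vector_derivative_at[OF this]
    have 2: "velocity M i (\<lambda>t. (\<tau> t, \<sigma> (\<rho> t))) t = (\<tau>' t, \<rho>' t *\<^sub>R ?w (\<rho> t))"
      using velocity_grw[where \<tau>=\<tau>, OF scx t i(1,2) \<tau>(1)[OF t]] vx[OF t i(1,2)] by simp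
    have cc: "metric_at F i (\<sigma> (\<rho> t)) (?w (\<rho> t)) (?w (\<rho> t)) = c"
      using c[OF r] velocity_square_chart[OF sc r i(1,2)] by simp
    \<comment> \<open>The Christoffel term is quadratic in the velocity; this is seen by testing the
      Koszul formula against every \<open>v\<close>.\<close>
    have 3: "christoffel F i (\<sigma> (\<rho> t)) (\<rho>' t *\<^sub>R ?w (\<rho> t)) (\<rho>' t *\<^sub>R ?w (\<rho> t)) = (\<rho>' t)\<^sup>2 *\<^sub>R ?\<Gamma>"
    proof (rule metric_nondegenerate[OF i(1,2)])
      fix v
      note L = linear_scale[OF dmet_linear(1)[OF i(1,2)]] linear_scale[OF dmet_linear(2)[OF i(1,2)]]
        linear_scale[OF dmet_linear(3)[OF i(1,2)]]
      have "2 * metric_at F i (\<sigma> (\<rho> t)) (christoffel F i (\<sigma> (\<rho> t)) (\<rho>' t *\<^sub>R ?w (\<rho> t)) (\<rho>' t *\<^sub>R ?w (\<rho> t))) v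
        = 2 * ((\<rho>' t)\<^sup>2 * metric_at F i (\<sigma> (\<rho> t)) ?\<Gamma> v)"
        unfolding christoffel_char[OF i(1,2)] mult.left_commute[of 2 "(\<rho>' t)\<^sup>2"]
        by (simp add: L power2_eq_square algebra_simps)
      then show "metric_at F i (\<sigma> (\<rho> t)) (christoffel F i (\<sigma> (\<rho> t)) (\<rho>' t *\<^sub>R ?w (\<rho> t)) (\<rho>' t *\<^sub>R ?w (\<rho> t))) v
        = metric_at F i (\<sigma> (\<rho> t)) ((\<rho>' t)\<^sup>2 *\<^sub>R ?\<Gamma>) v"
        by (simp add: bilinear_lmul[OF B])
    qed
    show "vector_derivative (velocity M i (\<lambda>t. (\<tau> t, \<sigma> (\<rho> t)))) (at t) +
      christoffel M i (\<tau> t, \<sigma> (\<rho> t)) (velocity M i (\<lambda>t. (\<tau> t, \<sigma> (\<rho> t))) t)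
        (velocity M i (\<lambda>t. (\<tau> t, \<sigma> (\<rho> t))) t) = 0"
      unfolding 1 2 christoffel_grw[OF i(1,3,2)] 3 bilinear_lmul[OF B] bilinear_rmul[OF B] cc
      by (simp add: power2_eq_square zero_prod_def algebra_simps)
  qed
qed

end

section \<open>Travel-time integrals\<close>

lemma interval_I_real: "interval_I (ereal x) (ereal y) = {x<..<y}"
  by (auto simp: interval_I_def)

text \<open>By the fundamental theorem of calculus \<open>u\<close> is a primitive of the continuous
  function \<open>q\<close> even across the exceptional points, hence differentiable there as well.
  It is applied at the times where a folded trajectory turns.\<close>

lemma DERIV_except_finite:
  fixes u q :: "real \<Rightarrow> real"
  assumes J: "open J" "is_interval J" and c: "continuous_on J u" "continuous_on J q"
    and N: "\<And>x y. x \<in> J \<Longrightarrow> y \<in> J \<Longrightarrow> finite (N \<inter> {x..y})"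
    and d: "\<And>r. r \<in> J - N \<Longrightarrow> (u has_real_derivative q r) (at r)"
    and r: "r \<in> J"
  shows "(u has_real_derivative q r) (at r)"
proof -
  obtain e where e: "e > 0" "cball r e \<subseteq> J" using open_contains_cball[of J] J r by blast
  let ?x = "r - e" and ?y = "r + e"
  have sub: "{?x..?y} \<subseteq> J" using e by (auto simp: cball_def dist_real_def abs_if subset_iff)
  have xy: "?x \<in> J" "?y \<in> J" using sub e by auto
  have int: "integral {?x..t} q = u t - u ?x" if "t \<in> {?x..?y}" for t
  proof (rule integral_unique, rule fundamental_theorem_of_calculus_interior_strong[OF N[OF xy]])
    show "?x \<le> t" using that by simp
    show "(u has_vector_derivative q s) (at s)" if "s \<in> {?x<..<t} - N \<inter> {?x..?y}" for s
    proof -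
      have "s \<in> {?x..?y}" using that \<open>t \<in> {?x..?y}\<close> by simp
      moreover from this have "s \<in> J" using sub by blast
      ultimately have "s \<in> J - N" using that by blast
      then show ?thesis
        using d[of s] by (simp add: has_real_derivative_iff_has_vector_derivative)
    qed
    show "continuous_on {?x..t} u" using that sub by (intro continuous_on_subset[OF c(1)]) auto
  qed
  have "((\<lambda>t. integral {?x..t} q) has_real_derivative q r) (at r within {?x..?y})"
    using e by (intro integral_has_real_derivative continuous_on_subset[OF c(2) sub]) auto
  then have "((\<lambda>t. u ?x + integral {?x..t} q) has_real_derivative q r) (at r within {?x..?y})"
    using DERIV_add[OF DERIV_const] by fastforce
  then have "(u has_real_derivative q r) (at r within {?x..?y})"
    using e by (elim has_field_derivative_transform_within[of _ _ _ _ 1]) (auto simp: int)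
  moreover have "at r within {?x..?y} = at r" using e by (intro at_within_interior) auto
  ultimately show ?thesis by simp
qed

locale warped_interval =
  fixes a b :: ereal and f :: "real \<Rightarrow> real"
  assumes ab: "a < b"
    and fs: "smooth_on (interval_I a b) f"
    and fp: "\<And>\<tau>. \<tau> \<in> interval_I a b \<Longrightarrow> f \<tau> > 0"
begin

abbreviation "I \<equiv> interval_I a b"
abbreviation "V \<equiv> warp f"
abbreviation "h D \<tau> \<equiv> 1 / (f \<tau>)\<^sup>2 / sqrt (V \<tau> - D)"

section \<open>Regularity of the potential \<open>V\<close>\<close>

lemma I_open: "open I" and I_interval: "is_interval I"
  using interval_I_props by auto

lemma I_between: "x \<in> I \<Longrightarrow> y \<in> I \<Longrightarrow> x \<le> t \<Longrightarrow> t \<le> y \<Longrightarrow> t \<in> I"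
  using I_interval unfolding is_interval_1 by blast

lemma I_sub: "x \<in> I \<Longrightarrow> y \<in> I \<Longrightarrow> {x..y} \<subseteq> I"
  by (rule subsetI, rule I_between[of x y]) simp_all

lemma V_pos: "\<tau> \<in> I \<Longrightarrow> V \<tau> > 0"
  using fp[of \<tau>] by (simp add: warp_def)

lemma f_cont: "continuous_on I f"
  using fs C_k_on.simps(1)[of I f] unfolding smooth_on_def by blast

lemma f_DERIV: "\<tau> \<in> I \<Longrightarrow> (f has_real_derivative deriv f \<tau>) (at \<tau>)"
  using smooth_on_differentiable[OF fs] DERIV_deriv_iff_real_differentiable by blast

lemma V_smooth: "smooth_on I V"
proof -
  have "C_k_on k I (\<lambda>x. inverse (f x * f x))" for k
  proof (rule C_k_on_inverse[OF I_open C_k_on_bilinear[OF I_open bounded_bilinear_mult]])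
    show "C_k_on k I f" using fs unfolding smooth_on_def by blast
    then show "C_k_on k I f" .
    show "f x * f x \<noteq> 0" if "x \<in> I" for x using fp[OF that] by simp
  qed
  moreover have "V = (\<lambda>x. inverse (f x * f x))"
    by (simp add: fun_eq_iff warp_def power2_eq_square divide_inverse)
  ultimately show ?thesis unfolding smooth_on_def by simp
qed

lemma V_DERIV: "\<tau> \<in> I \<Longrightarrow> (V has_real_derivative deriv V \<tau>) (at \<tau>)"
  using smooth_on_differentiable[OF V_smooth] DERIV_deriv_iff_real_differentiable by blast

lemma V_deriv_eq: "\<tau> \<in> I \<Longrightarrow> deriv V \<tau> = - (2 * deriv f \<tau> / (f \<tau>)^3)"
proof -
  assume t: "\<tau> \<in> I"
  have "(V has_real_derivative - (2 * deriv f \<tau> / (f \<tau>)^3)) (at \<tau>)"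
    unfolding warp_def using fp[OF t] f_DERIV[OF t]
    by (auto intro!: derivative_eq_intros simp: field_simps power2_eq_square power3_eq_cube)
  then show ?thesis by (rule DERIV_imp_deriv)
qed

lemma V_cont: "continuous_on I V"
  using V_smooth C_k_on.simps(1)[of I V] unfolding smooth_on_def by blast

lemma V_isCont: "\<tau> \<in> I \<Longrightarrow> isCont V \<tau>"
  using V_DERIV DERIV_isCont by blast

lemma dV_smooth: "smooth_on I (deriv V)"
proof -
  have 1: "smooth_on I (\<lambda>x. vector_derivative V (at x))"
    using smooth_onD_deriv(1)[OF I_open V_smooth] .
  have 2: "vector_derivative V (at x) = deriv V x" if "x \<in> I" for x
    using V_DERIV[OF that] by (simp add: has_real_derivative_iff_has_vector_derivative vector_derivative_at)
  show ?thesis unfolding smooth_on_def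
    using 1 C_k_on_cong[OF I_open, of "\<lambda>x. vector_derivative V (at x)" "deriv V"] 2
    unfolding smooth_on_def by blast
qed

lemma dV_DERIV: "\<tau> \<in> I \<Longrightarrow> (deriv V has_real_derivative deriv (deriv V) \<tau>) (at \<tau>)"
  using smooth_on_differentiable[OF dV_smooth] DERIV_deriv_iff_real_differentiable by blast

lemma dV_cont: "continuous_on I (deriv V)"
  using dV_smooth C_k_on.simps(1)[of I "deriv V"] unfolding smooth_on_def by blast

section \<open>Measurability, monotonicity and additivity of travel times\<close>

lemma h_cont: "continuous_on {\<tau>\<in>I. V \<tau> > D} (h D)"
  by (intro continuous_intros continuous_on_subset[OF f_cont] continuous_on_subset[OF V_cont])
     (auto dest: fp)

lemma h_pos: "\<tau> \<in> I \<Longrightarrow> V \<tau> > D \<Longrightarrow> h D \<tau> > 0"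
  using fp[of \<tau>] by simp

lemma h_eq: "h D \<tau> = V \<tau> / sqrt (V \<tau> - D)"
  by (simp add: warp_def)

lemma interval_I_subset: "a \<le> \<alpha> \<Longrightarrow> \<beta> \<le> b \<Longrightarrow> interval_I \<alpha> \<beta> \<subseteq> I"
  unfolding interval_I_def using le_less_trans less_le_trans by blast

lemma I_ereal: "\<tau> \<in> I \<longleftrightarrow> a < ereal \<tau> \<and> ereal \<tau> < b"
  by (simp add: interval_I_def)

lemma interval_I_sets [measurable]: "interval_I \<alpha> \<beta> \<in> sets borel"
  by (rule borel_open[OF interval_I_props(1)])

text \<open>Nothing is known about \<open>f\<close> outside \<open>I\<close>, so it is first
  replaced by its extension by zero, which is Borel measurable.\<close>

lemma h_meas:
  assumes "S \<subseteq> I" "S \<in> sets borel"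
  shows "(\<lambda>\<tau>. h D \<tau> * indicator S \<tau>) \<in> borel_measurable borel"
proof -
  define g where "g \<tau> = indicator I \<tau> *\<^sub>R f \<tau>" for \<tau>
  have [measurable]: "g \<in> borel_measurable borel"
    unfolding g_def by (rule borel_measurable_continuous_on_indicator[OF interval_I_sets f_cont])
  note [measurable] = assms(2)
  have "(\<lambda>\<tau>. 1 / (g \<tau>)\<^sup>2 / sqrt (1 / (g \<tau>)\<^sup>2 - D) * indicator S \<tau>) \<in> borel_measurable borel"
    by measurable
  moreover have "(\<lambda>\<tau>. 1 / (g \<tau>)\<^sup>2 / sqrt (1 / (g \<tau>)\<^sup>2 - D) * indicator S \<tau>) = (\<lambda>\<tau>. h D \<tau> * indicator S \<tau>)"
    using assms(1) by (auto simp: fun_eq_iff g_def warp_def indicator_def)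
  ultimately show ?thesis by (rule back_subst)
qed

lemma h_meas_ennreal:
  assumes "a \<le> \<alpha>" "\<beta> \<le> b"
  shows "(\<lambda>\<tau>. ennreal (h D \<tau>) * indicator (interval_I \<alpha> \<beta>) \<tau>) \<in> borel_measurable lborel"
proof -
  have "(\<lambda>\<tau>. ennreal (h D \<tau> * indicator (interval_I \<alpha> \<beta>) \<tau>)) \<in> borel_measurable lborel"
    using h_meas[OF interval_I_subset[OF assms] interval_I_sets, of D] by simp
  moreover have "(\<lambda>\<tau>. ennreal (h D \<tau> * indicator (interval_I \<alpha> \<beta>) \<tau>)) = (\<lambda>\<tau>. ennreal (h D \<tau>) * indicator (interval_I \<alpha> \<beta>) \<tau>)"
    by (auto simp: fun_eq_iff indicator_def)
  ultimately show ?thesis by simp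
qed

lemma h_int_empty: "\<beta> \<le> \<alpha> \<Longrightarrow> h_int f D \<alpha> \<beta> = 0"
proof -
  assume "\<beta> \<le> \<alpha>"
  then have "interval_I \<alpha> \<beta> = {}" unfolding interval_I_def using less_trans not_less by blast
  then show ?thesis by (simp add: h_int_def)
qed

lemma h_int_mono: "\<alpha>' \<le> \<alpha> \<Longrightarrow> \<beta> \<le> \<beta>' \<Longrightarrow> h_int f D \<alpha> \<beta> \<le> h_int f D \<alpha>' \<beta>'"
  unfolding h_int_def
proof (rule nn_integral_mono)
  fix x assume "\<alpha>' \<le> \<alpha>" "\<beta> \<le> \<beta>'"
  then have "x \<in> interval_I \<alpha> \<beta> \<Longrightarrow> x \<in> interval_I \<alpha>' \<beta>'"
    unfolding interval_I_def using le_less_trans less_le_trans by blast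
  then show "ennreal (h D x) * indicator (interval_I \<alpha> \<beta>) x \<le> ennreal (h D x) * indicator (interval_I \<alpha>' \<beta>') x"
    by (auto simp: indicator_def)
qed

lemma h_int_mono_D:
  assumes "D \<le> D'" "\<And>\<tau>. \<tau> \<in> interval_I \<alpha> \<beta> \<Longrightarrow> V \<tau> > D'"
  shows "h_int f D \<alpha> \<beta> \<le> h_int f D' \<alpha> \<beta>"
  unfolding h_int_def
proof (rule nn_integral_mono)
  fix x
  show "ennreal (h D x) * indicator (interval_I \<alpha> \<beta>) x \<le> ennreal (h D' x) * indicator (interval_I \<alpha> \<beta>) x"
  proof (cases "x \<in> interval_I \<alpha> \<beta>")
    case True
    then have "h D x \<le> h D' x"
      using assms(2)[OF True] assms(1) by (intro divide_left_mono) auto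
    then show ?thesis by (auto simp: indicator_def intro: ennreal_leI)
  qed simp
qed

lemma h_int_add:
  assumes "a \<le> \<alpha>" "\<gamma> \<le> b" "\<alpha> \<le> ereal \<beta>" "ereal \<beta> \<le> \<gamma>"
  shows "h_int f D \<alpha> \<gamma> = h_int f D \<alpha> (ereal \<beta>) + h_int f D (ereal \<beta>) \<gamma>"
proof -
  have "ereal \<beta> \<le> b" "a \<le> ereal \<beta>" using assms by auto
  note m = h_meas_ennreal[OF assms(1) this(1), of D] h_meas_ennreal[OF this(2) assms(2), of D]
  have "h_int f D \<alpha> \<gamma> = (\<integral>\<^sup>+\<tau>. ennreal (h D \<tau>) * indicator (interval_I \<alpha> (ereal \<beta>)) \<tau>
      + ennreal (h D \<tau>) * indicator (interval_I (ereal \<beta>) \<gamma>) \<tau> \<partial>lborel)"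
    unfolding h_int_def
  proof (rule nn_integral_cong_AE)
    \<comment> \<open>The two open intervals omit their common end point \<beta>, a null
      set.\<close>
    have "AE x in lborel. x \<noteq> \<beta>" by (rule AE_lborel_singleton)
    then show "AE x in lborel. ennreal (h D x) * indicator (interval_I \<alpha> \<gamma>) x =
        ennreal (h D x) * indicator (interval_I \<alpha> (ereal \<beta>)) x + ennreal (h D x) * indicator (interval_I (ereal \<beta>) \<gamma>) x"
    proof eventually_elim
      case (elim x)
      have "x \<in> interval_I \<alpha> \<gamma> \<longleftrightarrow> x \<in> interval_I \<alpha> (ereal \<beta>) \<or> x \<in> interval_I (ereal \<beta>) \<gamma>"
        using assms(3,4) elim unfolding interval_I_def
        by (auto intro: less_le_trans le_less_trans)
           (metis ereal_less_eq(3) le_less_trans less_le_trans less_ereal.simps(1) linorder_neqE_linordered_idom)+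
      moreover have "\<not> (x \<in> interval_I \<alpha> (ereal \<beta>) \<and> x \<in> interval_I (ereal \<beta>) \<gamma>)"
        by (auto simp: interval_I_def)
      ultimately show ?case by (auto simp: indicator_def)
    qed
  qed
  also have "\<dots> = h_int f D \<alpha> (ereal \<beta>) + h_int f D (ereal \<beta>) \<gamma>"
    unfolding h_int_def by (rule nn_integral_add[OF m])
  finally show ?thesis .
qed

lemma h_int_has_integral:
  assumes "x \<le> y" "\<And>\<tau>. x < \<tau> \<Longrightarrow> \<tau> < y \<Longrightarrow> V \<tau> \<ge> D" "(h D has_integral r) {x..y}"
  shows "h_int f D (ereal x) (ereal y) = ennreal r"
proof -
  have "(h D has_integral r) {x<..<y}" using assms(3) has_integral_Icc_iff_Ioo by blast
  then have "integral\<^sup>N lborel (\<lambda>\<tau>. ennreal (h D \<tau>) * indicator {x<..<y} \<tau>) = ennreal r"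
    using assms(2) by (intro nn_integral_has_integral_lebesgue') auto
  then show ?thesis by (simp add: h_int_def interval_I_real)
qed

lemma h_integrable_of_finite:
  assumes "x \<in> I" "y \<in> I" "x \<le> y" "\<And>\<tau>. x < \<tau> \<Longrightarrow> \<tau> < y \<Longrightarrow> V \<tau> \<ge> D" "h_int f D (ereal x) (ereal y) < \<infinity>"
  shows "h D integrable_on {x..y}"
proof -
  have "{x<..<y} \<subseteq> I" using I_sub[OF assms(1,2)] greaterThanLessThan_subseteq_atLeastAtMost_iff by blast
  have "(\<lambda>\<tau>. h D \<tau> * indicator {x<..<y} \<tau>) integrable_on UNIV"
  proof (rule nn_integral_integrable_on)
    show "(\<lambda>\<tau>. h D \<tau> * indicator {x<..<y} \<tau>) \<in> borel_measurable borel"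
      by (rule h_meas[OF \<open>{x<..<y} \<subseteq> I\<close>]) simp
    show "0 \<le> h D \<tau> * indicator {x<..<y} \<tau>" for \<tau>
      using assms(4)[of \<tau>] by (auto simp: indicator_def)
    have "(\<integral>\<^sup>+\<tau>. ennreal (h D \<tau> * indicator {x<..<y} \<tau>) \<partial>lborel) = h_int f D (ereal x) (ereal y)"
      unfolding h_int_def interval_I_real by (rule nn_integral_cong) (auto simp: indicator_def)
    then show "(\<integral>\<^sup>+\<tau>. ennreal (h D \<tau> * indicator {x<..<y} \<tau>) \<partial>lborel) < \<infinity>" using assms(5) by simp
  qed
  moreover have "(\<lambda>\<tau>. h D \<tau> * indicator {x<..<y} \<tau>) = (\<lambda>\<tau>. if \<tau> \<in> {x<..<y} then h D \<tau> else 0)"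
    by (auto simp: indicator_def fun_eq_iff)
  ultimately have "(\<lambda>\<tau>. if \<tau> \<in> {x<..<y} then h D \<tau> else 0) integrable_on UNIV"
    by (rule back_subst)
  then have "h D integrable_on {x<..<y}" unfolding integrable_restrict_UNIV .
  then show ?thesis using integrable_on_Icc_iff_Ioo by blast
qed

lemma h_int_finite:
  assumes "x \<in> I" "y \<in> I" "x \<le> y" "\<And>\<tau>. x \<le> \<tau> \<Longrightarrow> \<tau> \<le> y \<Longrightarrow> V \<tau> > D"
  shows "h_int f D (ereal x) (ereal y) < \<infinity>"
proof -
  have "h D integrable_on {x..y}"
    using assms I_between[OF assms(1,2)]
    by (intro integrable_continuous_real continuous_on_subset[OF h_cont[of D]]) auto
  then obtain r where "(h D has_integral r) {x..y}" by blast
  then show ?thesis using h_int_has_integral[of x y D r] assms by (simp add: less_imp_le)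
qed

text \<open>Monotone convergence along truncations. It replaces an interval that ends at a turning
  point or at \<open>b\<close>, where the integrand may be singular or the interval unbounded, by
  one that stops short of that end.\<close>

lemma h_int_less_approx:
  assumes "a \<le> \<alpha>" "\<beta> \<le> b" "\<alpha> < \<beta>" "y < h_int f D \<alpha> \<beta>"
  obtains t where "\<alpha> < ereal t" "ereal t < \<beta>" "y < h_int f D \<alpha> (ereal t)"
proof -
  obtain X where X: "incseq X" "\<And>i. \<alpha> < ereal (X i)" "\<And>i. ereal (X i) < \<beta>" "(\<lambda>i. ereal (X i)) \<longlonglongrightarrow> \<beta>"
    using ereal_incseq_approx[OF assms(3)] by blast
  let ?g = "\<lambda>i \<tau>. ennreal (h D \<tau>) * indicator (interval_I \<alpha> (ereal (X i))) \<tau>"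
  have inc: "incseq ?g"
  proof (rule incseq_SucI, rule le_funI)
    fix i \<tau>
    have "X i \<le> X (Suc i)" using X(1) by (rule incseq_SucD)
    then have "\<tau> \<in> interval_I \<alpha> (ereal (X i)) \<Longrightarrow> \<tau> \<in> interval_I \<alpha> (ereal (X (Suc i)))"
      by (auto simp: interval_I_def)
    then show "?g i \<tau> \<le> ?g (Suc i) \<tau>" by (auto simp: indicator_def)
  qed
  have sup: "(SUP i. ?g i \<tau>) = ennreal (h D \<tau>) * indicator (interval_I \<alpha> \<beta>) \<tau>" for \<tau>
  proof (cases "\<tau> \<in> interval_I \<alpha> \<beta>")
    case True
    then have "eventually (\<lambda>i. ereal \<tau> < ereal (X i)) sequentially"
      using order_tendstoD(1)[OF X(4), of "ereal \<tau>"] by (simp add: interval_I_def)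
    then obtain i where i: "\<tau> < X i" by (auto simp: eventually_sequentially)
    have "(SUP i. ?g i \<tau>) = ennreal (h D \<tau>)"
    proof (rule antisym)
      show "(SUP i. ?g i \<tau>) \<le> ennreal (h D \<tau>)" by (rule SUP_least) (auto simp: indicator_def)
      show "ennreal (h D \<tau>) \<le> (SUP i. ?g i \<tau>)"
        using True i by (intro SUP_upper2[of i]) (auto simp: interval_I_def)
    qed
    then show ?thesis using True by simp
  next
    case False
    then have "\<tau> \<notin> interval_I \<alpha> (ereal (X i))" for i
      using X(3)[of i] unfolding interval_I_def using less_trans by blast
    then show ?thesis using False by simp
  qed
  have "h_int f D \<alpha> \<beta> = (\<integral>\<^sup>+\<tau>. (SUP i. ?g i \<tau>) \<partial>lborel)"
    unfolding sup h_int_def ..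
  also have "\<dots> = (SUP i. integral\<^sup>N lborel (?g i))"
  proof (rule nn_integral_monotone_convergence_SUP[OF inc])
    show "?g i \<in> borel_measurable lborel" for i
      by (rule h_meas_ennreal[OF assms(1)]) (use X(3)[of i] assms(2) in auto)
  qed
  finally have "y < (SUP i. h_int f D \<alpha> (ereal (X i)))" using assms(4) by (simp add: h_int_def)
  then obtain i where "y < h_int f D \<alpha> (ereal (X i))" by (auto simp: less_SUP_iff)
  then show ?thesis using that X by blast
qed

lemma h_int_pos:
  assumes "x \<in> I" "y \<in> I" "x < y" "\<And>\<tau>. x < \<tau> \<Longrightarrow> \<tau> < y \<Longrightarrow> V \<tau> > D"
  shows "h_int f D (ereal x) (ereal y) > 0"
proof (rule ccontr)
  assume "\<not> ?thesis"
  then have "(\<integral>\<^sup>+\<tau>. ennreal (h D \<tau>) * indicator (interval_I (ereal x) (ereal y)) \<tau> \<partial>lborel) = 0"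
    by (simp add: h_int_def)
  moreover have "(\<lambda>\<tau>. ennreal (h D \<tau>) * indicator (interval_I (ereal x) (ereal y)) \<tau>) \<in> borel_measurable lborel"
    using assms(1,2) by (intro h_meas_ennreal) (auto simp: I_ereal)
  ultimately have "AE \<tau> in lborel. ennreal (h D \<tau>) * indicator (interval_I (ereal x) (ereal y)) \<tau> = 0"
    using nn_integral_0_iff_AE by blast
  then have "AE \<tau> in lborel. \<tau> \<notin> {x<..<y}"
  proof eventually_elim
    case (elim \<tau>)
    show ?case
    proof
      assume t: "\<tau> \<in> {x<..<y}"
      then have "h D \<tau> > 0" using assms(4) I_between[OF assms(1,2), of \<tau>] by (intro h_pos) auto
      then show False using elim t by (auto simp: interval_I_real)
    qed
  qed
  then have "{x<..<y} \<in> null_sets lborel" by (subst AE_iff_null_sets) auto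
  then show False using assms(3) by (simp add: null_sets_def)
qed

end

section \<open>Trajectories in the base\<close>

text \<open>The base component \<open>u\<close> of a geodesic as a function of the fibre arc length. Along solutions of
  the first two equations \<open>p\<^sup>2 - V(u)\<close> is constant; the third one fixes the constant.\<close>

definition traj :: "real set \<Rightarrow> (real \<Rightarrow> real) \<Rightarrow> real \<Rightarrow> real set \<Rightarrow> (real \<Rightarrow> real) \<Rightarrow> (real \<Rightarrow> real) \<Rightarrow> bool" where
  "traj I f D J u p \<longleftrightarrow> open J \<and> is_interval J \<and> u ` J \<subseteq> I \<and>
     (\<forall>r\<in>J. (u has_real_derivative p r / warp f (u r)) (at r) \<and>
        (p has_real_derivative deriv (warp f) (u r) / (2 * warp f (u r))) (at r) \<and>
        (p r)\<^sup>2 = warp f (u r) - D)"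

definition reach :: "real set \<Rightarrow> (real \<Rightarrow> real) \<Rightarrow> real \<Rightarrow> real \<Rightarrow> real \<Rightarrow> real \<Rightarrow> bool" where
  "reach I f D L x y \<longleftrightarrow> (\<exists>J u p. traj I f D J u p \<and> {0..L} \<subseteq> J \<and> u 0 = x \<and> u L = y)"

lemma reachI:
  "traj I f D J u p \<Longrightarrow> {0..L} \<subseteq> J \<Longrightarrow> u 0 = x \<Longrightarrow> u L = y \<Longrightarrow> reach I f D L x y"
  unfolding reach_def by blast

lemma reach_reverse:
  assumes "reach I f D L x y"
  shows "reach I f D L y x"
proof -
  obtain J u p where t: "traj I f D J u p" "{0..L} \<subseteq> J" "u 0 = x" "u L = y"
    using assms by (auto simp: reach_def)
  let ?J = "(\<lambda>r. L - r) -` J"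
  have d: "((\<lambda>r. L - r) has_real_derivative -1) (at r)" for r
    by (auto intro!: derivative_eq_intros)
  have "traj I f D ?J (\<lambda>r. u (L - r)) (\<lambda>r. - p (L - r))"
    unfolding traj_def
  proof (intro conjI ballI)
    show "open ?J" using t(1) by (intro open_vimage) (auto simp: traj_def intro: continuous_intros)
    have "is_interval J" using t(1) by (simp add: traj_def)
    then have *: "z \<in> J" if "x \<in> J" "y \<in> J" "x \<le> z" "z \<le> y" for x y z
      using that unfolding is_interval_1 by blast
    show "is_interval ?J"
      unfolding is_interval_1
    proof (intro ballI allI impI)
      fix x y z assume "x \<in> ?J" "y \<in> ?J" "x \<le> z \<and> z \<le> y"
      then show "z \<in> ?J" using *[of "L - y" "L - x" "L - z"] by simp
    qed
    show "(\<lambda>r. u (L - r)) ` ?J \<subseteq> I" using t(1) by (auto simp: traj_def)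
    fix r assume "r \<in> ?J"
    then have r: "(u has_real_derivative p (L - r) / warp f (u (L - r))) (at (L - r))"
        "(p has_real_derivative deriv (warp f) (u (L - r)) / (2 * warp f (u (L - r)))) (at (L - r))"
        "(p (L - r))\<^sup>2 = warp f (u (L - r)) - D"
      using t(1) by (auto simp: traj_def)
    show "((\<lambda>r. u (L - r)) has_real_derivative - p (L - r) / warp f (u (L - r))) (at r)"
      using DERIV_chain2[OF r(1) d] by simp
    show "((\<lambda>r. - p (L - r)) has_real_derivative deriv (warp f) (u (L - r)) / (2 * warp f (u (L - r)))) (at r)"
      using DERIV_minus[OF DERIV_chain2[OF r(2) d]] by simp
    show "(- p (L - r))\<^sup>2 = warp f (u (L - r)) - D" using r(3) by simp
  qed
  moreover have "{0..L} \<subseteq> ?J"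
  proof
    fix r assume "r \<in> {0..L}"
    then have "L - r \<in> {0..L}" by simp
    then show "r \<in> ?J" using t(2) by blast
  qed
  ultimately show ?thesis by (rule reachI) (use t(3,4) in simp_all)
qed

text \<open>One passage from \<open>A\<close> to \<open>B\<close> at level \<open>D\<close>. Each
  end may or may not be a turning point; \<open>fin\<close> allows a singular integrand there but
  keeps the passage time finite.\<close>

locale orbit = warped_interval +
  fixes D A B :: real
  assumes AB: "A \<in> I" "B \<in> I" "A < B"
    and VD: "\<And>\<tau>. A < \<tau> \<Longrightarrow> \<tau> < B \<Longrightarrow> V \<tau> > D"
    and VA: "V A \<ge> D" and VB: "V B \<ge> D"
    and fin: "h_int f D (ereal A) (ereal B) < \<infinity>"
begin

text \<open>\<open>Z x\<close> is the time still needed from \<open>x\<close> to \<open>B\<close>,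
  \<open>W\<close> the time of the whole passage, and \<open>g\<close> recovers the position from
  the remaining time. Counting from \<open>B\<close> turns the reflection at \<open>B\<close> into a
  folding of time at 0.\<close>

definition "Z x = integral {x..B} (h D)"
definition "W = Z A"
definition "g = inv_into {A..B} Z"

lemma V_ge: "A \<le> x \<Longrightarrow> x \<le> B \<Longrightarrow> V x \<ge> D"
  using VD[of x] VA VB by (metis less_le)

lemma AB_I: "A \<le> x \<Longrightarrow> x \<le> B \<Longrightarrow> x \<in> I"
  by (rule I_between[OF AB(1,2)])

lemma h_integrable: "A \<le> x \<Longrightarrow> y \<le> B \<Longrightarrow> h D integrable_on {x..y}"
proof (rule integrable_on_subinterval[OF h_integrable_of_finite[OF AB(1,2) _ _ fin]])
  show "A \<le> B" using AB by simp
qed (use VD in \<open>auto intro: less_imp_le\<close>)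

lemma Z_h_int: "A \<le> x \<Longrightarrow> x \<le> B \<Longrightarrow> h_int f D (ereal x) (ereal B) = ennreal (Z x)"
  unfolding Z_def
  by (rule h_int_has_integral[OF _ V_ge integrable_integral[OF h_integrable]]) simp_all

lemma Z_nonneg: "A \<le> x \<Longrightarrow> x \<le> B \<Longrightarrow> Z x \<ge> 0"
  unfolding Z_def by (rule integral_nonneg[OF h_integrable]) (use V_ge in simp_all)

lemma Z_B: "Z B = 0" by (simp add: Z_def)

lemma Z_diff: "A \<le> x \<Longrightarrow> x \<le> y \<Longrightarrow> y \<le> B \<Longrightarrow> Z y = Z x - integral {x..y} (h D)"
  unfolding Z_def using Henstock_Kurzweil_Integration.integral_combine[of x y B "h D"] h_integrable[of x B] by simp

lemma Z_cont: "continuous_on {A..B} Z"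
  unfolding Z_def by (rule indefinite_integral_continuous_1'[OF h_integrable]) auto

lemma Z_deriv:
  assumes "A < x" "x < B"
  shows "(Z has_real_derivative - h D x) (at x)"
proof -
  let ?x = "(A + x) / 2" and ?y = "(x + B) / 2"
  have "continuous_on {?x..?y} (h D)"
  proof (rule continuous_on_subset[OF h_cont], rule subsetI)
    fix t assume "t \<in> {?x..?y}"
    then have "A < t" "t < B" using assms by auto
    then show "t \<in> {\<tau> \<in> I. D < V \<tau>}" using VD[of t] AB_I[of t] by simp
  qed
  then have "((\<lambda>t. integral {?x..t} (h D)) has_real_derivative h D x) (at x within {?x..?y})"
    using assms by (intro integral_has_real_derivative) auto
  then have "((\<lambda>t. Z ?x - integral {?x..t} (h D)) has_real_derivative - h D x) (at x within {?x..?y})"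
    using DERIV_diff[OF DERIV_const] by fastforce
  then have "(Z has_real_derivative - h D x) (at x within {?x..?y})"
  proof (rule has_field_derivative_transform_within)
    show "(0::real) < 1" by simp
    show "x \<in> {?x..?y}" using assms by simp
    fix t assume "t \<in> {?x..?y}"
    then have "A \<le> ?x" "?x \<le> t" "t \<le> B" using assms by auto
    from Z_diff[OF this] show "Z ?x - integral {?x..t} (h D) = Z t" by (rule sym)
  qed
  moreover have "at x within {?x..?y} = at x" using assms by (intro at_within_interior) auto
  ultimately show ?thesis by simp
qed

lemma Z_strict: "A \<le> x \<Longrightarrow> x < y \<Longrightarrow> y \<le> B \<Longrightarrow> Z y < Z x"
proof (rule DERIV_neg_imp_decreasing_open[where f=Z])
  assume *: "A \<le> x" "x < y" "y \<le> B"
  show "x < y" by fact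
  show "continuous_on {x..y} Z" by (rule continuous_on_subset[OF Z_cont]) (use * in auto)
  fix t assume "x < t" "t < y"
  then have t: "A < t" "t < B" using * by auto
  then have "- h D t < 0" using h_pos[OF AB_I VD[OF t]] by simp
  then show "\<exists>z. (Z has_real_derivative z) (at t) \<and> z < 0" using Z_deriv[OF t] by blast
qed

lemma Z_inj: "inj_on Z {A..B}"
proof (rule linorder_inj_onI)
  fix x y assume "x < y" "x \<in> {A..B}" "y \<in> {A..B}"
  then show "Z x \<noteq> Z y" using Z_strict[of x y] by simp
qed auto

lemma W_pos: "W > 0"
  unfolding W_def using Z_strict[of A B] AB Z_B by simp

lemma Z_le_W: "A \<le> x \<Longrightarrow> x \<le> B \<Longrightarrow> Z x \<le> W"
  unfolding W_def using Z_strict[of A x] by (cases "x = A") auto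

lemma Z_image: "Z ` {A..B} = {0..W}"
proof
  show "Z ` {A..B} \<subseteq> {0..W}" using Z_le_W Z_nonneg by auto
  show "{0..W} \<subseteq> Z ` {A..B}"
  proof
    fix z assume "z \<in> {0..W}"
    then have "\<exists>x\<ge>A. x \<le> B \<and> Z x = z"
      using Z_cont AB Z_B by (intro IVT2') (auto simp: W_def)
    then show "z \<in> Z ` {A..B}" by auto
  qed
qed

lemma g_Z: "A \<le> x \<Longrightarrow> x \<le> B \<Longrightarrow> g (Z x) = x"
  unfolding g_def using Z_inj by (intro inv_into_f_f) auto

lemma Z_g: "0 \<le> z \<Longrightarrow> z \<le> W \<Longrightarrow> Z (g z) = z"
  unfolding g_def by (rule f_inv_into_f) (simp add: Z_image)

lemma g_range: "0 \<le> z \<Longrightarrow> z \<le> W \<Longrightarrow> A \<le> g z \<and> g z \<le> B"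
  unfolding g_def using inv_into_into[of z Z "{A..B}"] by (simp add: Z_image)

lemma g_range_strict: "0 < z \<Longrightarrow> z < W \<Longrightarrow> A < g z \<and> g z < B"
  using g_range[of z] Z_g[of z] Z_B W_def by (metis less_le less_irrefl)

lemma g_0: "g 0 = B" and g_W: "g W = A"
  using g_Z[of B] g_Z[of A] AB by (auto simp: Z_B W_def)

lemma g_cont: "continuous_on {0..W} g"
  unfolding Z_image[symmetric] by (rule continuous_on_inv[OF Z_cont compact_Icc]) (simp add: g_Z)

lemma g_deriv:
  assumes "0 < z" "z < W"
  shows "(g has_real_derivative - (1 / h D (g z))) (at z)"
proof -
  have r: "A < g z" "g z < B" using g_range_strict[OF assms] by auto
  have "isCont g z"
    using continuous_on_interior[OF g_cont, of z] assms by simp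
  then have "(g has_real_derivative inverse (- h D (g z))) (at z)"
    using Z_deriv[OF r] h_pos[of "g z" D] AB_I[of "g z"] VD[OF r] r assms Z_g
    by (intro DERIV_inverse_function[where f=Z and a=0 and b=W]) auto
  then show ?thesis by (simp add: divide_inverse)
qed

text \<open>A trajectory oscillating between turning points is smooth, although it is obtained from the
  half orbit \<open>g\<close> by folding the time axis with \<open>\<phi>\<close>, which is not differentiable on \<open>N\<close>.\<close>

lemma fold_traj:
  assumes J: "open J" "is_interval J" and \<phi>: "\<phi> ` J \<subseteq> {0..W}" "continuous_on J \<phi>"
    and N: "\<And>x y. x \<in> J \<Longrightarrow> y \<in> J \<Longrightarrow> finite (N \<inter> {x..y})"
    and d\<phi>: "\<And>r. r \<in> J - N \<Longrightarrow> (\<phi> has_real_derivative s r) (at r)"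
      "\<And>r. r \<in> J - N \<Longrightarrow> 0 < \<phi> r \<and> \<phi> r < W"
      "\<And>r. r \<in> J - N \<Longrightarrow> \<bar>s r\<bar> = 1 \<and> eventually (\<lambda>r'. s r' = s r) (nhds r)"
    and turn: "\<And>r. r \<in> J \<inter> N \<Longrightarrow> V (g (\<phi> r)) = D"
    and s: "\<And>r. \<bar>s r\<bar> \<le> (1::real)"
  shows "traj I f D J (\<lambda>r. g (\<phi> r)) (\<lambda>r. - (s r * sqrt (V (g (\<phi> r)) - D)))"
proof -
  let ?u = "\<lambda>r. g (\<phi> r)"
  let ?q = "\<lambda>r. sqrt (V (?u r) - D)"
  let ?p = "\<lambda>r. - (s r * ?q r)"
  have uI: "?u r \<in> I" if "r \<in> J" for r
  proof -
    have "\<phi> r \<in> {0..W}" using \<phi>(1) that by blast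
    then show ?thesis using g_range[of "\<phi> r"] AB_I[of "?u r"] by simp
  qed
  have uc: "continuous_on J ?u"
    by (rule continuous_on_compose2[OF g_cont \<phi>(2,1)])
  have Vc: "continuous_on J (\<lambda>r. V (?u r))"
    by (rule continuous_on_compose2[OF V_cont uc]) (use uI in auto)
  have qc: "continuous_on J ?q" by (intro continuous_intros Vc)
  have q0: "isCont ?q r" if "r \<in> J" for r
    using qc J(1) that continuous_on_eq_continuous_at by blast
  have s2: "s r * s r = 1" if "r \<in> J - N" for r
    using d\<phi>(3)[OF that] by (auto simp: abs_if split: if_splits)
  have VD': "V (?u r) > D" if "r \<in> J - N" for r
    using VD[of "?u r"] g_range_strict[of "\<phi> r"] d\<phi>(2)[OF that] by simp
  \<comment> \<open>The sign \<open>s\<close> jumps at the fold times, but there \<open>?q\<close>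
    vanishes, so the momentum stays continuous.\<close>
  have pc: "isCont ?p r" if r: "r \<in> J" for r
  proof (cases "r \<in> N")
    case False
    then have ev: "eventually (\<lambda>r'. s r' = s r) (nhds r)" using d\<phi>(3) r by blast
    have "isCont (\<lambda>r'. - (s r * ?q r')) r" by (intro continuous_intros q0[OF r])
    moreover have "eventually (\<lambda>r'. - (s r * ?q r') = ?p r') (nhds r)"
      using ev by eventually_elim simp
    ultimately show ?thesis using isCont_cong by fastforce
  next
    case True
    then have "?q r = 0" using turn r by simp
    then have "(?q \<longlongrightarrow> 0) (at r)" using q0[OF r] by (simp add: isCont_def)
    moreover have "\<bar>?p r'\<bar> \<le> \<bar>?q r'\<bar>" for r'
      using s[of r'] mult_right_mono[of "\<bar>s r'\<bar>" 1 "\<bar>?q r'\<bar>"] by (simp add: abs_mult)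
    ultimately have "(?p \<longlongrightarrow> 0) (at r)"
      by (intro Lim_null_comparison[of ?p "\<lambda>r. \<bar>?q r\<bar>"]) (auto simp: tendsto_rabs_zero)
    then show ?thesis using \<open>?q r = 0\<close> by (simp add: isCont_def)
  qed
  have du: "(?u has_real_derivative ?p r / V (?u r)) (at r)" if r: "r \<in> J - N" for r
  proof -
    have "(?u has_real_derivative - (1 / h D (?u r)) * s r) (at r)"
      using DERIV_chain2[OF g_deriv d\<phi>(1)[OF r]] d\<phi>(2)[OF r] by blast
    moreover have "- (1 / h D (?u r)) * s r = ?p r / V (?u r)"
      unfolding h_eq by (simp add: field_simps)
    ultimately show ?thesis by simp
  qed
  have dp: "(?p has_real_derivative deriv V (?u r) / (2 * V (?u r))) (at r)" if r: "r \<in> J - N" for r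
  proof -
    have rJ: "r \<in> J" using r by simp
    have q: "?q r > 0" using VD'[OF r] by simp
    have "((\<lambda>r'. V (?u r') - D) has_real_derivative deriv V (?u r) * (?p r / V (?u r))) (at r)"
      using DERIV_chain2[OF V_DERIV[OF uI[OF rJ]] du[OF r]] by (auto intro!: derivative_eq_intros)
    from DERIV_chain2[OF DERIV_real_sqrt this]
    have "(?q has_real_derivative inverse (?q r) / 2 * (deriv V (?u r) * (?p r / V (?u r)))) (at r)"
      using VD'[OF r] by simp
    from DERIV_minus[OF DERIV_cmult[OF this, of "s r"]]
    have d: "((\<lambda>r'. - (s r * ?q r')) has_real_derivative - (s r * (inverse (?q r) / 2 * (deriv V (?u r) * (?p r / V (?u r)))))) (at r)" .
    have e: "- (s r * (inverse (?q r) / 2 * (deriv V (?u r) * (?p r / V (?u r))))) = (s r * s r) * deriv V (?u r) / (2 * V (?u r))"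
      using q by (simp add: field_simps)
    have "((\<lambda>r'. - (s r * ?q r')) has_real_derivative deriv V (?u r) / (2 * V (?u r))) (at r)"
      using d unfolding e s2[OF r] mult_1 .
    moreover have "eventually (\<lambda>r'. - (s r * ?q r') = ?p r') (nhds r)"
      using d\<phi>(3)[OF r] by (auto elim: eventually_mono)
    ultimately show ?thesis
      using DERIV_cong_ev[OF refl, of "\<lambda>r'. - (s r * ?q r')" ?p r, OF _ refl] by blast
  qed
  have Vn: "V (?u r) \<noteq> 0" if "r \<in> J" for r using V_pos[OF uI[OF that]] by simp
  show ?thesis
    unfolding traj_def
  proof (intro conjI ballI J)
    show "?u ` J \<subseteq> I" using uI by auto
    have pc': "continuous_on J ?p" using pc continuous_at_imp_continuous_on by blast
    have c1: "continuous_on J (\<lambda>r. ?p r / V (?u r))"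
      using Vn by (intro continuous_on_divide pc' Vc) auto
    have c2: "continuous_on J (\<lambda>r. deriv V (?u r) / (2 * V (?u r)))"
      using Vn uI by (intro continuous_on_divide continuous_on_mult continuous_on_const Vc
          continuous_on_compose2[OF dV_cont uc]) auto
    fix r assume r: "r \<in> J"
    show "(?u has_real_derivative ?p r / V (?u r)) (at r)"
      by (rule DERIV_except_finite[OF J uc c1 N du r])
    show "(?p has_real_derivative deriv V (?u r) / (2 * V (?u r))) (at r)"
      by (rule DERIV_except_finite[OF J pc' c2 N dp r])
    show "(?p r)\<^sup>2 = V (?u r) - D"
    proof (cases "r \<in> N")
      case True then show ?thesis using turn r by simp
    next
      case False
      then have "(?p r)\<^sup>2 = (s r * s r) * (?q r)\<^sup>2" by (simp add: power2_eq_square)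
      then show ?thesis using s2[of r] VD'[of r] False r by simp
    qed
  qed
qed

text \<open>No folding occurs: the remaining time decreases with slope -1. Since both points lie
  strictly between \<open>A\<close> and \<open>B\<close>, there is room for an open time
  interval.\<close>

lemma direct_traj:
  assumes "A < x" "x \<le> y" "y < B"
  shows "\<exists>J u p. traj I f D J u p \<and> {0..Z x - Z y} \<subseteq> J \<and> u 0 = x \<and> u (Z x - Z y) = y \<and> (\<forall>r\<in>J. p r > 0)"
proof -
  let ?J = "{Z x - W<..<Z x}"
  have tr: "traj I f D ?J (\<lambda>r. g (Z x - r)) (\<lambda>r. - (-1 * sqrt (V (g (Z x - r)) - D)))"
    by (rule fold_traj[where N="{}" and s="\<lambda>_. -1"])
       (auto intro!: derivative_eq_intros continuous_intros simp: is_interval_1)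
  have "{0..Z x - Z y} \<subseteq> ?J"
    using Z_strict[of A x] Z_strict[of y B] assms Z_B by (auto simp: W_def)
  moreover have "- (-1 * sqrt (V (g (Z x - r)) - D)) > 0" if "r \<in> ?J" for r
    using VD g_range_strict[of "Z x - r"] that by simp
  moreover have "g (Z x - 0) = x" "g (Z x - (Z x - Z y)) = y"
    using g_Z[of x] g_Z[of y] assms by auto
  ultimately show ?thesis using tr
    by (intro exI[of _ ?J] exI[of _ "\<lambda>r. g (Z x - r)"] exI[of _ "\<lambda>r. - (-1 * sqrt (V (g (Z x - r)) - D))"]) simp
qed

text \<open>The remaining time is folded to \<open>\<bar>r - Z x\<bar>\<close>: it decreases to 0 at
  the turning point \<open>B\<close> and then grows again.\<close>

lemma bounce_reach:
  assumes "V B = D" "A < x" "x \<le> B" "A < y" "y \<le> B"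
  shows "reach I f D (Z x + Z y) x y"
proof -
  let ?J = "{Z x - W<..<Z x + W}"
  let ?s = "\<lambda>r. sgn (r - Z x)"
  have ev: "eventually (\<lambda>r'. ?s r' = ?s r) (nhds r)" if r: "r \<in> ?J - {Z x}" for r
  proof (cases "r > Z x")
    case True
    have "eventually (\<lambda>r'. r' \<in> {Z x<..}) (nhds r)" using True by (intro eventually_nhds_in_open) auto
    then show ?thesis by eventually_elim (use True in auto)
  next
    case False
    then have "r < Z x" using r by auto
    then have "eventually (\<lambda>r'. r' \<in> {..<Z x}) (nhds r)" by (intro eventually_nhds_in_open) auto
    then show ?thesis by eventually_elim (use \<open>r < Z x\<close> in auto)
  qed
  have tr: "traj I f D ?J (\<lambda>r. g \<bar>r - Z x\<bar>) (\<lambda>r. - (?s r * sqrt (V (g \<bar>r - Z x\<bar>) - D)))"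
  proof (rule fold_traj[where N="{Z x}"])
    fix r assume r: "r \<in> ?J - {Z x}"
    have "((\<lambda>r'. ?s r * (r' - Z x)) has_real_derivative ?s r) (at r)"
      by (auto intro!: derivative_eq_intros)
    moreover have "eventually (\<lambda>r'. ?s r * (r' - Z x) = \<bar>r' - Z x\<bar>) (nhds r)"
      using ev[OF r] by eventually_elim (simp add: abs_sgn)
    ultimately show "((\<lambda>r. \<bar>r - Z x\<bar>) has_real_derivative ?s r) (at r)"
      using DERIV_cong_ev[of r r "\<lambda>r'. ?s r * (r' - Z x)" "\<lambda>r. \<bar>r - Z x\<bar>" "?s r" "?s r"] by simp
    show "0 < \<bar>r - Z x\<bar> \<and> \<bar>r - Z x\<bar> < W" using r by (auto simp: abs_if)
    show "\<bar>?s r\<bar> = 1 \<and> eventually (\<lambda>r'. ?s r' = ?s r) (nhds r)" using ev[OF r] r by (auto simp: sgn_if)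
  qed (use assms g_0 in \<open>auto intro!: continuous_intros simp: is_interval_1 sgn_if\<close>)
  have "Z x < W" "Z y < W" "Z x \<ge> 0" "Z y \<ge> 0"
    using Z_strict[of A x] Z_strict[of A y] Z_nonneg assms by (auto simp: W_def)
  moreover have "g \<bar>0 - Z x\<bar> = x" "g \<bar>Z x + Z y - Z x\<bar> = y"
    using g_Z[of x] g_Z[of y] assms Z_nonneg by auto
  ultimately show ?thesis by (intro reachI[OF tr]) auto
qed

text \<open>The orbit between two turning points, continued periodically: \<open>W / pi * arccos (cos (pi * r / W))\<close>
  is the triangle wave of period \<open>2 * W\<close>.\<close>

lemma periodic_reach:
  assumes "V A = D" "V B = D" "A \<le> x" "x \<le> B" "A \<le> y" "y \<le> B"
    and "\<bar>\<epsilon>\<bar> = 1" "\<bar>\<delta>\<bar> = 1"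
  shows "reach I f D (2 * of_int k * W + \<epsilon> * Z x + \<delta> * Z y) x y"
proof -
  \<comment> \<open>The phase makes the wave start at height \<open>Z x\<close>, falling for
    \<epsilon> = 1 and rising for \<epsilon> = -1; \<open>k\<close> and \<delta> select one of the
    passages at height \<open>Z y\<close>.\<close>
  define \<theta> where "\<theta> r = pi * (r - \<epsilon> * Z x) / W" for r
  let ?\<phi> = "\<lambda>r. W / pi * arccos (cos (\<theta> r))"
  let ?s = "\<lambda>r. sgn (sin (\<theta> r))"
  let ?N = "{r. sin (\<theta> r) = 0}"
  have W: "W > 0" by (rule W_pos)
  have \<theta>c: "continuous_on UNIV \<theta>" unfolding \<theta>_def using W by (intro continuous_intros) auto
  have d\<theta>: "(\<theta> has_real_derivative pi / W) (at r)" for r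
    unfolding \<theta>_def using W by (auto intro!: derivative_eq_intros)
  have fin: "finite (?N \<inter> {r1..r2})" for r1 r2
  proof -
    have "?N \<inter> {r1..r2} \<subseteq> (\<lambda>i. real_of_int i * W + \<epsilon> * Z x) ` {i. \<lfloor>(r1 - \<epsilon> * Z x) / W\<rfloor> \<le> i \<and> i \<le> \<lceil>(r2 - \<epsilon> * Z x) / W\<rceil>}"
    proof
      fix r assume r: "r \<in> ?N \<inter> {r1..r2}"
      then obtain i :: int where "\<theta> r = of_int i * pi" by (auto simp: sin_zero_iff_int2)
      then have "pi * ((r - \<epsilon> * Z x) / W) = pi * of_int i" unfolding \<theta>_def by simp
      then have i: "(r - \<epsilon> * Z x) / W = of_int i" using pi_neq_zero mult_left_cancel by blast
      have "(r1 - \<epsilon> * Z x) / W \<le> of_int i" "of_int i \<le> (r2 - \<epsilon> * Z x) / W"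
        unfolding i[symmetric] using r W by (auto intro!: divide_right_mono)
      then have "\<lfloor>(r1 - \<epsilon> * Z x) / W\<rfloor> \<le> i" "i \<le> \<lceil>(r2 - \<epsilon> * Z x) / W\<rceil>" by linarith+
      moreover have "r = of_int i * W + \<epsilon> * Z x" using i W by (simp add: field_simps)
      ultimately show "r \<in> (\<lambda>i. real_of_int i * W + \<epsilon> * Z x) ` {i. \<lfloor>(r1 - \<epsilon> * Z x) / W\<rfloor> \<le> i \<and> i \<le> \<lceil>(r2 - \<epsilon> * Z x) / W\<rceil>}"
        by blast
    qed
    moreover have "finite {i. \<lfloor>(r1 - \<epsilon> * Z x) / W\<rfloor> \<le> i \<and> i \<le> \<lceil>(r2 - \<epsilon> * Z x) / W\<rceil>}"
      using finite_atLeastAtMost_int[of "\<lfloor>(r1 - \<epsilon> * Z x) / W\<rfloor>" "\<lceil>(r2 - \<epsilon> * Z x) / W\<rceil>"]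
      by (simp add: atLeastAtMost_def atLeast_def atMost_def Collect_conj_eq)
    ultimately show ?thesis using finite_surj by blast
  qed
  have tr: "traj I f D UNIV (\<lambda>r. g (?\<phi> r)) (\<lambda>r. - (?s r * sqrt (V (g (?\<phi> r)) - D)))"
  proof (rule fold_traj[where N="?N"])
    show "?\<phi> ` UNIV \<subseteq> {0..W}"
      using W arccos_lbound arccos_ubound by (auto simp: field_simps)
    show "continuous_on UNIV ?\<phi>"
      by (intro continuous_intros continuous_on_arccos \<theta>c) auto
    fix r assume "r \<in> UNIV - ?N"
    then have sn: "sin (\<theta> r) \<noteq> 0" by simp
    have sq: "(cos (\<theta> r))\<^sup>2 < 1" using sn sin_cos_squared_add[of "\<theta> r"]
      by (metis add_cancel_left_left cos_squared_eq diff_add_cancel diff_less_eq less_add_same_cancel1 linorder_not_less power2_less_eq_zero_iff)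
    then have c1: "-1 < cos (\<theta> r)" "cos (\<theta> r) < 1"
      by (auto simp: abs_square_less_1 abs_if split: if_splits)
    have sa: "sqrt (1 - (cos (\<theta> r))\<^sup>2) = \<bar>sin (\<theta> r)\<bar>"
      by (metis real_sqrt_abs sin_squared_eq)
    have "((\<lambda>r. cos (\<theta> r)) has_real_derivative - sin (\<theta> r) * (pi / W)) (at r)"
      using DERIV_chain2[OF DERIV_cos d\<theta>] .
    from DERIV_cmult[OF DERIV_chain2[OF DERIV_arccos[OF c1] this], of "W / pi"]
    have "(?\<phi> has_real_derivative W / pi * (inverse (- sqrt (1 - (cos (\<theta> r))\<^sup>2)) * (- sin (\<theta> r) * (pi / W)))) (at r)" .
    moreover have "W / pi * (inverse (- sqrt (1 - (cos (\<theta> r))\<^sup>2)) * (- sin (\<theta> r) * (pi / W))) = ?s r"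
      unfolding sa using W sn by (simp add: sgn_if abs_if field_simps)
    ultimately show "(?\<phi> has_real_derivative ?s r) (at r)" by simp
    have "0 < arccos (cos (\<theta> r))" "arccos (cos (\<theta> r)) < pi"
      using arccos_lt_bounded[OF c1] by auto
    then show "0 < ?\<phi> r \<and> ?\<phi> r < W" using W by (auto simp: field_simps)
    have "eventually (\<lambda>r'. ?s r' = ?s r) (nhds r)"
    proof -
      have c: "isCont (\<lambda>r. sin (\<theta> r)) r" using DERIV_isCont[OF DERIV_chain2[OF DERIV_sin d\<theta>]] .
      then have t: "filterlim (\<lambda>r. sin (\<theta> r)) (nhds (sin (\<theta> r))) (nhds r)"
        using continuous_at_imp_continuous_on tendsto_at_iff_tendsto_nhds isCont_def by blast
      show ?thesis
      proof (cases "sin (\<theta> r) > 0")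
        case True
        show ?thesis using order_tendstoD(1)[OF t True] by eventually_elim (use True in auto)
      next
        case False
        then have *: "sin (\<theta> r) < 0" using sn by simp
        show ?thesis using order_tendstoD(2)[OF t *] by eventually_elim (use * in auto)
      qed
    qed
    then show "\<bar>?s r\<bar> = 1 \<and> eventually (\<lambda>r'. ?s r' = ?s r) (nhds r)" using sn by (simp add: abs_sgn_eq)
  next
    fix r assume "r \<in> UNIV \<inter> ?N"
    then have "(cos (\<theta> r))\<^sup>2 = 1" using sin_cos_squared_add[of "\<theta> r"] by simp
    then have "cos (\<theta> r) = 1 \<or> cos (\<theta> r) = -1" by (simp add: power2_eq_1_iff)
    then show "V (g (?\<phi> r)) = D" using assms(1,2) g_0 g_W W by auto
  qed (use fin in \<open>auto simp: abs_sgn_eq\<close>)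
  have \<phi>: "?\<phi> r = z" if "r = \<epsilon> * Z x + 2 * of_int j * W + \<eta> * z" "\<bar>\<eta>\<bar> = 1" "0 \<le> z" "z \<le> W" for r z \<eta> j
  proof -
    have "\<theta> r = \<eta> * (pi * z / W) + 2 * of_int j * pi"
      unfolding \<theta>_def that(1) using W by (simp add: field_simps)
    then have "cos (\<theta> r) = cos (\<eta> * (pi * z / W))"
      using cos_add[of "\<eta> * (pi * z / W)" "2 * of_int j * pi"] cos_int_2pin[of j] sin_int_2pin[of j]
      by (simp add: mult.commute mult.left_commute)
    also have "\<dots> = cos (pi * z / W)"
      using that(2) by (cases "\<eta> \<ge> 0") (auto simp: abs_if)
    finally have "arccos (cos (\<theta> r)) = pi * z / W"
      using that W by (simp add: arccos_cos field_simps)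
    then show ?thesis using W by simp
  qed
  have "?\<phi> 0 = Z x"
    using assms by (intro \<phi>[of _ 0 "- \<epsilon>"] Z_nonneg Z_le_W) auto
  moreover have "?\<phi> (2 * of_int k * W + \<epsilon> * Z x + \<delta> * Z y) = Z y"
    using assms by (intro \<phi>[of _ k \<delta>] Z_nonneg Z_le_W) auto
  ultimately have "g (?\<phi> 0) = x" "g (?\<phi> (2 * of_int k * W + \<epsilon> * Z x + \<delta> * Z y)) = y"
    using g_Z assms by auto
  then show ?thesis by (intro reachI[OF tr]) auto
qed

end

context warped_interval begin

lemma V_open: "open {\<tau>\<in>I. V \<tau> > D}"
proof -
  have "open (I \<inter> V -` {D<..})"
    using V_cont I_open by (intro continuous_open_preimage) auto
  moreover have "I \<inter> V -` {D<..} = {\<tau>\<in>I. V \<tau> > D}" by auto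
  ultimately show ?thesis by simp
qed

lemma extend_left:
  assumes "x \<in> I" "V x > D"
  obtains A where "A \<in> I" "A < x" "\<And>\<tau>. A \<le> \<tau> \<Longrightarrow> \<tau> \<le> x \<Longrightarrow> V \<tau> > D"
proof -
  obtain e where e: "e > 0" "ball x e \<subseteq> {\<tau>\<in>I. V \<tau> > D}"
    using V_open[of D] assms by (metis (mono_tags, lifting) mem_Collect_eq open_contains_ball)
  then have "{\<tau>. x - e / 2 \<le> \<tau> \<and> \<tau> \<le> x} \<subseteq> {\<tau>\<in>I. V \<tau> > D}"
    by (auto simp: subset_iff dist_real_def)
  moreover from this have "x - e / 2 \<in> I" using e(1) by (auto simp: subset_iff)
  ultimately show ?thesis using e(1) by (intro that[of "x - e / 2"]) auto
qed

lemma extend_right: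
  assumes "x \<in> I" "V x > D"
  obtains B where "B \<in> I" "x < B" "\<And>\<tau>. x \<le> \<tau> \<Longrightarrow> \<tau> \<le> B \<Longrightarrow> V \<tau> > D"
proof -
  obtain e where e: "e > 0" "ball x e \<subseteq> {\<tau>\<in>I. V \<tau> > D}"
    using V_open[of D] assms by (metis (mono_tags, lifting) mem_Collect_eq open_contains_ball)
  then have "{\<tau>. x \<le> \<tau> \<and> \<tau> \<le> x + e / 2} \<subseteq> {\<tau>\<in>I. V \<tau> > D}"
    by (auto simp: subset_iff dist_real_def)
  moreover from this have "x + e / 2 \<in> I" using e(1) by (auto simp: subset_iff)
  ultimately show ?thesis using e(1) by (intro that[of "x + e / 2"]) auto
qed

text \<open>The interval is enlarged beyond both end points, where \<open>V\<close> still exceeds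
  \<open>D\<close>, so that the trajectory is defined on an open set of times around
  \<open>{0..L}\<close>.\<close>

lemma direct_traj:
  assumes xy: "x \<in> I" "y \<in> I" "x \<le> y" and VD: "\<And>\<tau>. x \<le> \<tau> \<Longrightarrow> \<tau> \<le> y \<Longrightarrow> V \<tau> > D"
    and L: "h_int f D (ereal x) (ereal y) = ennreal L" "L \<ge> 0"
  shows "\<exists>J u p. traj I f D J u p \<and> {0..L} \<subseteq> J \<and> u 0 = x \<and> u L = y \<and> (\<forall>r\<in>J. p r > 0)"
proof -
  obtain A where A: "A \<in> I" "A < x" "\<And>\<tau>. A \<le> \<tau> \<Longrightarrow> \<tau> \<le> x \<Longrightarrow> V \<tau> > D"
    using extend_left[of x D] xy VD[of x] by auto
  obtain B where B: "B \<in> I" "y < B" "\<And>\<tau>. y \<le> \<tau> \<Longrightarrow> \<tau> \<le> B \<Longrightarrow> V \<tau> > D"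
    using extend_right[of y D] xy VD[of y] by auto
  have V: "V \<tau> > D" if "A \<le> \<tau>" "\<tau> \<le> B" for \<tau>
    using A(3) B(3) VD that by (meson linear)
  interpret orbit a b f D A B
    by unfold_locales (use A B V xy h_int_finite[of A B D] in \<open>auto intro: less_imp_le\<close>)
  have "h_int f D (ereal x) (ereal B) = ennreal L + h_int f D (ereal y) (ereal B)"
    using h_int_add[of "ereal x" "ereal B" y D] xy A B L(1) by (simp add: I_ereal less_imp_le)
  then have "ennreal (Z x) = ennreal (L + Z y)"
    using Z_h_int[of x] Z_h_int[of y] Z_nonneg[of y] A B xy L(2) by simp
  then have "Z x = L + Z y"
    using Z_nonneg[of y] Z_nonneg[of x] A B xy L(2) by (subst (asm) ennreal_inj) auto
  then have "Z x - Z y = L" by simp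
  then show ?thesis using local.direct_traj[of x y] A B xy by auto
qed

lemma direct_reach:
  assumes xy: "x \<in> I" "y \<in> I" "x \<le> y" and VD: "\<And>\<tau>. x \<le> \<tau> \<Longrightarrow> \<tau> \<le> y \<Longrightarrow> V \<tau> > D"
    and L: "h_int f D (ereal x) (ereal y) = ennreal L" "L \<ge> 0"
  shows "reach I f D L x y"
  using direct_traj[OF assms] unfolding reach_def by blast

text \<open>Only the left end has to be enlarged, since the trajectory turns at \<open>B\<close>.
  Finiteness of the enlarged passage comes from that of the given times.\<close>

lemma bounce_reach:
  assumes xy: "x \<in> I" "x \<le> y" "y \<le> B" "x < B" "B \<in> I" "V B = D"
    and VD: "\<And>\<tau>. x \<le> \<tau> \<Longrightarrow> \<tau> < B \<Longrightarrow> V \<tau> > D"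
    and L: "h_int f D (ereal x) (ereal B) + h_int f D (ereal y) (ereal B) = ennreal L" "L \<ge> 0"
  shows "reach I f D L x y"
proof -
  obtain A where A: "A \<in> I" "A < x" "\<And>\<tau>. A \<le> \<tau> \<Longrightarrow> \<tau> \<le> x \<Longrightarrow> V \<tau> > D"
    using extend_left[of x D] xy VD[of x] by auto
  have V: "V \<tau> > D" if "A \<le> \<tau>" "\<tau> < B" for \<tau>
    using A(3) VD that by (meson linear)
  have "h_int f D (ereal x) (ereal B) < \<infinity>"
    using L(1) by (metis ennreal_add_eq_top ennreal_neq_top infinity_ennreal_def less_top)
  moreover have "h_int f D (ereal A) (ereal x) < \<infinity>"
    using h_int_finite[of A x D] A xy by auto
  ultimately have "h_int f D (ereal A) (ereal B) < \<infinity>"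
    using h_int_add[of "ereal A" "ereal B" x D] xy A by (simp add: I_ereal less_imp_le)
  then interpret orbit a b f D A B
    by unfold_locales (use A V xy in \<open>auto intro: less_imp_le\<close>)
  have "ennreal (Z x + Z y) = ennreal L"
    using Z_h_int[of x] Z_h_int[of y] Z_nonneg[of y] Z_nonneg[of x] A xy L(1)
      ennreal_plus[of "Z x" "Z y"] by simp
  then have "Z x + Z y = L"
    using Z_nonneg[of y] Z_nonneg[of x] A xy L(2) by (subst (asm) ennreal_inj) auto
  then show ?thesis using local.bounce_reach[of x y] A xy by auto
qed

end

section \<open>Turning points and continuity of the travel times\<close>

context warped_interval begin

section \<open>Turning points\<close>

lemma V_IVT:
  assumes "x \<in> I" "y \<in> I" "x \<le> y" "V x > D" "V y \<le> D"
  obtains t where "x < t" "t \<le> y" "V t = D"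
proof -
  have "\<exists>t\<ge>x. t \<le> y \<and> V t = D"
    using assms by (intro IVT2' continuous_on_subset[OF V_cont I_sub[OF assms(1,2)]]) auto
  then obtain t where t: "x \<le> t" "t \<le> y" "V t = D" by blast
  then show ?thesis using that[of t] assms(4) by (cases "t = x") auto
qed

text \<open>For \<open>D < V e\<close> the point \<open>e\<close> is not a root itself, so the case
  distinction by the slope in \<open>b_star\<close> disappears. Compactness makes the infimum a
  minimum, and the intermediate value theorem keeps \<open>V\<close> above \<open>D\<close> before
  it.\<close>

lemma b_star_cases:
  assumes "e \<in> I" "D < V e"
  obtains (none) "b_star a b f e D = b" "\<And>\<tau>. \<tau> \<in> I \<Longrightarrow> e \<le> \<tau> \<Longrightarrow> V \<tau> > D"
  | (point) B where "B \<in> I" "e < B" "b_star a b f e D = ereal B" "V B = D"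
      "\<And>\<tau>. e \<le> \<tau> \<Longrightarrow> \<tau> < B \<Longrightarrow> V \<tau> > D"
proof -
  define S where "S = {\<tau>\<in>I. \<tau> \<ge> e \<and> V \<tau> = D}"
  have "e \<notin> S" using assms by (simp add: S_def)
  moreover have "ereal e \<noteq> b" using assms by (auto simp: I_ereal)
  ultimately have "ereal ` S \<union> {b} - {ereal e} = ereal ` S \<union> {b}" by auto
  then have bs: "b_star a b f e D = Inf (ereal ` S \<union> {b})"
    by (simp add: b_star_def A_plus_def S_def)
  show ?thesis
  proof (cases "S = {}")
    case True
    have "V \<tau> > D" if t: "\<tau> \<in> I" "e \<le> \<tau>" for \<tau>
    proof (rule ccontr)
      assume "\<not> V \<tau> > D"
      then obtain t' where t': "e < t'" "t' \<le> \<tau>" "V t' = D"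
        using V_IVT[OF assms(1) t(1,2) assms(2)] by auto
      then have "t' \<in> S" using I_between[OF assms(1) t(1), of t'] by (simp add: S_def)
      then show False using True by blast
    qed
    then show ?thesis using none bs True by simp
  next
    case False
    then obtain t where t: "t \<in> S" by blast
    then have tI: "t \<in> I" "e \<le> t" "V t = D" by (auto simp: S_def)
    define K where "K = {e..t} \<inter> V -` {D}"
    have "closed K" unfolding K_def
      by (rule continuous_closed_preimage[OF continuous_on_subset[OF V_cont I_sub[OF assms(1) tI(1)]]]) auto
    moreover have "bounded K" unfolding K_def by (rule bounded_subset[of "{e..t}"]) auto
    moreover have "t \<in> K" using tI by (simp add: K_def)
    ultimately obtain B where B: "B \<in> K" "\<And>x. x \<in> K \<Longrightarrow> B \<le> x"
      using compact_attains_inf[of K] compact_eq_bounded_closed by blast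
    have BI: "B \<in> I" using B(1) I_between[OF assms(1) tI(1), of B] by (simp add: K_def)
    have VB: "V B = D" "e \<le> B" "B \<le> t" using B(1) by (auto simp: K_def)
    have eB: "e < B" using VB assms(2) by (cases "e = B") auto
    have gt: "V \<tau> > D" if t: "e \<le> \<tau>" "\<tau> < B" for \<tau>
    proof (rule ccontr)
      assume "\<not> V \<tau> > D"
      moreover have "\<tau> \<in> I" using I_between[OF assms(1) BI, of \<tau>] t by simp
      ultimately obtain t' where t': "e < t'" "t' \<le> \<tau>" "V t' = D"
        using V_IVT[OF assms(1) _ t(1) assms(2)] by auto
      then have "t' \<in> K" using t VB by (simp add: K_def)
      from B(2)[OF this] show False using t' t by simp
    qed
    have "Inf (ereal ` S \<union> {b}) = ereal B"
    proof (rule antisym)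
      show "Inf (ereal ` S \<union> {b}) \<le> ereal B"
        using BI VB by (intro Inf_lower) (auto simp: S_def)
      show "ereal B \<le> Inf (ereal ` S \<union> {b})"
      proof (rule Inf_greatest)
        fix z assume "z \<in> ereal ` S \<union> {b}"
        then consider "z = b" | s where "s \<in> S" "z = ereal s" by blast
        then show "ereal B \<le> z"
        proof cases
          case 1 then show ?thesis using BI by (simp add: I_ereal less_imp_le)
        next
          case 2
          then have "\<not> s < B" using gt[of s] by (auto simp: S_def)
          then show ?thesis using 2 by simp
        qed
      qed
    qed
    then show ?thesis using point[OF BI eB _ VB(1) gt] bs by simp
  qed
qed

lemma b_star_le: "e \<in> I \<Longrightarrow> D < V e \<Longrightarrow> b_star a b f e D \<le> b"
  by (erule b_star_cases) (auto simp: I_ereal less_imp_le)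

lemma b_star_V:
  assumes "e \<in> I" "D < V e" "e \<le> \<tau>" "ereal \<tau> < b_star a b f e D"
  shows "\<tau> \<in> I" "V \<tau> > D"
  using assms(1,2)
proof (atomize(full), cases rule: b_star_cases)
  case none
  have "a < ereal \<tau>" using assms(1,3) less_le_trans[of a "ereal e" "ereal \<tau>"] by (simp add: I_ereal)
  then have "\<tau> \<in> I" using none(1) assms(4) by (simp add: I_ereal)
  then show "\<tau> \<in> I \<and> D < V \<tau>" using none(2) assms(3) by simp
next
  case (point B)
  then have "\<tau> < B" using assms(4) by simp
  then show "\<tau> \<in> I \<and> D < V \<tau>" using point(5)[OF assms(3)] I_between[OF assms(1) point(1) assms(3)] by simp
qed

lemma b_star_gt:
  assumes "e \<in> I" "t \<in> I" "e \<le> t" "\<And>\<tau>. e \<le> \<tau> \<Longrightarrow> \<tau> \<le> t \<Longrightarrow> V \<tau> > D"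
  shows "ereal t < b_star a b f e D"
proof -
  have "D < V e" using assms by auto
  with assms(1) show ?thesis
  proof (cases rule: b_star_cases)
    case none then show ?thesis using assms(2) by (simp add: I_ereal)
  next
    case (point B)
    then show ?thesis using assms(4)[of B] by fastforce
  qed
qed

lemma b_star_eqI:
  assumes "e \<in> I" "B \<in> I" "e < B" "V B = D" "\<And>\<tau>. e \<le> \<tau> \<Longrightarrow> \<tau> < B \<Longrightarrow> V \<tau> > D"
  shows "b_star a b f e D = ereal B"
proof -
  have "D < V e" using assms by auto
  with assms(1) show ?thesis
  proof (cases rule: b_star_cases)
    case none then show ?thesis using assms(2)[THEN none(2)] assms(3,4) by simp
  next
    case (point B')
    have "\<not> B' < B" using assms(5)[of B'] point by auto
    moreover have "\<not> B < B'" using point(5)[of B] assms by auto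
    ultimately show ?thesis using point(3) by simp
  qed
qed

lemma b_star_eqI_b:
  assumes "e \<in> I" "\<And>\<tau>. \<tau> \<in> I \<Longrightarrow> e \<le> \<tau> \<Longrightarrow> V \<tau> > D"
  shows "b_star a b f e D = b"
proof -
  have "D < V e" using assms by auto
  with assms(1) show ?thesis
  proof (cases rule: b_star_cases)
    case (point B)
    then show ?thesis using assms(2)[of B] by auto
  qed
qed

text \<open>Base points in the same component of the set where \<open>V > D\<close> see the same
  turning point.\<close>

lemma b_star_base_change:
  assumes "e \<in> I" "e' \<in> I" "e \<le> e'" "\<And>\<tau>. e \<le> \<tau> \<Longrightarrow> \<tau> \<le> e' \<Longrightarrow> V \<tau> > D"
  shows "b_star a b f e' D = b_star a b f e D"
proof -
  have "D < V e'" using assms by auto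
  with assms(2) show ?thesis
  proof (cases rule: b_star_cases)
    case none
    have "b_star a b f e D = b"
      by (rule b_star_eqI_b[OF assms(1)]) (metis assms(4) none(2) linear)
    then show ?thesis using none by simp
  next
    case (point B)
    have "b_star a b f e D = ereal B"
    proof (rule b_star_eqI[OF assms(1) point(1) _ point(4)])
      show "e < B" using point(2) assms(3) by simp
      show "V \<tau> > D" if "e \<le> \<tau>" "\<tau> < B" for \<tau>
        using that assms(4)[of \<tau>] point(5)[of \<tau>] by (cases "\<tau> \<le> e'") auto
    qed
    then show ?thesis using point by simp
  qed
qed

text \<open>Near a critical point \<open>c\<close> at level \<open>D\<close> the integrand behaves like \<open>1 / (c - \<tau>)\<close>.\<close>

lemma crit_left:
  assumes "x \<in> I" "c \<in> I" "x < c" "V c = D" "deriv V c = 0"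
    and ge: "\<And>\<tau>. x \<le> \<tau> \<Longrightarrow> \<tau> \<le> c \<Longrightarrow> V \<tau> \<ge> D" and "D0 < D"
  obtains D' where "D0 < D'" "D' < D" "h_int f D' (ereal x) (ereal c) > ennreal y"
proof -
  define k where "k = deriv (deriv V) c"
  have Dp: "D > 0" using V_pos[OF assms(2)] assms(4) by simp
  have "(deriv V has_derivative (\<lambda>h. h * k)) (at c)"
    using dV_DERIV[OF assms(2)] by (simp add: has_field_derivative_def k_def mult.commute[of _ "deriv (deriv V) c"])
  then obtain d where d: "d > 0" "\<And>t. norm (t - c) < d \<Longrightarrow>
      norm (deriv V t - deriv V c - (t - c) * k) \<le> 1 * norm (t - c)"
    unfolding has_derivative_at_alt by (metis zero_less_one)
  define \<delta> where "\<delta> = min (d / 2) (c - x)"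
  have \<delta>: "0 < \<delta>" "\<delta> < d" "x \<le> c - \<delta>" using d(1) assms(3) by (auto simp: \<delta>_def)
  have dV: "\<bar>deriv V t\<bar> \<le> (\<bar>k\<bar> + 1) * (c - t)" if "c - \<delta> \<le> t" "t \<le> c" for t
  proof -
    have "\<bar>deriv V t - (t - c) * k\<bar> \<le> c - t"
      using d(2)[of t] that \<delta>(2) assms(5) by simp
    moreover have "\<bar>(t - c) * k\<bar> = (c - t) * \<bar>k\<bar>" using that by (simp add: abs_mult)
    ultimately show ?thesis by (simp add: algebra_simps)
  qed
  \<comment> \<open>Since \<open>c\<close> is critical, \<open>V - D\<close> is at most quadratic in
    the distance to \<open>c\<close>.\<close>
  have Vle: "V t - D \<le> (\<bar>k\<bar> + 1) * (c - t)\<^sup>2" if t: "c - \<delta> \<le> t" "t \<le> c" for t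
  proof (cases "t = c")
    case False
    then have "t < c" using t by simp
    have "\<exists>z>t. z < c \<and> V c - V t = (c - t) * deriv V z"
    proof (rule MVT2[OF \<open>t < c\<close>])
      fix s assume "t \<le> s" "s \<le> c"
      then show "(V has_real_derivative deriv V s) (at s)"
        using V_DERIV[of s] I_between[OF assms(1,2), of s] t \<delta> by simp
    qed
    then obtain z where z: "t < z" "z < c" "V c - V t = (c - t) * deriv V z" by blast
    have "\<bar>deriv V z\<bar> \<le> (\<bar>k\<bar> + 1) * (c - z)" using dV[of z] z t by simp
    also have "\<dots> \<le> (\<bar>k\<bar> + 1) * (c - t)" using z by (intro mult_left_mono) auto
    finally have "- deriv V z \<le> (\<bar>k\<bar> + 1) * (c - t)" by linarith
    from mult_left_mono[OF this, of "c - t"] have "(c - t) * (- deriv V z) \<le> (c - t) * ((\<bar>k\<bar> + 1) * (c - t))"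
      using t by simp
    then show ?thesis using z(3) assms(4) by (simp add: power2_eq_square algebra_simps)
  qed (use assms(4) in simp)
  define K where "K = \<bar>k\<bar> + 2"
  have K: "K > 0" by (simp add: K_def)
  define Q where "Q = D / sqrt K"
  have Q: "Q > 0" using Dp K by (simp add: Q_def)
  \<comment> \<open>The first bound lets the logarithmic integral of \<open>Q / (c - \<tau>)\<close>
    over \<open>{c - \<delta>..c - s}\<close> exceed \<open>y\<close>, the second keeps the new
    level above \<open>D0\<close>. Down to distance \<open>s\<close> from \<open>c\<close>, lowering
    the level by \<open>s\<^sup>2\<close> is absorbed by the extra 1 in \<open>K\<close>.\<close>
  define s where "s = min (\<delta> * exp (- ((\<bar>y\<bar> + 1) / Q))) (sqrt ((D - D0) / 2))"
  have s: "0 < s" "s \<le> \<delta> * exp (- ((\<bar>y\<bar> + 1) / Q))" "s \<le> sqrt ((D - D0) / 2)"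
    using \<delta> assms(7) by (auto simp: s_def)
  have "- ((\<bar>y\<bar> + 1) / Q) \<le> 0" using Q by simp
  then have "exp (- ((\<bar>y\<bar> + 1) / Q)) \<le> 1" by (simp only: exp_le_one_iff)
  then have s\<delta>: "s \<le> \<delta>" using s(2) \<delta>(1) mult_left_le[of "exp (- ((\<bar>y\<bar> + 1) / Q))" \<delta>] by linarith
  have "s\<^sup>2 \<le> (sqrt ((D - D0) / 2))\<^sup>2" using s by (intro power_mono) auto
  then have s2: "s\<^sup>2 \<le> (D - D0) / 2" using assms(7) by simp
  define D' where "D' = D - s\<^sup>2"
  have D': "D0 < D'" "D' < D" using s2 s(1) assms(7) unfolding D'_def by (simp_all add: field_simps)
  have lower: "Q / (c - \<tau>) \<le> h D' \<tau>" if t: "c - \<delta> \<le> \<tau>" "\<tau> \<le> c - s" for \<tau>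
  proof -
    have tc: "\<tau> < c" using t s(1) by simp
    have "s\<^sup>2 \<le> (c - \<tau>)\<^sup>2" using t s(1) by (intro power_mono) auto
    then have "V \<tau> - D' \<le> K * (c - \<tau>)\<^sup>2"
      using Vle[of \<tau>] t tc unfolding D'_def K_def by (simp add: algebra_simps)
    then have "sqrt (V \<tau> - D') \<le> sqrt (K * (c - \<tau>)\<^sup>2)" by simp
    also have "\<dots> = sqrt K * (c - \<tau>)" using tc by (simp add: real_sqrt_mult)
    finally have 1: "sqrt (V \<tau> - D') \<le> sqrt K * (c - \<tau>)" .
    have 2: "V \<tau> \<ge> D" using ge[of \<tau>] t \<delta> tc by simp
    then have 3: "sqrt (V \<tau> - D') > 0" using D'(2) by simp
    have "Q / (c - \<tau>) = D / (sqrt K * (c - \<tau>))" by (simp add: Q_def)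
    also have "\<dots> \<le> V \<tau> / sqrt (V \<tau> - D')"
      using 1 2 3 Dp tc K by (intro frac_le) auto
    finally show ?thesis unfolding h_eq .
  qed
  have "ennreal y < ennreal (\<bar>y\<bar> + 1)" by (rule ennreal_lessI) auto
  also have "\<bar>y\<bar> + 1 \<le> Q * (ln \<delta> - ln s)"
  proof -
    have "ln s \<le> ln (\<delta> * exp (- ((\<bar>y\<bar> + 1) / Q)))" using s \<delta> by simp
    also have "\<dots> = ln \<delta> - (\<bar>y\<bar> + 1) / Q" using \<delta> by (simp add: ln_mult)
    finally have "(\<bar>y\<bar> + 1) / Q \<le> ln \<delta> - ln s" by simp
    then show ?thesis using Q by (simp add: field_simps)
  qed
  then have "ennreal (\<bar>y\<bar> + 1) \<le> ennreal (Q * (ln \<delta> - ln s))" by (rule ennreal_leI)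
  also have "ennreal (Q * (ln \<delta> - ln s)) = (\<integral>\<^sup>+\<tau>. ennreal (Q / (c - \<tau>)) * indicator {c - \<delta>..c - s} \<tau> \<partial>lborel)"
  proof -
    have "(\<integral>\<^sup>+\<tau>. ennreal (Q / (c - \<tau>)) * indicator {c - \<delta>..c - s} \<tau> \<partial>lborel)
      = ennreal (- Q * ln (c - (c - s)) - (- Q * ln (c - (c - \<delta>))))"
    proof (rule nn_integral_FTC_Icc)
      fix \<tau> assume t: "\<tau> \<in> {c - \<delta>..c - s}"
      then have tc: "c - \<tau> > 0" using s(1) by simp
      then show "((\<lambda>\<tau>. - Q * ln (c - \<tau>)) has_real_derivative Q / (c - \<tau>)) (at \<tau>)"
        by (auto intro!: derivative_eq_intros simp: field_simps)
      show "0 \<le> Q / (c - \<tau>)" using tc Q by simp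
    qed (use s\<delta> in auto)
    then show ?thesis by (simp add: algebra_simps)
  qed
  also have "\<dots> \<le> h_int f D' (ereal x) (ereal c)"
    unfolding h_int_def interval_I_real
  proof (rule nn_integral_mono_AE)
    have "AE \<tau> in lborel. \<tau> \<noteq> c - \<delta>" by (rule AE_lborel_singleton)
    then show "AE \<tau> in lborel. ennreal (Q / (c - \<tau>)) * indicator {c - \<delta>..c - s} \<tau> \<le> ennreal (h D' \<tau>) * indicator {x<..<c} \<tau>"
    proof eventually_elim
      case (elim \<tau>)
      show ?case
      proof (cases "\<tau> \<in> {c - \<delta>..c - s}")
        case True
        then have "\<tau> \<in> {x<..<c}" using elim \<delta>(3) s(1) by auto
        then show ?thesis using True lower[of \<tau>] by (auto intro: ennreal_leI)
      qed simp
    qed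
  qed
  finally show ?thesis using that D' by blast
qed

text \<open>A zero slope would make the times at slightly lower levels arbitrarily large by
  \<open>crit_left\<close>, although they are bounded by the finite time at level \<open>D\<close>.
  A positive slope would produce values below \<open>D\<close> just to the left of
  \<open>B\<close>.\<close>

lemma nondegenerate:
  assumes "e \<in> I" "B \<in> I" "e < B" "V B = D" "\<And>\<tau>. e \<le> \<tau> \<Longrightarrow> \<tau> < B \<Longrightarrow> V \<tau> > D"
    and fin: "h_int f D (ereal e) (ereal B) < \<infinity>"
  shows "deriv V B < 0"
proof (rule ccontr)
  assume "\<not> deriv V B < 0"
  moreover have "\<not> deriv V B > 0"
  proof
    assume "deriv V B > 0"
    then obtain d where d: "d > 0" "\<And>h. h > 0 \<Longrightarrow> h < d \<Longrightarrow> V (B - h) < V B"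
      using DERIV_pos_inc_left[OF V_DERIV[OF assms(2)]] by blast
    define k where "k = min (d / 2) (B - e)"
    have "V (B - k) < V B" using d assms(3) by (intro d(2)) (auto simp: k_def)
    moreover have "V (B - k) > D" using d assms(3) by (intro assms(5)) (auto simp: k_def)
    ultimately show False using assms(4) by simp
  qed
  ultimately have 0: "deriv V B = 0" by simp
  obtain y where y: "h_int f D (ereal e) (ereal B) = ennreal y" "y \<ge> 0"
    using fin by (cases "h_int f D (ereal e) (ereal B)" rule: ennreal_cases) auto
  have "V \<tau> \<ge> D" if "e \<le> \<tau>" "\<tau> \<le> B" for \<tau>
    using assms(4) assms(5)[of \<tau>] that by (cases "\<tau> = B") (auto intro: less_imp_le)
  then obtain D' where D': "D - 1 < D'" "D' < D" "h_int f D' (ereal e) (ereal B) > ennreal y"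
    using crit_left[OF assms(1,2,3,4) 0, of "D - 1" y] by auto
  moreover have "h_int f D' (ereal e) (ereal B) \<le> h_int f D (ereal e) (ereal B)"
    using D' assms(5) by (intro h_int_mono_D) (auto simp: interval_I_real)
  ultimately show False using y by simp
qed

text \<open>The filter is one-sided because for \<open>D0 = D1\<close> the potential may equal the
  level at the end points. Fatou's lemma gives the lower half. The upper half is monotonicity in the
  level for \<open>D0 = D1\<close> and a uniform comparison of integrands otherwise.\<close>

lemma h_int_tendsto:
  assumes "x \<in> I" "y \<in> I" "x \<le> y" "\<And>\<tau>. x < \<tau> \<Longrightarrow> \<tau> < y \<Longrightarrow> V \<tau> > D1" "D0 \<le> D1"
  shows "((\<lambda>D. h_int f D (ereal x) (ereal y)) \<longlongrightarrow> h_int f D0 (ereal x) (ereal y)) (at D0 within {..D1})"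
proof (rule order_tendstoI)
  fix z assume z: "z < h_int f D0 (ereal x) (ereal y)"
  show "eventually (\<lambda>D. z < h_int f D (ereal x) (ereal y)) (at D0 within {..D1})"
  proof (rule sequentially_imp_eventually_within, intro allI impI)
    fix X assume X: "(\<forall>n. X n \<in> {..D1} \<and> X n \<noteq> D0) \<and> X \<longlonglongrightarrow> D0"
    let ?g = "\<lambda>n \<tau>. ennreal (h (X n) \<tau>) * indicator {x<..<y} \<tau>"
    have lim: "(\<lambda>n. ?g n \<tau>) \<longlonglongrightarrow> ennreal (h D0 \<tau>) * indicator {x<..<y} \<tau>" for \<tau>
    proof (cases "\<tau> \<in> {x<..<y}")
      case True
      then have "V \<tau> > D0" using assms(4)[of \<tau>] assms(5) by simp
      then have "(\<lambda>n. h (X n) \<tau>) \<longlonglongrightarrow> h D0 \<tau>" using X by (intro tendsto_intros) auto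
      then show ?thesis using True by (simp add: tendsto_ennrealI)
    qed simp
    have "h_int f D0 (ereal x) (ereal y) = (\<integral>\<^sup>+\<tau>. liminf (\<lambda>n. ?g n \<tau>) \<partial>lborel)"
      unfolding h_int_def interval_I_real using lim_imp_Liminf[OF _ lim] by simp
    also have "\<dots> \<le> liminf (\<lambda>n. integral\<^sup>N lborel (?g n))"
    proof (rule nn_integral_liminf)
      show "?g n \<in> borel_measurable lborel" for n
        using h_meas_ennreal[of "ereal x" "ereal y" "X n"] assms(1,2) by (simp add: interval_I_real I_ereal less_imp_le)
    qed
    finally have "z < liminf (\<lambda>n. h_int f (X n) (ereal x) (ereal y))"
      using z by (simp add: h_int_def interval_I_real)
    then show "eventually (\<lambda>n. z < h_int f (X n) (ereal x) (ereal y)) sequentially"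
      by (rule less_LiminfD)
  qed
next
  fix z assume z: "h_int f D0 (ereal x) (ereal y) < z"
  have mono: "h_int f D (ereal x) (ereal y) \<le> h_int f D0 (ereal x) (ereal y)" if "D \<le> D0" for D
    using that assms(4,5) by (intro h_int_mono_D) (auto simp: interval_I_real less_le_trans le_less_trans)
  show "eventually (\<lambda>D. h_int f D (ereal x) (ereal y) < z) (at D0 within {..D1})"
  proof (cases "D0 = D1")
    case True
    have "h_int f D (ereal x) (ereal y) < z" if "D \<in> {..D1}" for D
      using mono[of D] z that True by (auto intro: le_less_trans)
    then show ?thesis by (auto simp: eventually_at_filter)
  next
    case False
    then have D01: "D0 < D1" using assms(5) by simp
    \<comment> \<open>\<kappa> is half the gap between the level and the potential. For
      \<open>D \<le> D0 + \<kappa>\<close> the integrand at level \<open>D\<close> is at most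
      \<open>q D\<close> times the one at \<open>D0\<close>, and \<open>q D\<close> tends to
      1.\<close>
    define \<kappa> where "\<kappa> = (D1 - D0) / 2"
    have \<kappa>: "\<kappa> > 0" using D01 by (simp add: \<kappa>_def)
    define q where "q D = sqrt (1 + \<bar>D - D0\<bar> / \<kappa>)" for D
    have le: "h_int f D (ereal x) (ereal y) \<le> ennreal (q D) * h_int f D0 (ereal x) (ereal y)" if D: "D \<le> D0 + \<kappa>" for D
    proof -
      have "h_int f D (ereal x) (ereal y) \<le> (\<integral>\<^sup>+\<tau>. ennreal (q D) * (ennreal (h D0 \<tau>) * indicator {x<..<y} \<tau>) \<partial>lborel)"
        unfolding h_int_def interval_I_real
      proof (rule nn_integral_mono)
        fix \<tau>
        show "ennreal (h D \<tau>) * indicator {x<..<y} \<tau> \<le> ennreal (q D) * (ennreal (h D0 \<tau>) * indicator {x<..<y} \<tau>)"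
        proof (cases "\<tau> \<in> {x<..<y}")
          case True
          then have V1: "V \<tau> > D1" using assms(4)[of \<tau>] by simp
          then have V0: "V \<tau> > D0" using D01 by simp
          have VD: "V \<tau> - D > \<kappa>" using V1 D by (simp add: \<kappa>_def field_simps)
          have Vp: "V \<tau> > 0" using True I_between[OF assms(1,2), of \<tau>] V_pos by simp
          have "(V \<tau> - D0) \<le> (1 + \<bar>D - D0\<bar> / \<kappa>) * (V \<tau> - D)"
          proof -
            have "\<bar>D - D0\<bar> * \<kappa> \<le> \<bar>D - D0\<bar> * (V \<tau> - D)" using VD by (intro mult_left_mono) auto
            then have "\<bar>D - D0\<bar> \<le> \<bar>D - D0\<bar> / \<kappa> * (V \<tau> - D)" using \<kappa> by (simp add: field_simps)
            then show ?thesis by (simp add: ring_distribs)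
          qed
          then have "sqrt (V \<tau> - D0) \<le> q D * sqrt (V \<tau> - D)"
            unfolding q_def real_sqrt_mult[symmetric] by simp
          then have "V \<tau> * sqrt (V \<tau> - D0) \<le> V \<tau> * (q D * sqrt (V \<tau> - D))" using Vp by simp
          then have "V \<tau> / sqrt (V \<tau> - D) \<le> q D * (V \<tau> / sqrt (V \<tau> - D0))"
            using V0 VD \<kappa> by (simp add: field_simps)
          then have "h D \<tau> \<le> q D * h D0 \<tau>" unfolding h_eq .
          then have "ennreal (h D \<tau>) \<le> ennreal (q D) * ennreal (h D0 \<tau>)"
            using V0 \<kappa> by (subst ennreal_mult[symmetric]) (auto intro: ennreal_leI simp: q_def)
          then show ?thesis using True by simp
        qed simp
      qed
      also have "\<dots> = ennreal (q D) * h_int f D0 (ereal x) (ereal y)"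
        using h_meas_ennreal[of "ereal x" "ereal y" D0] assms(1,2)
        by (subst nn_integral_cmult) (auto simp: interval_I_real I_ereal h_int_def)
      finally show ?thesis .
    qed
    have "h_int f D0 (ereal x) (ereal y) < \<infinity>" using z by (metis infinity_ennreal_def less_le_trans top_greatest)
    then obtain H where H: "h_int f D0 (ereal x) (ereal y) = ennreal H" "H \<ge> 0"
      by (cases "h_int f D0 (ereal x) (ereal y)" rule: ennreal_cases) auto
    have "((\<lambda>D. q D * H) \<longlongrightarrow> q D0 * H) (at D0 within {..D1})"
      unfolding q_def using \<kappa> by (intro tendsto_intros) auto
    then have "((\<lambda>D. ennreal (q D * H)) \<longlongrightarrow> ennreal H) (at D0 within {..D1})"
      by (intro tendsto_ennrealI) (simp add: q_def)
    then have 1: "eventually (\<lambda>D. ennreal (q D * H) < z) (at D0 within {..D1})"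
      using z H by (intro order_tendstoD) auto
    have 2: "eventually (\<lambda>D. D < D0 + \<kappa>) (at D0 within {..D1})"
      using \<kappa> by (intro order_tendstoD[OF tendsto_ident_at]) simp
    show ?thesis using 1 2
    proof eventually_elim
      case (elim D)
      have "h_int f D (ereal x) (ereal y) \<le> ennreal (q D * H)"
        using le[of D] elim(2) H \<kappa> by (simp add: ennreal_mult q_def)
      then show ?case using elim(1) by (rule le_less_trans)
    qed
  qed
qed

lemma V_min:
  assumes "x \<in> I" "y \<in> I" "x \<le> y" "\<And>\<tau>. x \<le> \<tau> \<Longrightarrow> \<tau> \<le> y \<Longrightarrow> V \<tau> > D"
  obtains D1 where "D < D1" "\<And>\<tau>. x \<le> \<tau> \<Longrightarrow> \<tau> \<le> y \<Longrightarrow> V \<tau> > D1"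
proof -
  obtain t where t: "t \<in> {x..y}" "\<And>s. s \<in> {x..y} \<Longrightarrow> V t \<le> V s"
    using continuous_attains_inf[of "{x..y}" V] continuous_on_subset[OF V_cont I_sub[OF assms(1,2)]] assms(3)
    by auto
  have "V t > D" using t(1) assms(4) by simp
  show ?thesis
  proof (rule that[of "(D + V t) / 2"])
    fix s assume "x \<le> s" "s \<le> y"
    then show "(D + V t) / 2 < V s" using t(2)[of s] \<open>V t > D\<close> by simp
  qed (use \<open>V t > D\<close> in simp)
qed

lemma at_within_Iic: "(D::real) < D1 \<Longrightarrow> at D within {..D1} = at D"
  by (rule at_within_interior) simp

lemma h_int_tendsto_at:
  assumes "x \<in> I" "y \<in> I" "x \<le> y" "\<And>\<tau>. x \<le> \<tau> \<Longrightarrow> \<tau> \<le> y \<Longrightarrow> V \<tau> > D0"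
  shows "((\<lambda>D. h_int f D (ereal x) (ereal y)) \<longlongrightarrow> h_int f D0 (ereal x) (ereal y)) (at D0)"
proof -
  obtain D1 where D1: "D0 < D1" "\<And>\<tau>. x \<le> \<tau> \<Longrightarrow> \<tau> \<le> y \<Longrightarrow> V \<tau> > D1"
    using V_min[of x y D0] assms by metis
  show ?thesis using h_int_tendsto[OF assms(1,2,3), of D1 D0] D1 at_within_Iic[OF D1(1)] by simp
qed

text \<open>Travel time to the next turning point on the right, or to \<open>b\<close> if there is
  none.\<close>

definition rho :: "real \<Rightarrow> real \<Rightarrow> ennreal" where
  "rho e D = h_int f D (ereal e) (b_star a b f e D)"

text \<open>A piece that stops before the turning point and already takes more than \<open>z\<close>
  survives a small change of the level. This covers degenerate and missing turning points.\<close>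

lemma rho_lower:
  assumes "e \<in> I" "D0 < V e" "z < rho e D0"
  shows "eventually (\<lambda>D. z < rho e D) (at D0)"
proof -
  have eb: "ereal e < b_star a b f e D0" using b_star_gt[OF assms(1,1)] assms(2) by fastforce
  obtain t where t: "ereal e < ereal t" "ereal t < b_star a b f e D0" "z < h_int f D0 (ereal e) (ereal t)"
    using h_int_less_approx[OF _ b_star_le[OF assms(1,2)] eb assms(3)[unfolded rho_def]] assms(1)
    by (auto simp: I_ereal less_imp_le)
  have tI: "t \<in> I" using b_star_V(1)[OF assms(1,2) _ t(2)] t(1) by simp
  have V: "V \<tau> > D0" if "e \<le> \<tau>" "\<tau> \<le> t" for \<tau>
    using b_star_V(2)[OF assms(1,2) that(1)] t(2) that(2) by (meson ereal_less_eq(3) le_less_trans)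
  obtain D1 where D1: "D0 < D1" "\<And>\<tau>. e \<le> \<tau> \<Longrightarrow> \<tau> \<le> t \<Longrightarrow> V \<tau> > D1"
    using V_min[OF assms(1) tI _ V] t(1) by auto
  have "eventually (\<lambda>D. z < h_int f D (ereal e) (ereal t)) (at D0)"
    using order_tendstoD(1)[OF h_int_tendsto_at[OF assms(1) tI _ V] t(3)] t(1) by simp
  moreover have "eventually (\<lambda>D. D < D1) (at D0)"
    using order_tendstoD(2)[OF tendsto_ident_at D1(1)] .
  ultimately show ?thesis
  proof eventually_elim
    case (elim D)
    have "ereal t < b_star a b f e D"
      by (rule b_star_gt[OF assms(1) tI]) (use t(1) D1(2) elim(2) in \<open>auto intro: less_trans\<close>)
    then have "h_int f D (ereal e) (ereal t) \<le> rho e D"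
      unfolding rho_def by (intro h_int_mono) auto
    then show ?case using elim(1) by (rule less_le_trans[rotated])
  qed
qed

text \<open>At a nondegenerate turning point the square root singularity is integrable, uniformly in the level.\<close>

lemma turning_small:
  assumes "B \<in> I" "deriv V B < 0" "\<epsilon> > 0" "\<eta> > 0"
  obtains \<delta> where "\<delta> > 0" "\<delta> < \<eta>" "B - \<delta> \<in> I" "B + \<delta> \<in> I"
    "\<And>s t. B - \<delta> \<le> s \<Longrightarrow> s < t \<Longrightarrow> t \<le> B + \<delta> \<Longrightarrow> V t < V s"
    "\<And>s t. B - \<delta> \<le> s \<Longrightarrow> s \<le> t \<Longrightarrow> t \<le> B + \<delta> \<Longrightarrow> h_int f (V t) (ereal s) (ereal t) \<le> ennreal \<epsilon>"
proof -
  define \<kappa> where "\<kappa> = - deriv V B / 2"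
  have \<kappa>: "\<kappa> > 0" using assms(2) by (simp add: \<kappa>_def)
  have Dev: "\<forall>\<^sub>F \<tau> in at B. deriv V \<tau> < - \<kappa>"
  proof -
    have "isCont (deriv V) B" using dV_DERIV[OF assms(1)] DERIV_isCont by blast
    then have "(deriv V \<longlongrightarrow> deriv V B) (at B)" by (simp add: isCont_def)
    moreover have "deriv V B < - \<kappa>" using assms(2) by (simp add: \<kappa>_def)
    ultimately show ?thesis by (rule order_tendstoD(2))
  qed
  define C where "C = V B + 1"
  have C: "C > 0" using V_pos[OF assms(1)] by (simp add: C_def)
  have Vev: "\<forall>\<^sub>F \<tau> in at B. V \<tau> < C"
    using V_isCont[OF assms(1)] unfolding isCont_def C_def by (intro order_tendstoD) auto
  have Iev: "\<forall>\<^sub>F \<tau> in at B. \<tau> \<in> I" using I_open assms(1) by (rule eventually_at_in_open')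
  obtain d where d: "d > 0" "\<And>\<tau>. \<tau> \<noteq> B \<Longrightarrow> dist \<tau> B < d \<Longrightarrow> deriv V \<tau> < - \<kappa> \<and> V \<tau> < C \<and> \<tau> \<in> I"
    using eventually_conj[OF Dev eventually_conj[OF Vev Iev]] unfolding eventually_at by auto
  \<comment> \<open>Chosen so that the majorant \<open>C / S / sqrt (t - \<tau>)\<close> with
    \<open>S = sqrt \<kappa>\<close> integrates to at most \<epsilon> over an interval of length
    \<open>2 * \<delta>\<close>.\<close>
  define R where "R = ((\<epsilon> * sqrt \<kappa>) / (2 * C))\<^sup>2"
  have R: "R > 0" unfolding R_def using assms(3) \<kappa> C by (intro zero_less_power divide_pos_pos) auto
  define \<delta> where "\<delta> = min (min (d / 2) (\<eta> / 2)) (R / 2)"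
  have \<delta>': "\<delta> \<le> d / 2" "\<delta> \<le> \<eta> / 2" "\<delta> \<le> R / 2"
    unfolding \<delta>_def
    by (rule min.coboundedI1[OF min.cobounded1], rule min.coboundedI1[OF min.cobounded2], rule min.cobounded2)
  have "\<delta> > 0" unfolding \<delta>_def using d(1) assms(4) R by simp
  moreover have "\<delta> < d" using \<delta>'(1) d(1) by linarith
  moreover have "\<delta> < \<eta>" using \<delta>'(2) assms(4) by linarith
  moreover have "2 * \<delta> \<le> R" using \<delta>'(3) by simp
  ultimately have \<delta>: "\<delta> > 0" "\<delta> < d" "\<delta> < \<eta>" "2 * \<delta> \<le> R" by auto
  have near: "deriv V \<tau> \<le> - \<kappa> \<and> V \<tau> \<le> C \<and> \<tau> \<in> I" if "B - \<delta> \<le> \<tau>" "\<tau> \<le> B + \<delta>" for \<tau>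
  proof (cases "\<tau> = B")
    case True then show ?thesis using \<kappa> assms(1) by (simp add: C_def \<kappa>_def)
  next
    case False
    have "dist \<tau> B < d" using that \<delta>(2) by (auto simp: dist_real_def abs_if)
    then show ?thesis using d(2)[OF False] by simp
  qed
  have MV: "\<kappa> * (t - s) \<le> V s - V t" if "B - \<delta> \<le> s" "s < t" "t \<le> B + \<delta>" for s t
  proof -
    have "\<exists>z>s. z < t \<and> V t - V s = (t - s) * deriv V z"
      by (rule MVT2[OF that(2)]) (use near that in \<open>auto intro!: V_DERIV\<close>)
    then obtain w where w: "s < w" "w < t" "V t - V s = (t - s) * deriv V w" by blast
    have "(t - s) * \<kappa> \<le> (t - s) * (- deriv V w)"
      using near[of w] w that by (intro mult_left_mono) auto
    then show ?thesis using w(3) by (simp add: mult.commute)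
  qed
  show ?thesis
  proof (rule that[OF \<delta>(1,3)])
    show "B - \<delta> \<in> I" "B + \<delta> \<in> I" using near \<delta>(1) by auto
    show "V t < V s" if "B - \<delta> \<le> s" "s < t" "t \<le> B + \<delta>" for s t
    proof -
      have "0 < \<kappa> * (t - s)" using \<kappa> that(2) by simp
      then show ?thesis using MV[OF that] by linarith
    qed
    show "h_int f (V t) (ereal s) (ereal t) \<le> ennreal \<epsilon>" if st: "B - \<delta> \<le> s" "s \<le> t" "t \<le> B + \<delta>" for s t
    proof -
      define S where "S = sqrt \<kappa>"
      have S: "S > 0" using \<kappa> by (simp add: S_def)
      let ?F = "\<lambda>\<tau>. - (2 * C / S) * sqrt (t - \<tau>)"
      have hle: "h (V t) \<tau> \<le> C / S / sqrt (t - \<tau>)" if "s < \<tau>" "\<tau> < t" for \<tau>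
      proof -
        have "\<kappa> * (t - \<tau>) \<le> V \<tau> - V t" using MV[of \<tau> t] that st by simp
        then have "sqrt \<kappa> * sqrt (t - \<tau>) \<le> sqrt (V \<tau> - V t)" by (simp add: real_sqrt_mult[symmetric])
        then have "V \<tau> / sqrt (V \<tau> - V t) \<le> C / (sqrt \<kappa> * sqrt (t - \<tau>))"
          using near[of \<tau>] that st \<kappa> C by (intro frac_le) auto
        then show ?thesis unfolding h_eq S_def by simp
      qed
      have int: "((\<lambda>\<tau>. C / S / sqrt (t - \<tau>)) has_integral ?F t - ?F s) {s..t}"
      proof (rule fundamental_theorem_of_calculus_interior)
        show "continuous_on {s..t} ?F" by (intro continuous_intros)
        fix \<tau> assume t: "\<tau> \<in> {s<..<t}"
        then have "t - \<tau> > 0" by simp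
        then have "(?F has_real_derivative C / S / sqrt (t - \<tau>)) (at \<tau>)"
          using S by (auto intro!: derivative_eq_intros simp: field_simps)
        then show "(?F has_vector_derivative C / S / sqrt (t - \<tau>)) (at \<tau>)"
          by (simp add: has_real_derivative_iff_has_vector_derivative)
      qed (use st in simp)
      have "h_int f (V t) (ereal s) (ereal t) \<le>
        (\<integral>\<^sup>+\<tau>. ennreal (C / S / sqrt (t - \<tau>)) * indicator {s..t} \<tau> \<partial>lborel)"
        unfolding h_int_def interval_I_real
        by (rule nn_integral_mono) (use hle in \<open>auto simp: indicator_def intro: ennreal_leI\<close>)
      also have "\<dots> = ennreal (?F t - ?F s)"
        by (rule nn_integral_has_integral_lebesgue'[OF _ int]) (use C S in auto)
      also have "?F t - ?F s \<le> \<epsilon>"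
      proof -
        have "sqrt (t - s) \<le> sqrt (2 * \<delta>)" using st by simp
        also have "\<dots> \<le> sqrt R" using \<delta>(4) by (rule real_sqrt_le_mono)
        also have "\<dots> = (\<epsilon> * sqrt \<kappa>) / (2 * C)" unfolding R_def using assms(3) \<kappa> C by simp
        finally have "sqrt (t - s) \<le> (\<epsilon> * S) / (2 * C)" by (simp add: S_def)
        from mult_left_mono[OF this, of "2 * C / S"] show ?thesis using S C by simp
      qed
      then have "ennreal (?F t - ?F s) \<le> ennreal \<epsilon>" by (rule ennreal_leI)
      finally show ?thesis .
    qed
  qed
qed

text \<open>The strict bound makes the time finite and hence the turning point \<open>B\<close>
  nondegenerate. Nearby levels then turn within \<delta> of \<open>B\<close>, and the piece beyond
  \<open>B - \<delta>\<close> costs at most \<epsilon>.\<close>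

lemma rho_upper:
  assumes "e \<in> I" "D0 < V e" "b_star a b f e D0 < b" "rho e D0 < z"
  shows "eventually (\<lambda>D. rho e D < z) (at D0)"
proof -
  obtain B where B: "B \<in> I" "e < B" "b_star a b f e D0 = ereal B" "V B = D0"
      "\<And>\<tau>. e \<le> \<tau> \<Longrightarrow> \<tau> < B \<Longrightarrow> V \<tau> > D0"
    using assms(1,2) by (cases rule: b_star_cases) (use assms(3) in auto)
  have fin: "rho e D0 < \<infinity>" using assms(4) by (metis infinity_ennreal_def less_le_trans top_greatest)
  have dB: "deriv V B < 0"
    using nondegenerate[OF assms(1) B(1,2,4,5)] fin B(3) by (simp add: rho_def)
  obtain H where H: "rho e D0 = ennreal H" "H \<ge> 0" using fin by (cases "rho e D0" rule: ennreal_cases) auto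
  obtain z' where z': "H < z'" "ennreal z' \<le> z" 
  proof (cases z rule: ennreal_cases)
    case (real r)
    then show ?thesis using that[of r] assms(4) H by (simp add: ennreal_less_iff)
  qed (use that[of "H + 1"] in auto)
  define \<epsilon> where "\<epsilon> = (z' - H) / 2"
  have \<epsilon>: "\<epsilon> > 0" using z'(1) by (simp add: \<epsilon>_def)
  have "B - e > 0" using B(2) by simp
  from turning_small[OF B(1) dB \<epsilon> this] obtain \<delta> where \<delta>: "\<delta> > 0" "\<delta> < B - e" "B - \<delta> \<in> I" "B + \<delta> \<in> I"
    "\<And>s t. B - \<delta> \<le> s \<Longrightarrow> s < t \<Longrightarrow> t \<le> B + \<delta> \<Longrightarrow> V t < V s"
    "\<And>s t. B - \<delta> \<le> s \<Longrightarrow> s \<le> t \<Longrightarrow> t \<le> B + \<delta> \<Longrightarrow> h_int f (V t) (ereal s) (ereal t) \<le> ennreal \<epsilon>"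
    by metis
  have eB: "\<And>\<tau>. e \<le> \<tau> \<Longrightarrow> \<tau> \<le> B - \<delta> \<Longrightarrow> V \<tau> > D0" using B(5) \<delta>(1) by auto
  obtain D1 where D1: "D0 < D1" "\<And>\<tau>. e \<le> \<tau> \<Longrightarrow> \<tau> \<le> B - \<delta> \<Longrightarrow> V \<tau> > D1"
    using V_min[OF assms(1) \<delta>(3) _ eB] \<delta>(2) by auto
  have VB\<delta>: "V (B + \<delta>) < D0" using \<delta>(5)[of B "B + \<delta>"] \<delta>(1) B(4) by simp
  have "h_int f D0 (ereal e) (ereal (B - \<delta>)) \<le> rho e D0"
    unfolding rho_def B(3) using \<delta>(1) by (intro h_int_mono) auto
  also have "rho e D0 < ennreal (H + \<epsilon>)" using H \<epsilon> by (simp add: ennreal_less_iff)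
  finally have lt: "h_int f D0 (ereal e) (ereal (B - \<delta>)) < ennreal (H + \<epsilon>)" .
  have 1: "\<forall>\<^sub>F D in at D0. h_int f D (ereal e) (ereal (B - \<delta>)) < ennreal (H + \<epsilon>)"
    using order_tendstoD(2)[OF h_int_tendsto_at[OF assms(1) \<delta>(3) _ eB] lt] \<delta>(2) by simp
  have 2: "\<forall>\<^sub>F D in at D0. D < D1" "\<forall>\<^sub>F D in at D0. V (B + \<delta>) < D"
    using order_tendstoD[OF tendsto_ident_at] D1(1) VB\<delta> by blast+
  show ?thesis using 1 2
  proof eventually_elim
    case (elim D)
    have De: "D < V e" using D1(2)[of e] \<delta>(2) elim(2) by simp
    have gt: "ereal (B - \<delta>) < b_star a b f e D"
      by (rule b_star_gt[OF assms(1) \<delta>(3)]) (use \<delta>(2) D1(2) elim(2) in \<open>auto intro: less_trans\<close>)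
    obtain B' where B': "B' \<in> I" "b_star a b f e D = ereal B'" "V B' = D"
      "\<And>\<tau>. e \<le> \<tau> \<Longrightarrow> \<tau> < B' \<Longrightarrow> V \<tau> > D"
      using assms(1) De
    proof (cases rule: b_star_cases)
      case none
      then show ?thesis using none(2)[OF \<delta>(4)] elim(3) \<delta>(1,2) by simp
    qed (use that in auto)
    have lo: "B - \<delta> < B'" using gt B'(2) by simp
    have "\<not> B + \<delta> < B'" using B'(4)[of "B + \<delta>"] elim(3) \<delta>(1) B(2) by auto
    then have hi: "B' \<le> B + \<delta>" by simp
    have part2: "h_int f D (ereal (B - \<delta>)) (ereal B') \<le> ennreal \<epsilon>"
      using \<delta>(6)[of "B - \<delta>" B'] lo hi B'(3) by simp
    have "rho e D = h_int f D (ereal e) (ereal (B - \<delta>)) + h_int f D (ereal (B - \<delta>)) (ereal B')"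
      unfolding rho_def B'(2)
      using assms(1) B'(1) \<delta>(2) lo by (intro h_int_add) (auto simp: I_ereal less_imp_le)
    also have "\<dots> \<le> ennreal \<epsilon> + h_int f D (ereal e) (ereal (B - \<delta>))"
      unfolding add.commute[of "ennreal \<epsilon>"] using part2 by (rule add_left_mono)
    also have "\<dots> < ennreal \<epsilon> + ennreal (H + \<epsilon>)"
      unfolding ennreal_add_left_cancel_less using elim(1) by simp
    also have "\<dots> = ennreal z'" using H(2) \<epsilon> by (simp add: ennreal_plus[symmetric] \<epsilon>_def field_simps del: ennreal_plus)
    finally show ?case using z'(2) by (rule less_le_trans)
  qed
qed

lemma rho_tendsto:
  assumes "e \<in> I" "D0 < V e" "b_star a b f e D0 < b"
  shows "(rho e \<longlongrightarrow> rho e D0) (at D0)"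
  using rho_lower[OF assms(1,2)] rho_upper[OF assms] by (intro order_tendstoI)

end

section \<open>Reflection of the base interval\<close>

lemma interval_I_reflect: "\<tau> \<in> interval_I (- \<beta>) (- \<alpha>) \<longleftrightarrow> - \<tau> \<in> interval_I \<alpha> \<beta>"
  unfolding interval_I_def mem_Collect_eq
  using ereal_uminus_less_reorder[of \<beta> "ereal \<tau>"] ereal_less_uminus_reorder[of "ereal \<tau>" \<alpha>]
  by auto

lemma interval_I_reflect_image: "interval_I (- \<beta>) (- \<alpha>) = uminus ` interval_I \<alpha> \<beta>"
proof (rule set_eqI)
  fix \<tau> show "\<tau> \<in> interval_I (- \<beta>) (- \<alpha>) \<longleftrightarrow> \<tau> \<in> uminus ` interval_I \<alpha> \<beta>"
    unfolding interval_I_reflect using image_eqI[of \<tau> uminus "- \<tau>" "interval_I \<alpha> \<beta>"] by auto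
qed

lemma warp_reflect: "warp (\<lambda>x. f (- x)) \<tau> = warp f (- \<tau>)"
  by (simp add: warp_def)

lemma to_b_reflect:
  assumes "a < b"
  shows "to_b (- a) = filtermap uminus (to_a a)"
proof (cases a)
  case (real r)
  then show ?thesis using at_left_minus[of "- r"] by (simp add: to_b_def to_a_def)
next
  case MInf
  then show ?thesis using at_top_mirror by (simp add: to_b_def to_a_def)
qed (use assms in simp)

lemma m_b_reflect: "a < b \<Longrightarrow> m_b (- a) (\<lambda>x. f (- x)) = m_a a f"
  unfolding m_b_def m_a_def
  by (simp add: to_b_reflect warp_reflect Liminf_filtermap_eq)

lemma m_a_reflect:
  assumes "a < b"
  shows "m_a (- b) (\<lambda>x. f (- x)) = m_b b f"
proof -
  have "- b < - a" using assms by simp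
  from m_b_reflect[OF this, of "\<lambda>x. f (- x)"] show ?thesis by simp
qed

lemma m_inf_reflect: "m_inf (- b) (- a) (\<lambda>x. f (- x)) = m_inf a b f"
  unfolding m_inf_def interval_I_reflect_image warp_reflect by (simp add: image_image)

lemma rel_min_reflect: "a < b \<Longrightarrow> rel_min_at_b (- b) (- a) (\<lambda>x. f (- x)) \<longleftrightarrow> rel_min_at_a a b f"
  unfolding rel_min_at_b_def rel_min_at_a_def m_b_reflect interval_I_reflect_image warp_reflect
  by simp

lemma uminus_mem_image: "- c \<in> uminus ` S \<longleftrightarrow> (c::real) \<in> S"
  by auto

lemma close_reflect: "a < b \<Longrightarrow> close_to_b (- b) (- a) (\<lambda>x. f (- x)) (- c) \<longleftrightarrow> close_to_a a b f c"
  unfolding close_to_b_def close_to_a_def m_b_reflect interval_I_reflect_image warp_reflect uminus_mem_image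
  by simp

lemma b_star_le_b: "ereal \<tau> < b \<Longrightarrow> b_star a b f \<tau> D \<le> b"
  unfolding b_star_def A_plus_def by (auto intro!: Inf_lower)

lemma a_star_ge_a: "a < ereal \<tau> \<Longrightarrow> a \<le> a_star a b f \<tau> D"
  unfolding a_star_def A_minus_def by (auto intro!: Sup_upper)

text \<open>Consequences of conditions (C) and (R) at \<open>b\<close> that are free of choice and of limits in \<open>T\<close>, so that
  their mirror images at \<open>a\<close> take the same form for \<open>f (- x)\<close> on \<open>(- b, - a)\<close>.\<close>

definition cond_b :: "ereal \<Rightarrow> ereal \<Rightarrow> (real \<Rightarrow> real) \<Rightarrow> ennreal \<Rightarrow> bool" where
  "cond_b a b f d \<longleftrightarrow> \<not> rel_min_at_b a b f \<or>
     (\<exists>c. close_to_b a b f c \<and>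
       (let \<mu> = real_of_ereal (m_b b f); J = h_int f \<mu> (ereal c) b;
            dd = Limsup (at \<mu>) (\<lambda>D. h_int f D (ereal c) (b_star a b f c D)) - J
        in J = \<infinity> \<or> 2 * dd \<ge> d \<or>
           (ereal (m_inf a b f) < m_b b f \<and>
            (INF D\<in>{m_inf a b f<..\<mu>}. h_int f D (a_star a b f c D) b) \<le> dd)))"

definition cond_R_b :: "ereal \<Rightarrow> ereal \<Rightarrow> (real \<Rightarrow> real) \<Rightarrow> ennreal \<Rightarrow> bool" where
  "cond_R_b a b f d \<longleftrightarrow>
     (\<forall>\<tau>\<in>interval_I a b. warp f \<tau> > m_inf a b f) \<and>
     m_a a f = ereal (m_inf a b f) \<and> m_b b f = ereal (m_inf a b f) \<and>
     (\<forall>x\<in>interval_I a b. \<forall>L\<le>d.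
        (\<forall>T\<in>interval_I a b. Liminf (at_right (m_inf a b f)) (\<lambda>D. h_int f D (ereal x) (ereal T)) \<le> L) \<longrightarrow>
        (\<exists>n. (n \<noteq> 0 \<longrightarrow> (\<forall>T\<in>interval_I a b. Liminf (at_right (m_inf a b f))
               (\<lambda>D. E_int a b f x n D + of_nat (n - 1) * W_int a b f x D
                      + h_int f D (a_star a b f x D) (ereal T)) \<le> L)) \<and>
             (\<forall>T\<in>interval_I a b. L \<le> Limsup (at_right (m_inf a b f))
               (\<lambda>D. E_int a b f x n D + of_nat n * W_int a b f x D
                      + h_int f D (ereal T) (b_star a b f x D)))))"

context warped_interval begin

text \<open>Interpreting the locale at the mirror image yields every statement at \<open>a\<close>
  from the one at \<open>b\<close>; the lemmas around it translate the notions involved.\<close>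

lemma reflected: "warped_interval (- b) (- a) (\<lambda>x. f (- x))"
proof
  show "- b < - a" using ab by simp
  show "smooth_on (interval_I (- b) (- a)) (\<lambda>x. f (- x))"
    unfolding smooth_on_def
  proof
    fix k
    have o: "open (interval_I (- b) (- a))" by (rule interval_I_props(1))
    have "C_k_on k (interval_I (- b) (- a)) (\<lambda>x. - x)"
      by (rule C_k_on_bounded_linear[OF o bounded_linear_minus[OF bounded_linear_ident] C_k_on_id[OF o]])
    moreover have "C_k_on k I f" using fs unfolding smooth_on_def by blast
    moreover have "uminus ` interval_I (- b) (- a) \<subseteq> I"
      using interval_I_reflect[of _ b a] by auto
    ultimately show "C_k_on k (interval_I (- b) (- a)) (\<lambda>x. f (- x))"
      using C_k_on_compose[OF o I_open, of "\<lambda>x. - x" k f] by blast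
  qed
  show "f (- \<tau>) > 0" if "\<tau> \<in> interval_I (- b) (- a)" for \<tau>
    using that fp[of "- \<tau>"] interval_I_reflect[of \<tau> b a] by simp
qed

lemma deriv_reflect:
  assumes "e \<in> I"
  shows "deriv (warp (\<lambda>x. f (- x))) (- e) = - deriv V e"
proof (rule DERIV_imp_deriv)
  have "((\<lambda>\<tau>. V (- \<tau>)) has_real_derivative deriv V e * -1) (at (- e))"
    by (rule DERIV_chain2[where f=V]) (use V_DERIV[OF assms] in \<open>auto intro!: derivative_eq_intros\<close>)
  moreover have "warp (\<lambda>x. f (- x)) = (\<lambda>\<tau>. V (- \<tau>))" by (simp add: fun_eq_iff warp_reflect)
  ultimately show "(warp (\<lambda>x. f (- x)) has_real_derivative - deriv V e) (at (- e))" by simp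
qed

lemma h_int_reflect:
  assumes "a \<le> \<alpha>" "\<beta> \<le> b"
  shows "h_int (\<lambda>x. f (- x)) D (- \<beta>) (- \<alpha>) = h_int f D \<alpha> \<beta>"
proof -
  let ?g = "\<lambda>\<tau>. ennreal (h D \<tau>) * indicator (interval_I \<alpha> \<beta>) \<tau>"
  have "?g \<in> borel_measurable borel" using h_meas_ennreal[OF assms, of D] by simp
  from nn_integral_real_affine[OF this, of "-1" 0]
  have "h_int f D \<alpha> \<beta> = (\<integral>\<^sup>+\<tau>. ?g (- \<tau>) \<partial>lborel)" by (simp add: h_int_def)
  also have "\<dots> = h_int (\<lambda>x. f (- x)) D (- \<beta>) (- \<alpha>)"
    unfolding h_int_def
    by (rule nn_integral_cong) (simp add: warp_reflect indicator_def interval_I_reflect)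
  finally show ?thesis by simp
qed

lemma A_minus_reflect: "A_minus a b f e D = uminus ` A_plus (- b) (- a) (\<lambda>x. f (- x)) (- e) D"
proof (rule set_eqI)
  fix z :: ereal
  let ?P = "\<lambda>\<tau>. \<tau> \<in> I \<and> \<tau> \<le> e \<and> V \<tau> = D"
  have "z \<in> A_minus a b f e D \<longleftrightarrow> (\<exists>\<tau>. z = ereal \<tau> \<and> ?P \<tau>) \<or> z = a"
    unfolding A_minus_def by auto
  also have "\<dots> \<longleftrightarrow> (\<exists>\<tau>. - z = ereal \<tau> \<and> ?P (- \<tau>)) \<or> - z = - a"
  proof -
    have "(\<exists>\<tau>. z = ereal \<tau> \<and> ?P \<tau>) \<longleftrightarrow> (\<exists>\<tau>. z = ereal (- \<tau>) \<and> ?P (- \<tau>))"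
      by (metis minus_minus)
    then show ?thesis by (metis ereal_uminus_uminus uminus_ereal.simps(1))
  qed
  also have "\<dots> \<longleftrightarrow> - z \<in> A_plus (- b) (- a) (\<lambda>x. f (- x)) (- e) D"
    unfolding A_plus_def interval_I_reflect warp_reflect by (auto simp: minus_le_iff)
  also have "\<dots> \<longleftrightarrow> z \<in> uminus ` A_plus (- b) (- a) (\<lambda>x. f (- x)) (- e) D"
    by (metis (no_types, lifting) ereal_uminus_uminus image_iff)
  finally show "z \<in> A_minus a b f e D \<longleftrightarrow> z \<in> uminus ` A_plus (- b) (- a) (\<lambda>x. f (- x)) (- e) D" .
qed

lemma a_star_reflect:
  assumes "e \<in> I"
  shows "a_star a b f e D = - b_star (- b) (- a) (\<lambda>x. f (- x)) (- e) D"
proof -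
  let ?A = "A_plus (- b) (- a) (\<lambda>x. f (- x)) (- e) D"
  have "uminus ` ?A - {ereal e} = uminus ` (?A - {ereal (- e)})"
    by (auto simp: image_iff) (metis ereal_uminus_uminus uminus_ereal.simps(1))+
  then show ?thesis
    unfolding a_star_def b_star_def A_minus_reflect deriv_reflect[OF assms]
    by (simp add: ereal_Sup_uminus_image_eq)
qed

lemma reach_reflect:
  assumes "reach (interval_I (- b) (- a)) (\<lambda>x. f (- x)) D L (- x) (- y)"
  shows "reach I f D L x y"
proof -
  let ?f = "\<lambda>x. f (- x)"
  obtain J u p where t: "traj (interval_I (- b) (- a)) ?f D J u p" "{0..L} \<subseteq> J" "u 0 = - x" "u L = - y"
    using assms by (auto simp: reach_def)
  have "traj I f D J (\<lambda>r. - u r) (\<lambda>r. - p r)"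
    unfolding traj_def
  proof (intro conjI ballI)
    show "open J" "is_interval J" using t(1) by (auto simp: traj_def)
    have uI: "- u r \<in> I" if "r \<in> J" for r
    proof -
      have "u r \<in> interval_I (- b) (- a)" using t(1) that by (auto simp: traj_def)
      then show ?thesis by (simp add: interval_I_reflect)
    qed
    then show "(\<lambda>r. - u r) ` J \<subseteq> I" by auto
    fix r assume r: "r \<in> J"
    have d: "(u has_real_derivative p r / V (- u r)) (at r)"
        "(p has_real_derivative deriv (warp ?f) (u r) / (2 * V (- u r))) (at r)"
        "(p r)\<^sup>2 = V (- u r) - D"
      using t(1) r by (auto simp: traj_def warp_reflect)
    show "((\<lambda>r. - u r) has_real_derivative - p r / V (- u r)) (at r)"
      using DERIV_minus[OF d(1)] by simp
    have "deriv (warp ?f) (u r) = - deriv V (- u r)"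
      using deriv_reflect[OF uI[OF r]] by simp
    then show "((\<lambda>r. - p r) has_real_derivative deriv V (- u r) / (2 * V (- u r))) (at r)"
      using DERIV_minus[OF d(2)] by simp
    show "(- p r)\<^sup>2 = V (- u r) - D" using d(3) by simp
  qed
  then show ?thesis by (rule reachI) (use t in auto)
qed

lemma h_int_b_star_reflect:
  assumes "e \<in> I" "ereal x \<le> b"
  shows "h_int (\<lambda>x. f (- x)) D (ereal (- x)) (b_star (- b) (- a) (\<lambda>x. f (- x)) (- e) D)
    = h_int f D (a_star a b f e D) (ereal x)"
proof -
  have "a \<le> a_star a b f e D" using a_star_ge_a assms by (simp add: I_ereal)
  from h_int_reflect[OF this assms(2), of D] show ?thesis
    by (simp add: a_star_reflect[OF assms(1)])
qed

lemma h_int_a_star_reflect: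
  assumes "e \<in> I" "a \<le> \<alpha>"
  shows "h_int (\<lambda>x. f (- x)) D (a_star (- b) (- a) (\<lambda>x. f (- x)) (- e) D) (- \<alpha>)
    = h_int f D \<alpha> (b_star a b f e D)"
proof -
  have "b_star a b f e D \<le> b" using b_star_le_b assms by (simp add: I_ereal)
  from h_int_reflect[OF assms(2) this, of D]
  have 1: "h_int (\<lambda>x. f (- x)) D (- b_star a b f e D) (- \<alpha>) = h_int f D \<alpha> (b_star a b f e D)" .
  interpret R: warped_interval "- b" "- a" "\<lambda>x. f (- x)" by (rule reflected)
  have "- e \<in> interval_I (- b) (- a)" using assms(1) by (simp add: interval_I_reflect)
  from R.a_star_reflect[OF this, of D] have "a_star (- b) (- a) (\<lambda>x. f (- x)) (- e) D = - b_star a b f e D"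
    by simp
  then show ?thesis using 1 by simp
qed

section \<open>Conditions (C) and (R) in the form used at both ends\<close>

lemma some_close_b:
  assumes "rel_min_at_b a b f"
  shows "close_to_b a b f (SOME c. close_to_b a b f c)"
proof -
  obtain s where s: "s \<in> I" "\<forall>\<tau>\<in>I. s < \<tau> \<longrightarrow> ereal (V \<tau>) > m_b b f"
    using assms by (auto simp: rel_min_at_b_def)
  obtain c where c: "ereal s < ereal c" "ereal c < b"
    using ereal_dense2[of "ereal s" b] s(1) by (auto simp: I_ereal)
  then have "c \<in> I" using s(1) less_trans[of a "ereal s" "ereal c"] by (simp add: I_ereal)
  then have "close_to_b a b f c" unfolding close_to_b_def using s c by auto
  then show ?thesis by (rule someI)
qed

text \<open>Once there is a relative minimum, the point chosen in \<open>d_b\<close> and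
  \<open>i_b\<close> is close to \<open>b\<close> and serves as witness; the alternative of an
  infinite time brings its own point.\<close>

lemma cond_b_of_C:
  assumes "condition_C_b a b f d"
  shows "cond_b a b f d"
proof (cases "rel_min_at_b a b f")
  case True
  let ?\<mu> = "real_of_ereal (m_b b f)"
  let ?c = "SOME c. close_to_b a b f c"
  note cl = some_close_b[OF True]
  consider (2) c where "close_to_b a b f c" "h_int f ?\<mu> (ereal c) b = \<infinity>"
    | (3) "2 * d_b a b f \<ge> d" | (4) "ereal (m_inf a b f) < m_b b f" "d_b a b f \<ge> i_b a b f"
    using assms True unfolding condition_C_b_def by blast
  then show ?thesis
  proof cases
    case 2
    then show ?thesis unfolding cond_b_def Let_def by blast
  next
    case 3
    then show ?thesis unfolding cond_b_def Let_def d_b_def using cl by blast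
  next
    case 4
    then show ?thesis unfolding cond_b_def Let_def d_b_def i_b_def using cl by blast
  qed
qed (simp add: cond_b_def)

lemma some_close_a:
  assumes "rel_min_at_a a b f"
  shows "close_to_a a b f (SOME c. close_to_a a b f c)"
proof -
  interpret R: warped_interval "- b" "- a" "\<lambda>x. f (- x)" by (rule reflected)
  have "close_to_b (- b) (- a) (\<lambda>x. f (- x)) (SOME c. close_to_b (- b) (- a) (\<lambda>x. f (- x)) c)"
    by (rule R.some_close_b) (simp add: rel_min_reflect[OF ab] assms)
  from someI[of "close_to_a a b f", OF this[THEN close_reflect[OF ab, THEN iffD1, of _ "- _", unfolded minus_minus]]]
  show ?thesis .
qed

lemma cond_b_reflect_of_C:
  assumes "condition_C_a a b f d"
  shows "cond_b (- b) (- a) (\<lambda>x. f (- x)) d"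
proof (cases "rel_min_at_a a b f")
  case True
  let ?f = "\<lambda>x. f (- x)"
  let ?\<mu> = "real_of_ereal (m_a a f)"
  let ?c = "SOME c. close_to_a a b f c"
  note cl = some_close_a[OF True]
  have cI: "c \<in> I" if "close_to_a a b f c" for c using that by (simp add: close_to_a_def)
  have J: "h_int ?f D (ereal (- c)) (- a) = h_int f D a (ereal c)" if "close_to_a a b f c" for c D
    using h_int_reflect[of a "ereal c" D] cI[OF that] by (simp add: I_ereal less_imp_le)
  have S: "h_int ?f D (ereal (- c)) (b_star (- b) (- a) ?f (- c) D) = h_int f D (a_star a b f c D) (ereal c)"
    if "close_to_a a b f c" for c D
    using h_int_b_star_reflect[OF cI[OF that], of c D] cI[OF that] by (simp add: I_ereal less_imp_le)
  have A: "h_int ?f D (a_star (- b) (- a) ?f (- c) D) (- a) = h_int f D a (b_star a b f c D)"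
    if "close_to_a a b f c" for c D
    using h_int_a_star_reflect[OF cI[OF that], of a D] by simp
  have cl': "close_to_b (- b) (- a) ?f (- c)" if "close_to_a a b f c" for c
    using that close_reflect[OF ab] by simp
  consider (2) c where "close_to_a a b f c" "h_int f ?\<mu> a (ereal c) = \<infinity>"
    | (3) "2 * d_a a b f \<ge> d" | (4) "ereal (m_inf a b f) < m_a a f" "d_a a b f \<ge> i_a a b f"
    using assms True unfolding condition_C_a_def by blast
  \<comment> \<open>The alternatives are first gathered at \<open>a\<close> in the shape of
    \<open>cond_b\<close>, so that the mirror formulas \<open>J\<close>, \<open>S\<close> and
    \<open>A\<close> can rewrite them literally.\<close>
  then have "\<exists>c. close_to_a a b f c \<and>
       (let J = h_int f ?\<mu> a (ereal c);
            dd = Limsup (at ?\<mu>) (\<lambda>D. h_int f D (a_star a b f c D) (ereal c)) - J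
        in J = \<infinity> \<or> 2 * dd \<ge> d \<or>
           (ereal (m_inf a b f) < m_a a f \<and>
            (INF D\<in>{m_inf a b f<..?\<mu>}. h_int f D a (b_star a b f c D)) \<le> dd))"
  proof cases
    case 2
    then show ?thesis unfolding Let_def by blast
  next
    case 3
    then show ?thesis unfolding Let_def d_a_def using cl by blast
  next
    case 4
    then show ?thesis unfolding Let_def d_a_def i_a_def using cl by blast
  qed
  then obtain c where c: "close_to_a a b f c"
       "let J = h_int f ?\<mu> a (ereal c);
            dd = Limsup (at ?\<mu>) (\<lambda>D. h_int f D (a_star a b f c D) (ereal c)) - J
        in J = \<infinity> \<or> 2 * dd \<ge> d \<or>
           (ereal (m_inf a b f) < m_a a f \<and>
            (INF D\<in>{m_inf a b f<..?\<mu>}. h_int f D a (b_star a b f c D)) \<le> dd)" by blast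
  show ?thesis
    unfolding cond_b_def m_b_reflect[OF ab] m_inf_reflect
    by (rule disjI2, rule exI[of _ "- c"], rule conjI[OF cl'[OF c(1)]])
       (use c(2) in \<open>simp only: J[OF c(1)] S[OF c(1)] A[OF c(1)] Let_def\<close>)
qed (simp add: cond_b_def rel_min_reflect[OF ab])

lemma eventually_to_b:
  assumes "T0 \<in> I"
  shows "eventually (\<lambda>T. T0 < T \<and> T \<in> I) (to_b b)"
proof -
  have 1: "T0 < T \<and> T \<in> I" if "T0 < T" "ereal T < b" for T
    using that assms less_trans[of a "ereal T0" "ereal T"] by (simp add: I_ereal)
  show ?thesis
  proof (cases b)
    case (real r)
    then have "T0 < r" using assms by (simp add: interval_I_def)
    from eventually_at_left_real[OF this] have "eventually (\<lambda>T. T0 < T \<and> T \<in> I) (at_left r)"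
    proof eventually_elim
      case (elim T)
      then show ?case using 1[of T] real by simp
    qed
    then show ?thesis unfolding to_b_def using real by simp
  next
    case PInf
    have "eventually (\<lambda>T. T0 < T) at_top" by (rule eventually_gt_at_top)
    then have "eventually (\<lambda>T. T0 < T \<and> T \<in> I) at_top"
    proof eventually_elim
      case (elim T)
      then show ?case using 1[of T] PInf by simp
    qed
    then show ?thesis unfolding to_b_def using PInf by simp
  qed (use ab in simp)
qed

lemma to_b_nontrivial: "to_b b \<noteq> bot"
  using ab by (cases b) (auto simp: to_b_def trivial_limit_at_left_real)

text \<open>Monotonicity in the cut-off turns the outer limits of condition (R) into suprema and
  infima, that is, into bounds for every single \<open>T\<close>.\<close>

lemma Lim_to_b_mono:
  fixes g :: "real \<Rightarrow> ennreal"
  assumes "\<And>s t. s \<in> I \<Longrightarrow> t \<in> I \<Longrightarrow> s \<le> t \<Longrightarrow> g s \<le> g t"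
  shows "Lim (to_b b) g = (SUP T\<in>I. g T)"
proof (rule tendsto_Lim[OF to_b_nontrivial], rule order_tendstoI)
  fix z assume "z < (SUP T\<in>I. g T)"
  then obtain T0 where T0: "T0 \<in> I" "z < g T0" by (auto simp: less_SUP_iff)
  show "eventually (\<lambda>T. z < g T) (to_b b)"
    using eventually_to_b[OF T0(1)]
  proof eventually_elim
    case (elim T)
    then have "g T0 \<le> g T" using assms[OF T0(1), of T] by simp
    with T0(2) show ?case by (rule less_le_trans)
  qed
next
  fix z assume z: "(SUP T\<in>I. g T) < z"
  obtain T0 where "T0 \<in> I" using ab ereal_dense2[of a b] by (auto simp: I_ereal)
  from eventually_to_b[OF this] show "eventually (\<lambda>T. g T < z) (to_b b)"
  proof eventually_elim
    case (elim T)
    then have "g T \<le> (SUP T\<in>I. g T)" by (intro SUP_upper) simp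
    then show ?case using z by (rule le_less_trans)
  qed
qed

lemma Lim_to_b_antimono:
  fixes g :: "real \<Rightarrow> ennreal"
  assumes "\<And>s t. s \<in> I \<Longrightarrow> t \<in> I \<Longrightarrow> s \<le> t \<Longrightarrow> g t \<le> g s"
  shows "Lim (to_b b) g = (INF T\<in>I. g T)"
proof (rule tendsto_Lim[OF to_b_nontrivial], rule order_tendstoI)
  fix z assume "(INF T\<in>I. g T) < z"
  then obtain T0 where T0: "T0 \<in> I" "g T0 < z" by (auto simp: INF_less_iff)
  show "eventually (\<lambda>T. g T < z) (to_b b)"
    using eventually_to_b[OF T0(1)]
  proof eventually_elim
    case (elim T)
    then have "g T \<le> g T0" using assms[OF T0(1), of T] by simp
    then show ?case using T0(2) by (rule le_less_trans)
  qed
next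
  fix z assume z: "z < (INF T\<in>I. g T)"
  obtain T0 where "T0 \<in> I" using ab ereal_dense2[of a b] by (auto simp: I_ereal)
  from eventually_to_b[OF this] show "eventually (\<lambda>T. z < g T) (to_b b)"
  proof eventually_elim
    case (elim T)
    then have "(INF T\<in>I. g T) \<le> g T" by (intro INF_lower) simp
    with z show ?case by (rule less_le_trans)
  qed
qed

lemma Lim_to_a:
  fixes g :: "real \<Rightarrow> ennreal"
  shows "Lim (to_a a) g = Lim (to_b (- a)) (\<lambda>T. g (- T))"
proof -
  have "to_b (- a) = filtermap uminus (to_a a)" by (rule to_b_reflect[OF ab])
  then show ?thesis unfolding t2_space_class.Lim_def by (simp add: filterlim_filtermap)
qed

lemma Lim_to_a_mono:
  fixes g :: "real \<Rightarrow> ennreal"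
  assumes "\<And>s t. s \<in> I \<Longrightarrow> t \<in> I \<Longrightarrow> s \<le> t \<Longrightarrow> g t \<le> g s"
  shows "Lim (to_a a) g = (SUP T\<in>I. g T)"
proof -
  interpret R: warped_interval "- b" "- a" "\<lambda>x. f (- x)" by (rule reflected)
  have "Lim (to_b (- a)) (\<lambda>T. g (- T)) = (SUP T\<in>interval_I (- b) (- a). g (- T))"
    by (rule R.Lim_to_b_mono) (simp add: interval_I_reflect assms)
  then show ?thesis by (simp add: Lim_to_a interval_I_reflect_image image_image)
qed

lemma Lim_to_a_antimono:
  fixes g :: "real \<Rightarrow> ennreal"
  assumes "\<And>s t. s \<in> I \<Longrightarrow> t \<in> I \<Longrightarrow> s \<le> t \<Longrightarrow> g s \<le> g t"
  shows "Lim (to_a a) g = (INF T\<in>I. g T)"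
proof -
  interpret R: warped_interval "- b" "- a" "\<lambda>x. f (- x)" by (rule reflected)
  have "Lim (to_b (- a)) (\<lambda>T. g (- T)) = (INF T\<in>interval_I (- b) (- a). g (- T))"
    by (rule R.Lim_to_b_antimono) (simp add: interval_I_reflect assms)
  then show ?thesis by (simp add: Lim_to_a interval_I_reflect_image image_image)
qed

text \<open>The premise puts \<open>L\<close> into \<open>{r_i a b f x 0..d}\<close>, and the
  interval with index \<open>n\<close> that contains it yields both families of bounds. For index 0
  the lower family is the premise itself.\<close>

lemma cond_R_b_of_R:
  assumes "condition_R a b f d"
  shows "cond_R_b a b f d"
proof -
  let ?m = "m_inf a b f"
  note R = assms[unfolded condition_R_def]
  show ?thesis
    unfolding cond_R_b_def
  proof (intro conjI)
    show "\<forall>\<tau>\<in>I. V \<tau> > ?m" "m_a a f = ereal ?m" "m_b b f = ereal ?m" using R by auto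
    show "\<forall>x\<in>I. \<forall>L\<le>d.
        (\<forall>T\<in>I. Liminf (at_right ?m) (\<lambda>D. h_int f D (ereal x) (ereal T)) \<le> L) \<longrightarrow>
        (\<exists>n. (n \<noteq> 0 \<longrightarrow> (\<forall>T\<in>I. Liminf (at_right ?m)
               (\<lambda>D. E_int a b f x n D + of_nat (n - 1) * W_int a b f x D
                      + h_int f D (a_star a b f x D) (ereal T)) \<le> L)) \<and>
             (\<forall>T\<in>I. L \<le> Limsup (at_right ?m)
               (\<lambda>D. E_int a b f x n D + of_nat n * W_int a b f x D
                      + h_int f D (ereal T) (b_star a b f x D))))"
    proof (intro ballI allI impI)
      fix x L assume x: "x \<in> I" and L: "L \<le> d"
        and le: "\<forall>T\<in>I. Liminf (at_right ?m) (\<lambda>D. h_int f D (ereal x) (ereal T)) \<le> L"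
      have i: "r_i a b f x n = (SUP T\<in>I. Liminf (at_right ?m) (\<lambda>D.
         if n = 0 then h_int f D (ereal x) (ereal T)
         else E_int a b f x n D + of_nat (n - 1) * W_int a b f x D
              + h_int f D (a_star a b f x D) (ereal T)))" for n
        unfolding r_i_def
        by (rule Lim_to_b_mono, rule Liminf_mono, rule always_eventually)
           (auto intro!: add_left_mono h_int_mono)
      have s: "r_s a b f x n = (INF T\<in>I. Limsup (at_right ?m) (\<lambda>D.
         E_int a b f x n D + of_nat n * W_int a b f x D + h_int f D (ereal T) (b_star a b f x D)))" for n
        unfolding r_s_def
        by (rule Lim_to_b_antimono, rule Limsup_mono, rule always_eventually)
           (auto intro!: add_left_mono h_int_mono)
      have "r_i a b f x 0 \<le> L" unfolding i using le by (auto intro!: SUP_least)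
      then have "L \<in> {r_i a b f x 0..d}" using L by simp
      then obtain n where n: "r_i a b f x n \<le> L" "L \<le> r_s a b f x n" using R x by fastforce
      show "\<exists>n. (n \<noteq> 0 \<longrightarrow> (\<forall>T\<in>I. Liminf (at_right ?m)
               (\<lambda>D. E_int a b f x n D + of_nat (n - 1) * W_int a b f x D
                      + h_int f D (a_star a b f x D) (ereal T)) \<le> L)) \<and>
             (\<forall>T\<in>I. L \<le> Limsup (at_right ?m)
               (\<lambda>D. E_int a b f x n D + of_nat n * W_int a b f x D
                      + h_int f D (ereal T) (b_star a b f x D)))"
      proof (intro exI[of _ n] conjI impI ballI)
        fix T assume T: "T \<in> I"
        show "L \<le> Limsup (at_right ?m)
               (\<lambda>D. E_int a b f x n D + of_nat n * W_int a b f x D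
                      + h_int f D (ereal T) (b_star a b f x D))"
          using n(2) T unfolding s by (auto simp: le_INF_iff)
        assume "n \<noteq> 0"
        then show "Liminf (at_right ?m)
               (\<lambda>D. E_int a b f x n D + of_nat (n - 1) * W_int a b f x D
                      + h_int f D (a_star a b f x D) (ereal T)) \<le> L"
          using n(1) T unfolding i by (auto simp: SUP_le_iff)
      qed
    qed
  qed
qed

lemma cond_R_b_reflect_of_R:
  assumes "condition_R a b f d"
  shows "cond_R_b (- b) (- a) (\<lambda>x. f (- x)) d"
proof -
  let ?m = "m_inf a b f"
  let ?f = "\<lambda>x. f (- x)"
  note R = assms[unfolded condition_R_def]
  have bs: "h_int ?f D (ereal (- t)) (b_star (- b) (- a) ?f (- x) D) = h_int f D (a_star a b f x D) (ereal t)"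
    if "x \<in> I" "t \<in> I" for D x t
    using h_int_b_star_reflect[OF that(1), of t D] that(2) by (simp add: I_ereal less_imp_le)
  have as: "h_int ?f D (a_star (- b) (- a) ?f (- x) D) (ereal (- t)) = h_int f D (ereal t) (b_star a b f x D)"
    if "x \<in> I" "t \<in> I" for D x t
    using h_int_a_star_reflect[OF that(1), of "ereal t" D] that(2) by (simp add: I_ereal less_imp_le)
  have hh: "h_int ?f D (ereal (- x)) (ereal (- t)) = h_int f D (ereal t) (ereal x)"
    if "x \<in> I" "t \<in> I" for D x t
    using h_int_reflect[of "ereal t" "ereal x" D] that by (simp add: I_ereal less_imp_le)
  \<comment> \<open>Reflection exchanges the times to the left and to the right, so
    \<open>W_int\<close> is preserved and \<open>E_int\<close> becomes \<open>G_int\<close>.\<close>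
  have W: "W_int (- b) (- a) ?f (- x) D = W_int a b f x D" if "x \<in> I" for D x
    unfolding W_int_def \<Lambda>_int_def R_int_def bs[OF that that] as[OF that that] by (rule add.commute)
  have E: "E_int (- b) (- a) ?f (- x) n D = G_int a b f x n D" if "x \<in> I" for n D x
    unfolding E_int_def G_int_def \<Lambda>_int_def R_int_def bs[OF that that] as[OF that that] ..
  have main: "\<exists>n. (n \<noteq> 0 \<longrightarrow> (\<forall>T\<in>I. Liminf (at_right ?m)
               (\<lambda>D. G_int a b f x n D + of_nat (n - 1) * W_int a b f x D
                      + h_int f D (ereal T) (b_star a b f x D)) \<le> L)) \<and>
             (\<forall>T\<in>I. L \<le> Limsup (at_right ?m)
               (\<lambda>D. G_int a b f x n D + of_nat n * W_int a b f x D
                      + h_int f D (a_star a b f x D) (ereal T)))"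
    if x: "x \<in> I" and L: "L \<le> d"
      and le: "\<forall>T\<in>I. Liminf (at_right ?m) (\<lambda>D. h_int f D (ereal T) (ereal x)) \<le> L" for x L
  proof -
    have i: "l_i a b f x n = (SUP T\<in>I. Liminf (at_right ?m) (\<lambda>D.
       if n = 0 then h_int f D (ereal T) (ereal x)
       else G_int a b f x n D + of_nat (n - 1) * W_int a b f x D
            + h_int f D (ereal T) (b_star a b f x D)))" for n
      unfolding l_i_def
      by (rule Lim_to_a_mono, rule Liminf_mono, rule always_eventually)
         (auto intro!: add_left_mono h_int_mono)
    have s: "l_s a b f x n = (INF T\<in>I. Limsup (at_right ?m) (\<lambda>D.
       G_int a b f x n D + of_nat n * W_int a b f x D + h_int f D (a_star a b f x D) (ereal T)))" for n
      unfolding l_s_def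
      by (rule Lim_to_a_antimono, rule Limsup_mono, rule always_eventually)
         (auto intro!: add_left_mono h_int_mono)
    have "l_i a b f x 0 \<le> L" unfolding i using le by (auto intro!: SUP_least)
    then have "L \<in> {l_i a b f x 0..d}" using L by simp
    then obtain n where n: "l_i a b f x n \<le> L" "L \<le> l_s a b f x n" using R x by fastforce
    show ?thesis
    proof (intro exI[of _ n] conjI impI ballI)
      fix T assume T: "T \<in> I"
      show "L \<le> Limsup (at_right ?m)
             (\<lambda>D. G_int a b f x n D + of_nat n * W_int a b f x D
                    + h_int f D (a_star a b f x D) (ereal T))"
        using n(2) T unfolding s by (auto simp: le_INF_iff)
      assume "n \<noteq> 0"
      then show "Liminf (at_right ?m)
             (\<lambda>D. G_int a b f x n D + of_nat (n - 1) * W_int a b f x D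
                    + h_int f D (ereal T) (b_star a b f x D)) \<le> L"
        using n(1) T unfolding i by (auto simp: SUP_le_iff)
    qed
  qed
  show ?thesis
    unfolding cond_R_b_def m_inf_reflect m_b_reflect[OF ab] m_a_reflect[OF ab] interval_I_reflect_image
      ball_simps warp_reflect minus_minus
  proof (intro conjI)
    show "\<forall>\<tau>\<in>I. V \<tau> > ?m" "m_b b f = ereal ?m" "m_a a f = ereal ?m" using R by auto
    show "\<forall>x\<in>I. \<forall>L\<le>d.
        (\<forall>T\<in>I. Liminf (at_right ?m) (\<lambda>D. h_int ?f D (ereal (- x)) (ereal (- T))) \<le> L) \<longrightarrow>
        (\<exists>n. (n \<noteq> 0 \<longrightarrow> (\<forall>T\<in>I. Liminf (at_right ?m)
               (\<lambda>D. E_int (- b) (- a) ?f (- x) n D + of_nat (n - 1) * W_int (- b) (- a) ?f (- x) D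
                      + h_int ?f D (a_star (- b) (- a) ?f (- x) D) (ereal (- T))) \<le> L)) \<and>
             (\<forall>T\<in>I. L \<le> Limsup (at_right ?m)
               (\<lambda>D. E_int (- b) (- a) ?f (- x) n D + of_nat n * W_int (- b) (- a) ?f (- x) D
                      + h_int ?f D (ereal (- T)) (b_star (- b) (- a) ?f (- x) D))))"
    proof (intro ballI allI impI)
      fix x L assume x: "x \<in> I" and L: "L \<le> d"
        and le: "\<forall>T\<in>I. Liminf (at_right ?m) (\<lambda>D. h_int ?f D (ereal (- x)) (ereal (- T))) \<le> L"
      have "\<forall>T\<in>I. Liminf (at_right ?m) (\<lambda>D. h_int f D (ereal T) (ereal x)) \<le> L"
        using le hh[OF x] by simp
      from main[OF x L this] show "\<exists>n. (n \<noteq> 0 \<longrightarrow> (\<forall>T\<in>I. Liminf (at_right ?m)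
               (\<lambda>D. E_int (- b) (- a) ?f (- x) n D + of_nat (n - 1) * W_int (- b) (- a) ?f (- x) D
                      + h_int ?f D (a_star (- b) (- a) ?f (- x) D) (ereal (- T))) \<le> L)) \<and>
             (\<forall>T\<in>I. L \<le> Limsup (at_right ?m)
               (\<lambda>D. E_int (- b) (- a) ?f (- x) n D + of_nat n * W_int (- b) (- a) ?f (- x) D
                      + h_int ?f D (ereal (- T)) (b_star (- b) (- a) ?f (- x) D)))"
        using E[OF x] W[OF x] as[OF x] bs[OF x] by simp
    qed
  qed
qed

end

section \<open>The bouncing family of trajectories\<close>

text \<open>The intermediate value theorem in the form used under the assumption that no level is a
  solution: one member of the family below \<open>c\<close> keeps the whole family below
  \<open>c\<close>.\<close>

lemma connected_avoids_less:
  fixes T :: "real \<Rightarrow> ennreal"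
  assumes "connected S" "continuous_on S T" "D1 \<in> S" "T D1 < c" "\<And>D. D \<in> S \<Longrightarrow> T D \<noteq> c" "D \<in> S"
  shows "T D < c"
proof (rule ccontr)
  assume "\<not> T D < c"
  then have "c \<le> T D" by simp
  have "connected (T ` S)" using connected_continuous_image[OF assms(2,1)] .
  from connectedD_interval[OF this imageI[OF assms(3)] imageI[OF assms(6)] less_imp_le[OF assms(4)] \<open>c \<le> T D\<close>]
  show False using assms(5) by blast
qed

lemma eventually_real_at_right: "m < (c::real) \<Longrightarrow> eventually (\<lambda>D. m < D \<and> D < c) (at_right m)"
  by (rule eventually_mono[OF eventually_at_right_real]) auto

lemma Liminf_le_eventually:
  fixes g :: "real \<Rightarrow> ennreal"
  assumes "eventually (\<lambda>D. g D \<le> C) F" "F \<noteq> bot"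
  shows "Liminf F g \<le> C"
proof (rule ccontr)
  assume "\<not> ?thesis"
  then have "eventually (\<lambda>D. C < g D) F" by (intro less_LiminfD) simp
  with assms(1) have "eventually (\<lambda>D. False) F" by eventually_elim simp
  then show False using assms(2) by (simp add: trivial_limit_def)
qed

context warped_interval begin

lemma eventually_to_bD:
  assumes "eventually P (to_b b)"
  obtains T0 where "T0 \<in> I" "\<And>\<tau>. \<tau> \<in> I \<Longrightarrow> T0 < \<tau> \<Longrightarrow> P \<tau>"
proof -
  obtain t where t: "t \<in> I" using ab ereal_dense2[of a b] by (auto simp: I_ereal)
  show ?thesis
  proof (cases b)
    case (real r)
    have tr: "t < r" using t real by (simp add: interval_I_def)
    have "eventually P (at_left r)" using assms real by (simp add: to_b_def)
    then obtain c where c: "c < r" "\<And>y. c < y \<Longrightarrow> y < r \<Longrightarrow> P y"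
      unfolding eventually_at_left[OF tr] by blast
    show ?thesis
    proof (rule that[of "max c t"])
      show "max c t \<in> I"
        using t c(1) tr real less_le_trans[of a "ereal t" "ereal c"]
        by (cases "c \<le> t") (auto simp: interval_I_def max_def)
      fix \<tau> assume "\<tau> \<in> I" "max c t < \<tau>"
      then show "P \<tau>" using c(2)[of \<tau>] real by (simp add: interval_I_def)
    qed
  next
    case PInf
    then have "eventually P at_top" using assms by (simp add: to_b_def)
    then obtain c where c: "\<And>y. c < y \<Longrightarrow> P y" unfolding eventually_at_top_dense by blast
    show ?thesis
    proof (rule that[of "max c t"])
      show "max c t \<in> I"
        using t PInf less_le_trans[of a "ereal t" "ereal c"]
        by (cases "c \<le> t") (auto simp: interval_I_def max_def)
      fix \<tau> assume "\<tau> \<in> I" "max c t < \<tau>"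
      then show "P \<tau>" using c[of \<tau>] by simp
    qed
  qed (use ab in simp)
qed

lemma b_star_lt_b:
  assumes "e \<in> I" "D < V e" "\<tau> \<in> I" "e \<le> \<tau>" "V \<tau> \<le> D"
  shows "b_star a b f e D < b"
  using assms(1,2)
proof (cases rule: b_star_cases)
  case none
  then show ?thesis using none(2)[OF assms(3,4)] assms(5) by simp
qed (simp add: I_ereal)

lemma b_star_lt_b_of_m_b:
  assumes "e \<in> I" "D < V e" "m_b b f < ereal D"
  shows "b_star a b f e D < b"
  using assms(1,2)
proof (cases rule: b_star_cases)
  case none
  have "ereal D \<le> m_b b f" unfolding m_b_def
  proof (rule Liminf_bounded)
    show "\<forall>\<^sub>F \<tau> in to_b b. ereal D \<le> ereal (V \<tau>)"
      using eventually_to_b[OF assms(1)] by eventually_elim (use none in \<open>auto intro: less_imp_le\<close>)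
  qed
  then show ?thesis using assms(3) by simp
qed (simp add: I_ereal)

lemma dec_right:
  assumes "c \<in> I" "deriv V c < 0"
  obtains \<tau> where "\<tau> \<in> I" "c < \<tau>" "V \<tau> < V c"
proof -
  obtain d where d: "d > 0" "\<And>h. h > 0 \<Longrightarrow> h < d \<Longrightarrow> V (c + h) < V c"
    using DERIV_neg_dec_right[OF V_DERIV[OF assms(1)] assms(2)] by blast
  obtain e where e: "e > 0" "ball c e \<subseteq> I" using I_open assms(1) openE by blast
  have "c + min d e / 2 \<in> ball c e" using d(1) e(1) by (auto simp: dist_real_def min_def)
  then show ?thesis using d e by (intro that[of "c + min d e / 2"]) auto
qed

lemma rho_base_change:
  assumes "x \<in> I" "e \<in> I" "x \<le> e" "\<And>\<tau>. x \<le> \<tau> \<Longrightarrow> \<tau> \<le> e \<Longrightarrow> V \<tau> > D"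
  shows "rho x D = h_int f D (ereal x) (ereal e) + rho e D"
proof -
  have "D < V e" using assms by auto
  have "b_star a b f e D \<le> b" by (rule b_star_le[OF assms(2) \<open>D < V e\<close>])
  moreover have "ereal e < b_star a b f x D" by (rule b_star_gt[OF assms])
  moreover have "b_star a b f e D = b_star a b f x D" by (rule b_star_base_change[OF assms])
  ultimately show ?thesis
    unfolding rho_def using assms(1,3) h_int_add[of "ereal x" "b_star a b f x D" e D]
    by (simp add: I_ereal less_imp_le)
qed

lemma bounce_reach':
  assumes "x \<in> I" "y \<in> I" "x \<le> y" "\<And>\<tau>. x \<le> \<tau> \<Longrightarrow> \<tau> \<le> y \<Longrightarrow> V \<tau> > D"
    and "b_star a b f y D < b" "rho x D + rho y D = ennreal L" "L \<ge> 0"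
  shows "reach I f D L x y"
proof -
  have Dy: "D < V y" using assms(3,4) by auto
  with assms(2) show ?thesis
  proof (cases rule: b_star_cases)
    case none
    then show ?thesis using assms(5) by simp
  next
    case (point B)
    have "b_star a b f x D = ereal B" using b_star_base_change[OF assms(1-4)] point(3) by simp
    then have 1: "h_int f D (ereal x) (ereal B) + h_int f D (ereal y) (ereal B) = ennreal L"
      using assms(6) point(3) by (simp add: rho_def)
    have 2: "V \<tau> > D" if "x \<le> \<tau>" "\<tau> < B" for \<tau>
      using that assms(4)[of \<tau>] point(5)[of \<tau>] by (cases "\<tau> \<le> y") auto
    show ?thesis
      by (rule bounce_reach[OF assms(1,3) _ _ point(1,4) 2 1 assms(7)]) (use point(2) assms(3) in auto)
  qed
qed

text \<open>By connectedness the bouncing times stay below \<open>L\<close> on all levels down to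
  the infimum \<mu> of \<open>V\<close> to the right of \<open>y\<close>. Were \<mu> attained, the
  turning point at level \<mu> would be a minimum with infinite travel time, and the times at nearby
  levels would exceed \<open>L\<close>. So \<mu> is approached only at \<open>b\<close>.\<close>

lemma bounce_family:
  assumes xy: "x \<in> I" "y \<in> I" "x \<le> y" and L: "L \<ge> 0"
    and nosol: "\<And>D. \<not> reach I f D L x y"
    and VD1: "\<And>\<tau>. x \<le> \<tau> \<Longrightarrow> \<tau> \<le> y \<Longrightarrow> V \<tau> > D1"
    and bs: "b_star a b f y D1 < b"
    and lt: "rho x D1 + rho y D1 < ennreal L"
  shows "\<exists>\<mu>. m_b b f = ereal \<mu> \<and> \<mu> < D1 \<and> (\<forall>\<tau>\<in>I. x \<le> \<tau> \<longrightarrow> V \<tau> > \<mu>) \<and>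
    (\<forall>D. \<mu> < D \<longrightarrow> D \<le> D1 \<longrightarrow> rho x D + rho y D < ennreal L)"
proof -
  define S where "S = V ` {\<tau>\<in>I. y \<le> \<tau>}"
  define \<mu> where "\<mu> = Inf S"
  have bdd: "bdd_below S" unfolding S_def bdd_below_def using V_pos by (auto intro!: exI[of _ 0] less_imp_le)
  have ne: "S \<noteq> {}" unfolding S_def using xy by auto
  have \<mu>_le: "\<mu> \<le> V \<tau>" if "\<tau> \<in> I" "y \<le> \<tau>" for \<tau>
    unfolding \<mu>_def by (rule cInf_lower[OF _ bdd]) (use that in \<open>auto simp: S_def\<close>)
  have below: "\<exists>\<tau>\<in>I. y \<le> \<tau> \<and> V \<tau> < D" if "\<mu> < D" for D
    using cInf_lessD[OF ne that[unfolded \<mu>_def]] by (auto simp: S_def)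
  have Dy1: "D1 < V y" "D1 < V x" using VD1 xy by auto
  have V': "V \<tau> > D" if "D \<le> D1" "x \<le> \<tau>" "\<tau> \<le> y" for D \<tau>
    using VD1[OF that(2,3)] that(1) by simp
  have star: "b_star a b f y D < b" "b_star a b f x D < b" if "\<mu> < D" "D \<le> D1" for D
  proof -
    obtain \<tau> where "\<tau> \<in> I" "y \<le> \<tau>" "V \<tau> < D" using below[OF \<open>\<mu> < D\<close>] by blast
    then show "b_star a b f y D < b" "b_star a b f x D < b"
      using b_star_lt_b[of y D \<tau>] b_star_lt_b[of x D \<tau>] xy Dy1 that by auto
  qed
  have cont: "continuous_on {\<mu><..D1} (\<lambda>D. rho x D + rho y D)"
  proof (rule continuous_at_imp_continuous_on, rule ballI)
    fix D assume "D \<in> {\<mu><..D1}"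
    then have D: "\<mu> < D" "D \<le> D1" by auto
    have "(rho x \<longlongrightarrow> rho x D) (at D)" "(rho y \<longlongrightarrow> rho y D) (at D)"
      using rho_tendsto[OF xy(1) _ star(2)[OF D]] rho_tendsto[OF xy(2) _ star(1)[OF D]] Dy1 D by auto
    then show "isCont (\<lambda>D. rho x D + rho y D) D" unfolding isCont_def by (rule tendsto_add)
  qed
  have fin1: "rho y D1 < \<infinity>"
  proof -
    have "rho y D1 \<le> rho x D1 + rho y D1" by simp
    also have "\<dots> < \<infinity>" using lt by (metis ennreal_less_top infinity_ennreal_def less_trans)
    finally show ?thesis .
  qed
  \<comment> \<open>The turning point at level \<open>D1\<close> has negative slope, so smaller
    values of \<open>V\<close> occur beyond it.\<close>
  have \<mu>D1: "\<mu> < D1"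
    using xy(2) Dy1(1)
  proof (cases rule: b_star_cases)
    case (point B)
    have "deriv V B < 0"
      using nondegenerate[OF xy(2) point(1,2,4,5)] fin1 point(3) by (simp add: rho_def)
    then obtain \<tau> where "\<tau> \<in> I" "B < \<tau>" "V \<tau> < D1" using dec_right[OF point(1)] point(4) by auto
    then show ?thesis using \<mu>_le[of \<tau>] point(2) by simp
  qed (use bs in simp)
  have T2: "rho x D + rho y D < ennreal L" if D: "\<mu> < D" "D \<le> D1" for D
  proof (rule connected_avoids_less[OF _ cont _ lt])
    show "connected {\<mu><..D1}" by simp
    show "D1 \<in> {\<mu><..D1}" "D \<in> {\<mu><..D1}" using \<mu>D1 D by auto
    fix D' assume "D' \<in> {\<mu><..D1}"
    then have D': "\<mu> < D'" "D' \<le> D1" by auto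
    show "rho x D' + rho y D' \<noteq> ennreal L"
      using bounce_reach'[OF xy V'[OF D'(2)] star(1)[OF D'] _ L] nosol by blast
  qed
  have attained: "V \<tau> > \<mu>" if \<tau>: "\<tau> \<in> I" "y \<le> \<tau>" for \<tau>
  proof (rule ccontr)
    assume "\<not> V \<tau> > \<mu>"
    then have Vt: "V \<tau> \<le> \<mu>" by simp
    have \<mu>y: "\<mu> < V y" using \<mu>D1 Dy1 by simp
    from xy(2) \<mu>y show False
    proof (cases rule: b_star_cases)
      case none
      then show ?thesis using none(2)[OF \<tau>] Vt by simp
    next
      case (point B)
      \<comment> \<open>A finite time would make the slope at \<open>B\<close> negative and produce
        values below the infimum.\<close>
      have inf: "rho y \<mu> = \<infinity>"
      proof (rule ccontr)
        assume "rho y \<mu> \<noteq> \<infinity>"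
        then have "h_int f \<mu> (ereal y) (ereal B) < \<infinity>" using point(3) by (simp add: rho_def less_top)
        then have "deriv V B < 0" using nondegenerate[OF xy(2) point(1,2,4,5)] by simp
        then obtain \<tau>' where "\<tau>' \<in> I" "B < \<tau>'" "V \<tau>' < \<mu>" using dec_right[OF point(1)] point(4) by auto
        then show False using \<mu>_le[of \<tau>'] point(2) by simp
      qed
      have "eventually (\<lambda>D. ennreal L < rho y D) (at \<mu>)"
        by (rule rho_lower[OF xy(2) \<mu>y]) (simp add: inf)
      then have "eventually (\<lambda>D. ennreal L < rho y D) (at_right \<mu>)"
        by (rule filter_leD[OF at_le, rotated]) simp
      moreover have "eventually (\<lambda>D. \<mu> < D \<and> D < D1) (at_right \<mu>)" by (rule eventually_real_at_right[OF \<mu>D1])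
      ultimately have "eventually (\<lambda>D. False) (at_right \<mu>)"
      proof eventually_elim
        case (elim D)
        have "rho y D \<le> rho x D + rho y D" by simp
        then show ?case using elim T2[of D] by (meson less_imp_le less_le_trans not_less)
      qed
      then show False by simp
    qed
  qed
  have mb: "m_b b f = ereal \<mu>"
  proof (rule antisym)
    show "ereal \<mu> \<le> m_b b f" unfolding m_b_def
    proof (rule Liminf_bounded)
      show "\<forall>\<^sub>F \<tau> in to_b b. ereal \<mu> \<le> ereal (V \<tau>)"
        using eventually_to_b[OF xy(2)] by eventually_elim (use \<mu>_le in auto)
    qed
    show "m_b b f \<le> ereal \<mu>"
    proof (rule ccontr)
      assume "\<not> ?thesis"
      \<comment> \<open>Otherwise \<open>V\<close> would stay above some \<open>z > \<mu>\<close>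
        near \<open>b\<close>, and by compactness above some \<open>D2 > \<mu>\<close> on the rest,
        so \<mu> could not be the infimum.\<close>
      then obtain z where z: "ereal \<mu> < ereal z" "ereal z < m_b b f"
        using ereal_dense2[of "ereal \<mu>" "m_b b f"] by (auto simp: not_le)
      have "eventually (\<lambda>\<tau>. ereal z < ereal (V \<tau>)) (to_b b)"
        using z(2) unfolding m_b_def by (rule less_LiminfD)
      then obtain T0 where T0: "T0 \<in> I" "\<And>\<tau>. \<tau> \<in> I \<Longrightarrow> T0 < \<tau> \<Longrightarrow> ereal z < ereal (V \<tau>)"
        using eventually_to_bD by blast
      let ?T = "max y T0"
      have T: "?T \<in> I" using xy T0 by (simp add: max_def)
      have "V \<tau> > \<mu>" if "y \<le> \<tau>" "\<tau> \<le> ?T" for \<tau>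
        using attained[of \<tau>] I_between[OF xy(2) T that] that by simp
      then obtain D2 where D2: "\<mu> < D2" "\<And>\<tau>. y \<le> \<tau> \<Longrightarrow> \<tau> \<le> ?T \<Longrightarrow> V \<tau> > D2"
        using V_min[OF xy(2) T, of \<mu>] by auto
      obtain \<tau> where \<tau>: "\<tau> \<in> I" "y \<le> \<tau>" "V \<tau> < min z D2" using below[of "min z D2"] z(1) D2(1) by auto
      then show False using D2(2)[of \<tau>] T0(2)[of \<tau>] by (cases "\<tau> \<le> ?T") (auto simp: not_le)
    qed
  qed
  have all: "V \<tau> > \<mu>" if "\<tau> \<in> I" "x \<le> \<tau>" for \<tau>
    using attained[of \<tau>] VD1[of \<tau>] \<mu>D1 that by (cases "\<tau> \<le> y") auto
  show ?thesis using mb \<mu>D1 all T2 by (intro exI[of _ \<mu>]) simp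
qed

text \<open>The limit at \<mu> of the inequality for bouncing times: twice the excess of the
  limiting time over the time to \<open>b\<close>, plus the two direct times to \<open>b\<close>, is
  at most \<open>L\<close>. All base points are compared at the common point \<open>e\<close>, so
  that only \<open>rho e\<close> behaves irregularly.\<close>

lemma limsup_rho_bound:
  assumes xy: "x \<in> I" "y \<in> I" "x \<le> y" and L: "L \<ge> 0"
    and mb: "m_b b f = ereal \<mu>" and \<mu>D1: "\<mu> < D1"
    and gt: "\<And>\<tau>. \<tau> \<in> I \<Longrightarrow> x \<le> \<tau> \<Longrightarrow> V \<tau> > \<mu>"
    and T2: "\<And>D. \<mu> < D \<Longrightarrow> D \<le> D1 \<Longrightarrow> rho x D + rho y D < ennreal L"
    and c: "close_to_b a b f c"
  shows "h_int f \<mu> (ereal c) b < \<infinity>"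
    and "2 * (Limsup (at \<mu>) (\<lambda>D. h_int f D (ereal c) (b_star a b f c D)) - h_int f \<mu> (ereal c) b)
      + h_int f \<mu> (ereal x) b + h_int f \<mu> (ereal y) b \<le> ennreal L"
proof -
  obtain s where s: "s < c" "\<And>\<tau>. \<tau> \<in> I \<Longrightarrow> s < \<tau> \<Longrightarrow> V \<tau> > \<mu>"
    using c mb by (auto simp: close_to_b_def)
  have cI: "c \<in> I" using c by (simp add: close_to_b_def)
  define e where "e = max c y"
  have eI: "e \<in> I" using cI xy by (simp add: e_def max_def)
  have ge: "x \<le> e" "y \<le> e" "c \<le> e" using xy by (auto simp: e_def)
  have gt3: "V \<tau> > \<mu>" if "z \<in> {x, y, c}" "z \<le> \<tau>" "\<tau> \<in> I" for z \<tau>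
    using that gt[of \<tau>] s xy by auto
  have zI: "z \<in> I" "z \<le> e" if "z \<in> {x, y, c}" for z using that xy cI ge by auto
  define H where "H z D = enn2real (h_int f D (ereal z) (ereal e))" for z D
  have "\<exists>D2. \<mu> < D2 \<and> (\<forall>\<tau>. z \<le> \<tau> \<longrightarrow> \<tau> \<le> e \<longrightarrow> V \<tau> > D2)" if z: "z \<in> {x, y, c}" for z
  proof -
    have "V \<tau> > \<mu>" if "z \<le> \<tau>" "\<tau> \<le> e" for \<tau> using gt3[OF z that(1)] I_between[OF zI(1)[OF z] eI that] by simp
    from V_min[OF zI(1)[OF z] eI zI(2)[OF z] this] show ?thesis by blast
  qed
  then obtain DD where DD: "\<And>z. z \<in> {x, y, c} \<Longrightarrow> \<mu> < DD z" "\<And>z \<tau>. z \<in> {x, y, c} \<Longrightarrow> z \<le> \<tau> \<Longrightarrow> \<tau> \<le> e \<Longrightarrow> V \<tau> > DD z"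
    by metis
  define D2 where "D2 = min D1 (min (DD x) (min (DD y) (DD c)))"
  have D2: "\<mu> < D2" "D2 \<le> D1" using DD(1) \<mu>D1 by (auto simp: D2_def)
  have VD2: "V \<tau> > D" if "z \<in> {x, y, c}" "z \<le> \<tau>" "\<tau> \<le> e" "D < D2" for z \<tau> D
    using DD(2)[OF that(1-3)] that(1,4) by (auto simp: D2_def)
  have Hfin: "h_int f D (ereal z) (ereal e) = ennreal (H z D)" if "z \<in> {x, y, c}" "D < D2" for z D
    unfolding H_def using h_int_finite[OF zI(1)[OF that(1)] eI zI(2)[OF that(1)] VD2[OF that(1) _ _ that(2)]]
    by (simp add: less_top)
  have H0: "H z D \<ge> 0" for z D by (simp add: H_def)
  have Hlim: "(H z \<longlongrightarrow> H z \<mu>) (at \<mu>)" if z: "z \<in> {x, y, c}" for z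
  proof -
    have "((\<lambda>D. h_int f D (ereal z) (ereal e)) \<longlongrightarrow> ennreal (H z \<mu>)) (at \<mu>)"
      using h_int_tendsto_at[OF zI(1)[OF z] eI zI(2)[OF z] VD2[OF z _ _ D2(1)]] Hfin[OF z D2(1)] by simp
    from tendsto_enn2real[OF this H0] show ?thesis unfolding H_def .
  qed
  have rz: "rho z D = ennreal (H z D) + rho e D" if "z \<in> {x, y, c}" "D < D2" for z D
    using rho_base_change[OF zI(1)[OF that(1)] eI zI(2)[OF that(1)] VD2[OF that(1) _ _ that(2)]] Hfin[OF that] by simp
  \<comment> \<open>Half of what \<open>L\<close> leaves after the regular parts, hence an upper
    bound for \<open>rho e D\<close>.\<close>
  define K where "K D = (L - H x D - H y D) / 2" for D
  have rK: "rho e D \<le> ennreal (K D) \<and> K D \<ge> 0" if D: "\<mu> < D" "D < D2" for D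
  proof -
    have lt: "ennreal (H x D) + rho e D + (ennreal (H y D) + rho e D) < ennreal L"
      using T2[of D] D D2(2) rz[of x D] rz[of y D] by simp
    have "rho e D < \<infinity>"
    proof (rule ccontr)
      assume "\<not> ?thesis"
      then have "rho e D = top" by (simp add: not_less top_unique)
      then show False using lt by simp
    qed
    then obtain g where g: "rho e D = ennreal g" "g \<ge> 0" by (cases "rho e D" rule: ennreal_cases) auto
    have "ennreal (H x D + g + (H y D + g)) < ennreal L"
      using lt g H0[of x D] H0[of y D] by (simp only: ennreal_plus add_nonneg_nonneg)
    then have "H x D + g + (H y D + g) < L" using H0[of x D] H0[of y D] g by (simp add: ennreal_less_iff del: ennreal_plus)
    then have "g \<le> K D" by (simp add: K_def)
    then show ?thesis using g by (auto intro: ennreal_leI)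
  qed
  have Klim: "(K \<longlongrightarrow> K \<mu>) (at \<mu>)" unfolding K_def using Hlim by (intro tendsto_intros) auto
  have evr: "eventually (\<lambda>D. \<mu> < D \<and> D < D2) (at_right \<mu>)" by (rule eventually_real_at_right[OF D2(1)])
  have Klimr: "(K \<longlongrightarrow> K \<mu>) (at_right \<mu>)" by (rule tendsto_mono[OF at_le Klim]) simp
  have K0: "K \<mu> \<ge> 0"
    by (rule tendsto_lowerbound[OF Klimr eventually_mono[OF evr]]) (use rK in auto)
  have \<mu>e: "\<mu> < V e" using gt3[of x e] eI ge by simp
  have bse: "b_star a b f e \<mu> = b" by (rule b_star_eqI_b[OF eI]) (use gt ge in auto)
  have J: "rho e \<mu> \<le> ennreal (K \<mu>)"
  proof (rule ccontr)
    assume "\<not> ?thesis"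
    then obtain z where z: "ennreal (K \<mu>) < z" "z < rho e \<mu>" using dense[of "ennreal (K \<mu>)" "rho e \<mu>"] by (auto simp: not_le)
    have "eventually (\<lambda>D. z < rho e D) (at_right \<mu>)"
      by (rule filter_leD[OF at_le rho_lower[OF eI \<mu>e z(2)]]) simp
    moreover have "eventually (\<lambda>D. ennreal (K D) < z) (at_right \<mu>)"
      by (rule order_tendstoD(2)[OF tendsto_ennrealI[OF Klimr] z(1)])
    ultimately have "eventually (\<lambda>D. False) (at_right \<mu>)" using evr
    proof eventually_elim
      case (elim D)
      then show ?case using rK[of D] by (meson less_le_trans less_asym)
    qed
    then show False by simp
  qed
  then have "rho e \<mu> \<noteq> top" by (auto simp: top_unique)
  then obtain j where j: "rho e \<mu> = ennreal j" "j \<ge> 0" by (cases "rho e \<mu>" rule: ennreal_cases) auto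
  have jK: "j \<le> K \<mu>" using J K0 j by (simp add: ennreal_le_iff)
  have Jz: "h_int f \<mu> (ereal z) b = ennreal (H z \<mu> + j)" if z: "z \<in> {x, y, c}" for z
  proof -
    have "b_star a b f z \<mu> = b" by (rule b_star_eqI_b[OF zI(1)[OF z]]) (use gt3[OF z] in auto)
    then have "h_int f \<mu> (ereal z) b = rho z \<mu>" by (simp add: rho_def)
    then show ?thesis using rz[OF z D2(1)] j H0 by (simp add: ennreal_plus)
  qed
  show "h_int f \<mu> (ereal c) b < \<infinity>" using Jz[of c] by simp
  let ?Ls = "Limsup (at \<mu>) (\<lambda>D. h_int f D (ereal c) (b_star a b f c D))"
  have "?Ls \<le> ennreal (H c \<mu> + K \<mu>)"
    unfolding Limsup_le_iff
  proof (intro allI impI)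
    fix z assume z: "ennreal (H c \<mu> + K \<mu>) < z"
    have "((\<lambda>D. ennreal (H c D + K D)) \<longlongrightarrow> ennreal (H c \<mu> + K \<mu>)) (at \<mu>)"
      by (intro tendsto_ennrealI tendsto_add Hlim Klim) simp
    from order_tendstoD(2)[OF this z] have 1: "eventually (\<lambda>D. ennreal (H c D + K D) < z) (at \<mu>)" .
    have "((\<lambda>D. ennreal (H c D + K \<mu>)) \<longlongrightarrow> ennreal (H c \<mu> + K \<mu>)) (at \<mu>)"
      by (intro tendsto_ennrealI tendsto_add Hlim tendsto_const) simp
    from order_tendstoD(2)[OF this z] have 2: "eventually (\<lambda>D. ennreal (H c D + K \<mu>) < z) (at \<mu>)" .
    have 3: "eventually (\<lambda>D. D < D2) (at \<mu>)" by (rule order_tendstoD(2)[OF tendsto_ident_at D2(1)])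
    have 4: "eventually (\<lambda>D. D \<noteq> \<mu>) (at \<mu>)" by (simp add: eventually_at_filter)
    from 1 2 3 4 show "eventually (\<lambda>D. h_int f D (ereal c) (b_star a b f c D) < z) (at \<mu>)"
    proof eventually_elim
      case (elim D)
      have r: "h_int f D (ereal c) (b_star a b f c D) = ennreal (H c D) + rho e D"
        using rz[of c D] elim(3) by (simp add: rho_def)
      show ?case
      proof (cases "D > \<mu>")
        case True
        have "ennreal (H c D) + rho e D \<le> ennreal (H c D) + ennreal (K D)"
          using rK[OF True elim(3)] by (intro add_left_mono) auto
        also have "\<dots> = ennreal (H c D + K D)" using rK[OF True elim(3)] H0 by (simp add: ennreal_plus)
        finally show ?thesis using r elim(1) by (auto intro: le_less_trans)
      next
        case False
        \<comment> \<open>The limit superior is two-sided. Below \<mu> the time is bounded by the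
          time to \<open>b\<close> at level \<mu>, by monotonicity in the level.\<close>
        then have D: "D < \<mu>" using elim(4) by simp
        have "rho e D \<le> h_int f D (ereal e) b"
          unfolding rho_def using b_star_le[OF eI, of D] D \<mu>e by (intro h_int_mono) auto
        also have "\<dots> \<le> h_int f \<mu> (ereal e) b"
        proof (rule h_int_mono_D)
          fix \<tau> assume "\<tau> \<in> interval_I (ereal e) b"
          then have "e \<le> \<tau>" "ereal \<tau> < b" by (auto simp: interval_I_def)
          then show "\<mu> < V \<tau>" using b_star_V(2)[OF eI \<mu>e, of \<tau>] bse by simp
        qed (use D in simp)
        also have "\<dots> \<le> ennreal (K \<mu>)" using J bse by (simp add: rho_def)
        finally have "ennreal (H c D) + rho e D \<le> ennreal (H c D) + ennreal (K \<mu>)" by (rule add_left_mono)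
        also have "\<dots> = ennreal (H c D + K \<mu>)" using K0 H0 by (simp add: ennreal_plus)
        finally show ?thesis using r elim(2) by (auto intro: le_less_trans)
      qed
    qed
  qed
  then have "?Ls - h_int f \<mu> (ereal c) b \<le> ennreal (H c \<mu> + K \<mu>) - ennreal (H c \<mu> + j)"
    unfolding Jz[of c, simplified] by (rule ennreal_minus_mono) simp
  also have "\<dots> = ennreal (K \<mu> - j)" using H0[of c \<mu>] j(2) by (subst ennreal_minus) auto
  finally have "2 * (?Ls - h_int f \<mu> (ereal c) b) \<le> 2 * ennreal (K \<mu> - j)" by (rule mult_left_mono) simp
  also have "\<dots> = ennreal (2 * (K \<mu> - j))" using jK by (subst ennreal_mult) auto
  finally have "2 * (?Ls - h_int f \<mu> (ereal c) b) + h_int f \<mu> (ereal x) b + h_int f \<mu> (ereal y) b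
    \<le> ennreal (2 * (K \<mu> - j)) + ennreal (H x \<mu> + j) + ennreal (H y \<mu> + j)"
    using Jz[of x] Jz[of y] by (intro add_mono) auto
  also have "\<dots> = ennreal (2 * (K \<mu> - j) + (H x \<mu> + j) + (H y \<mu> + j))"
    using jK H0[of x \<mu>] H0[of y \<mu>] j(2) by (simp add: ennreal_plus[symmetric] del: ennreal_plus)
  also have "2 * (K \<mu> - j) + (H x \<mu> + j) + (H y \<mu> + j) = L" by (simp add: K_def field_simps)
  finally show "2 * (?Ls - h_int f \<mu> (ereal c) b) + h_int f \<mu> (ereal x) b + h_int f \<mu> (ereal y) b \<le> ennreal L" .
qed

text \<open>The bound \<open>2 * dd \<le> L\<close> is strict since the time from \<open>x\<close>
  to \<open>b\<close> is positive. With \<open>L \<le> d\<close> this excludes an infinite time and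
  \<open>2 * dd \<ge> d\<close>, and the remaining alternative of (C) supplies a level whose passage
  from the left turning point to \<open>b\<close> takes less than \<open>L / 2\<close>.\<close>

lemma cond_b_consequence:
  assumes xy: "x \<in> I" "y \<in> I" "x \<le> y" and L: "L \<ge> 0"
    and mb: "m_b b f = ereal \<mu>" and \<mu>D1: "\<mu> < D1"
    and gt: "\<And>\<tau>. \<tau> \<in> I \<Longrightarrow> x \<le> \<tau> \<Longrightarrow> V \<tau> > \<mu>"
    and T2: "\<And>D. \<mu> < D \<Longrightarrow> D \<le> D1 \<Longrightarrow> rho x D + rho y D < ennreal L"
    and cond: "cond_b a b f d" and Ld: "ennreal L \<le> d"
  shows "\<exists>c D. close_to_b a b f c \<and> m_inf a b f < D \<and> D \<le> \<mu> \<and>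
    2 * h_int f D (a_star a b f c D) b < ennreal L"
proof -
  have "rel_min_at_b a b f" unfolding rel_min_at_b_def mb using xy(1) gt by (intro bexI[of _ x]) auto
  then obtain c where c: "close_to_b a b f c" and
    alt: "h_int f \<mu> (ereal c) b = \<infinity> \<or>
        d \<le> 2 * (Limsup (at \<mu>) (\<lambda>D. h_int f D (ereal c) (b_star a b f c D)) - h_int f \<mu> (ereal c) b) \<or>
        m_inf a b f < \<mu> \<and> (INF D\<in>{m_inf a b f<..\<mu>}. h_int f D (a_star a b f c D) b)
          \<le> Limsup (at \<mu>) (\<lambda>D. h_int f D (ereal c) (b_star a b f c D)) - h_int f \<mu> (ereal c) b"
    using cond unfolding cond_b_def mb Let_def by auto
  define dd where "dd = Limsup (at \<mu>) (\<lambda>D. h_int f D (ereal c) (b_star a b f c D)) - h_int f \<mu> (ereal c) b"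
  note lb = limsup_rho_bound[OF xy L mb \<mu>D1 gt T2 c, folded dd_def]
  have pos: "h_int f \<mu> (ereal x) b > 0"
  proof -
    obtain t where t: "ereal x < ereal t" "ereal t < b" using ereal_dense2[of "ereal x" b] xy(1) by (auto simp: I_ereal)
    then have tI: "t \<in> I" using xy(1) less_trans[of a "ereal x" "ereal t"] by (simp add: I_ereal)
    have "0 < h_int f \<mu> (ereal x) (ereal t)"
      using t(1) gt I_between[OF xy(1) tI] by (intro h_int_pos xy(1) tI) auto
    also have "\<dots> \<le> h_int f \<mu> (ereal x) b" using t(2) by (intro h_int_mono) auto
    finally show ?thesis .
  qed
  have "2 * dd + h_int f \<mu> (ereal x) b \<le> 2 * dd + h_int f \<mu> (ereal x) b + h_int f \<mu> (ereal y) b" by simp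
  also have "\<dots> \<le> ennreal L" by (rule lb(2))
  finally have le: "2 * dd + h_int f \<mu> (ereal x) b \<le> ennreal L" .
  have "2 * dd \<le> 2 * dd + h_int f \<mu> (ereal x) b" by simp
  then have "2 * dd \<le> ennreal L" using le by (rule order_trans)
  then have "2 * dd \<noteq> \<infinity>" by (metis ennreal_neq_top infinity_ennreal_def top.extremum_uniqueI)
  then have "2 * dd + 0 < 2 * dd + h_int f \<mu> (ereal x) b"
    unfolding ennreal_add_left_cancel_less using pos by simp
  then have "2 * dd < 2 * dd + h_int f \<mu> (ereal x) b" by (simp only: add_0_right)
  then have lt: "2 * dd < ennreal L" using le by (rule less_le_trans)
  have 3: "m_inf a b f < \<mu>" "(INF D\<in>{m_inf a b f<..\<mu>}. h_int f D (a_star a b f c D) b) \<le> dd"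
    using alt lb(1) lt Ld unfolding dd_def[symmetric] by (auto dest: less_le_trans)
  have "dd < ennreal (L / 2)"
  proof (rule ccontr)
    assume "\<not> ?thesis"
    then have "2 * ennreal (L / 2) \<le> 2 * dd" by (intro mult_left_mono) auto
    moreover have "2 * ennreal (L / 2) = ennreal L" using L by (subst ennreal_numeral[symmetric], subst ennreal_mult[symmetric]) auto
    ultimately show False using lt by simp
  qed
  then have "(INF D\<in>{m_inf a b f<..\<mu>}. h_int f D (a_star a b f c D) b) < ennreal (L / 2)"
    using 3(2) by (rule le_less_trans[rotated])
  then obtain D where D: "D \<in> {m_inf a b f<..\<mu>}" "h_int f D (a_star a b f c D) b < ennreal (L / 2)"
    unfolding INF_less_iff by blast
  have "2 * h_int f D (a_star a b f c D) b < ennreal L"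
  proof -
    obtain g where g: "h_int f D (a_star a b f c D) b = ennreal g" "g \<ge> 0" "g < L / 2"
      using D(2) by (cases "h_int f D (a_star a b f c D) b" rule: ennreal_cases) (auto simp: ennreal_less_iff)
    have "2 * ennreal g = ennreal (2 * g)" using g by (subst ennreal_mult) auto
    then show ?thesis using g by (simp add: ennreal_less_iff)
  qed
  then show ?thesis using c D(1) by auto
qed

lemma m_inf_less:
  assumes "\<And>\<tau>. \<tau> \<in> I \<Longrightarrow> V \<tau> \<ge> D"
  shows "D \<le> m_inf a b f"
proof -
  obtain t where "t \<in> I" using ab ereal_dense2[of a b] by (auto simp: I_ereal)
  then show ?thesis unfolding m_inf_def using assms by (intro cINF_greatest) auto
qed

text \<open>The level \<open>D\<close> found at \<open>b\<close> starts a bouncing family on the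
  left: \<open>D > m_inf\<close> forces a turning point there, and the two times to it are parts of
  the short passage to \<open>b\<close>. In the mirror the same argument ends at a lower bound \<nu>
  of \<open>V\<close> on all of \<open>I\<close>, and then no level between \<open>m_inf\<close> and
  \<nu> is left for condition (C) at \<open>a\<close>.\<close>

lemma bounce_family_cond_C:
  assumes xy: "x \<in> I" "y \<in> I" "x \<le> y" and L: "L \<ge> 0"
    and nosol: "\<And>D. \<not> reach I f D L x y"
    and VD1: "\<And>\<tau>. x \<le> \<tau> \<Longrightarrow> \<tau> \<le> y \<Longrightarrow> V \<tau> > D1"
    and bs: "b_star a b f y D1 < b"
    and lt: "rho x D1 + rho y D1 < ennreal L"
    and cond: "cond_b a b f d" "cond_b (- b) (- a) (\<lambda>x. f (- x)) d" and Ld: "ennreal L \<le> d"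
  shows False
proof -
  interpret R: warped_interval "- b" "- a" "\<lambda>x. f (- x)" by (rule reflected)
  obtain \<mu> where \<mu>: "m_b b f = ereal \<mu>" "\<mu> < D1" "\<And>\<tau>. \<tau> \<in> I \<Longrightarrow> x \<le> \<tau> \<Longrightarrow> V \<tau> > \<mu>"
    "\<And>D. \<mu> < D \<Longrightarrow> D \<le> D1 \<Longrightarrow> rho x D + rho y D < ennreal L"
    using bounce_family[OF xy L nosol VD1 bs lt] by blast
  obtain c D where c: "close_to_b a b f c" and D: "m_inf a b f < D" "D \<le> \<mu>"
    "2 * h_int f D (a_star a b f c D) b < ennreal L"
    using cond_b_consequence[OF xy L \<mu> cond(1) Ld] by blast
  have cI: "c \<in> I" using c by (simp add: close_to_b_def)
  obtain s where s: "s < c" "\<And>\<tau>. \<tau> \<in> I \<Longrightarrow> s < \<tau> \<Longrightarrow> V \<tau> > \<mu>"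
    using c \<mu>(1) by (auto simp: close_to_b_def)
  have Vc: "V \<tau> > D" if "\<tau> \<in> I" "x \<le> \<tau> \<or> c \<le> \<tau>" for \<tau>
    using that \<mu>(3)[of \<tau>] s D(2) by fastforce
  have rI: "- t \<in> interval_I (- b) (- a)" if "t \<in> I" for t using that by (simp add: interval_I_reflect)
  have Dx: "D < warp (\<lambda>x. f (- x)) (- x)" "D < warp (\<lambda>x. f (- x)) (- c)" "D < warp (\<lambda>x. f (- x)) (- y)"
    using Vc xy cI by (auto simp: warp_reflect)
  have seg: "D < warp (\<lambda>x. f (- x)) \<tau>" if "u \<in> {x, y, c}" "v \<in> {x, y, c}" "- v \<le> \<tau>" "\<tau> \<le> - u" for u v \<tau>
  proof -
    have "- \<tau> \<in> I" by (rule I_between[of u v]) (use that xy cI in auto)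
    then show ?thesis unfolding warp_reflect using Vc[of "- \<tau>"] that xy by auto
  qed
  have base: "b_star (- b) (- a) (\<lambda>x. f (- x)) (- u) D = b_star (- b) (- a) (\<lambda>x. f (- x)) (- v) D"
    if "u \<in> {x, y, c}" "v \<in> {x, y, c}" for u v
  proof (cases "u \<le> v")
    case True
    show ?thesis
      by (rule R.b_star_base_change) (use that True xy cI rI seg[of u v] in auto)
  next
    case False
    show ?thesis
      by (rule R.b_star_base_change[symmetric]) (use that False xy cI rI seg[of v u] in auto)
  qed
  have bs': "b_star (- b) (- a) (\<lambda>x. f (- x)) (- x) D < - a"
  proof (rule ccontr)
    assume *: "\<not> ?thesis"
    have "V \<tau> \<ge> D" if "\<tau> \<in> I" for \<tau>
    proof (cases "x \<le> \<tau>")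
      case True
      then show ?thesis using Vc[OF that] by simp
    next
      case False
      have "ereal (- \<tau>) < - a"
        using that ereal_less_uminus_reorder[of "ereal (- \<tau>)" a] by (simp add: I_ereal)
      then have "ereal (- \<tau>) < b_star (- b) (- a) (\<lambda>x. f (- x)) (- x) D" using * by (auto simp: not_less intro: less_le_trans)
      from R.b_star_V(2)[OF rI[OF xy(1)] Dx(1) _ this] False show ?thesis by (simp add: warp_reflect)
    qed
    then have "D \<le> m_inf a b f" by (rule m_inf_less)
    then show False using D(1) by simp
  qed
  have as: "a_star a b f u D = a_star a b f c D" if "u \<in> {x, y, c}" for u
    using base[OF that, of c] a_star_reflect[of u D] a_star_reflect[of c D] that xy cI by auto
  have Rrho: "R.rho (- u) D = h_int f D (a_star a b f c D) (ereal u)" if "u \<in> {x, y}" for u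
    unfolding R.rho_def using h_int_b_star_reflect[of u u D] that xy as[of u]
    by (auto simp: I_ereal less_imp_le)
  have lt': "R.rho (- y) D + R.rho (- x) D < ennreal L"
  proof -
    have "R.rho (- u) D \<le> h_int f D (a_star a b f c D) b" if "u \<in> {x, y}" for u
      unfolding Rrho[OF that] using that xy by (intro h_int_mono) (auto simp: I_ereal less_imp_le)
    then have "R.rho (- y) D + R.rho (- x) D \<le> h_int f D (a_star a b f c D) b + h_int f D (a_star a b f c D) b"
      by (intro add_mono) auto
    also have "\<dots> = 2 * h_int f D (a_star a b f c D) b" by (simp add: mult_2)
    finally show ?thesis using D(3) by (rule le_less_trans)
  qed
  have nosol': "\<not> reach (interval_I (- b) (- a)) (\<lambda>x. f (- x)) D L (- y) (- x)" for D
    using reach_reflect[of D L y x] reach_reverse nosol by blast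
  have yx: "- y \<in> interval_I (- b) (- a)" "- x \<in> interval_I (- b) (- a)" "- y \<le> - x" using rI xy by auto
  have segD: "D < warp (\<lambda>x. f (- x)) \<tau>" if "- y \<le> \<tau>" "\<tau> \<le> - x" for \<tau>
    using seg[of x y \<tau>] that by simp
  obtain \<nu> where \<nu>: "m_b (- a) (\<lambda>x. f (- x)) = ereal \<nu>" "\<nu> < D"
    "\<And>\<tau>. \<tau> \<in> interval_I (- b) (- a) \<Longrightarrow> - y \<le> \<tau> \<Longrightarrow> warp (\<lambda>x. f (- x)) \<tau> > \<nu>"
    "\<And>D'. \<nu> < D' \<Longrightarrow> D' \<le> D \<Longrightarrow> R.rho (- y) D' + R.rho (- x) D' < ennreal L"
    using R.bounce_family[OF yx L nosol' segD bs' lt'] by blast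
  obtain D' where D': "m_inf (- b) (- a) (\<lambda>x. f (- x)) < D'" "D' \<le> \<nu>"
    using R.cond_b_consequence[OF yx L \<nu> cond(2) Ld] by blast
  have "V \<tau> \<ge> \<nu>" if \<tau>: "\<tau> \<in> I" for \<tau>
  proof (cases "\<tau> \<le> y")
    case True
    then show ?thesis using \<nu>(3)[OF rI[OF \<tau>]] by (simp add: warp_reflect)
  next
    case False
    then show ?thesis using Vc[OF \<tau>] xy(3) \<nu>(2) by simp
  qed
  then have "\<nu> \<le> m_inf a b f" by (rule m_inf_less)
  then show False using D' by (simp add: m_inf_reflect)
qed

end

section \<open>The oscillating family of trajectories\<close>

context warped_interval begin

text \<open>The mirror image of \<open>rho\<close>: travel time from the left turning point, or from
  \<open>a\<close> if there is none.\<close>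

definition lam :: "real \<Rightarrow> real \<Rightarrow> ennreal" where
  "lam e D = h_int f D (a_star a b f e D) (ereal e)"

lemma lam_eq_rho_reflect:
  assumes "e \<in> I"
  shows "warped_interval.rho (- b) (- a) (\<lambda>x. f (- x)) (- e) D = lam e D"
proof -
  interpret R: warped_interval "- b" "- a" "\<lambda>x. f (- x)" by (rule reflected)
  show ?thesis unfolding R.rho_def lam_def
    using h_int_b_star_reflect[OF assms, of e D] assms by (simp add: I_ereal less_imp_le)
qed

lemma lam_tendsto:
  assumes "e \<in> I" "D0 < V e" "a < a_star a b f e D0"
  shows "(lam e \<longlongrightarrow> lam e D0) (at D0)"
proof -
  interpret R: warped_interval "- b" "- a" "\<lambda>x. f (- x)" by (rule reflected)
  have eq: "R.rho (- e) = lam e" by (rule ext) (rule lam_eq_rho_reflect[OF assms(1)])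
  have "b_star (- b) (- a) (\<lambda>x. f (- x)) (- e) D0 < - a"
    using assms(3) unfolding a_star_reflect[OF assms(1)]
    using ereal_less_uminus_reorder[of "b_star (- b) (- a) (\<lambda>x. f (- x)) (- e) D0" a] by simp
  moreover have "- e \<in> interval_I (- b) (- a)" using assms(1) by (simp add: interval_I_reflect)
  ultimately show ?thesis using R.rho_tendsto[of "- e" D0] assms(2) unfolding eq by (simp add: warp_reflect)
qed

lemma lam_lower:
  assumes "e \<in> I" "D0 < V e" "z < lam e D0"
  shows "eventually (\<lambda>D. z < lam e D) (at D0)"
proof -
  interpret R: warped_interval "- b" "- a" "\<lambda>x. f (- x)" by (rule reflected)
  have eq: "R.rho (- e) = lam e" by (rule ext) (rule lam_eq_rho_reflect[OF assms(1)])
  have "- e \<in> interval_I (- b) (- a)" using assms(1) by (simp add: interval_I_reflect)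
  then show ?thesis using R.rho_lower[of "- e" D0 z] assms(2,3) unfolding eq by (simp add: warp_reflect)
qed

lemma lam_base_change:
  assumes "x \<in> I" "e \<in> I" "x \<le> e" "\<And>\<tau>. x \<le> \<tau> \<Longrightarrow> \<tau> \<le> e \<Longrightarrow> V \<tau> > D"
  shows "lam e D = lam x D + h_int f D (ereal x) (ereal e)"
proof -
  interpret R: warped_interval "- b" "- a" "\<lambda>x. f (- x)" by (rule reflected)
  have "R.rho (- e) D = h_int (\<lambda>x. f (- x)) D (ereal (- e)) (ereal (- x)) + R.rho (- x) D"
    by (rule R.rho_base_change) (use assms in \<open>auto simp: interval_I_reflect warp_reflect\<close>)
  then show ?thesis
    using lam_eq_rho_reflect[OF assms(1)] lam_eq_rho_reflect[OF assms(2)]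
      h_int_reflect[of "ereal x" "ereal e" D] assms(1,2)
    by (simp add: I_ereal less_imp_le add.commute)
qed

lemma a_star_base_change:
  assumes "x \<in> I" "e \<in> I" "x \<le> e" "\<And>\<tau>. x \<le> \<tau> \<Longrightarrow> \<tau> \<le> e \<Longrightarrow> V \<tau> > D"
  shows "a_star a b f x D = a_star a b f e D"
proof -
  interpret R: warped_interval "- b" "- a" "\<lambda>x. f (- x)" by (rule reflected)
  have "b_star (- b) (- a) (\<lambda>x. f (- x)) (- x) D = b_star (- b) (- a) (\<lambda>x. f (- x)) (- e) D"
    by (rule R.b_star_base_change) (use assms in \<open>auto simp: interval_I_reflect warp_reflect\<close>)
  then show ?thesis using a_star_reflect assms by simp
qed

lemma a_star_gt_a_of_m_a:
  assumes "e \<in> I" "D < V e" "m_a a f < ereal D"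
  shows "a < a_star a b f e D"
proof -
  interpret R: warped_interval "- b" "- a" "\<lambda>x. f (- x)" by (rule reflected)
  have "b_star (- b) (- a) (\<lambda>x. f (- x)) (- e) D < - a"
    by (rule R.b_star_lt_b_of_m_b) (use assms in \<open>auto simp: interval_I_reflect warp_reflect m_b_reflect[OF ab]\<close>)
  then show ?thesis unfolding a_star_reflect[OF assms(1)]
    using ereal_less_uminus_reorder[of "b_star (- b) (- a) (\<lambda>x. f (- x)) (- e) D" a] by simp
qed

lemma a_star_point:
  assumes "e \<in> I" "D < V e" "a < a_star a b f e D"
  obtains A where "A \<in> I" "A < e" "a_star a b f e D = ereal A" "V A = D"
    "\<And>\<tau>. A < \<tau> \<Longrightarrow> \<tau> \<le> e \<Longrightarrow> V \<tau> > D"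
proof -
  interpret R: warped_interval "- b" "- a" "\<lambda>x. f (- x)" by (rule reflected)
  have "- e \<in> interval_I (- b) (- a)" "D < warp (\<lambda>x. f (- x)) (- e)"
    using assms by (simp_all add: interval_I_reflect warp_reflect)
  then show ?thesis
  proof (cases rule: R.b_star_cases)
    case none
    then have "a_star a b f e D = a" using a_star_reflect[OF assms(1)] by simp
    then show ?thesis using assms(3) by simp
  next
    case (point B)
    show ?thesis
    proof (rule that[of "- B"])
      show "- B \<in> I" using point(1) by (simp add: interval_I_reflect)
      show "V \<tau> > D" if "- B < \<tau>" "\<tau> \<le> e" for \<tau>
        using point(5)[of "- \<tau>"] that by (simp add: warp_reflect)
    qed (use point a_star_reflect[OF assms(1)] in \<open>auto simp: warp_reflect\<close>)
  qed
qed

text \<open>Where \<open>V\<close> decreases, a level just below \<open>V y\<close> has its turning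
  point close to \<open>y\<close>, and \<open>turning_small\<close> bounds the time to it.\<close>

lemma rho_at_left:
  assumes "y \<in> I" "deriv V y < 0"
  shows "(rho y \<longlongrightarrow> 0) (at_left (V y))"
proof (rule order_tendstoI)
  fix z :: ennreal assume "0 < z"
  then obtain w where w: "0 < w" "w < z" using dense by blast
  then have "w \<noteq> top" by auto
  then obtain \<epsilon> where \<epsilon>: "w = ennreal \<epsilon>" "\<epsilon> > 0" using w(1) by (cases w rule: ennreal_cases) auto
  obtain \<delta> where \<delta>: "\<delta> > 0" "y + \<delta> \<in> I" "\<And>s t. y - \<delta> \<le> s \<Longrightarrow> s < t \<Longrightarrow> t \<le> y + \<delta> \<Longrightarrow> V t < V s"
    "\<And>s t. y - \<delta> \<le> s \<Longrightarrow> s \<le> t \<Longrightarrow> t \<le> y + \<delta> \<Longrightarrow> h_int f (V t) (ereal s) (ereal t) \<le> ennreal \<epsilon>"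
    using turning_small[OF assms \<epsilon>(2) zero_less_one] by metis
  have lt: "V (y + \<delta>) < V y" using \<delta>(3)[of y "y + \<delta>"] \<delta>(1) by simp
  have "eventually (\<lambda>D. D \<in> {V (y + \<delta>)<..<V y}) (at_left (V y))" by (rule eventually_at_left_real[OF lt])
  then show "eventually (\<lambda>D. rho y D < z) (at_left (V y))"
  proof eventually_elim
    case (elim D)
    then have D: "V (y + \<delta>) < D" "D < V y" by auto
    from assms(1) D(2) show ?case
    proof (cases rule: b_star_cases)
      case none
      then show ?thesis using none(2)[OF \<delta>(2)] D \<delta>(1) by simp
    next
      case (point B)
      have "\<not> y + \<delta> < B" using point(5)[of "y + \<delta>"] D(1) \<delta>(1) by auto
      then have "rho y D \<le> ennreal \<epsilon>"
        unfolding rho_def point(3) using \<delta>(4)[of y B] \<delta>(1) point(2,4) by simp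
      then show ?thesis using w \<epsilon> by (auto intro: le_less_trans)
    qed
  qed
qed simp

text \<open>As the level rises to \<open>V y\<close>, the detour beyond \<open>y\<close> costs
  \<open>2 * rho y D\<close>, which tends to 0. So the bouncing family continues the direct
  one.\<close>

lemma bounce_start:
  assumes xy: "x \<in> I" "y \<in> I" "x \<le> y"
    and min: "\<And>\<tau>. x \<le> \<tau> \<Longrightarrow> \<tau> \<le> y \<Longrightarrow> V \<tau> \<ge> V y" "\<And>\<tau>. x < \<tau> \<Longrightarrow> \<tau> < y \<Longrightarrow> V \<tau> > V y"
    and dy: "deriv V y < 0" and lt: "h_int f (V y) (ereal x) (ereal y) < z"
  shows "eventually (\<lambda>D. b_star a b f y D < b \<and> rho x D + rho y D < z \<and> D < V y) (at_left (V y))"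
proof -
  have P: "((\<lambda>D. h_int f D (ereal x) (ereal y)) \<longlongrightarrow> h_int f (V y) (ereal x) (ereal y)) (at_left (V y))"
    by (rule tendsto_within_subset[OF h_int_tendsto[OF xy min(2), of "V y"]]) auto
  have "((\<lambda>D. h_int f D (ereal x) (ereal y) + rho y D + rho y D) \<longlongrightarrow> h_int f (V y) (ereal x) (ereal y) + 0 + 0) (at_left (V y))"
    by (intro tendsto_add P rho_at_left xy(2) dy)
  then have 1: "eventually (\<lambda>D. h_int f D (ereal x) (ereal y) + rho y D + rho y D < z) (at_left (V y))"
    using lt by (intro order_tendstoD(2)) auto
  obtain \<tau> where \<tau>: "\<tau> \<in> I" "y < \<tau>" "V \<tau> < V y" using dec_right[OF xy(2) dy] by blast
  have 2: "eventually (\<lambda>D. D \<in> {V \<tau><..<V y}) (at_left (V y))" by (rule eventually_at_left_real[OF \<tau>(3)])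
  from 1 2 show ?thesis
  proof eventually_elim
    case (elim D)
    then have D: "V \<tau> < D" "D < V y" by auto
    have "rho x D = h_int f D (ereal x) (ereal y) + rho y D"
      by (rule rho_base_change[OF xy]) (use min(1) D in \<open>auto intro: less_le_trans\<close>)
    then show ?case using elim(1) b_star_lt_b[OF xy(2) D(2) \<tau>(1)] \<tau>(2) D by simp
  qed
qed

text \<open>\<open>l\<close>, \<open>q\<close> and \<open>r\<close> are the times from
  \<open>A\<close> to \<open>y\<close>, from \<open>x\<close> to \<open>y\<close> and from
  \<open>y\<close> to \<open>B\<close>; thus \<open>W = l + r\<close>, \<open>Z x = q + r\<close>
  and \<open>Z y = r\<close> in \<open>periodic_reach\<close>.\<close>

lemma periodic_reach':
  assumes ends: "A \<in> I" "B \<in> I" "A < B" "A \<le> x" "x \<le> y" "y \<le> B"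
    and lev: "\<And>\<tau>. A < \<tau> \<Longrightarrow> \<tau> < B \<Longrightarrow> V \<tau> > D" "V A = D" "V B = D"
    and l: "h_int f D (ereal A) (ereal y) = ennreal l" "l \<ge> 0"
    and q: "h_int f D (ereal x) (ereal y) = ennreal q" "q \<ge> 0"
    and r: "h_int f D (ereal y) (ereal B) = ennreal r" "r \<ge> 0"
    and s: "\<bar>\<epsilon>\<bar> = 1" "\<bar>\<delta>\<bar> = 1" and L: "L = 2 * of_int k * (l + r) + \<epsilon> * (q + r) + \<delta> * r"
  shows "reach I f D L x y"
proof -
  have AI: "a \<le> ereal A" "ereal B \<le> b" "a \<le> ereal x"
    using ends I_between[OF ends(1,2), of x] by (auto simp: I_ereal less_imp_le)
  have AB': "h_int f D (ereal A) (ereal B) = ennreal (l + r)"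
    using h_int_add[OF AI(1,2), of y D] ends l r by simp
  interpret orbit a b f D A B
    by unfold_locales (use ends lev AB' in auto)
  have "A \<le> y" using ends by simp
  then have Zy: "Z y = r" using Z_h_int[of y] Z_nonneg[of y] ends r by simp
  have "h_int f D (ereal x) (ereal B) = ennreal (q + r)"
    using h_int_add[OF AI(3,2), of y D] ends q r by simp
  then have "ennreal (Z x) = ennreal (q + r)" using Z_h_int[of x] ends by simp
  then have Zx: "Z x = q + r" using Z_nonneg[of x] ends q r by (subst (asm) ennreal_inj) auto
  have "ennreal W = ennreal (l + r)" using Z_h_int[of A] ends AB' by (simp add: W_def)
  then have "W = l + r" using W_pos l r by (subst (asm) ennreal_inj) auto
  then show ?thesis
    using periodic_reach[OF lev(2,3), of x y \<epsilon> \<delta> k] ends s L Zx Zy by simp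
qed

text \<open>For \<open>n \<noteq> 0\<close>, \<open>Tin\<close> is the arrival time at
  \<open>y\<close> after \<open>n\<close> bounces, moving right, and \<open>Tout\<close> the one
  after a further bounce, moving left; they differ by \<open>2 * rho y D\<close>. Condition (R) puts
  \<open>L\<close> above some \<open>Tin\<close> and below some \<open>Tout\<close>. Without a hit
  this gives \<open>Tin < L < Tout\<close> on all of \<open>S\<close>, while the two times meet as
  the level tends to \<open>V y\<close>.\<close>

lemma cond_R_contradiction:
  assumes xy: "x \<in> I" "y \<in> I" "x \<le> y" and L: "L \<ge> 0"
    and nosol: "\<And>D. \<not> reach I f D L x y"
    and min: "\<And>\<tau>. x \<le> \<tau> \<Longrightarrow> \<tau> \<le> y \<Longrightarrow> V \<tau> \<ge> V y" "\<And>\<tau>. x < \<tau> \<Longrightarrow> \<tau> < y \<Longrightarrow> V \<tau> > V y"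
    and dy: "deriv V y < 0" and lt: "h_int f (V y) (ereal x) (ereal y) < ennreal L"
    and cond: "cond_R_b a b f d" and Ld: "ennreal L \<le> d"
  shows False
proof -
  define m where "m = m_inf a b f"
  define Y where "Y = V y"
  define S where "S = {m<..<Y}"
  have gtm: "V \<tau> > m" if "\<tau> \<in> I" for \<tau> using cond that by (auto simp: cond_R_b_def m_def)
  have ma: "m_a a f = ereal m" and mb: "m_b b f = ereal m" using cond by (auto simp: cond_R_b_def m_def)
  have mY: "m < Y" using gtm[OF xy(2)] by (simp add: Y_def)
  have start: "eventually (\<lambda>D. b_star a b f y D < b \<and> rho x D + rho y D < ennreal L \<and> D < Y) (at_left Y)"
    unfolding Y_def by (rule bounce_start[OF xy min dy lt])
  have VD: "V \<tau> > D" if "D \<in> S" "x \<le> \<tau>" "\<tau> \<le> y" for D \<tau>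
    using min(1)[OF that(2,3)] that(1) by (simp add: S_def Y_def)
  have Dxy: "D < V x" "D < V y" if "D \<in> S" for D using VD[OF that] xy(3) by auto
  have T2: "rho x D + rho y D < ennreal L" if D: "D \<in> S" for D
  proof -
    have "eventually (\<lambda>D'. D' \<in> {D<..<Y}) (at_left Y)"
      using D by (intro eventually_at_left_real) (simp add: S_def)
    with start have "eventually (\<lambda>D'. D' \<in> {D<..<Y} \<and> b_star a b f y D' < b \<and> rho x D' + rho y D' < ennreal L) (at_left Y)"
      by eventually_elim simp
    then obtain D1 where D1: "D1 \<in> {D<..<Y}" "b_star a b f y D1 < b" "rho x D1 + rho y D1 < ennreal L"
      using eventually_happens'[of "at_left Y"] by auto
    have "D1 \<in> S" using D1(1) D by (simp add: S_def)
    have "\<exists>\<mu>. m_b b f = ereal \<mu> \<and> \<mu> < D1 \<and> (\<forall>\<tau>\<in>I. x \<le> \<tau> \<longrightarrow> V \<tau> > \<mu>) \<and>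
      (\<forall>D. \<mu> < D \<longrightarrow> D \<le> D1 \<longrightarrow> rho x D + rho y D < ennreal L)"
      by (rule bounce_family[OF xy L nosol VD[OF \<open>D1 \<in> S\<close>] D1(2,3)])
    then show ?thesis using mb D D1(1) by (auto simp: S_def)
  qed
  have star: "b_star a b f x D < b" "b_star a b f y D < b" "a < a_star a b f x D" "a < a_star a b f y D" if D: "D \<in> S" for D
    using b_star_lt_b_of_m_b[of _ D] a_star_gt_a_of_m_a[of _ D] xy Dxy[OF D] mb ma D by (auto simp: S_def)
  have rho_x: "rho x D = h_int f D (ereal x) (ereal y) + rho y D" if D: "D \<in> S" for D
    by (rule rho_base_change[OF xy VD[OF D]])
  have lam_y: "lam y D = lam x D + h_int f D (ereal x) (ereal y)" if D: "D \<in> S" for D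
    by (rule lam_base_change[OF xy VD[OF D]])
  have RL: "R_int a b f x D = rho x D" "\<Lambda>_int a b f x D = lam x D" for D
    by (simp_all add: R_int_def \<Lambda>_int_def rho_def lam_def)
  have Sev: "eventually (\<lambda>D. D \<in> S) (at_right m)"
    unfolding S_def by (rule eventually_at_right_real[OF mY])
  obtain T where T: "T \<in> I" "y < T" using dec_right[OF xy(2) dy] by blast
  have "\<exists>n. (n \<noteq> 0 \<longrightarrow> (\<forall>T\<in>I. Liminf (at_right m)
               (\<lambda>D. E_int a b f x n D + of_nat (n - 1) * W_int a b f x D
                      + h_int f D (a_star a b f x D) (ereal T)) \<le> ennreal L)) \<and>
             (\<forall>T\<in>I. ennreal L \<le> Limsup (at_right m)
               (\<lambda>D. E_int a b f x n D + of_nat n * W_int a b f x D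
                      + h_int f D (ereal T) (b_star a b f x D)))"
  proof -
    \<comment> \<open>The premise of (R) holds because the time from \<open>x\<close> to
      \<open>t\<close> is eventually part of the bouncing time, which stays below
      \<open>L\<close>.\<close>
    have "Liminf (at_right m) (\<lambda>D. h_int f D (ereal x) (ereal t)) \<le> ennreal L" if t: "t \<in> I" for t
    proof (rule Liminf_le_eventually)
      show "eventually (\<lambda>D. h_int f D (ereal x) (ereal t) \<le> ennreal L) (at_right m)"
      proof (cases "x \<le> t")
        case False
        then show ?thesis using h_int_empty[of "ereal t" "ereal x"] by simp
      next
        case True
        have "V \<tau> > m" if "x \<le> \<tau>" "\<tau> \<le> t" for \<tau> using gtm I_between[OF xy(1) t that] by simp
        then obtain D2 where D2: "m < D2" "\<And>\<tau>. x \<le> \<tau> \<Longrightarrow> \<tau> \<le> t \<Longrightarrow> V \<tau> > D2"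
          using V_min[OF xy(1) t True, of m] by auto
        have "eventually (\<lambda>D. D \<in> {m<..<D2}) (at_right m)" by (rule eventually_at_right_real[OF D2(1)])
        with Sev show ?thesis
        proof eventually_elim
          case (elim D)
          have "ereal t < b_star a b f x D"
            by (rule b_star_gt[OF xy(1) t True]) (use D2(2) elim(2) in \<open>auto intro: less_trans\<close>)
          then have "h_int f D (ereal x) (ereal t) \<le> rho x D" unfolding rho_def by (intro h_int_mono) auto
          also have "\<dots> \<le> rho x D + rho y D" by simp
          also have "\<dots> \<le> ennreal L" using T2[OF elim(1)] by simp
          finally show ?case .
        qed
      qed
    qed simp
    then show ?thesis using cond xy(1) Ld unfolding cond_R_b_def m_def[symmetric] by blast
  qed
  then obtain n where
    nin: "n \<noteq> 0 \<Longrightarrow> Liminf (at_right m) (\<lambda>D. E_int a b f x n D + of_nat (n - 1) * W_int a b f x D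
                      + h_int f D (a_star a b f x D) (ereal T)) \<le> ennreal L" and
    nout: "ennreal L \<le> Limsup (at_right m) (\<lambda>D. E_int a b f x n D + of_nat n * W_int a b f x D
                      + h_int f D (ereal T) (b_star a b f x D))"
    using T(1) by blast
  define Tin where "Tin D = E_int a b f x n D + of_nat (n - 1) * W_int a b f x D + lam y D" for D
  define Tout where "Tout D = E_int a b f x n D + of_nat n * W_int a b f x D + rho y D" for D
  have "h_int f m (ereal y) (ereal T) > 0"
    using T xy(2) gtm I_between[OF xy(2) T(1)] by (intro h_int_pos) auto
  then obtain w where w: "0 < w" "w < h_int f m (ereal y) (ereal T)" using dense by blast
  then have "w \<noteq> top" by auto
  have L0: "L > 0"
  proof (rule ccontr)
    assume "\<not> ?thesis"
    then have "L = 0" using L by simp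
    then show False using lt by simp
  qed
  \<comment> \<open>Condition (R) bounds times measured at \<open>T\<close>, whereas arrivals take
    place at \<open>y\<close>. Near the level \<open>m\<close> the time from \<open>y\<close> to
    \<open>T\<close> exceeds \<open>c0\<close>, and this margin makes the inequalities at
    \<open>y\<close> strict.\<close>
  define c0 where "c0 = min w (ennreal (L / 2))"
  have c0: "0 < c0" "c0 < h_int f m (ereal y) (ereal T)" "c0 \<le> ennreal (L / 2)"
    using w L0 by (auto simp: c0_def min_less_iff_disj)
  then have c0t: "c0 \<noteq> top" by (auto simp: top_unique)
  have gtyT: "V \<tau> > m" if "y \<le> \<tau>" "\<tau> \<le> T" for \<tau> using gtm I_between[OF xy(2) T(1) that] by simp
  obtain D2 where D2: "m < D2" "\<And>\<tau>. y \<le> \<tau> \<Longrightarrow> \<tau> \<le> T \<Longrightarrow> V \<tau> > D2"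
    using V_min[OF xy(2) T(1) _ gtyT] T(2) by auto
  have ev: "eventually (\<lambda>D. D \<in> S \<and> D < D2 \<and> c0 < h_int f D (ereal y) (ereal T)) (at_right m)"
  proof -
    have "((\<lambda>D. h_int f D (ereal y) (ereal T)) \<longlongrightarrow> h_int f m (ereal y) (ereal T)) (at m)"
      using T(2) by (intro h_int_tendsto_at[OF xy(2) T(1) _ gtyT]) auto
    from order_tendstoD(1)[OF this c0(2)]
    have "eventually (\<lambda>D. c0 < h_int f D (ereal y) (ereal T)) (at_right m)"
      by (rule filter_leD[OF at_le, rotated]) simp
    moreover have "eventually (\<lambda>D. D \<in> {m<..<D2}) (at_right m)" by (rule eventually_at_right_real[OF D2(1)])
    ultimately show ?thesis using Sev by eventually_elim simp
  qed
  have split_T: "rho y D = h_int f D (ereal y) (ereal T) + h_int f D (ereal T) (b_star a b f x D)"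
      "h_int f D (a_star a b f x D) (ereal T) = lam y D + h_int f D (ereal y) (ereal T)"
    if D: "D \<in> S" "D < D2" for D
  proof -
    have "ereal T < b_star a b f y D"
      by (rule b_star_gt[OF xy(2) T(1)]) (use T(2) D2(2) D(2) in \<open>auto intro: less_trans\<close>)
    moreover have "b_star a b f y D = b_star a b f x D" by (rule b_star_base_change[OF xy VD[OF D(1)]])
    ultimately show "rho y D = h_int f D (ereal y) (ereal T) + h_int f D (ereal T) (b_star a b f x D)"
      unfolding rho_def
      using h_int_add[of "ereal y" "b_star a b f y D" T D] b_star_le[OF xy(2) Dxy(2)[OF D(1)]] xy(2) T(2)
      by (simp add: I_ereal less_imp_le)
    obtain A where A: "A \<in> I" "A < y" "a_star a b f y D = ereal A"
      using a_star_point[OF xy(2) Dxy(2)[OF D(1)] star(4)[OF D(1)]] by blast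
    have "a_star a b f x D = ereal A"
      unfolding A(3)[symmetric] by (rule a_star_base_change[OF xy VD[OF D(1)]])
    then show "h_int f D (a_star a b f x D) (ereal T) = lam y D + h_int f D (ereal y) (ereal T)"
      unfolding lam_def A(3)
      using A T h_int_add[of "ereal A" "ereal T" y D] by (simp add: I_ereal less_imp_le)
  qed
  have ex_out: "\<exists>D\<in>S. Tout D > ennreal L"
  proof (rule ccontr)
    assume "\<not> ?thesis"
    then have le: "Tout D \<le> ennreal L" if "D \<in> S" for D using that by (auto simp: not_less)
    have "Limsup (at_right m) (\<lambda>D. E_int a b f x n D + of_nat n * W_int a b f x D
                      + h_int f D (ereal T) (b_star a b f x D)) \<le> ennreal L - c0"
    proof (rule Limsup_bounded)
      show "\<forall>\<^sub>F D in at_right m. E_int a b f x n D + of_nat n * W_int a b f x D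
                      + h_int f D (ereal T) (b_star a b f x D) \<le> ennreal L - c0"
        using ev
      proof eventually_elim
        case (elim D)
        let ?X = "E_int a b f x n D + of_nat n * W_int a b f x D + h_int f D (ereal T) (b_star a b f x D)"
        have "?X + c0 \<le> ?X + h_int f D (ereal y) (ereal T)" using elim by (intro add_left_mono) auto
        also have "\<dots> = Tout D" unfolding Tout_def using split_T(1)[of D] elim by (simp add: add_ac)
        also have "\<dots> \<le> ennreal L" using le elim by blast
        finally show ?case using c0t by (intro ennreal_le_minus_iff[THEN iffD2]) (auto simp: add.commute)
      qed
    qed
    with nout have "ennreal L \<le> ennreal L - c0" by (rule order_trans)
    moreover have "ennreal L - c0 < ennreal L"
      using c0(1) L0 by (intro ennreal_between) auto
    ultimately show False by simp
  qed
  \<comment> \<open>For \<open>n = 0\<close> the time \<open>Tout\<close> is the bouncing time,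
    which is already known to be below \<open>L\<close>.\<close>
  have n0: "n \<noteq> 0"
  proof
    assume "n = 0"
    then have "Tout D = rho x D + rho y D" for D unfolding Tout_def E_int_def by (simp add: RL)
    then show False using ex_out T2 by (auto dest: less_asym)
  qed
  have ex_in: "\<exists>D\<in>S. Tin D < ennreal L"
  proof (rule ccontr)
    assume "\<not> ?thesis"
    then have ge: "Tin D \<ge> ennreal L" if "D \<in> S" for D using that by (auto simp: not_less)
    have "ennreal L + c0 \<le> Liminf (at_right m) (\<lambda>D. E_int a b f x n D + of_nat (n - 1) * W_int a b f x D
                      + h_int f D (a_star a b f x D) (ereal T))"
    proof (rule Liminf_bounded)
      show "\<forall>\<^sub>F D in at_right m. ennreal L + c0 \<le> E_int a b f x n D + of_nat (n - 1) * W_int a b f x D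
                      + h_int f D (a_star a b f x D) (ereal T)"
        using ev
      proof eventually_elim
        case (elim D)
        have "ennreal L + c0 \<le> Tin D + h_int f D (ereal y) (ereal T)"
          using ge elim by (intro add_mono) auto
        also have "\<dots> = E_int a b f x n D + of_nat (n - 1) * W_int a b f x D + h_int f D (a_star a b f x D) (ereal T)"
          unfolding Tin_def using split_T(2)[of D] elim by (simp add: add_ac)
        finally show ?case .
      qed
    qed
    then have "ennreal L + c0 \<le> ennreal L" using nin[OF n0] by (rule order_trans)
    then have "ennreal L + c0 \<le> ennreal L + 0" by (simp only: add_0_right)
    then show False using c0(1) ennreal_add_left_cancel_le[of "ennreal L" c0 0] by simp
  qed
  have reals: "\<exists>l q r. lam y D = ennreal l \<and> h_int f D (ereal x) (ereal y) = ennreal q \<and> rho y D = ennreal r \<and>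
      0 \<le> q \<and> q \<le> l \<and> 0 \<le> r \<and>
      Tin D = ennreal ((if even n then q + r else l - q) + real (n - 1) * (l + r) + l) \<and>
      Tout D = ennreal ((if even n then q + r else l - q) + real n * (l + r) + r)"
    if D: "D \<in> S" and fin: "lam x D < top" for D
  proof -
    have "rho x D + rho y D < top" using T2[OF D] by (rule less_trans) simp
    then have "h_int f D (ereal x) (ereal y) \<noteq> top" "rho y D \<noteq> top" unfolding rho_x[OF D] by auto
    then obtain q r where qr: "h_int f D (ereal x) (ereal y) = ennreal q" "0 \<le> q" "rho y D = ennreal r" "0 \<le> r"
      by (metis ennreal_cases)
    obtain p where p: "lam x D = ennreal p" "0 \<le> p" using fin by (cases "lam x D" rule: ennreal_cases) auto
    have ly: "lam y D = ennreal (p + q)" unfolding lam_y[OF D] p qr using p qr by simp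
    have rx: "rho x D = ennreal (q + r)" unfolding rho_x[OF D] qr using qr by simp
    have W: "W_int a b f x D = ennreal (p + q + r)" unfolding W_int_def RL p rx using p qr by simp
    have nW: "of_nat k * W_int a b f x D = ennreal (real k * (p + q + r))" for k
      unfolding W ennreal_of_nat_eq_real_of_nat using p qr by (subst ennreal_mult) auto
    have E: "E_int a b f x n D = ennreal (if even n then q + r else p)" unfolding E_int_def RL p rx by simp
    have add3: "ennreal s + ennreal t + ennreal u = ennreal (s + t + u)" if "0 \<le> s" "0 \<le> t" "0 \<le> u" for s t u
      using that by simp
    have "Tin D = ennreal ((if even n then q + r else p) + real (n - 1) * (p + q + r) + (p + q))"
      unfolding Tin_def E nW ly by (rule add3) (use p qr in auto)
    moreover have "Tout D = ennreal ((if even n then q + r else p) + real n * (p + q + r) + r)"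
      unfolding Tout_def E nW qr(3) by (rule add3) (use p qr in auto)
    ultimately show ?thesis using ly qr p by (intro exI[of _ "p + q"] exI[of _ q] exI[of _ r]) auto
  qed
  \<comment> \<open>The arrival times in the shape required by \<open>periodic_reach'\<close> with
    \<open>k = (n + 1) div 2\<close>. The parity of \<open>n\<close> fixes the initial direction,
    the last sign the direction of arrival; \<open>n0\<close> makes the subtraction
    \<open>n - 1\<close> exact.\<close>
  have alg_in: "(if even n then q + r else l - q) + real (n - 1) * (l + r) + l
      = 2 * of_int (int ((n + 1) div 2)) * (l + r) + (if even n then 1 else -1) * (q + r) + (-1) * r" for l q r :: real
  proof -
    have n1: "real (n - 1) = real n - 1" using n0 by (simp add: of_nat_diff)
    show ?thesis
    proof (cases "even n")
      case True
      then obtain k where "n = 2 * k" by blast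
      then show ?thesis unfolding n1 by (simp add: algebra_simps)
    next
      case False
      then obtain k where "n = 2 * k + 1" using oddE by blast
      then show ?thesis unfolding n1 by (simp add: algebra_simps)
    qed
  qed
  have alg_out: "(if even n then q + r else l - q) + real n * (l + r) + r
      = 2 * of_int (int ((n + 1) div 2)) * (l + r) + (if even n then 1 else -1) * (q + r) + 1 * r" for l q r :: real
  proof (cases "even n")
    case True
    then obtain k where "n = 2 * k" by blast
    then show ?thesis by (simp add: algebra_simps)
  next
    case False
    then obtain k where "n = 2 * k + 1" using oddE by blast
    then show ?thesis by (simp add: algebra_simps)
  qed
  have sgn: "\<bar>if even n then 1 else - 1 :: real\<bar> = 1" by simp
  \<comment> \<open>A hit makes the time to the left turning point finite, and then the oscillation
    between the two turning points leads from \<open>x\<close> to \<open>y\<close> in time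
    \<open>L\<close>.\<close>
  have no_hit: "Tin D \<noteq> ennreal L \<and> Tout D \<noteq> ennreal L" if D: "D \<in> S" for D
  proof (rule ccontr)
    assume "\<not> ?thesis"
    then have hit: "Tin D = ennreal L \<or> Tout D = ennreal L" by simp
    have "lam x D \<le> lam y D" unfolding lam_y[OF D] by simp
    also have "lam y D \<le> Tin D" unfolding Tin_def by simp
    finally have 1: "lam x D \<le> Tin D" .
    have "lam x D \<le> W_int a b f x D" unfolding W_int_def RL by simp
    also have "\<dots> \<le> of_nat n * W_int a b f x D"
      using n0 mult_right_mono[of 1 "of_nat n" "W_int a b f x D"] by (simp add: Suc_leI)
    also have "\<dots> \<le> Tout D" unfolding Tout_def by (simp add: add_increasing add_increasing2)
    finally have 2: "lam x D \<le> Tout D" .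
    have "lam x D < top" using hit 1 2 by (auto intro: le_less_trans)
    from reals[OF D this] obtain l q r where lqr: "lam y D = ennreal l" "h_int f D (ereal x) (ereal y) = ennreal q"
      "rho y D = ennreal r" "0 \<le> q" "q \<le> l" "0 \<le> r"
      "Tin D = ennreal ((if even n then q + r else l - q) + real (n - 1) * (l + r) + l)"
      "Tout D = ennreal ((if even n then q + r else l - q) + real n * (l + r) + r)" by blast
    obtain A where A: "A \<in> I" "A < y" "a_star a b f y D = ereal A" "V A = D"
       "\<And>\<tau>. A < \<tau> \<Longrightarrow> \<tau> \<le> y \<Longrightarrow> V \<tau> > D"
      using a_star_point[OF xy(2) Dxy(2)[OF D] star(4)[OF D]] by blast
    have Ax: "A \<le> x" using VD[OF D, of A] A by force
    have e0: "(if even n then q + r else l - q) \<ge> 0" using lqr by simp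
    from xy(2) Dxy(2)[OF D] show False
    proof (cases rule: b_star_cases)
      case none
      then show ?thesis using star(2)[OF D] by simp
    next
      case (point B)
      have V: "V \<tau> > D" if "A < \<tau>" "\<tau> < B" for \<tau>
        using A(5)[of \<tau>] point(5)[of \<tau>] that by (cases "\<tau> \<le> y") auto
      have hl: "h_int f D (ereal A) (ereal y) = ennreal l" using lqr(1) A(3) by (simp add: lam_def)
      have hr: "h_int f D (ereal y) (ereal B) = ennreal r" using lqr(3) point(3) by (simp add: rho_def)
      have l0: "0 \<le> l" using lqr by simp
      have AB: "A < B" "y \<le> B" using A point by auto
      have P: "reach I f D L x y" if "\<bar>\<sigma>\<bar> = 1"
          "L = 2 * of_int (int ((n + 1) div 2)) * (l + r) + (if even n then 1 else -1) * (q + r) + \<sigma> * r" for \<sigma> :: real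
        by (rule periodic_reach'[OF A(1) point(1) AB(1) Ax xy(3) AB(2) V A(4) point(4) hl l0 lqr(2) lqr(4) hr lqr(6) sgn that])
      have p1: "\<bar>- 1 :: real\<bar> = 1" "\<bar>1 :: real\<bar> = 1" by auto
      from hit show ?thesis
      proof
        assume h: "Tin D = ennreal L"
        have "0 \<le> (if even n then q + r else l - q) + real (n - 1) * (l + r) + l"
          using e0 lqr l0 by (intro add_nonneg_nonneg mult_nonneg_nonneg) auto
        then have "L = (if even n then q + r else l - q) + real (n - 1) * (l + r) + l"
          using h L unfolding lqr(7) by (simp only: ennreal_inj)
        from P[OF p1(1) this[unfolded alg_in]] show False using nosol by blast
      next
        assume h: "Tout D = ennreal L"
        have "0 \<le> (if even n then q + r else l - q) + real n * (l + r) + r"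
          using e0 lqr l0 by (intro add_nonneg_nonneg mult_nonneg_nonneg) auto
        then have "L = (if even n then q + r else l - q) + real n * (l + r) + r"
          using h L unfolding lqr(8) by (simp only: ennreal_inj)
        from P[OF p1(2) this[unfolded alg_out]] show False using nosol by blast
      qed
    qed
  qed
  have contS: "continuous_on S Tin" "continuous_on S Tout"
  proof -
    have lim: "(Tin \<longlongrightarrow> Tin D) (at D)" "(Tout \<longlongrightarrow> Tout D) (at D)" if D: "D \<in> S" for D
    proof -
      note r = rho_tendsto[OF xy(1) Dxy(1)[OF D] star(1)[OF D]] rho_tendsto[OF xy(2) Dxy(2)[OF D] star(2)[OF D]]
      note l = lam_tendsto[OF xy(1) Dxy(1)[OF D] star(3)[OF D]] lam_tendsto[OF xy(2) Dxy(2)[OF D] star(4)[OF D]]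
      have E: "(E_int a b f x n \<longlongrightarrow> E_int a b f x n D) (at D)"
        unfolding E_int_def RL using r(1) l(1) by simp
      have W: "(W_int a b f x \<longlongrightarrow> W_int a b f x D) (at D)"
        unfolding W_int_def RL by (intro tendsto_add l(1) r(1))
      show "(Tin \<longlongrightarrow> Tin D) (at D)" "(Tout \<longlongrightarrow> Tout D) (at D)"
        unfolding Tin_def Tout_def by (intro tendsto_add E ennreal_tendsto_cmult W l r of_nat_less_top)+
    qed
    then have "isCont Tin D" "isCont Tout D" if "D \<in> S" for D using that by (auto simp: isCont_def)
    then show "continuous_on S Tin" "continuous_on S Tout" using continuous_at_imp_continuous_on by blast+
  qed
  have connS: "connected S" unfolding S_def by simp
  have Tin_lt: "Tin D < ennreal L" if "D \<in> S" for D
    using ex_in connected_avoids_less[OF connS contS(1) _ _ _ that] no_hit by blast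
  have Tout_gt: "Tout D > ennreal L" if D: "D \<in> S" for D
  proof (rule ccontr)
    assume "\<not> ?thesis"
    then have "Tout D < ennreal L" using no_hit[OF D] by (simp add: not_less le_less)
    then have "Tout D' < ennreal L" if "D' \<in> S" for D'
      using connected_avoids_less[OF connS contS(2) D _ _ that] no_hit by blast
    then show False using ex_out by (auto dest: less_asym)
  qed
  text \<open>As the level increases to \<open>V y\<close> both arrival times tend to the same limit, which is
    the arrival time at the turning point \<open>y\<close>.\<close>
  have "(if x < y then y - x else 1) > 0" by simp
  from turning_small[OF xy(2) dy zero_less_one this] obtain \<delta> where \<delta>: "\<delta> > 0" "\<delta> < (if x < y then y - x else 1)"
    "y - \<delta> \<in> I" "\<And>s t. y - \<delta> \<le> s \<Longrightarrow> s < t \<Longrightarrow> t \<le> y + \<delta> \<Longrightarrow> V t < V s"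
    "\<And>s t. y - \<delta> \<le> s \<Longrightarrow> s \<le> t \<Longrightarrow> t \<le> y + \<delta> \<Longrightarrow> h_int f (V t) (ereal s) (ereal t) \<le> ennreal 1"
    by metis
  \<comment> \<open>At level \<open>Y\<close> the point \<open>y\<close> is a turning point and
    cannot be a base point in \<open>lam_tendsto\<close>. The base point is moved to
    \<open>e\<close>, where \<open>V e > Y\<close>, and \<open>h_int_tendsto\<close> handles the
    piece from \<open>e\<close> to \<open>y\<close>. The bound on \<delta> keeps \<open>e\<close> to
    the right of \<open>x\<close> if \<open>x < y\<close>.\<close>
  define e where "e = y - \<delta>"
  have e: "e \<in> I" "e < y" "x < y \<Longrightarrow> x < e" using \<delta>(1,2,3) by (auto simp: e_def split: if_splits)
  have Ve: "V \<tau> > Y" if "e \<le> \<tau>" "\<tau> < y" for \<tau>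
    using \<delta>(4)[of \<tau> y] that \<delta>(1) by (simp add: Y_def e_def)
  have hey: "h_int f Y (ereal e) (ereal y) < top"
    using \<delta>(5)[of e y] \<delta>(1) by (auto simp: Y_def e_def intro: le_less_trans)
  have astar_e: "a < a_star a b f e Y"
    using a_star_gt_a_of_m_a[OF e(1) Ve[of e]] e(2) ma mY by simp
  obtain A where A: "A \<in> I" "A < e" "a_star a b f e Y = ereal A" "V A = Y"
       "\<And>\<tau>. A < \<tau> \<Longrightarrow> \<tau> \<le> e \<Longrightarrow> V \<tau> > Y"
    using a_star_point[OF e(1) _ astar_e] Ve[of e] e(2) by auto
  have SevL: "eventually (\<lambda>D. D \<in> S) (at_left Y)"
    unfolding S_def by (rule eventually_at_left_real[OF mY])
  have lam_ey: "lam y D = lam e D + h_int f D (ereal e) (ereal y)" if D: "D \<in> S" for D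
  proof (rule lam_base_change[OF e(1) xy(2)])
    fix \<tau> assume "e \<le> \<tau>" "\<tau> \<le> y"
    then show "V \<tau> > D" using Ve[of \<tau>] Dxy(2)[OF D] D by (cases "\<tau> = y") (auto simp: S_def)
  qed (use e in simp)
  have YVe: "Y < V e" using Ve[of e] e(2) by simp
  \<comment> \<open>Lower semicontinuity carries the bound from \<open>Tin\<close> to the limit
    level, so the time to the left turning point is finite there too.\<close>
  have "lam e Y \<le> ennreal L"
  proof (rule ccontr)
    assume "\<not> ?thesis"
    then have "eventually (\<lambda>D. ennreal L < lam e D) (at Y)" by (intro lam_lower[OF e(1) YVe]) simp
    then have "eventually (\<lambda>D. ennreal L < lam e D) (at_left Y)" by (rule filter_leD[OF at_le, rotated]) simp
    with SevL have "eventually (\<lambda>D. False) (at_left Y)"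
    proof eventually_elim
      case (elim D)
      have "lam e D \<le> lam y D" unfolding lam_ey[OF elim(1)] by simp
      also have "\<dots> \<le> Tin D" unfolding Tin_def by simp
      also have "\<dots> < ennreal L" by (rule Tin_lt[OF elim(1)])
      finally show ?case using elim(2) by simp
    qed
    then show False by simp
  qed
  then have lame: "lam e Y < top" by (rule le_less_trans) simp
  define lY where "lY = enn2real (lam e Y + h_int f Y (ereal e) (ereal y))"
  define qY where "qY = enn2real (h_int f Y (ereal x) (ereal y))"
  have lY: "lam e Y + h_int f Y (ereal e) (ereal y) = ennreal lY" "lY \<ge> 0"
    unfolding lY_def using lame hey by auto
  have "h_int f Y (ereal x) (ereal y) < top" using lt unfolding Y_def by (rule less_trans) simp
  then have qY: "h_int f Y (ereal x) (ereal y) = ennreal qY" "qY \<ge> 0"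
    unfolding qY_def by auto
  define l where "l D = enn2real (lam y D)" for D
  define q where "q D = enn2real (h_int f D (ereal x) (ereal y))" for D
  define r where "r D = enn2real (rho y D)" for D
  have llim: "(l \<longlongrightarrow> lY) (at_left Y)"
  proof -
    have 1: "(lam e \<longlongrightarrow> lam e Y) (at_left Y)"
      by (rule tendsto_mono[OF at_le lam_tendsto[OF e(1) YVe astar_e]]) simp
    have 2: "((\<lambda>D. h_int f D (ereal e) (ereal y)) \<longlongrightarrow> h_int f Y (ereal e) (ereal y)) (at_left Y)"
      by (rule tendsto_within_subset[OF h_int_tendsto[OF e(1) xy(2), of Y Y]]) (use e Ve in auto)
    have "((\<lambda>D. lam e D + h_int f D (ereal e) (ereal y)) \<longlongrightarrow> ennreal lY) (at_left Y)"
      unfolding lY(1)[symmetric] by (intro tendsto_add 1 2)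
    moreover have "eventually (\<lambda>D. lam e D + h_int f D (ereal e) (ereal y) = lam y D) (at_left Y)"
      using SevL by eventually_elim (simp add: lam_ey)
    ultimately have "(lam y \<longlongrightarrow> ennreal lY) (at_left Y)" by (rule Lim_transform_eventually)
    from tendsto_enn2real[OF this lY(2)] show ?thesis unfolding l_def .
  qed
  have qlim: "(q \<longlongrightarrow> qY) (at_left Y)"
  proof -
    have "((\<lambda>D. h_int f D (ereal x) (ereal y)) \<longlongrightarrow> ennreal qY) (at_left Y)"
      unfolding qY(1)[symmetric] unfolding Y_def
      by (rule tendsto_within_subset[OF h_int_tendsto[OF xy min(2), of "V y"]]) auto
    from tendsto_enn2real[OF this qY(2)] show ?thesis unfolding q_def .
  qed
  have rlim: "(r \<longlongrightarrow> 0) (at_left Y)"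
    unfolding r_def using tendsto_enn2real[of "rho y" 0] rho_at_left[OF xy(2) dy] by (simp add: Y_def)
  \<comment> \<open>On \<open>S\<close>, \<open>G D\<close> is the real value of
    \<open>Tin D\<close>, and \<open>G D + 2 * r D\<close> that of \<open>Tout D\<close>.\<close>
  define G where "G D = (if even n then q D + r D else l D - q D) + real (n - 1) * (l D + r D) + l D" for D
  define GY where "GY = (if even n then qY + 0 else lY - qY) + real (n - 1) * (lY + 0) + lY"
  have Glim: "(G \<longlongrightarrow> GY) (at_left Y)"
  proof -
    have "((\<lambda>D. if even n then q D + r D else l D - q D) \<longlongrightarrow> (if even n then qY + 0 else lY - qY)) (at_left Y)"
      using tendsto_add[OF qlim rlim] tendsto_diff[OF llim qlim] by (cases "even n") simp_all
    then show ?thesis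
      unfolding G_def GY_def by (intro tendsto_add tendsto_mult tendsto_const llim rlim)
  qed
  have bounds: "G D \<le> L \<and> L \<le> G D + 2 * r D" if D: "D \<in> S" for D
  proof -
    have "lam x D \<le> lam y D" unfolding lam_y[OF D] by simp
    also have "\<dots> \<le> Tin D" unfolding Tin_def by simp
    also have "\<dots> < top" using Tin_lt[OF D] by (rule less_trans) simp
    finally have "lam x D < top" .
    from reals[OF D this] obtain l' q' r' where lqr: "lam y D = ennreal l'" "h_int f D (ereal x) (ereal y) = ennreal q'"
      "rho y D = ennreal r'" "0 \<le> q'" "q' \<le> l'" "0 \<le> r'"
      "Tin D = ennreal ((if even n then q' + r' else l' - q') + real (n - 1) * (l' + r') + l')"
      "Tout D = ennreal ((if even n then q' + r' else l' - q') + real n * (l' + r') + r')" by blast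
    have eq: "l D = l'" "q D = q'" "r D = r'" using lqr by (auto simp: l_def q_def r_def)
    have nonneg: "0 \<le> (if even n then q' + r' else l' - q') + real k * (l' + r')" for k
      using lqr by (intro add_nonneg_nonneg mult_nonneg_nonneg) auto
    have "(if even n then q' + r' else l' - q') + real (n - 1) * (l' + r') + l' < L"
      using Tin_lt[OF D] nonneg[of "n - 1"] lqr unfolding lqr(7) by (subst (asm) ennreal_less_iff) auto
    then have 1: "G D \<le> L" unfolding G_def eq by simp
    have "L < (if even n then q' + r' else l' - q') + real n * (l' + r') + r'"
      using Tout_gt[OF D] L unfolding lqr(8) by (subst (asm) ennreal_less_iff) auto
    moreover have "real n * (l' + r') = real (n - 1) * (l' + r') + (l' + r')"
    proof -
      have n1: "real n = real (n - 1) + 1" using n0 by simp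
      show ?thesis by (subst n1) (simp only: distrib_right mult_1)
    qed
    ultimately have "L \<le> G D + 2 * r D" unfolding G_def eq by linarith
    with 1 show ?thesis by simp
  qed
  have "GY \<le> L"
    by (rule tendsto_upperbound[OF Glim eventually_mono[OF SevL]]) (use bounds in auto)
  moreover have "L \<le> GY + 2 * 0"
    by (rule tendsto_lowerbound[OF tendsto_add[OF Glim tendsto_mult[OF tendsto_const rlim]] eventually_mono[OF SevL]])
       (use bounds in auto)
  ultimately have "L = GY" by simp
  \<comment> \<open>At the limit level \<open>y\<close> itself is the right turning point, hence
    \<open>r = 0\<close> in \<open>periodic_reach'\<close>.\<close>
  then have LY: "L = 2 * of_int (int ((n + 1) div 2)) * (lY + 0) + (if even n then 1 else -1) * (qY + 0) + (-1) * 0"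
    unfolding GY_def alg_in .
  have hA: "h_int f Y (ereal A) (ereal y) = ennreal lY"
    using h_int_add[of "ereal A" "ereal y" e Y] A e xy(2) lY(1) by (simp add: lam_def I_ereal less_imp_le)
  have Ax: "A \<le> x"
  proof (rule ccontr)
    assume "\<not> A \<le> x"
    then have "x < A" "A < y" using A e by auto
    then have "V A > Y" using min(2)[of A] by (simp add: Y_def)
    then show False using A(4) by simp
  qed
  have V: "V \<tau> > Y" if "A < \<tau>" "\<tau> < y" for \<tau> using A(5)[of \<tau>] Ve[of \<tau>] that by (cases "\<tau> \<le> e") auto
  have h0: "h_int f Y (ereal y) (ereal y) = ennreal 0" using h_int_empty by simp
  have m1: "\<bar>- 1 :: real\<bar> = 1" by simp
  have Ay: "A < y" using A e by simp
  have "reach I f Y L x y"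
    by (rule periodic_reach'[OF A(1) xy(2) Ay Ax xy(3) order_refl V A(4) Y_def[symmetric] hA lY(2) qY h0 order_refl sgn m1 LY])
  then show False using nosol by blast
qed

section \<open>The direct family and the existence of a trajectory\<close>

lemma h_int_small:
  assumes xy: "x \<in> I" "y \<in> I" "x \<le> y" and V: "\<And>\<tau>. x \<le> \<tau> \<Longrightarrow> \<tau> \<le> y \<Longrightarrow> V \<tau> \<ge> D0" and L: "L > 0"
  obtains D where "D < D0" "h_int f D (ereal x) (ereal y) < ennreal L"
proof -
  obtain t where t: "t \<in> {x..y}" "\<And>s. s \<in> {x..y} \<Longrightarrow> V s \<le> V t"
    using continuous_attains_sup[of "{x..y}" V] continuous_on_subset[OF V_cont I_sub[OF xy(1,2)]] xy(3) by auto
  define C where "C = V t"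
  have C: "C > 0" using V_pos[of t] I_between[OF xy(1,2), of t] t(1) by (simp add: C_def)
  \<comment> \<open>With the level \<open>D0 - s\<^sup>2\<close> the integrand is at most
    \<open>C / s\<close>, and \<open>s\<close> exceeds \<open>C * (y - x) / L\<close>.\<close>
  define s where "s = 2 * C * (y - x) / L + 1"
  have s: "s > 0" using C L xy(3) by (simp add: s_def add_nonneg_pos)
  define D where "D = D0 - s\<^sup>2"
  have hle: "h D \<tau> \<le> C / s" if "\<tau> \<in> {x..y}" for \<tau>
  proof -
    have "s\<^sup>2 \<le> V \<tau> - D" using V[of \<tau>] that by (simp add: D_def)
    then have "s \<le> sqrt (V \<tau> - D)" using s by (intro real_le_rsqrt)
    then show ?thesis unfolding h_eq using t(2)[OF that] s C by (intro frac_le) (auto simp: C_def)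
  qed
  have "h_int f D (ereal x) (ereal y) \<le> (\<integral>\<^sup>+\<tau>. ennreal (C / s) * indicator {x..y} \<tau> \<partial>lborel)"
    unfolding h_int_def interval_I_real
    by (rule nn_integral_mono) (use hle in \<open>auto simp: indicator_def intro: ennreal_leI\<close>)
  also have "\<dots> = ennreal (C / s) * ennreal (y - x)" using xy(3) by (subst nn_integral_cmult_indicator) auto
  also have "\<dots> = ennreal (C / s * (y - x))" using C s xy(3) by (subst ennreal_mult) auto
  also have "\<dots> < ennreal L"
  proof (rule ennreal_lessI[OF L])
    have "C * (y - x) \<le> 2 * C * (y - x)" using C xy(3) by simp
    also have "\<dots> < L * s" unfolding s_def using L by (simp add: field_simps)
    finally show "C / s * (y - x) < L" using s by (simp add: field_simps)
  qed
  finally show ?thesis using that[of D] s by (simp add: D_def)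
qed

lemma direct_below:
  assumes xy: "x \<in> I" "y \<in> I" "x \<le> y" and V: "\<And>\<tau>. x \<le> \<tau> \<Longrightarrow> \<tau> \<le> y \<Longrightarrow> V \<tau> \<ge> D0" and L: "L > 0"
    and avoid: "\<And>D. D < D0 \<Longrightarrow> h_int f D (ereal x) (ereal y) \<noteq> ennreal L" and D: "D < D0"
  shows "h_int f D (ereal x) (ereal y) < ennreal L"
proof -
  obtain D1 where D1: "D1 < D0" "h_int f D1 (ereal x) (ereal y) < ennreal L"
    by (rule h_int_small[OF xy V L])
  have "isCont (\<lambda>D. h_int f D (ereal x) (ereal y)) D'" if "D' < D0" for D'
    unfolding isCont_def by (rule h_int_tendsto_at[OF xy]) (use V that in \<open>auto intro: less_le_trans\<close>)
  then have c: "continuous_on {..<D0} (\<lambda>D. h_int f D (ereal x) (ereal y))"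
    by (intro continuous_at_imp_continuous_on) auto
  show ?thesis by (rule connected_avoids_less[OF _ c _ D1(2)]) (use D1 D avoid in auto)
qed

text \<open>\<open>Y\<close> is the minimum of \<open>V\<close> between the points. Direct times
  below \<open>Y\<close> stay less than \<open>L\<close>, so no minimum point is critical, for there
  they would blow up. Hence the minimum occurs only at end points, and \<open>V\<close> falls
  further beyond them.\<close>

lemma direct_start:
  assumes xy: "x \<in> I" "y \<in> I" "x < y" and L: "L > 0" and nosol: "\<And>D. \<not> reach I f D L x y"
  shows "\<exists>Y. (\<forall>\<tau>. x \<le> \<tau> \<longrightarrow> \<tau> \<le> y \<longrightarrow> V \<tau> \<ge> Y) \<and> (\<forall>\<tau>. x < \<tau> \<longrightarrow> \<tau> < y \<longrightarrow> V \<tau> > Y) \<and>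
    h_int f Y (ereal x) (ereal y) < ennreal L \<and>
    (V y = Y \<and> deriv V y < 0 \<or> V x = Y \<and> deriv V x > 0)"
proof -
  interpret R: warped_interval "- b" "- a" "\<lambda>x. f (- x)" by (rule reflected)
  have le: "x \<le> y" using xy by simp
  have rI: "- t \<in> interval_I (- b) (- a)" if "t \<in> I" for t using that by (simp add: interval_I_reflect)
  obtain t where t: "t \<in> {x..y}" "\<And>s. s \<in> {x..y} \<Longrightarrow> V t \<le> V s"
    using continuous_attains_inf[of "{x..y}" V] continuous_on_subset[OF V_cont I_sub[OF xy(1,2)]] xy(3) by auto
  define Y where "Y = V t"
  have ge: "V \<tau> \<ge> Y" if "x \<le> \<tau>" "\<tau> \<le> y" for \<tau> using t(2)[of \<tau>] that by (simp add: Y_def)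
  have avoid: "h_int f D (ereal x) (ereal y) \<noteq> ennreal L" if "D < Y" for D
  proof
    assume "h_int f D (ereal x) (ereal y) = ennreal L"
    from direct_reach[OF xy(1,2) le _ this] show False using nosol ge that L by (auto intro: less_le_trans)
  qed
  have lt: "h_int f D (ereal x) (ereal y) < ennreal L" if "D < Y" for D
    by (rule direct_below[OF xy(1,2) le ge L avoid that])
  have crit: "deriv V c \<noteq> 0" if c: "x < c" "c \<le> y" "V c = Y" for c
  proof
    assume d0: "deriv V c = 0"
    have cI: "c \<in> I" using I_between[OF xy(1,2), of c] c by simp
    obtain D' where D': "Y - 1 < D'" "D' < Y" "h_int f D' (ereal x) (ereal c) > ennreal L"
      using crit_left[OF xy(1) cI c(1,3) d0, of "Y - 1" L] ge c by auto
    have "h_int f D' (ereal x) (ereal c) \<le> h_int f D' (ereal x) (ereal y)" using c by (intro h_int_mono) auto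
    then show False using lt[OF D'(2)] D'(3) by simp
  qed
  have crit_x: "deriv V x \<noteq> 0" if Vx: "V x = Y"
  proof
    assume d0: "deriv V x = 0"
    have "warp (\<lambda>x. f (- x)) (- x) = Y" "deriv (warp (\<lambda>x. f (- x))) (- x) = 0"
      using Vx deriv_reflect[OF xy(1)] d0 by (simp_all add: warp_reflect)
    from R.crit_left[OF rI[OF xy(2)] rI[OF xy(1)] _ this, of "Y - 1" L]
    obtain D' where D': "Y - 1 < D'" "D' < Y" "h_int (\<lambda>x. f (- x)) D' (ereal (- y)) (ereal (- x)) > ennreal L"
      using ge xy(3) by (auto simp: warp_reflect)
    have "h_int (\<lambda>x. f (- x)) D' (ereal (- y)) (ereal (- x)) = h_int f D' (ereal x) (ereal y)"
      using h_int_reflect[of "ereal x" "ereal y" D'] xy by (simp add: I_ereal less_imp_le)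
    then show False using lt[OF D'(2)] D'(3) by simp
  qed
  have gt: "V \<tau> > Y" if "x < \<tau>" "\<tau> < y" for \<tau>
  proof (rule ccontr)
    assume "\<not> V \<tau> > Y"
    then have V\<tau>: "V \<tau> = Y" using ge[of \<tau>] that by simp
    have "deriv V \<tau> = 0"
    proof (rule DERIV_local_min[OF V_DERIV])
      show "\<tau> \<in> I" using I_between[OF xy(1,2)] that by simp
      show "0 < min (\<tau> - x) (y - \<tau>)" using that by simp
      show "\<forall>s. \<bar>\<tau> - s\<bar> < min (\<tau> - x) (y - \<tau>) \<longrightarrow> V \<tau> \<le> V s"
        using ge V\<tau> by (auto simp: abs_less_iff)
    qed
    then show False using crit[of \<tau>] that V\<tau> by simp
  qed
  have dy: "deriv V y < 0" if "V y = Y"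
  proof -
    have "\<not> deriv V y > 0"
    proof
      assume "deriv V y > 0"
      then obtain d where d: "d > 0" "\<And>h. h > 0 \<Longrightarrow> h < d \<Longrightarrow> V (y - h) < V y"
        using DERIV_pos_inc_left[OF V_DERIV[OF xy(2)]] by blast
      have "V (y - min (d / 2) (y - x)) < V y" using d(1) xy(3) by (intro d(2)) auto
      moreover have "V (y - min (d / 2) (y - x)) \<ge> Y" using d(1) xy(3) by (intro ge) auto
      ultimately show False using that by simp
    qed
    then show ?thesis using crit[OF xy(3) order_refl that] by simp
  qed
  have dx: "deriv V x > 0" if "V x = Y"
  proof -
    have "\<not> deriv V x < 0"
    proof
      assume "deriv V x < 0"
      then obtain d where d: "d > 0" "\<And>h. h > 0 \<Longrightarrow> h < d \<Longrightarrow> V (x + h) < V x"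
        using DERIV_neg_dec_right[OF V_DERIV[OF xy(1)]] by blast
      have "V (x + min (d / 2) (y - x)) < V x" using d(1) xy(3) by (intro d(2)) auto
      moreover have "V (x + min (d / 2) (y - x)) \<ge> Y" using d(1) xy(3) by (intro ge) (auto simp: min_def)
      ultimately show False using that by simp
    qed
    then show ?thesis using crit_x[OF that] by simp
  qed
  have ends: "V y = Y \<or> V x = Y"
  proof -
    have "\<not> (x < t \<and> t < y)" using gt[of t] by (auto simp: Y_def)
    then have "t = x \<or> t = y" using t(1) by auto
    then show ?thesis by (auto simp: Y_def)
  qed
  have "h_int f Y (ereal x) (ereal y) \<le> ennreal L"
  proof (rule tendsto_upperbound)
    show "((\<lambda>D. h_int f D (ereal x) (ereal y)) \<longlongrightarrow> h_int f Y (ereal x) (ereal y)) (at_left Y)"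
      by (rule tendsto_within_subset[OF h_int_tendsto[OF xy(1,2) le gt, of Y]]) auto
    show "eventually (\<lambda>D. h_int f D (ereal x) (ereal y) \<le> ennreal L) (at_left Y)"
    proof (rule eventually_mono)
      show "eventually (\<lambda>D. D \<in> {Y - 1<..<Y}) (at_left Y)" by (rule eventually_at_left_real) simp
    qed (use lt in \<open>auto intro: less_imp_le\<close>)
  qed simp
  \<comment> \<open>Equality would be a solution at level \<open>Y\<close> that starts or arrives at
    a turning point; if both ends are turning points, it is half a period of an oscillation.\<close>
  moreover have "h_int f Y (ereal x) (ereal y) \<noteq> ennreal L"
  proof
    assume eq: "h_int f Y (ereal x) (ereal y) = ennreal L"
    have h0: "h_int f Y (ereal s) (ereal s) = 0" for s using h_int_empty by simp
    have gt': "Y < V \<tau>" if "x \<le> \<tau>" "\<tau> < y" "V x \<noteq> Y" for \<tau>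
      using gt[of \<tau>] ge[of \<tau>] that by (cases "\<tau> = x") auto
    have gt'': "Y < V \<tau>" if "x < \<tau>" "\<tau> \<le> y" "V y \<noteq> Y" for \<tau>
      using gt[of \<tau>] ge[of \<tau>] that by (cases "\<tau> = y") auto
    consider (1) "V y = Y" "V x \<noteq> Y" | (2) "V x = Y" "V y \<noteq> Y" | (3) "V x = Y" "V y = Y" using ends by blast
    then show False
    proof cases
      case 1
      have "reach I f Y L x y"
        by (rule bounce_reach[OF xy(1) le order_refl xy(3,2) 1(1)]) (use gt' 1 eq h0 L in auto)
      then show False using nosol by blast
    next
      case 2
      have eq': "h_int (\<lambda>x. f (- x)) Y (ereal (- y)) (ereal (- x)) = ennreal L"
        using h_int_reflect[of "ereal x" "ereal y" Y] xy eq by (simp add: I_ereal less_imp_le)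
      have "reach (interval_I (- b) (- a)) (\<lambda>x. f (- x)) Y L (- y) (- x)"
      proof (rule R.bounce_reach[OF rI[OF xy(2)] _ order_refl _ rI[OF xy(1)]])
        show "Y < warp (\<lambda>x. f (- x)) \<tau>" if "- y \<le> \<tau>" "\<tau> < - x" for \<tau>
          using gt''[of "- \<tau>"] that 2 by (simp add: warp_reflect)
        show "h_int (\<lambda>x. f (- x)) Y (ereal (- y)) (ereal (- x)) + h_int (\<lambda>x. f (- x)) Y (ereal (- x)) (ereal (- x)) = ennreal L"
          using eq' R.h_int_empty[of "ereal (- x)" "ereal (- x)" Y] by simp
      qed (use xy 2 L in \<open>auto simp: warp_reflect\<close>)
      from reach_reverse[OF reach_reflect[OF this]] show False using nosol by blast
    next
      case 3
      have L0: "0 \<le> L" using L by simp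
      have h0': "h_int f Y (ereal y) (ereal y) = ennreal 0" using h0 by simp
      have "reach I f Y L x y"
        by (rule periodic_reach'[OF xy order_refl le order_refl gt 3 eq L0 eq L0 h0' order_refl, of 1 1 _ 0]) auto
      then show False using nosol by blast
    qed
  qed
  ultimately have "h_int f Y (ereal x) (ereal y) < ennreal L" by simp
  then show ?thesis using ge gt ends dx dy by (intro exI[of _ Y]) auto
qed

text \<open>At a critical point of \<open>V\<close> the base component rests while the geodesic
  moves in the fibre.\<close>

lemma reach_constant:
  assumes "x \<in> I" "deriv V x = 0"
  shows "reach I f (V x) L x x"
proof (rule reachI)
  show "traj I f (V x) UNIV (\<lambda>_. x) (\<lambda>_. 0)" unfolding traj_def using assms by auto
qed auto

lemma reach_exists_aux:
  assumes xy: "x \<in> I" "y \<in> I" "x \<le> y" and L: "L > 0" and nosol: "\<And>D. \<not> reach I f D L x y"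
    and min: "\<And>\<tau>. x \<le> \<tau> \<Longrightarrow> \<tau> \<le> y \<Longrightarrow> V \<tau> \<ge> V y" "\<And>\<tau>. x < \<tau> \<Longrightarrow> \<tau> < y \<Longrightarrow> V \<tau> > V y"
    and dy: "deriv V y < 0" and lt: "h_int f (V y) (ereal x) (ereal y) < ennreal L"
    and cond: "cond_b a b f d \<and> cond_b (- b) (- a) (\<lambda>x. f (- x)) d \<or> cond_R_b a b f d" and Ld: "ennreal L \<le> d"
  shows False
  using cond
proof
  assume c: "cond_b a b f d \<and> cond_b (- b) (- a) (\<lambda>x. f (- x)) d"
  have L0: "L \<ge> 0" using L by simp
  have "eventually (\<lambda>D. b_star a b f y D < b \<and> rho x D + rho y D < ennreal L \<and> D < V y) (at_left (V y))"
    by (rule bounce_start[OF xy min dy lt])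
  then obtain D where D: "b_star a b f y D < b" "rho x D + rho y D < ennreal L" "D < V y"
    using eventually_happens'[of "at_left (V y)"] by auto
  have VD: "D < V \<tau>" if "x \<le> \<tau>" "\<tau> \<le> y" for \<tau> using min(1)[OF that] D(3) by simp
  show False by (rule bounce_family_cond_C[OF xy L0 nosol VD D(1,2) conjunct1[OF c] conjunct2[OF c] Ld])
next
  assume c: "cond_R_b a b f d"
  show False by (rule cond_R_contradiction[OF xy less_imp_le[OF L] nosol min dy lt c Ld])
qed

theorem reach_exists:
  assumes xy: "x \<in> I" "y \<in> I" and L: "L > 0" and Ld: "ennreal L \<le> d"
    and cond: "condition_C a b f d \<or> condition_R a b f d"
  shows "\<exists>D. reach I f D L x y"
proof -
  interpret R: warped_interval "- b" "- a" "\<lambda>x. f (- x)" by (rule reflected)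
  have cond1: "cond_b a b f d \<and> cond_b (- b) (- a) (\<lambda>x. f (- x)) d \<or> cond_R_b a b f d"
    using cond cond_b_of_C cond_b_reflect_of_C cond_R_b_of_R by (auto simp: condition_C_def)
  have cond2: "cond_b (- b) (- a) (\<lambda>x. f (- x)) d \<and> cond_b (- (- a)) (- (- b)) (\<lambda>x. f (- (- x))) d \<or> cond_R_b (- b) (- a) (\<lambda>x. f (- x)) d"
    using cond cond_b_of_C cond_b_reflect_of_C cond_R_b_reflect_of_R by (auto simp: condition_C_def)
  have rI: "- t \<in> interval_I (- b) (- a)" if "t \<in> I" for t using that by (simp add: interval_I_reflect)
  have main: False if xy: "x \<in> I" "y \<in> I" "x \<le> y" and nosol: "\<And>D. \<not> reach I f D L x y" for x y
  proof -
    have nosol': "\<not> reach (interval_I (- b) (- a)) (\<lambda>x. f (- x)) D L (- y) (- x)" for D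
      using reach_reflect[of D L y x] reach_reverse nosol by blast
    have yx: "- y \<le> - x" using xy by simp
    \<comment> \<open>A minimum at the left end is treated in the mirror image, where the roles of
      \<open>x\<close> and \<open>y\<close> are exchanged.\<close>
    have refl: False
      if Y: "\<And>\<tau>. x \<le> \<tau> \<Longrightarrow> \<tau> \<le> y \<Longrightarrow> V \<tau> \<ge> V x" "\<And>\<tau>. x < \<tau> \<Longrightarrow> \<tau> < y \<Longrightarrow> V \<tau> > V x"
        "h_int f (V x) (ereal x) (ereal y) < ennreal L" "deriv V x > 0"
    proof (rule R.reach_exists_aux[OF rI[OF xy(2)] rI[OF xy(1)] yx L nosol' _ _ _ _ cond2 Ld])
      show "warp (\<lambda>x. f (- x)) (- x) \<le> warp (\<lambda>x. f (- x)) \<tau>" if "- y \<le> \<tau>" "\<tau> \<le> - x" for \<tau>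
        using Y(1)[of "- \<tau>"] that by (simp add: warp_reflect)
      show "warp (\<lambda>x. f (- x)) (- x) < warp (\<lambda>x. f (- x)) \<tau>" if "- y < \<tau>" "\<tau> < - x" for \<tau>
        using Y(2)[of "- \<tau>"] that by (simp add: warp_reflect)
      show "deriv (warp (\<lambda>x. f (- x))) (- x) < 0" using deriv_reflect[OF xy(1)] Y(4) by simp
      show "h_int (\<lambda>x. f (- x)) (warp (\<lambda>x. f (- x)) (- x)) (ereal (- y)) (ereal (- x)) < ennreal L"
        using h_int_reflect[of "ereal x" "ereal y" "V x"] xy Y(3) by (simp add: I_ereal less_imp_le warp_reflect)
    qed
    show False
    proof (cases "x = y")
      case True
      have h0: "h_int f (V x) (ereal x) (ereal x) < ennreal L" using h_int_empty L by simp
      consider "deriv V x = 0" | "deriv V x < 0" | "deriv V x > 0" by linarith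
      then show False
      proof cases
        case 1
        then show False using reach_constant[OF xy(1), of L] nosol True by blast
      next
        case 2
        show False by (rule reach_exists_aux[OF xy L nosol _ _ _ _ cond1 Ld]) (use True 2 h0 in auto)
      next
        case 3
        show False by (rule refl) (use True 3 h0 in auto)
      qed
    next
      case False
      then have "x < y" using xy by simp
      then obtain Y where Y: "\<And>\<tau>. x \<le> \<tau> \<Longrightarrow> \<tau> \<le> y \<Longrightarrow> V \<tau> \<ge> Y" "\<And>\<tau>. x < \<tau> \<Longrightarrow> \<tau> < y \<Longrightarrow> V \<tau> > Y"
        "h_int f Y (ereal x) (ereal y) < ennreal L"
        "V y = Y \<and> deriv V y < 0 \<or> V x = Y \<and> deriv V x > 0"
        using direct_start[OF xy(1,2) _ L nosol] by blast
      from Y(4) show False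
      proof
        assume y: "V y = Y \<and> deriv V y < 0"
        show False by (rule reach_exists_aux[OF xy L nosol _ _ _ _ cond1 Ld]) (use y Y in auto)
      next
        assume x: "V x = Y \<and> deriv V x > 0"
        show False by (rule refl) (use x Y in auto)
      qed
    qed
  qed
  show ?thesis
  proof (rule ccontr)
    assume *: "\<not> ?thesis"
    then have n1: "\<not> reach I f D L x y" for D by simp
    \<comment> \<open>Time reversal reduces the opposite order of the points to
      \<open>main\<close>.\<close>
    then have n2: "\<not> reach I f D L y x" for D using reach_reverse[of I f D L y x] by blast
    show False
    proof (cases "x \<le> y")
      case True
      show ?thesis by (rule main[OF xy True n1])
    next
      case False
      then have yx: "y \<le> x" by simp
      show ?thesis by (rule main[OF xy(2,1) yx n2])
    qed
  qed
qed

end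

section \<open>Geodesics of the spacetime from trajectories in the base\<close>

text \<open>Passage from the fibre arc length to the affine parameter: \<Phi> is the primitive of
  the density \<phi>, later \<open>1 / V (u r)\<close>, and \<open>g\<close> is its inverse.\<close>

lemma inverse_of_integral:
  fixes \<phi> :: "real \<Rightarrow> real"
  assumes ab: "\<alpha> < \<beta>" and c: "continuous_on {\<alpha>..\<beta>} \<phi>" and pos: "\<And>r. r \<in> {\<alpha>..\<beta>} \<Longrightarrow> \<phi> r > 0"
  shows "\<exists>\<Phi> g. (\<forall>r s. \<alpha> \<le> r \<longrightarrow> r < s \<longrightarrow> s \<le> \<beta> \<longrightarrow> \<Phi> r < (\<Phi> s :: real)) \<and> \<Phi> \<alpha> = 0 \<and>
    (\<forall>r. \<alpha> \<le> r \<longrightarrow> r \<le> \<beta> \<longrightarrow> g (\<Phi> r) = r) \<and>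
    (\<forall>t. 0 < t \<longrightarrow> t < \<Phi> \<beta> \<longrightarrow> \<alpha> < g t \<and> g t < \<beta> \<and> (g has_real_derivative 1 / \<phi> (g t)) (at t))"
proof -
  define \<Phi> where "\<Phi> r = integral {\<alpha>..r} \<phi>" for r
  define g where "g = inv_into {\<alpha>..\<beta>} \<Phi>"
  have d: "(\<Phi> has_real_derivative \<phi> r) (at r within {\<alpha>..\<beta>})" if "r \<in> {\<alpha>..\<beta>}" for r
    unfolding \<Phi>_def by (rule integral_has_real_derivative[OF c that])
  have cont: "continuous_on {\<alpha>..\<beta>} \<Phi>" using d by (rule DERIV_continuous_on)
  have d': "(\<Phi> has_real_derivative \<phi> r) (at r)" if "\<alpha> < r" "r < \<beta>" for r
    using d[of r] that at_within_interior[of r "{\<alpha>..\<beta>}"] by simp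
  have mono: "\<Phi> r < \<Phi> s" if "\<alpha> \<le> r" "r < s" "s \<le> \<beta>" for r s
  proof (rule DERIV_pos_imp_increasing_open[OF that(2)])
    show "continuous_on {r..s} \<Phi>" by (rule continuous_on_subset[OF cont]) (use that in auto)
    fix x assume "r < x" "x < s"
    then have x: "\<alpha> < x" "x < \<beta>" using that by auto
    then have "\<phi> x > 0" using pos[of x] by simp
    then show "\<exists>y. (\<Phi> has_real_derivative y) (at x) \<and> y > 0" using d'[OF x] by blast
  qed
  have \<Phi>0: "\<Phi> \<alpha> = 0" by (simp add: \<Phi>_def)
  have inj: "inj_on \<Phi> {\<alpha>..\<beta>}"
  proof (rule linorder_inj_onI)
    fix x y assume "x < y" "x \<in> {\<alpha>..\<beta>}" "y \<in> {\<alpha>..\<beta>}"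
    then show "\<Phi> x \<noteq> \<Phi> y" using mono[of x y] by simp
  qed auto
  have le: "0 \<le> \<Phi> r" "\<Phi> r \<le> \<Phi> \<beta>" if "r \<in> {\<alpha>..\<beta>}" for r
    using mono[of \<alpha> r] mono[of r \<beta>] that \<Phi>0 by (cases "r = \<alpha>"; cases "r = \<beta>"; force)+
  have img: "\<Phi> ` {\<alpha>..\<beta>} = {0..\<Phi> \<beta>}"
  proof
    show "\<Phi> ` {\<alpha>..\<beta>} \<subseteq> {0..\<Phi> \<beta>}" using le by auto
    show "{0..\<Phi> \<beta>} \<subseteq> \<Phi> ` {\<alpha>..\<beta>}"
    proof
      fix z assume "z \<in> {0..\<Phi> \<beta>}"
      then have "\<exists>x\<ge>\<alpha>. x \<le> \<beta> \<and> \<Phi> x = z" using cont ab \<Phi>0 by (intro IVT') auto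
      then show "z \<in> \<Phi> ` {\<alpha>..\<beta>}" by auto
    qed
  qed
  have g\<Phi>: "g (\<Phi> r) = r" if "\<alpha> \<le> r" "r \<le> \<beta>" for r
    unfolding g_def using inj that by (intro inv_into_f_f) auto
  have \<Phi>g: "\<Phi> (g t) = t" "g t \<in> {\<alpha>..\<beta>}" if "0 \<le> t" "t \<le> \<Phi> \<beta>" for t
  proof -
    have "t \<in> \<Phi> ` {\<alpha>..\<beta>}" using that img by simp
    then show "\<Phi> (g t) = t" "g t \<in> {\<alpha>..\<beta>}"
      unfolding g_def by (rule f_inv_into_f, rule inv_into_into)
  qed
  have gc: "continuous_on {0..\<Phi> \<beta>} g"
    unfolding img[symmetric] by (rule continuous_on_inv[OF cont compact_Icc]) (simp add: g\<Phi>)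
  have gr: "\<alpha> < g t \<and> g t < \<beta>" if "0 < t" "t < \<Phi> \<beta>" for t
  proof -
    have "g t \<noteq> \<alpha>" "g t \<noteq> \<beta>" using \<Phi>g(1)[of t] that \<Phi>0 by auto
    then show ?thesis using \<Phi>g(2)[of t] that by auto
  qed
  have gd: "(g has_real_derivative 1 / \<phi> (g t)) (at t)" if "0 < t" "t < \<Phi> \<beta>" for t
  proof -
    have "isCont g t" using continuous_on_interior[OF gc, of t] that by simp
    moreover have "\<phi> (g t) \<noteq> 0" using pos[of "g t"] gr[OF that] by simp
    ultimately have "(g has_real_derivative inverse (\<phi> (g t))) (at t)"
      using d'[of "g t"] gr[OF that] that \<Phi>g(1)
      by (intro DERIV_inverse_function[where f=\<Phi> and a=0 and b="\<Phi> \<beta>"]) auto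
    then show ?thesis by (simp add: divide_inverse)
  qed
  show ?thesis
    by (rule exI[of _ \<Phi>], rule exI[of _ g]) (intro conjI allI impI mono \<Phi>0 g\<Phi> gd gr[THEN conjunct1] gr[THEN conjunct2]; assumption)
qed

lemma open_interval_margin:
  fixes J :: "real set"
  assumes "open J" "is_interval J" "{x..y} \<subseteq> J" "x \<le> y"
  obtains e where "e > 0" "{x - e..y + e} \<subseteq> J"
proof -
  obtain e1 where e1: "e1 > 0" "cball x e1 \<subseteq> J" using assms open_contains_cball[of J] by force
  obtain e2 where e2: "e2 > 0" "cball y e2 \<subseteq> J" using assms open_contains_cball[of J] by force
  let ?e = "min e1 e2"
  have "x - ?e \<in> cball x e1" "y + ?e \<in> cball y e2" using e1 e2 by (auto simp: dist_real_def)
  then have m: "x - ?e \<in> J" "y + ?e \<in> J" using e1 e2 by auto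
  have "{x - ?e..y + ?e} \<subseteq> J"
  proof
    fix z assume "z \<in> {x - ?e..y + ?e}"
    then show "z \<in> J" using m assms(2) unfolding is_interval_1 by (meson atLeastAtMost_iff)
  qed
  then show ?thesis using that[of ?e] e1 e2 by simp
qed

context grw_space begin

text \<open>In the affine parameter the base velocity is \<open>T * p\<close> and the fibre speed
  \<open>T * V\<close>, whence the squared velocity \<open>T\<^sup>2 * D\<close>. The factor
  \<open>T\<close> rescales the parameter interval to \<open>{0..1}\<close>.\<close>

lemma traj_lift:
  assumes ab: "a < b" and geo: "geodesic F J' \<sigma>" "{0..1} \<subseteq> J'"
    and c: "\<And>t. t \<in> J' \<Longrightarrow> velocity_square F \<sigma> t = L\<^sup>2" and L: "L > 0"
    and tr: "traj I f D J u p" "{0..L} \<subseteq> J"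
  shows "\<exists>\<gamma> T. T > 0 \<and> geodesic_joins M \<gamma> (u 0, \<sigma> 0) (u L, \<sigma> 1) \<and>
    (\<forall>t\<in>{0..1}. velocity_square M \<gamma> t = T\<^sup>2 * D \<and> (\<exists>r\<in>J. future_pointing M \<gamma> t \<longleftrightarrow> p r > 0))"
proof -
  interpret W: warped_interval a b f by unfold_locales (use ab f_smooth f_pos in auto)
  note t = tr(1)[unfolded traj_def]
  have J': "open J'" "is_interval J'" using geo(1) by (auto simp: geodesic_def smooth_curve_def)
  obtain e1 where e1: "e1 > 0" "{0 - e1..L + e1} \<subseteq> J"
    by (rule open_interval_margin[of J 0 L]) (use t tr(2) L in auto)
  obtain e2 where e2: "e2 > 0" "{0 - e2..1 + e2} \<subseteq> J'"
    by (rule open_interval_margin[of J' 0 1]) (use J' geo(2) in auto)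
  \<comment> \<open>Arc length \<open>r\<close> corresponds to the parameter \<open>r / L\<close> of
    \<sigma>, so the margin available in \<open>J'\<close> is scaled by \<open>L\<close>.\<close>
  define e where "e = min e1 (e2 * L)"
  have e: "e > 0" "e \<le> e1" "e \<le> e2 * L" using e1(1) e2(1) L by (auto simp: e_def)
  let ?\<alpha> = "- e" and ?\<beta> = "L + e"
  have sub: "{?\<alpha>..?\<beta>} \<subseteq> J" using e1(2) e(2) by auto
  have uI: "u r \<in> I" if "r \<in> J" for r using t that by blast
  have subJ': "r / L \<in> J'" if "?\<alpha> \<le> r" "r \<le> ?\<beta>" for r
  proof -
    have "- e2 \<le> r / L" "r / L \<le> 1 + e2" using that e(3) L by (auto simp: field_simps)
    then show ?thesis using e2(2) by auto
  qed
  let ?V = "warp f"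
  have ucont: "continuous_on J u" using t DERIV_isCont by (intro continuous_at_imp_continuous_on) blast
  have Vn: "?V (u r) > 0" if "r \<in> J" for r using W.V_pos[OF uI[OF that]] .
  have Vc: "continuous_on J (\<lambda>r. ?V (u r))"
    by (rule continuous_on_compose2[OF W.V_cont ucont]) (use uI in auto)
  have \<phi>c: "continuous_on {?\<alpha>..?\<beta>} (\<lambda>r. 1 / ?V (u r))"
    by (intro continuous_on_divide continuous_on_const continuous_on_subset[OF Vc sub])
       (use Vn sub in fastforce)
  have \<phi>p: "1 / ?V (u r) > 0" if "r \<in> {?\<alpha>..?\<beta>}" for r using Vn[of r] sub that by auto
  have \<alpha>\<beta>: "?\<alpha> < ?\<beta>" using e L by simp
  obtain \<Phi> g where \<Phi>g: "\<forall>r s. ?\<alpha> \<le> r \<longrightarrow> r < s \<longrightarrow> s \<le> ?\<beta> \<longrightarrow> \<Phi> r < (\<Phi> s :: real)" "\<Phi> ?\<alpha> = 0"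
    "\<forall>r. ?\<alpha> \<le> r \<longrightarrow> r \<le> ?\<beta> \<longrightarrow> g (\<Phi> r) = r"
    "\<forall>t. 0 < t \<longrightarrow> t < \<Phi> ?\<beta> \<longrightarrow> ?\<alpha> < g t \<and> g t < ?\<beta> \<and> (g has_real_derivative 1 / (1 / ?V (u (g t)))) (at t)"
    using inverse_of_integral[OF \<alpha>\<beta> \<phi>c \<phi>p] by blast
  define B where "B = \<Phi> ?\<beta>"
  have \<Phi>: "\<Phi> r < \<Phi> s" if "?\<alpha> \<le> r" "r < s" "s \<le> ?\<beta>" for r s using \<Phi>g(1) that by blast
  have g\<Phi>: "g (\<Phi> r) = r" if "?\<alpha> \<le> r" "r \<le> ?\<beta>" for r using \<Phi>g(3) that by blast
  have gr: "?\<alpha> < g t \<and> g t < ?\<beta>" and gd: "(g has_real_derivative 1 / (1 / ?V (u (g t)))) (at t)"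
    if "0 < t" "t < B" for t using \<Phi>g(4) that unfolding B_def by blast+
  define T where "T = \<Phi> L - \<Phi> 0"
  have T: "T > 0" "\<Phi> 0 > 0" "\<Phi> L < B"
    using \<Phi>[of 0 L] \<Phi>[of ?\<alpha> 0] \<Phi>[of L ?\<beta>] \<Phi>g(2) e L by (auto simp: T_def B_def)
  define r where "r s = g (\<Phi> 0 + T * s)" for s
  define J1 where "J1 = {- \<Phi> 0 / T<..<(B - \<Phi> 0) / T}"
  have J1: "0 < \<Phi> 0 + T * s" "\<Phi> 0 + T * s < B" if "s \<in> J1" for s
    using that T by (auto simp: J1_def field_simps)
  have J1o: "open J1" "is_interval J1" by (auto simp: J1_def is_interval_1)
  have rng: "?\<alpha> < r s" "r s < ?\<beta>" if "s \<in> J1" for s using gr[OF J1[OF that]] by (auto simp: r_def)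
  have rJ: "r s \<in> J" if "s \<in> J1" for s using rng[OF that] sub by auto
  have rd: "(r has_real_derivative T * ?V (u (r s))) (at s)" if s: "s \<in> J1" for s
  proof -
    have "((\<lambda>s. \<Phi> 0 + T * s) has_real_derivative T) (at s)" by (auto intro!: derivative_eq_intros)
    from DERIV_chain2[OF gd[OF J1[OF s]] this] show ?thesis unfolding r_def by (simp add: mult.commute)
  qed
  define \<tau> where "\<tau> s = u (r s)" for s
  define \<tau>' where "\<tau>' s = T * p (r s)" for s
  define \<rho> where "\<rho> s = r s / L" for s
  define \<rho>' where "\<rho>' s = T / L * ?V (\<tau> s)" for s
  have \<tau>I: "\<tau> s \<in> I" if "s \<in> J1" for s using uI[OF rJ[OF that]] by (simp add: \<tau>_def)
  have d\<tau>: "(\<tau> has_real_derivative \<tau>' s) (at s)" if s: "s \<in> J1" for s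
  proof -
    have "(u has_real_derivative p (r s) / ?V (u (r s))) (at (r s))" using t rJ[OF s] by blast
    from DERIV_chain2[OF this rd[OF s]] show ?thesis
      using Vn[OF rJ[OF s]] by (simp add: \<tau>_def[abs_def] \<tau>'_def mult.commute)
  qed
  have d\<tau>': "(\<tau>' has_real_derivative T\<^sup>2 * (deriv ?V (\<tau> s) / 2)) (at s)" if s: "s \<in> J1" for s
  proof -
    have "(p has_real_derivative deriv ?V (u (r s)) / (2 * ?V (u (r s)))) (at (r s))" using t rJ[OF s] by blast
    from DERIV_cmult[OF DERIV_chain2[OF this rd[OF s]], of T] show ?thesis
      using Vn[OF rJ[OF s]] by (simp add: \<tau>_def \<tau>'_def[abs_def] power2_eq_square field_simps)
  qed
  have d\<rho>: "(\<rho> has_real_derivative \<rho>' s) (at s)" if s: "s \<in> J1" for s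
    using DERIV_cdivide[OF rd[OF s], of L] by (simp add: \<rho>_def[abs_def] \<rho>'_def \<tau>_def)
  have d\<rho>': "(\<rho>' has_real_derivative T / L * (deriv ?V (\<tau> s) * \<tau>' s)) (at s)" if s: "s \<in> J1" for s
    using DERIV_cmult[OF DERIV_chain2[OF W.V_DERIV[OF \<tau>I[OF s]] d\<tau>[OF s]], of "T / L"]
    by (simp add: \<rho>'_def[abs_def])
  have fV: "deriv ?V (\<tau> s) = - (2 * deriv f (\<tau> s) / (f (\<tau> s))^3)" "f (\<tau> s) > 0" "?V (\<tau> s) = 1 / (f (\<tau> s))\<^sup>2" if "s \<in> J1" for s
    using W.V_deriv_eq[OF \<tau>I[OF that]] f_pos[OF \<tau>I[OF that]] by (auto simp: warp_def)
  have e\<tau>: "(\<tau>' has_real_derivative - (f (\<tau> s) * deriv f (\<tau> s) * L\<^sup>2 * (\<rho>' s)\<^sup>2)) (at s)" if s: "s \<in> J1" for s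
  proof -
    have "T\<^sup>2 * (deriv ?V (\<tau> s) / 2) = - (f (\<tau> s) * deriv f (\<tau> s) * L\<^sup>2 * (\<rho>' s)\<^sup>2)"
      unfolding \<rho>'_def fV(1)[OF s] fV(3)[OF s] using fV(2)[OF s] L
      by (simp add: field_simps power2_eq_square power3_eq_cube)
    then show ?thesis using d\<tau>'[OF s] by simp
  qed
  have e\<rho>: "(\<rho>' has_real_derivative - (2 * deriv f (\<tau> s) / f (\<tau> s) * \<tau>' s * \<rho>' s)) (at s)" if s: "s \<in> J1" for s
  proof -
    have "T / L * (deriv ?V (\<tau> s) * \<tau>' s) = - (2 * deriv f (\<tau> s) / f (\<tau> s) * \<tau>' s * \<rho>' s)"
      unfolding \<rho>'_def fV(1)[OF s] fV(3)[OF s] using fV(2)[OF s] L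
      by (simp add: field_simps power2_eq_square power3_eq_cube)
    then show ?thesis using d\<rho>'[OF s] by simp
  qed
  have s\<tau>: "smooth_on J1 \<tau>"
  proof (rule smooth_on_ode2[OF J1o(1) W.I_open _ _ d\<tau> d\<tau>'])
    show "\<tau> ` J1 \<subseteq> I" using \<tau>I by auto
    have "bounded_linear (\<lambda>x. T\<^sup>2 * (x / 2))"
      using bounded_linear_mult_right[of "T\<^sup>2 / 2"] by (simp add: mult.commute field_simps)
    from C_k_on_bounded_linear[OF W.I_open this] show "smooth_on I (\<lambda>x. T\<^sup>2 * (deriv ?V x / 2))"
      using W.dV_smooth unfolding smooth_on_def by blast
  qed
  have s\<rho>: "smooth_on J1 \<rho>"
  proof (rule smooth_on_antiderivative[OF J1o(1) d\<rho>])
    have "C_k_on k J1 \<rho>'" for k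
    proof -
      have 1: "C_k_on k J1 \<tau>" "C_k_on k I ?V" using s\<tau> W.V_smooth unfolding smooth_on_def by blast+
      have "C_k_on k J1 (\<lambda>s. ?V (\<tau> s))"
        by (rule C_k_on_compose[OF J1o(1) W.I_open _ 1]) (use \<tau>I in auto)
      from C_k_on_bounded_linear[OF J1o(1) bounded_linear_mult_right[of "T / L"] this]
      show ?thesis unfolding \<rho>'_def[abs_def] .
    qed
    then show "smooth_on J1 \<rho>'" unfolding smooth_on_def by blast
  qed
  have sub\<tau>: "\<tau> ` J1 \<subseteq> I" using \<tau>I by auto
  have sub\<rho>: "\<rho> ` J1 \<subseteq> J'"
    using subJ' rng by (auto simp: \<rho>_def less_imp_le)
  define \<gamma> where "\<gamma> s = (\<tau> s, \<sigma> (\<rho> s))" for s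
  have geo\<gamma>: "geodesic M J1 \<gamma>" unfolding \<gamma>_def[abs_def]
    by (rule geodesic_lift(1)[OF geo(1) c J1o sub\<tau> sub\<rho> s\<tau> s\<rho> d\<tau> e\<tau> d\<rho> e\<rho>])
  have lift2: "velocity_square M \<gamma> s = - (\<tau>' s)\<^sup>2 + (f (\<tau> s))\<^sup>2 * (L\<^sup>2 * (\<rho>' s)\<^sup>2)" if "s \<in> J1" for s
    unfolding \<gamma>_def[abs_def]
    by (rule geodesic_lift(2)[OF geo(1) c J1o sub\<tau> sub\<rho> s\<tau> s\<rho> d\<tau> e\<tau> d\<rho> e\<rho>]) (use that in auto)
  have lift3: "future_pointing M \<gamma> s \<longleftrightarrow> \<tau>' s > 0" if "s \<in> J1" for s
    unfolding \<gamma>_def[abs_def]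
    by (rule geodesic_lift(3)[OF geo(1) c J1o sub\<tau> sub\<rho> s\<tau> s\<rho> d\<tau> e\<tau> d\<rho> e\<rho>]) (use that in auto)
  have in01: "{0..1} \<subseteq> J1"
  proof
    fix s :: real assume s: "s \<in> {0..1}"
    have "- \<Phi> 0 / T < 0" using T by (simp add: divide_neg_pos)
    moreover have "1 < (B - \<Phi> 0) / T" using T by (simp add: T_def field_simps)
    ultimately show "s \<in> J1" using s by (auto simp: J1_def)
  qed
  have r0: "r 0 = 0" "r 1 = L" using g\<Phi>[of 0] g\<Phi>[of L] e L by (auto simp: r_def T_def)
  have "geodesic_joins M \<gamma> (u 0, \<sigma> 0) (u L, \<sigma> 1)"
    unfolding geodesic_joins_def using geo\<gamma> in01 r0 L by (auto simp: \<gamma>_def \<tau>_def \<rho>_def)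
  moreover have "velocity_square M \<gamma> s = T\<^sup>2 * D \<and> (\<exists>r\<in>J. future_pointing M \<gamma> s \<longleftrightarrow> p r > 0)" if "s \<in> {0..1}" for s
  proof -
    have s: "s \<in> J1" using in01 that by blast
    have "velocity_square M \<gamma> s = - (\<tau>' s)\<^sup>2 + (f (\<tau> s))\<^sup>2 * (L\<^sup>2 * (\<rho>' s)\<^sup>2)"
      by (rule lift2[OF s])
    also have "(f (\<tau> s))\<^sup>2 * (L\<^sup>2 * (\<rho>' s)\<^sup>2) = T\<^sup>2 * ?V (\<tau> s)"
      unfolding \<rho>'_def fV(3)[OF s] using fV(2)[OF s] L by (simp add: field_simps power2_eq_square)
    also have "(\<tau>' s)\<^sup>2 = T\<^sup>2 * (?V (\<tau> s) - D)"
    proof -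
      have "(p (r s))\<^sup>2 = ?V (u (r s)) - D" using t rJ[OF s] by blast
      then show ?thesis by (simp add: \<tau>'_def \<tau>_def power_mult_distrib)
    qed
    finally have 1: "velocity_square M \<gamma> s = T\<^sup>2 * D" by (simp add: algebra_simps)
    have "future_pointing M \<gamma> s \<longleftrightarrow> \<tau>' s > 0"
      by (rule lift3[OF s])
    also have "\<dots> \<longleftrightarrow> p (r s) > 0" using T by (simp add: \<tau>'_def zero_less_mult_iff)
    finally show ?thesis using 1 rJ[OF s] by blast
  qed
  ultimately show ?thesis using T(1) by blast
qed

text \<open>Definiteness of the metric makes the velocity vanish in every chart, so the curve is
  locally constant on a connected domain.\<close>

lemma zero_speed_constant:
  assumes sc: "smooth_curve F J \<sigma>" and z: "\<And>t. t \<in> J \<Longrightarrow> velocity_square F \<sigma> t = 0" and xy: "x \<in> J" "y \<in> J"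
  shows "\<sigma> x = \<sigma> y"
proof (rule connected_local_const[of J x y \<sigma>, OF _ xy])
  have J: "open J" "is_interval J" "\<sigma> ` J \<subseteq> points F" using sc by (auto simp: smooth_curve_def)
  show "connected J" using J(2) is_interval_connected by blast
  show "\<forall>t\<in>J. eventually (\<lambda>s. \<sigma> t = \<sigma> s) (at t within J)"
  proof
    fix t assume t: "t \<in> J"
    obtain i where i: "i \<in> charts F" "\<sigma> t \<in> chart_dom F i" using J(3) t by (auto simp: points_def)
    have o: "open {s\<in>J. \<sigma> s \<in> chart_dom F i}" by (rule curve_chart_open[OF sc i(1)])
    then obtain e where e: "e > 0" "ball t e \<subseteq> {s\<in>J. \<sigma> s \<in> chart_dom F i}" using t i openE by blast
    have v0: "((chart_map F i \<circ> \<sigma>) has_vector_derivative 0) (at s within ball t e)" if "s \<in> ball t e" for s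
    proof -
      have s: "s \<in> J" "\<sigma> s \<in> chart_dom F i" using e(2) that by auto
      have "metric_at F i (\<sigma> s) (velocity F i \<sigma> s) (velocity F i \<sigma> s) = 0"
        using z[OF s(1)] velocity_square_chart[OF sc s(1) i(1) s(2)] by simp
      then have "velocity F i \<sigma> s = 0" using metric_props(3)[OF i(1) s(2)] by (metis less_irrefl)
      then show ?thesis
        using velocity_smooth(2)[OF sc i(1) s] has_vector_derivative_at_within by metis
    qed
    have "\<exists>c. \<forall>s\<in>ball t e. (chart_map F i \<circ> \<sigma>) s = c"
      by (rule has_vector_derivative_zero_constant[OF convex_ball v0]) blast+
    then obtain c where "\<forall>s\<in>ball t e. (chart_map F i \<circ> \<sigma>) s = c" by blast
    then have "(chart_map F i \<circ> \<sigma>) s = (chart_map F i \<circ> \<sigma>) t" if "s \<in> ball t e" for s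
      using e(1) that by simp
    then have "\<sigma> t = \<sigma> s" if "s \<in> ball t e" for s
      using chart_inj[OF i(1)] e(2) that i(2) unfolding inj_on_def by fastforce
    then show "eventually (\<lambda>s. \<sigma> t = \<sigma> s) (at t within J)"
      unfolding eventually_at using e(1) by (intro exI[of _ e]) (auto simp: dist_commute)
  qed
qed

text \<open>The case of zero distance, where arc length cannot serve as a parameter: the base
  component moves affinely over a fixed fibre point, with \<rho> constantly 0.\<close>

lemma vertical_lift:
  assumes geo: "geodesic F J' \<sigma>" "{0..1} \<subseteq> J'"
    and c: "\<And>t. t \<in> J' \<Longrightarrow> velocity_square F \<sigma> t = 0" and I: "\<tau>0 \<in> I" "\<tau>1 \<in> I"
  shows "\<exists>\<gamma>. geodesic_joins M \<gamma> (\<tau>0, \<sigma> 0) (\<tau>1, \<sigma> 1) \<and>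
    (\<forall>t\<in>{0..1}. velocity_square M \<gamma> t = - (\<tau>1 - \<tau>0)\<^sup>2 \<and> (future_pointing M \<gamma> t \<longleftrightarrow> \<tau>0 < \<tau>1))"
proof -
  have sc: "smooth_curve F J' \<sigma>" using geo(1) by (simp add: geodesic_def)
  have eq: "\<sigma> 1 = \<sigma> 0" by (rule zero_speed_constant[OF sc c]) (use geo(2) in auto)
  define \<tau> where "\<tau> s = \<tau>0 + s * (\<tau>1 - \<tau>0)" for s
  define J where "J = \<tau> -` I"
  have oI: "open I" "is_interval I" using interval_I_props by auto
  have c\<tau>: "continuous_on UNIV \<tau>" unfolding \<tau>_def by (intro continuous_intros)
  have J: "open J" unfolding J_def using oI(1) c\<tau> by (simp add: open_vimage)
  have "convex I" using oI(2) is_interval_convex by blast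
  have Ji: "is_interval J"
    unfolding is_interval_1
  proof (intro ballI allI impI)
    fix x y z assume xy: "x \<in> J" "y \<in> J" "x \<le> z \<and> z \<le> y"
    have "\<tau> z \<in> I"
    proof (cases "\<tau>0 \<le> \<tau>1")
      case True
      then have "\<tau> x \<le> \<tau> z" "\<tau> z \<le> \<tau> y" using xy by (auto simp: \<tau>_def mult_right_mono)
      then show ?thesis using xy oI(2) unfolding is_interval_1 J_def by blast
    next
      case False
      then have "\<tau> y \<le> \<tau> z" "\<tau> z \<le> \<tau> x" using xy by (auto simp: \<tau>_def mult_right_mono_neg)
      then show ?thesis using xy oI(2) unfolding is_interval_1 J_def by blast
    qed
    then show "z \<in> J" by (simp add: J_def)
  qed
  have in01: "{0..1} \<subseteq> J"
  proof
    fix s :: real assume "s \<in> {0..1}"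
    moreover have "0 \<in> J" "1 \<in> J" using I by (auto simp: J_def \<tau>_def)
    ultimately show "s \<in> J" using Ji unfolding is_interval_1 by (meson atLeastAtMost_iff)
  qed
  have d\<tau>: "(\<tau> has_real_derivative (\<tau>1 - \<tau>0)) (at s)" for s
    unfolding \<tau>_def by (auto intro!: derivative_eq_intros)
  have s\<tau>: "smooth_on J \<tau>"
    by (rule smooth_on_antiderivative[OF J d\<tau>]) (simp add: smooth_on_def C_k_on_const[OF J])
  have s0: "smooth_on J (\<lambda>_. 0 :: real)" by (simp add: smooth_on_def C_k_on_const[OF J])
  have subI: "\<tau> ` J \<subseteq> I" by (auto simp: J_def)
  have sub0: "(\<lambda>_. 0) ` J \<subseteq> J'" using geo(2) by auto
  have lift1: "geodesic M J (\<lambda>t. (\<tau> t, \<sigma> 0))"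
    by (rule geodesic_lift(1)[where \<rho>="\<lambda>_. 0" and \<rho>'="\<lambda>_. 0", OF geo(1) c J Ji subI sub0 s\<tau> s0 d\<tau>]) auto
  have lift2: "velocity_square M (\<lambda>t. (\<tau> t, \<sigma> 0)) t = - (\<tau>1 - \<tau>0)\<^sup>2 + (f (\<tau> t))\<^sup>2 * (0 * 0\<^sup>2)" if "t \<in> J" for t
    by (rule geodesic_lift(2)[where \<rho>="\<lambda>_. 0" and \<rho>'="\<lambda>_. 0", OF geo(1) c J Ji subI sub0 s\<tau> s0 d\<tau>]) (use that in auto)
  have lift3: "future_pointing M (\<lambda>t. (\<tau> t, \<sigma> 0)) t \<longleftrightarrow> \<tau>1 - \<tau>0 > 0" if "t \<in> J" for t
    by (rule geodesic_lift(3)[where \<rho>="\<lambda>_. 0" and \<rho>'="\<lambda>_. 0", OF geo(1) c J Ji subI sub0 s\<tau> s0 d\<tau>]) (use that in auto)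
  have "geodesic_joins M (\<lambda>t. (\<tau> t, \<sigma> 0)) (\<tau>0, \<sigma> 0) (\<tau>1, \<sigma> 1)"
    unfolding geodesic_joins_def using lift1 in01 eq by (auto simp: \<tau>_def)
  then show ?thesis using lift2 lift3 in01 by (intro exI[of _ "\<lambda>t. (\<tau> t, \<sigma> 0)"]) (auto simp: subset_iff)
qed

text \<open>On the parameter interval \<open>{0..1}\<close> the constant speed equals the length,
  hence the distance.\<close>

lemma minimizing_geodesic:
  assumes wc: "weakly_convex F" and x: "x0 \<in> points F" "x1 \<in> points F"
  shows "\<exists>\<sigma> J' L. geodesic F J' \<sigma> \<and> {0..1} \<subseteq> J' \<and> \<sigma> 0 = x0 \<and> \<sigma> 1 = x1 \<and>
    (\<forall>t\<in>J'. velocity_square F \<sigma> t = L\<^sup>2) \<and> L \<ge> 0 \<and> riemannian_dist F x0 x1 = ennreal L"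
proof -
  obtain \<sigma> where "geodesic_joins F \<sigma> x0 x1" and len: "curve_length F 0 1 \<sigma> = riemannian_dist F x0 x1"
    using wc x unfolding weakly_convex_def by blast
  then obtain J' where J': "geodesic F J' \<sigma>" "{0..1} \<subseteq> J'" "\<sigma> 0 = x0" "\<sigma> 1 = x1"
    unfolding geodesic_joins_def by blast
  have "\<exists>c. \<forall>t\<in>J'. velocity_square F \<sigma> t = c" by (rule geodesic_speed_constant[OF J'(1)]) blast
  then obtain c where c: "\<And>t. t \<in> J' \<Longrightarrow> velocity_square F \<sigma> t = c" by blast
  have "0 \<in> J'" using J'(2) by auto
  moreover have "smooth_curve F J' \<sigma>" using J'(1) by (simp add: geodesic_def)
  ultimately have c0: "c \<ge> 0" using velocity_square_nonneg c by metis
  have "curve_length F 0 1 \<sigma> = (\<integral>\<^sup>+(t::real). ennreal (sqrt c) * indicator {0..1} t \<partial>lborel)"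
    unfolding curve_length_def
    by (rule nn_integral_cong) (use c J'(2) in \<open>auto simp: indicator_def subset_iff\<close>)
  also have "\<dots> = ennreal (sqrt c)" by (subst nn_integral_cmult_indicator) auto
  finally have "riemannian_dist F x0 x1 = ennreal (sqrt c)" using len by simp
  then show ?thesis using J' c c0 by (intro exI[of _ \<sigma>] exI[of _ J'] exI[of _ "sqrt c"]) simp
qed

theorem geodesically_connected_grw:
  assumes ab: "a < b" and wc: "weakly_convex F"
    and cond: "condition_C a b f (riemannian_diam F) \<or> condition_R a b f (riemannian_diam F)"
  shows "geodesically_connected M"
  unfolding geodesically_connected_def
proof (intro ballI)
  interpret W: warped_interval a b f by unfold_locales (use ab f_smooth f_pos in auto)
  fix z z' assume z: "z \<in> points M" "z' \<in> points M"
  obtain \<tau>0 x0 \<tau>1 x1 where zz: "z = (\<tau>0, x0)" "z' = (\<tau>1, x1)" by (cases z, cases z')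
  have I: "\<tau>0 \<in> I" "\<tau>1 \<in> I" "x0 \<in> points F" "x1 \<in> points F" using z by (auto simp: zz points_grw)
  obtain \<sigma> J' L where \<sigma>: "geodesic F J' \<sigma>" "{0..1} \<subseteq> J'" "\<sigma> 0 = x0" "\<sigma> 1 = x1"
    "\<And>t. t \<in> J' \<Longrightarrow> velocity_square F \<sigma> t = L\<^sup>2" "L \<ge> 0" "riemannian_dist F x0 x1 = ennreal L"
    using minimizing_geodesic[OF wc I(3,4)] by blast
  show "\<exists>\<gamma>. geodesic_joins M \<gamma> z z'"
  proof (cases "L = 0")
    case True
    then have "velocity_square F \<sigma> t = 0" if "t \<in> J'" for t using \<sigma>(5)[OF that] by simp
    from vertical_lift[OF \<sigma>(1,2) this I(1,2)] show ?thesis unfolding zz \<sigma>(3,4) by blast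
  next
    case False
    then have L: "L > 0" using \<sigma>(6) by simp
    have "ennreal L \<le> riemannian_diam F"
      unfolding riemannian_diam_def \<sigma>(7)[symmetric] using I by (intro SUP_upper2[of x0] SUP_upper2[of x1]) auto
    from W.reach_exists[OF I(1,2) L this cond] obtain D where "reach I f D L \<tau>0 \<tau>1" by blast
    then obtain J u p where "traj I f D J u p" "{0..L} \<subseteq> J" "u 0 = \<tau>0" "u L = \<tau>1" by (auto simp: reach_def)
    with traj_lift[OF ab \<sigma>(1,2,5) L] show ?thesis unfolding zz \<sigma>(3,4)[symmetric] by blast
  qed
qed

end

section \<open>Causality\<close>

context grw_space begin

lemma inverse_f_cont: "continuous_on I (\<lambda>\<tau>. 1 / f \<tau>)"
  using f_deriv DERIV_isCont f_pos
  by (intro continuous_at_imp_continuous_on ballI continuous_intros) (auto dest: f_pos)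

text \<open>Causality bounds the fibre speed by the base velocity divided by \<open>f\<close>. The
  difference \<Psi> of the two primitives is therefore nondecreasing, and strictly increasing along
  a timelike piece.\<close>

lemma causal_piece:
  assumes sc: "smooth_curve M J \<gamma>" and s: "s < s'" "{s..s'} \<subseteq> J"
    and causal: "\<And>t. t \<in> {s..s'} \<Longrightarrow> velocity_square M \<gamma> t \<le> 0 \<and> future_pointing M \<gamma> t"
  shows "fst (\<gamma> s) \<in> I \<and> fst (\<gamma> s') \<in> I \<and> fst (\<gamma> s) < fst (\<gamma> s') \<and>
    (\<exists>l\<ge>0. curve_length F s s' (snd \<circ> \<gamma>) = ennreal l \<and>
      l \<le> integral {fst (\<gamma> s)..fst (\<gamma> s')} (\<lambda>\<tau>. 1 / f \<tau>) \<and>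
      ((\<forall>t\<in>{s..s'}. velocity_square M \<gamma> t < 0) \<longrightarrow> l < integral {fst (\<gamma> s)..fst (\<gamma> s')} (\<lambda>\<tau>. 1 / f \<tau>)))"
proof -
  define \<tau> x v where "\<tau> = fst \<circ> \<gamma>" and "x = snd \<circ> \<gamma>" and "v = velocity_square F x"
  have \<gamma>: "\<gamma> = (\<lambda>t. (\<tau> t, x t))" by (simp add: \<tau>_def x_def)
  note p = smooth_curve_grwD[OF sc, folded \<tau>_def x_def]
  have d\<tau>: "(\<tau> has_real_derivative deriv \<tau> t) (at t)" if "t \<in> J" for t
    using p(3)[OF that] DERIV_deriv_iff_real_differentiable by blast
  have \<tau>I: "\<tau> t \<in> I" if "t \<in> J" for t using p(2) that by blast
  have v0: "v t \<ge> 0" if "t \<in> J" for t unfolding v_def by (rule velocity_square_nonneg[OF p(1) that])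
  have pos: "deriv \<tau> t > 0" if "t \<in> {s..s'}" for t
  proof -
    have "t \<in> J" using s that by blast
    then show ?thesis
      using velocity_square_grw(2)[where \<tau>=\<tau>, OF p(1) _ \<tau>I d\<tau>] causal[OF that] unfolding \<gamma> by blast
  qed
  have vs: "velocity_square M \<gamma> t = - (deriv \<tau> t)\<^sup>2 + (f (\<tau> t))\<^sup>2 * v t" if "t \<in> {s..s'}" for t
  proof -
    have "t \<in> J" using s that by blast
    then show ?thesis
      using velocity_square_grw(1)[where \<tau>=\<tau>, OF p(1) _ \<tau>I d\<tau>] unfolding \<gamma> v_def by blast
  qed
  have fp: "f (\<tau> t) > 0" if "t \<in> {s..s'}" for t using f_pos[OF \<tau>I[of t]] s that by blast
  have le: "sqrt (v t) \<le> deriv \<tau> t / f (\<tau> t)" if t: "t \<in> {s..s'}" for t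
  proof (rule real_le_lsqrt)
    show "0 \<le> deriv \<tau> t / f (\<tau> t)" using pos[OF t] fp[OF t] by simp
    show "v t \<le> (deriv \<tau> t / f (\<tau> t))\<^sup>2"
      using causal[OF t] vs[OF t] fp[OF t] by (simp add: field_simps)
  qed
  have less: "sqrt (v t) < deriv \<tau> t / f (\<tau> t)" if t: "t \<in> {s..s'}" and tl: "velocity_square M \<gamma> t < 0" for t
  proof (rule real_less_lsqrt)
    show "0 \<le> deriv \<tau> t / f (\<tau> t)" using pos[OF t] fp[OF t] by simp
    show "v t < (deriv \<tau> t / f (\<tau> t))\<^sup>2"
      using tl vs[OF t] fp[OF t] by (simp add: field_simps)
  qed
  have mono: "\<tau> t < \<tau> t'" if "s \<le> t" "t < t'" "t' \<le> s'" for t t'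
  proof (rule DERIV_pos_imp_increasing[OF that(2)])
    fix z assume "t \<le> z" "z \<le> t'"
    then have z: "z \<in> {s..s'}" using that by auto
    then have "z \<in> J" using s by blast
    then show "\<exists>y. (\<tau> has_real_derivative y) (at z) \<and> y > 0" using d\<tau> pos[OF z] by blast
  qed
  let ?a = "\<tau> s" and ?b = "\<tau> s'"
  have "s \<in> J" "s' \<in> J" using s by auto
  then have sI: "?a \<in> I" "?b \<in> I" using \<tau>I by blast+
  have sub: "{?a..?b} \<subseteq> I" using sI interval_I_props(2) unfolding is_interval_1 by (meson atLeastAtMost_iff subsetI)
  have \<tau>ab: "\<tau> t \<in> {?a..?b}" if "t \<in> {s..s'}" for t
    using mono[of s t] mono[of t s'] that by (cases "t = s"; cases "t = s'"; force)
  let ?G = "\<lambda>y. integral {?a..y} (\<lambda>\<tau>. 1 / f \<tau>)"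
  have fc: "continuous_on {?a..?b} (\<lambda>\<tau>. 1 / f \<tau>)" by (rule continuous_on_subset[OF inverse_f_cont sub])
  have vc: "continuous_on {s..s'} (\<lambda>t. sqrt (v t))"
    unfolding v_def by (intro continuous_intros continuous_on_subset[OF velocity_square_continuous[OF p(1)] s(2)])
  have dG: "(?G has_real_derivative 1 / f y) (at y within {?a..?b})" if "y \<in> {?a..?b}" for y
    by (rule integral_has_real_derivative[OF fc that])
  have dH: "((\<lambda>t. integral {s..t} (\<lambda>t. sqrt (v t))) has_real_derivative sqrt (v t)) (at t within {s..s'})" if "t \<in> {s..s'}" for t
    by (rule integral_has_real_derivative[OF vc that])
  define \<Psi> where "\<Psi> t = ?G (\<tau> t) - integral {s..t} (\<lambda>t. sqrt (v t))" for t
  have \<Psi>c: "continuous_on {s..s'} \<Psi>"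
    unfolding \<Psi>_def
  proof (intro continuous_on_diff)
    have "continuous_on {s..s'} \<tau>"
      using d\<tau> DERIV_isCont s(2) by (intro continuous_at_imp_continuous_on) blast
    moreover have "\<tau> ` {s..s'} \<subseteq> {?a..?b}" using \<tau>ab by blast
    ultimately show "continuous_on {s..s'} (\<lambda>t. ?G (\<tau> t))"
      using continuous_on_compose2[OF DERIV_continuous_on[OF dG]] by blast
    show "continuous_on {s..s'} (\<lambda>t. integral {s..t} (\<lambda>t. sqrt (v t)))" by (rule DERIV_continuous_on[OF dH])
  qed
  have d\<Psi>: "(\<Psi> has_real_derivative deriv \<tau> t / f (\<tau> t) - sqrt (v t)) (at t)" if t: "s < t" "t < s'" for t
  proof -
    have "?a < \<tau> t" "\<tau> t < ?b" using mono[of s t] mono[of t s'] t by auto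
    then have 1: "(?G has_real_derivative 1 / f (\<tau> t)) (at (\<tau> t))"
      using dG[of "\<tau> t"] at_within_interior[of "\<tau> t" "{?a..?b}"] by simp
    have "t \<in> J" using t s by auto
    from DERIV_chain2[OF 1 d\<tau>[OF this]]
    have 2: "((\<lambda>t. ?G (\<tau> t)) has_real_derivative deriv \<tau> t / f (\<tau> t)) (at t)" by simp
    have "((\<lambda>t. integral {s..t} (\<lambda>t. sqrt (v t))) has_real_derivative sqrt (v t)) (at t)"
      using dH[of t] t at_within_interior[of t "{s..s'}"] by simp
    from DERIV_diff[OF 2 this] show ?thesis unfolding \<Psi>_def .
  qed
  have \<Psi>0: "\<Psi> s = 0" by (simp add: \<Psi>_def)
  have "\<Psi> s \<le> \<Psi> s'"
  proof (rule DERIV_nonneg_imp_increasing_open[OF less_imp_le[OF s(1)] _ \<Psi>c])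
    fix t assume t: "s < t" "t < s'"
    then have "t \<in> {s..s'}" by simp
    from le[OF this] show "\<exists>y. (\<Psi> has_real_derivative y) (at t) \<and> 0 \<le> y" using d\<Psi>[OF t] by force
  qed
  then have l1: "integral {s..s'} (\<lambda>t. sqrt (v t)) \<le> ?G ?b" using \<Psi>0 by (simp add: \<Psi>_def)
  have l2: "integral {s..s'} (\<lambda>t. sqrt (v t)) < ?G ?b" if tl: "\<forall>t\<in>{s..s'}. velocity_square M \<gamma> t < 0"
  proof -
    have "\<Psi> s < \<Psi> s'"
    proof (rule DERIV_pos_imp_increasing_open[OF s(1) _ \<Psi>c])
      fix t assume t: "s < t" "t < s'"
      then have "t \<in> {s..s'}" by simp
      from less[OF this] tl this show "\<exists>y. (\<Psi> has_real_derivative y) (at t) \<and> 0 < y" using d\<Psi>[OF t] by force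
    qed
    then show ?thesis using \<Psi>0 by (simp add: \<Psi>_def)
  qed
  have vi: "((\<lambda>t. sqrt (v t)) has_integral integral {s..s'} (\<lambda>t. sqrt (v t))) {s..s'}"
    by (intro integrable_integral integrable_continuous_real vc)
  have sv0: "0 \<le> sqrt (v t)" if "t \<in> {s..s'}" for t using v0[of t] s that by auto
  have "curve_length F s s' x = ennreal (integral {s..s'} (\<lambda>t. sqrt (v t)))"
    unfolding curve_length_def v_def[symmetric]
    by (rule nn_integral_has_integral_lebesgue'[OF sv0 vi])
  moreover have "integral {s..s'} (\<lambda>t. sqrt (v t)) \<ge> 0" by (rule has_integral_nonneg[OF vi sv0])
  moreover have "fst (\<gamma> s) = ?a" "fst (\<gamma> s') = ?b" by (simp_all add: \<tau>_def)
  ultimately show ?thesis using l1 l2 sI mono[of s s'] s(1) unfolding x_def[symmetric] by auto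
qed

lemma causal_curve_bound:
  assumes c: "piecewise_smooth_curve M n t c (\<tau>0, x0) (\<tau>1, x1)"
    and causal: "\<And>k s. k \<le> n \<Longrightarrow> s \<in> {t k..t (Suc k)} \<Longrightarrow> velocity_square M (c k) s \<le> 0 \<and> future_pointing M (c k) s"
  shows "\<tau>0 < \<tau>1 \<and> riemannian_dist F x0 x1 \<le> ennreal (integral {\<tau>0..\<tau>1} (\<lambda>\<tau>. 1 / f \<tau>)) \<and>
    ((\<forall>k\<le>n. \<forall>s\<in>{t k..t (Suc k)}. velocity_square M (c k) s < 0) \<longrightarrow>
      riemannian_dist F x0 x1 < ennreal (integral {\<tau>0..\<tau>1} (\<lambda>\<tau>. 1 / f \<tau>)))"
proof -
  note P = c[unfolded piecewise_smooth_curve_def]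
  \<comment> \<open>For positive index the break value is read off at the right end of the previous
    piece, which also covers the index \<open>Suc n\<close>; the gluing condition identifies it with
    the left end of the next piece.\<close>
  define T where "T k = (if k = 0 then \<tau>0 else fst (c (k - 1) (t k)))" for k
  have T1: "fst (c k (t k)) = T k" if "k \<le> n" for k
    using P that by (cases k) (auto simp: T_def)
  have T2: "fst (c k (t (Suc k))) = T (Suc k)" for k by (simp add: T_def)
  have T0: "T 0 = \<tau>0" "T (Suc n) = \<tau>1" using P by (simp_all add: T_def)
  let ?A = "\<lambda>x y. integral {x..y} (\<lambda>\<tau>. 1 / f \<tau>)"
  have piece: "\<exists>l. T k \<in> I \<and> T (Suc k) \<in> I \<and> T k < T (Suc k) \<and> 0 \<le> l \<and>
     curve_length F (t k) (t (Suc k)) (snd \<circ> c k) = ennreal l \<and> l \<le> ?A (T k) (T (Suc k)) \<and>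
     ((\<forall>s\<in>{t k..t (Suc k)}. velocity_square M (c k) s < 0) \<longrightarrow> l < ?A (T k) (T (Suc k)))" if k: "k \<le> n" for k
  proof -
    obtain J where J: "{t k..t (Suc k)} \<subseteq> J" "smooth_curve M J (c k)" "t k < t (Suc k)" using P k by blast
    from causal_piece[OF J(2,3,1) causal[OF k]] show ?thesis unfolding T1[OF k] T2 by blast
  qed
  then obtain l where l: "\<And>k. k \<le> n \<Longrightarrow> T k \<in> I \<and> T (Suc k) \<in> I \<and> T k < T (Suc k) \<and> 0 \<le> l k \<and>
     curve_length F (t k) (t (Suc k)) (snd \<circ> c k) = ennreal (l k) \<and> l k \<le> ?A (T k) (T (Suc k)) \<and>
     ((\<forall>s\<in>{t k..t (Suc k)}. velocity_square M (c k) s < 0) \<longrightarrow> l k < ?A (T k) (T (Suc k)))"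
    by metis
  have comb: "?A (T 0) (T (Suc k)) = ?A (T 0) (T k) + ?A (T k) (T (Suc k))" if "k \<le> n" "T 0 \<le> T k" for k
  proof -
    have "{T 0..T (Suc k)} \<subseteq> I"
      using l[of 0] l[OF that(1)] interval_I_props(2) unfolding is_interval_1 by (meson atLeastAtMost_iff subsetI le0)
    then have "(\<lambda>\<tau>. 1 / f \<tau>) integrable_on {T 0..T (Suc k)}"
      by (intro integrable_continuous_real continuous_on_subset[OF inverse_f_cont])
    from Henstock_Kurzweil_Integration.integral_combine[OF that(2) _ this] l[OF that(1)] show ?thesis by simp
  qed
  have step: "T 0 < T (Suc m) \<and> (\<Sum>k\<le>m. l k) \<le> ?A (T 0) (T (Suc m)) \<and>
     ((\<forall>k\<le>n. \<forall>s\<in>{t k..t (Suc k)}. velocity_square M (c k) s < 0) \<longrightarrow> (\<Sum>k\<le>m. l k) < ?A (T 0) (T (Suc m)))"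
    if "m \<le> n" for m using that
  proof (induction m)
    case 0
    then show ?case using l[of 0] by simp
  next
    case (Suc m)
    then show ?case using l[of "Suc m"] comb[of "Suc m"] by (auto intro: add_mono add_strict_mono)
  qed
  have "piecewise_smooth_curve F n t (\<lambda>k. snd \<circ> c k) x0 x1"
    unfolding piecewise_smooth_curve_def using P smooth_curve_grwD(1) by (simp; metis)
  then have "riemannian_dist F x0 x1 \<le> (\<Sum>k\<le>n. curve_length F (t k) (t (Suc k)) (snd \<circ> c k))"
    unfolding riemannian_dist_def
    by (intro Inf_lower CollectI exI[of _ n] exI[of _ t] exI[of _ "\<lambda>k. snd \<circ> c k"] conjI refl)
  also have "\<dots> = (\<Sum>k\<le>n. ennreal (l k))" by (rule sum.cong) (use l in auto)
  also have "\<dots> = ennreal (\<Sum>k\<le>n. l k)" by (rule sum_ennreal) (use l in auto)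
  finally have le: "riemannian_dist F x0 x1 \<le> ennreal (\<Sum>k\<le>n. l k)" .
  have nn: "(\<Sum>k\<le>n. l k) \<ge> 0" by (rule sum_nonneg) (use l in auto)
  have less: "riemannian_dist F x0 x1 < ennreal (?A \<tau>0 \<tau>1)" if "(\<Sum>k\<le>n. l k) < ?A \<tau>0 \<tau>1"
    using le ennreal_lessI[OF _ that] nn that by (meson le_less_trans)
  show ?thesis
    using step[of n] less order_trans[OF le ennreal_leI] unfolding T0 by blast
qed

text \<open>At level 0 the integrand is \<open>1 / f\<close>, so the hypothesis compares the
  distance with the direct time at \<open>D = 0\<close>. Continuity in the level yields some
  \<open>D \<le> 0\<close>, negative in the strict case, and direct trajectories have
  \<open>p > 0\<close>, hence point to the future.\<close>

lemma future_geodesic: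
  assumes ab: "a < b" and wc: "weakly_convex F"
    and \<tau>: "\<tau>0 \<in> I" "\<tau>1 \<in> I" "\<tau>0 < \<tau>1" and x: "x0 \<in> points F" "x1 \<in> points F"
    and le: "riemannian_dist F x0 x1 \<le> ennreal (integral {\<tau>0..\<tau>1} (\<lambda>\<tau>. 1 / f \<tau>))"
  shows "\<exists>\<gamma>. geodesic_joins M \<gamma> (\<tau>0, x0) (\<tau>1, x1) \<and>
    (\<forall>t\<in>{0..1}. future_pointing M \<gamma> t \<and> velocity_square M \<gamma> t \<le> 0 \<and>
      (riemannian_dist F x0 x1 < ennreal (integral {\<tau>0..\<tau>1} (\<lambda>\<tau>. 1 / f \<tau>)) \<longrightarrow> velocity_square M \<gamma> t < 0))"
proof -
  interpret W: warped_interval a b f by unfold_locales (use ab f_smooth f_pos in auto)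
  let ?A = "integral {\<tau>0..\<tau>1} (\<lambda>\<tau>. 1 / f \<tau>)"
  obtain \<sigma> J' L where \<sigma>: "geodesic F J' \<sigma>" "{0..1} \<subseteq> J'" "\<sigma> 0 = x0" "\<sigma> 1 = x1"
    "\<And>t. t \<in> J' \<Longrightarrow> velocity_square F \<sigma> t = L\<^sup>2" "L \<ge> 0" "riemannian_dist F x0 x1 = ennreal L"
    using minimizing_geodesic[OF wc x] by blast
  have btw: "r \<in> I" if "\<tau>0 \<le> r" "r \<le> \<tau>1" for r by (rule W.I_between[OF \<tau>(1,2) that])
  have Vp: "W.V r > 0" if "\<tau>0 \<le> r" "r \<le> \<tau>1" for r by (rule W.V_pos[OF btw[OF that]])
  have A: "h_int f 0 (ereal \<tau>0) (ereal \<tau>1) = ennreal ?A"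
  proof (rule W.h_int_has_integral)
    have "((\<lambda>\<tau>. 1 / f \<tau>) has_integral ?A) {\<tau>0..\<tau>1}"
      by (intro integrable_integral integrable_continuous_real continuous_on_subset[OF inverse_f_cont]) (use btw in auto)
    moreover have "1 / f r = 1 / (f r)\<^sup>2 / sqrt (W.V r - 0)" if "r \<in> {\<tau>0..\<tau>1}" for r
      using f_pos[OF btw[of r]] that by (simp add: warp_def real_sqrt_divide power2_eq_square)
    ultimately show "((\<lambda>\<tau>. 1 / (f \<tau>)\<^sup>2 / sqrt (W.V \<tau> - 0)) has_integral ?A) {\<tau>0..\<tau>1}"
      by (rule has_integral_eq[rotated])
  qed (use \<tau> Vp in \<open>auto simp: less_imp_le\<close>)
  show ?thesis
  proof (cases "L = 0")
    case True
    then have "velocity_square F \<sigma> t = 0" if "t \<in> J'" for t using \<sigma>(5)[OF that] by simp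
    from vertical_lift[OF \<sigma>(1,2) this \<tau>(1,2)] obtain \<gamma> where \<gamma>: "geodesic_joins M \<gamma> (\<tau>0, x0) (\<tau>1, x1)"
      "\<forall>t\<in>{0..1}. velocity_square M \<gamma> t = - (\<tau>1 - \<tau>0)\<^sup>2 \<and> (future_pointing M \<gamma> t \<longleftrightarrow> \<tau>0 < \<tau>1)"
      unfolding \<sigma>(3,4) by blast
    moreover have "- (\<tau>1 - \<tau>0)\<^sup>2 < 0" using \<tau>(3) by simp
    ultimately show ?thesis using \<tau>(3) by (intro exI[of _ \<gamma>]) auto
  next
    case False
    then have L: "L > 0" using \<sigma>(6) by simp
    have "\<exists>D\<le>0. h_int f D (ereal \<tau>0) (ereal \<tau>1) = ennreal L \<and> (ennreal L < ennreal ?A \<longrightarrow> D < 0)"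
    proof (cases "ennreal L < ennreal ?A")
      case False
      then have "ennreal L = ennreal ?A" using le \<sigma>(7) by simp
      then show ?thesis using A by (intro exI[of _ 0]) simp
    next
      case True
      \<comment> \<open>If no negative level fits, all times at negative levels are below
        \<open>L\<close> by \<open>direct_below\<close>, contradicting their convergence to a limit
        above \<open>L\<close> at level 0.\<close>
      have "\<exists>D<0. h_int f D (ereal \<tau>0) (ereal \<tau>1) = ennreal L"
      proof (rule ccontr)
        assume no: "\<not> (\<exists>D<0. h_int f D (ereal \<tau>0) (ereal \<tau>1) = ennreal L)"
        have below: "h_int f D (ereal \<tau>0) (ereal \<tau>1) < ennreal L" if "D < 0" for D
          by (rule W.direct_below[OF \<tau>(1,2) less_imp_le[OF \<tau>(3)] _ L _ that])
             (use Vp no in \<open>auto simp: less_imp_le\<close>)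
        have "((\<lambda>D. h_int f D (ereal \<tau>0) (ereal \<tau>1)) \<longlongrightarrow> h_int f 0 (ereal \<tau>0) (ereal \<tau>1)) (at 0 within {..0})"
          by (rule W.h_int_tendsto[OF \<tau>(1,2) less_imp_le[OF \<tau>(3)]]) (use Vp in auto)
        from order_tendstoD(1)[OF this, of "ennreal L"] True
        have "eventually (\<lambda>D. ennreal L < h_int f D (ereal \<tau>0) (ereal \<tau>1)) (at 0 within {..0})" by (simp add: A)
        then have "eventually (\<lambda>D. ennreal L < h_int f D (ereal \<tau>0) (ereal \<tau>1)) (at_left 0)"
          by (rule filter_leD[OF at_le, rotated]) auto
        moreover have "eventually (\<lambda>D. D < (0::real)) (at_left 0)" by (simp add: eventually_at_filter)
        ultimately have "eventually (\<lambda>D. False) (at_left (0::real))"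
        proof eventually_elim
          case (elim D)
          then show ?case using below[of D] by (meson less_asym)
        qed
        then show False by simp
      qed
      then show ?thesis by (meson less_imp_le)
    qed
    then obtain D where D: "D \<le> 0" "h_int f D (ereal \<tau>0) (ereal \<tau>1) = ennreal L" "ennreal L < ennreal ?A \<Longrightarrow> D < 0"
      by blast
    have VD: "W.V r > D" if "\<tau>0 \<le> r" "r \<le> \<tau>1" for r using Vp[OF that] D(1) by simp
    obtain J u p where tr: "traj I f D J u p" "{0..L} \<subseteq> J" "u 0 = \<tau>0" "u L = \<tau>1" "\<forall>r\<in>J. p r > 0"
      using W.direct_traj[OF \<tau>(1,2) less_imp_le[OF \<tau>(3)] VD D(2) less_imp_le[OF L]] by blast
    obtain \<gamma> T where \<gamma>: "T > 0" "geodesic_joins M \<gamma> (\<tau>0, x0) (\<tau>1, x1)"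
      "\<forall>t\<in>{0..1}. velocity_square M \<gamma> t = T\<^sup>2 * D \<and> (\<exists>r\<in>J. future_pointing M \<gamma> t \<longleftrightarrow> p r > 0)"
      using traj_lift[OF ab \<sigma>(1,2,5) L tr(1,2)] unfolding \<sigma>(3,4) tr(3,4) by blast
    have "T\<^sup>2 * D \<le> 0" using D(1) by (simp add: mult_nonneg_nonpos)
    moreover have "T\<^sup>2 * D < 0" if "ennreal L < ennreal ?A"
      using D(3)[OF that] \<gamma>(1) by (simp add: mult_pos_neg)
    ultimately show ?thesis using \<gamma>(2,3) tr(5) unfolding \<sigma>(7) by (intro exI[of _ \<gamma>]) auto
  qed
qed

lemma geodesic_joins_piecewise:
  assumes "geodesic_joins M' \<gamma> z z'"
  shows "piecewise_smooth_curve M' 0 real (\<lambda>_. \<gamma>) z z'"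
  using assms unfolding geodesic_joins_def piecewise_smooth_curve_def geodesic_def by auto

text \<open>The relations are symmetric, but precedence strictly increases the base component, so
  only the order given by \<tau> can occur. The converse direction uses the geodesic itself as a
  causal curve with a single smooth piece.\<close>

lemma causality_grw:
  assumes ab: "a < b" and wc: "weakly_convex F"
    and \<tau>: "\<tau>0 \<in> I" "\<tau>1 \<in> I" "\<tau>0 < \<tau>1" and x: "x0 \<in> points F" "x1 \<in> points F"
    and L: "L = (\<integral>\<^sup>+\<tau>\<in>{\<tau>0..\<tau>1}. ennreal (1 / f \<tau>) \<partial>lborel)"
  shows "chronologically_related M (\<tau>0, x0) (\<tau>1, x1) \<longleftrightarrow> L > riemannian_dist F x0 x1"
    and "causally_related M (\<tau>0, x0) (\<tau>1, x1) \<longleftrightarrow> L \<ge> riemannian_dist F x0 x1"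
    and "L > riemannian_dist F x0 x1 \<Longrightarrow>
      \<exists>\<gamma>. geodesic_joins M \<gamma> (\<tau>0, x0) (\<tau>1, x1) \<and> (\<forall>t\<in>{0..1}. timelike_at M \<gamma> t)"
    and "L \<ge> riemannian_dist F x0 x1 \<Longrightarrow>
      \<exists>\<gamma>. geodesic_joins M \<gamma> (\<tau>0, x0) (\<tau>1, x1) \<and> (\<forall>t\<in>{0..1}. nonspacelike_at M \<gamma> t)"
proof -
  let ?A = "integral {\<tau>0..\<tau>1} (\<lambda>\<tau>. 1 / f \<tau>)" and ?d = "riemannian_dist F x0 x1"
  have sub: "{\<tau>0..\<tau>1} \<subseteq> I" using \<tau> interval_I_props(2) unfolding is_interval_1 by (meson atLeastAtMost_iff subsetI)
  have LA: "L = ennreal ?A"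
    unfolding L
  proof (rule nn_integral_has_integral_lebesgue')
    show "0 \<le> 1 / f r" if "r \<in> {\<tau>0..\<tau>1}" for r using f_pos[of r] sub that by force
    show "((\<lambda>\<tau>. 1 / f \<tau>) has_integral ?A) {\<tau>0..\<tau>1}"
      by (intro integrable_integral integrable_continuous_real continuous_on_subset[OF inverse_f_cont sub])
  qed
  have geo: "\<exists>\<gamma>. geodesic_joins M \<gamma> (\<tau>0, x0) (\<tau>1, x1) \<and>
    (\<forall>t\<in>{0..1}. future_pointing M \<gamma> t \<and> velocity_square M \<gamma> t \<le> 0 \<and> (L > ?d \<longrightarrow> velocity_square M \<gamma> t < 0))"
    if "L \<ge> ?d" using future_geodesic[OF ab wc \<tau> x] that unfolding LA by blast
  have caus: "\<sigma> < \<sigma>' \<and> riemannian_dist F y y' \<le> ennreal (integral {\<sigma>..\<sigma>'} (\<lambda>\<tau>. 1 / f \<tau>))"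
    if cp: "causally_precedes M (\<sigma>, y) (\<sigma>', y')" for \<sigma> \<sigma>' y y'
  proof -
    obtain n t c where c: "piecewise_smooth_curve M n t c (\<sigma>, y) (\<sigma>', y')"
      "\<forall>k\<le>n. \<forall>s\<in>{t k..t (Suc k)}. velocity_square M (c k) s \<le> 0 \<and> future_pointing M (c k) s"
      using cp unfolding causally_precedes_def nonspacelike_at_def by blast
    from c(2) have "velocity_square M (c k) s \<le> 0 \<and> future_pointing M (c k) s" if "k \<le> n" "s \<in> {t k..t (Suc k)}" for k s
      using that by blast
    from causal_curve_bound[OF c(1) this] show ?thesis by blast
  qed
  have chron: "\<sigma> < \<sigma>' \<and> riemannian_dist F y y' < ennreal (integral {\<sigma>..\<sigma>'} (\<lambda>\<tau>. 1 / f \<tau>))"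
    if cp: "chron_precedes M (\<sigma>, y) (\<sigma>', y')" for \<sigma> \<sigma>' y y'
  proof -
    obtain n t c where c: "piecewise_smooth_curve M n t c (\<sigma>, y) (\<sigma>', y')"
      "\<forall>k\<le>n. \<forall>s\<in>{t k..t (Suc k)}. velocity_square M (c k) s < 0 \<and> future_pointing M (c k) s"
      using cp unfolding chron_precedes_def timelike_at_def by blast
    then have "velocity_square M (c k) s \<le> 0 \<and> future_pointing M (c k) s" if "k \<le> n" "s \<in> {t k..t (Suc k)}" for k s
      using that by (meson less_imp_le)
    from causal_curve_bound[OF c(1) this] c(2) show ?thesis by blast
  qed
  show "chronologically_related M (\<tau>0, x0) (\<tau>1, x1) \<longleftrightarrow> L > ?d"
  proof
    assume "chronologically_related M (\<tau>0, x0) (\<tau>1, x1)"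
    then show "L > ?d" using chron[of \<tau>0 x0 \<tau>1 x1] chron[of \<tau>1 x1 \<tau>0 x0] \<tau>(3)
      unfolding chronologically_related_def LA by (meson less_asym)
  next
    assume "L > ?d"
    with geo obtain \<gamma> where \<gamma>: "geodesic_joins M \<gamma> (\<tau>0, x0) (\<tau>1, x1)"
      "\<forall>t\<in>{0..1}. timelike_at M \<gamma> t \<and> future_pointing M \<gamma> t" unfolding timelike_at_def by (meson less_imp_le)
    have "chron_precedes M (\<tau>0, x0) (\<tau>1, x1)" unfolding chron_precedes_def
      by (rule exI[of _ 0], rule exI[of _ real], rule exI[of _ "\<lambda>_. \<gamma>"])
         (use geodesic_joins_piecewise[OF \<gamma>(1)] \<gamma>(2) in simp)
    then show "chronologically_related M (\<tau>0, x0) (\<tau>1, x1)" unfolding chronologically_related_def by blast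
  qed
  show "causally_related M (\<tau>0, x0) (\<tau>1, x1) \<longleftrightarrow> L \<ge> ?d"
  proof
    assume "causally_related M (\<tau>0, x0) (\<tau>1, x1)"
    then show "L \<ge> ?d" using caus[of \<tau>0 x0 \<tau>1 x1] caus[of \<tau>1 x1 \<tau>0 x0] \<tau>(3)
      unfolding causally_related_def LA by (meson less_asym)
  next
    assume "L \<ge> ?d"
    with geo obtain \<gamma> where \<gamma>: "geodesic_joins M \<gamma> (\<tau>0, x0) (\<tau>1, x1)"
      "\<forall>t\<in>{0..1}. nonspacelike_at M \<gamma> t \<and> future_pointing M \<gamma> t" unfolding nonspacelike_at_def by meson
    have "causally_precedes M (\<tau>0, x0) (\<tau>1, x1)" unfolding causally_precedes_def
      by (rule exI[of _ 0], rule exI[of _ real], rule exI[of _ "\<lambda>_. \<gamma>"])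
         (use geodesic_joins_piecewise[OF \<gamma>(1)] \<gamma>(2) in simp)
    then show "causally_related M (\<tau>0, x0) (\<tau>1, x1)" unfolding causally_related_def by blast
  qed
  show "\<exists>\<gamma>. geodesic_joins M \<gamma> (\<tau>0, x0) (\<tau>1, x1) \<and> (\<forall>t\<in>{0..1}. timelike_at M \<gamma> t)" if "L > ?d"
    using geo that unfolding timelike_at_def by (meson less_imp_le)
  show "\<exists>\<gamma>. geodesic_joins M \<gamma> (\<tau>0, x0) (\<tau>1, x1) \<and> (\<forall>t\<in>{0..1}. nonspacelike_at M \<gamma> t)" if "L \<ge> ?d"
    using geo that unfolding nonspacelike_at_def by meson
qed

end

theorem theorem1:
  fixes F :: "('i, 'p::{t2_space, second_countable_topology}, 'e::euclidean_space) metric_manifold"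
    and a b :: ereal
    and f :: "real \<Rightarrow> real"
  assumes "riemannian_manifold F"
    and "weakly_convex F"
    and "a < b"
    and "smooth_on (interval_I a b) f"
    and "\<forall>\<tau>\<in>interval_I a b. f \<tau> > 0"
  shows "(\<forall>\<tau>0\<in>interval_I a b. \<forall>\<tau>0'\<in>interval_I a b. \<forall>x0\<in>points F. \<forall>x0'\<in>points F. \<tau>0 < \<tau>0' \<longrightarrow>
           (let M = grw a b f F; z0 = (\<tau>0, x0); z0' = (\<tau>0', x0');
                L = (\<integral>\<^sup>+\<tau>\<in>{\<tau>0..\<tau>0'}. ennreal (1 / f \<tau>) \<partial>lborel)
            in (chronologically_related M z0 z0' \<longleftrightarrow> L > riemannian_dist F x0 x0') \<and>
               (causally_related M z0 z0' \<longleftrightarrow> L \<ge> riemannian_dist F x0 x0') \<and>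
               (chronologically_related M z0 z0' \<longrightarrow>
                  (\<exists>\<gamma>. geodesic_joins M \<gamma> z0 z0' \<and> (\<forall>t\<in>{0..1}. timelike_at M \<gamma> t))) \<and>
               (causally_related M z0 z0' \<longrightarrow>
                  (\<exists>\<gamma>. geodesic_joins M \<gamma> z0 z0' \<and> (\<forall>t\<in>{0..1}. nonspacelike_at M \<gamma> t))))) \<and>
         (condition_C a b f (riemannian_diam F) \<or> condition_R a b f (riemannian_diam F) \<longrightarrow>
           geodesically_connected (grw a b f F))"
proof -
  interpret grw_space F a b f by unfold_locales (use assms in auto)
  show ?thesis
    unfolding Let_def
  proof (intro conjI ballI impI)
    show "geodesically_connected M"
      if "condition_C a b f (riemannian_diam F) \<or> condition_R a b f (riemannian_diam F)"
      by (rule geodesically_connected_grw[OF assms(3,2) that])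
  next
    fix \<tau>0 \<tau>1 x0 x1 assume "\<tau>0 \<in> I" "\<tau>1 \<in> I" "x0 \<in> points F" "x1 \<in> points F" "\<tau>0 < \<tau>1"
    note c = causality_grw[OF assms(3,2) this(1,2,5,3,4) refl]
    show "chronologically_related M (\<tau>0, x0) (\<tau>1, x1) \<longleftrightarrow>
        riemannian_dist F x0 x1 < (\<integral>\<^sup>+\<tau>\<in>{\<tau>0..\<tau>1}. ennreal (1 / f \<tau>) \<partial>lborel)"
      "causally_related M (\<tau>0, x0) (\<tau>1, x1) \<longleftrightarrow>
        riemannian_dist F x0 x1 \<le> (\<integral>\<^sup>+\<tau>\<in>{\<tau>0..\<tau>1}. ennreal (1 / f \<tau>) \<partial>lborel)" by (fact c(1,2))+
    show "\<exists>\<gamma>. geodesic_joins M \<gamma> (\<tau>0, x0) (\<tau>1, x1) \<and> (\<forall>t\<in>{0..1}. timelike_at M \<gamma> t)"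
      if "chronologically_related M (\<tau>0, x0) (\<tau>1, x1)" using c(1,3) that by blast
    show "\<exists>\<gamma>. geodesic_joins M \<gamma> (\<tau>0, x0) (\<tau>1, x1) \<and> (\<forall>t\<in>{0..1}. nonspacelike_at M \<gamma> t)"
      if "causally_related M (\<tau>0, x0) (\<tau>1, x1)" using c(2,4) that by blast
  qed
qed

end
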